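(* Let $\mathbb{K}$ be a commutative ring with unit and let $P$ be an operadic poset species, with structure morphisms $a$, $\varphi_x$, $\psi_x$. For every finite set $S$ and every partition $\pi\in\Pi(S)$, let $$\hat{\rho}_\pi: \hat{h}^{\bullet}(P(\pi)) \otimes \bigotimes_{T\in\pi} h^{\bullet}(P(T)) \longrightarrow \hat{h}^{\bullet}(P(S))$$ be the composition of $\mathrm{id}\otimes\kappa$, where $\kappa:\bigotimes_{T\in \pi}h^{\bullet}(P(T))\to h^{\bullet}(\prod_{T\in\pi}P(T))$ is the Künneth morphism, with the sum over all $x\in P(S)$ such that $a(x)=\pi$ of the morphisms $$\hat{h}^{\bullet}(P(\pi))\otimes h^{\bullet}\Big(\prod_{T\in \pi}P(T)\Big) \xrightarrow{\varphi_x^*\otimes\psi_x^*} \hat{h}^{\bullet}(P_{\leq x}(S))\otimes h^{\bullet}(P_{\geq x}(S)) \xrightarrow{\hat{\mu}_x} \hat{h}^\bullet(P(S)).$$ Then the morphisms $\hat{\rho}_\pi$ give the graded linear species $\hat{h}^\bullet(P):S\mapsto \hat{h}^\bullet(P(S))$ the structure of a right operadic module over the graded operad $h^\bullet(P)$.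
   Context: Conventions. All posets are finite, all finite sets $S$ are non-empty. Graded $\mathbb{K}$-modules carry the Koszul sign symmetry. Operads are described by composition maps $\rho_\pi:F(\pi)\otimes\bigotimes_{T\in\pi}F(T)\to F(S)$ indexed by partitions $\pi$ of $S$ (viewed as sets of blocks); i.e. they are monoids for $(F\circ G)(S)=\bigoplus_{\pi\in\Pi(S)}F(\pi)\otimes\bigotimes_{T\in\pi}G(T)$. A right module over $F$ is a graded species $G$ with an associative and unital action $G\circ F\to G$. Poset cohomology. Let $P$ be a poset, $\min P$, $\max P$ its sets of minimal and maximal elements. $\hat{c}^n(P)$ is the free $\mathbb{K}$-module on symbols $[x_0<\cdots<x_n]$ for chains with $x_n\in\max P$, with differential $d[x_0<\cdots<x_n]=\sum_{y<x_0}[y<x_0<\cdots<x_n]+\sum_{i=1}^n(-1)^i\sum_{x_{i-1}<y<x_i}[\cdots<x_{i-1}<y<x_i<\cdots]$. $c^\bullet(P)\subset\hat{c}^\bullet(P)$ is the subcomplex spanned by chains with moreover $x_0\in\min P$. Their cohomologies are $\hat{h}^\bullet(P)$ and $h^\bullet(P)$. For a morphism of posets $f:P\to Q$, $f^*[y_0<\cdots<y_n]=\sum_{f(x_i)=y_i}[x_0<\cdots<x_n]$ induces $f^*:\hat{h}^\bullet(Q)\to\hat{h}^\bullet(P)$ if $f^{-1}(\max Q)\subset\max P$, and $f^*:h^\bullet(Q)\to h^\bullet(P)$ if moreover $f^{-1}(\min Q)\subset\min P$. The Künneth morphism is induced by $[x_0<\cdots<x_m]\otimes[y_0<\cdots<y_n]\mapsto[(x_0,y_0)<\cdots<(x_m,y_0)<(x_m,y_1)<\cdots<(x_m,y_n)]$.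 For $x\in P$ the concatenation morphisms $\mu_x:h^\bullet(P_{\le x})\otimes h^\bullet(P_{\ge x})\to h^\bullet(P)$ and $\hat{\mu}_x:\hat{h}^\bullet(P_{\le x})\otimes h^\bullet(P_{\ge x})\to\hat{h}^\bullet(P)$ are induced by $[x_0<\cdots<x_m=x]\otimes[x=x_m<\cdots<x_{m+n}]\mapsto[x_0<\cdots<x_{m+n}]$. Operad structure on $h^\bullet(P)$. For an operadic poset species $P$, the species $h^\bullet(P):S\mapsto h^\bullet(P(S))$ is a graded operad, with composition maps $\rho_\pi: h^{\bullet}(P(\pi)) \otimes \bigotimes_{T\in\pi} h^{\bullet}(P(T)) \to h^{\bullet}(P(S))$ given by $\sum_{x\in P(S),a(x)=\pi}\mu_x\circ(\varphi_x^*\otimes\psi_x^* )\circ(\mathrm{id}\otimes\kappa)$, with $\kappa$ the Künneth morphism. Partitions. $\Pi(S)$ is the poset of partitions of $S$, with $\alpha\le\beta$ iff $\alpha$ is obtained by merging blocks of $\beta$. For $T\subset S$, $\pi_{|T}$ is the set of blocks of $\pi$ contained in $T$. There are isomorphisms $\varphi_\pi:\Pi_{\le\pi}(S)\to\Pi(\pi)$, $\alpha\mapsto\{\pi_{|T},T\in\alpha\}$, and $\psi_\pi:\Pi_{\ge\pi}(S)\to\prod_{T\in\pi}\Pi(T)$, $\beta\mapsto(\beta_{|T})_{T\in\pi}$. Operadic poset species. A poset species is a functor from finite sets and bijections to posets. An operadic poset species is a poset species $P$ with a morphism of poset species $a:P\to\Pi$ such that $a^{-1}(\min\Pi(S))=\min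 P(S)$ and $a^{-1}(\max\Pi(S))=\max P(S)$ for all $S$, and, for all $S$ and $x\in P(S)$ with $a(x)=\pi$, morphisms of posets $\varphi_x:P_{\le x}(S)\to P(\pi)$ and $\psi_x:P_{\ge x}(S)\to\prod_{T\in\pi}P(T)$ with $a\circ\varphi_x=\varphi_\pi\circ a$ and $a\circ\psi_x=\psi_\pi\circ a$, satisfying: (Equivariance) For a bijection $f:S\to S'$, $x\in P(S)$, $x'=P(f)(x)$, $\pi=a(x)$, $\pi'=a(x')$, and the induced bijections $f:\pi\to\pi'$ and $f_{|T}:T\to f(T)$: $P(f)\circ\varphi_x=\varphi_{x'}\circ P(f)$ and $(P(f_{|T}))_{T\in\pi}\circ\psi_x=\psi_{x'}\circ P(f)$. (Unitality) $P(\{s\})$ is a singleton for every singleton $\{s\}$. (Associativity) Let $x\le x'$ in $P(S)$, $\pi=a(x)$, $\pi'=a(x')$, $\underline{x}=\varphi_{x'}(x)\in P(\pi')$, $(x'_{|T})_{T\in\pi}=\psi_x(x')$; identify $\pi$ with the partition $\{\pi'_{|T},T\in\pi\}$ of $\pi'$. Then $\varphi_{\underline{x}}\circ\varphi_{x'}=\varphi_x$ on $P_{\le x}(S)$; $(\psi_{x'_{|T}})_{T\in\pi}\circ\psi_x=\psi_{x'}$ on $P_{\ge x'}(S)$; and $\psi_{\underline{x}}\circ\varphi_{x'}=(\varphi_{x'_{|T}})_{T\in\pi}\circ\psi_x$ as maps $P_{[x,x']}(S)\to\prod_{T\in\pi}P(\pi'_{|T})$.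
   Formalization: Added to the axioms of P: φ_x sends only x to max P(π) and ψ_x only x to a minimal element (so the pullbacks exist), and for x maximal φ_x is the identification P(S)=P({{s}}), for x minimal ψ_x is the inclusion (else the unit laws fail). *)

theory Defs
  imports
    "HOL-Algebra.AbelCoset"
    "HOL-Algebra.Module"
    "HOL-Library.FSet"
    "HOL-Library.FuncSet"
    "HOL-Library.Disjoint_Sets"
begin

section \<open>Finite sets and their partitions\<close>

text \<open>
  A poset species is evaluated on a finite set \<open>S\<close>, on partitions of \<open>S\<close> (sets of blocks), on
  partitions of those, and so on.  To have all of these in one type, finite sets are taken to be
  finite sets of elements of the hereditarily finite sets over an arbitrary type of atoms.  Every
  finite set of atoms is such a set, and a block of a partition is again an element.
\<close>

datatype 'a hfset = Atom 'a | HSet "'a hfset fset"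

definition blk :: "'a hfset set \<Rightarrow> 'a hfset" where
  "blk A = HSet (Abs_fset A)"

fun elts :: "'a hfset \<Rightarrow> 'a hfset set" where
  "elts (Atom a) = {}"
| "elts (HSet A) = fset A"

text \<open>The convention that finite sets are non-empty.\<close>

definition finset :: "'a set \<Rightarrow> bool" where
  "finset S \<longleftrightarrow> finite S \<and> S \<noteq> {}"

definition Parts :: "'a hfset set \<Rightarrow> 'a hfset set set" where
  "Parts S = {blk ` Q | Q. partition_on S Q}"

text \<open>
  Posets are represented by their order relations; the underlying set is the \<^const>\<open>Field\<close>.
  In the partition poset, \<open>\<alpha> \<le> \<beta>\<close> iff \<open>\<beta>\<close> refines \<open>\<alpha>\<close>, so that \<open>{S}\<close> is the minimum.
\<close>

definition Part_poset :: "'a hfset set \<Rightarrow> 'a hfset set rel" where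
  "Part_poset S = {(\<alpha>, \<beta>). \<alpha> \<in> Parts S \<and> \<beta> \<in> Parts S \<and> refines S (elts ` \<beta>) (elts ` \<alpha>)}"

text \<open>\<open>restr \<pi> T\<close> is \<open>\<pi>\<^bsub>|T\<^esub>\<close>, the set of blocks of \<open>\<pi>\<close> contained in \<open>T\<close>.\<close>

definition restr :: "'a hfset set \<Rightarrow> 'a hfset \<Rightarrow> 'a hfset set" where
  "restr \<pi> T = {V \<in> \<pi>. elts V \<subseteq> elts T}"

text \<open>The isomorphism \<open>\<phi>\<^sub>\<pi>\<close> from partitions coarser than \<open>\<pi>\<close> to partitions of the set \<open>\<pi>\<close>.\<close>

definition part_lower :: "'a hfset set \<Rightarrow> 'a hfset set \<Rightarrow> 'a hfset set" where
  "part_lower \<pi> \<alpha> = (\<lambda>T. blk (restr \<pi> T)) ` \<alpha>"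

text \<open>The action of a bijection on blocks, and (by taking images) on partitions.\<close>

definition blk_map :: "('a hfset \<Rightarrow> 'a hfset) \<Rightarrow> 'a hfset \<Rightarrow> 'a hfset" where
  "blk_map f T = blk (f ` elts T)"

section \<open>Posets and their cohomology\<close>

definition finite_poset :: "'p rel \<Rightarrow> bool" where
  "finite_poset r \<longleftrightarrow> finite r \<and> partial_order_on (Field r) r"

definition min_elems :: "'p rel \<Rightarrow> 'p set" where
  "min_elems r = {x \<in> Field r. \<forall>y. (y, x) \<in> r \<longrightarrow> y = x}"

definition max_elems :: "'p rel \<Rightarrow> 'p set" where
  "max_elems r = {x \<in> Field r. \<forall>y. (x, y) \<in> r \<longrightarrow> y = x}"

text \<open>The subposets \<open>P\<^bsub>\<le>x\<^esub>\<close> and \<open>P\<^bsub>\<ge>x\<^esub>\<close>.\<close>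

definition down :: "'p rel \<Rightarrow> 'p \<Rightarrow> 'p rel" where
  "down r x = r \<inter> (under r x \<times> under r x)"

definition up :: "'p rel \<Rightarrow> 'p \<Rightarrow> 'p rel" where
  "up r x = r \<inter> (above r x \<times> above r x)"

definition prod_poset :: "'i set \<Rightarrow> ('i \<Rightarrow> 'p rel) \<Rightarrow> ('i \<Rightarrow> 'p) rel" where
  "prod_poset I r = {(f, g). f \<in> (\<Pi>\<^sub>E i\<in>I. Field (r i)) \<and> g \<in> (\<Pi>\<^sub>E i\<in>I. Field (r i)) \<and>
     (\<forall>i\<in>I. (f i, g i) \<in> r i)}"

text \<open>
  A chain \<open>[x\<^sub>0 < \<dots> < x\<^sub>n]\<close> is a list of length \<open>n + 1\<close>.  \<open>chat_chains\<close> and \<open>c_chains\<close> are the bases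
  of the complex ending in maximal elements and of its subcomplex.
\<close>

definition chat_chains :: "'p rel \<Rightarrow> nat \<Rightarrow> 'p list set" where
  "chat_chains r n = {xs. length xs = Suc n \<and> set xs \<subseteq> Field r \<and>
     sorted_wrt (\<lambda>x y. (x, y) \<in> r \<and> x \<noteq> y) xs \<and> last xs \<in> max_elems r}"

definition c_chains :: "'p rel \<Rightarrow> nat \<Rightarrow> 'p list set" where
  "c_chains r n = {xs \<in> chat_chains r n. hd xs \<in> min_elems r}"

text \<open>
  The free module on a set \<open>A\<close> consists of the finitely supported functions on \<open>A\<close>, extended by
  zero; \<open>delta b\<close> is the basis element \<open>b\<close>.  The multiplicative fields of the record are not used
  for modules.
\<close>

definition free_mod :: "'b set \<Rightarrow> ('k::comm_ring_1, 'b \<Rightarrow> 'k) module" where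
  "free_mod A = \<lparr> carrier = {c. finite {b. c b \<noteq> 0} \<and> {b. c b \<noteq> 0} \<subseteq> A},
     monoid.mult = (\<lambda>_ _. undefined), one = undefined,
     ring.zero = (\<lambda>_. 0), add = (\<lambda>c c' b. c b + c' b), smult = (\<lambda>k c b. k * c b) \<rparr>"

definition delta :: "'b \<Rightarrow> 'b \<Rightarrow> 'k::comm_ring_1" where
  "delta b = (\<lambda>z. of_bool (z = b))"

definition free_ext :: "('b \<Rightarrow> 'c \<Rightarrow> 'k) \<Rightarrow> ('b \<Rightarrow> 'k) \<Rightarrow> 'c \<Rightarrow> 'k::comm_ring_1" where
  "free_ext g c = (\<lambda>z. \<Sum>b | c b \<noteq> 0. c b * g b z)"

text \<open>The quotient of a module by a submodule, following the library's \<^const>\<open>A_FactGroup\<close>.\<close>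

definition fact_mod :: "('k, 'm) module \<Rightarrow> 'm set \<Rightarrow> ('k, 'm set) module" where
  "fact_mod M N = \<lparr> carrier = a_rcosets\<^bsub>M\<^esub> N,
     monoid.mult = (\<lambda>_ _. undefined), one = undefined,
     ring.zero = N, add = set_add M, smult = (\<lambda>k X. the_elem ((\<lambda>x. N +>\<^bsub>M\<^esub> (k \<odot>\<^bsub>M\<^esub> x)) ` X)) \<rparr>"

text \<open>
  The differential on basis elements: \<open>y\<close> is inserted before the entry \<open>x\<^sub>i\<close>, for \<open>0 \<le> i \<le> n\<close>.
\<close>

definition d_chain :: "'p rel \<Rightarrow> 'p list \<Rightarrow> 'p list \<Rightarrow> 'k::comm_ring_1" where
  "d_chain r xs = (\<lambda>z. \<Sum>i<length xs.
     \<Sum>y | (y, xs ! i) \<in> r \<and> y \<noteq> xs ! i \<and> (0 < i \<longrightarrow> (xs ! (i - 1), y) \<in> r \<and> xs ! (i - 1) \<noteq> y).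
       (-1) ^ i * delta (take i xs @ y # drop i xs) z)"

definition codiff :: "'p rel \<Rightarrow> ('p list \<Rightarrow> 'k) \<Rightarrow> 'p list \<Rightarrow> 'k::comm_ring_1" where
  "codiff r = free_ext (d_chain r)"

text \<open>
  Cohomology of the complex spanned by the chains \<open>C r n\<close>, where \<open>C\<close> is one of
  \<^const>\<open>chat_chains\<close> and \<^const>\<open>c_chains\<close>.
\<close>

definition cocycles ::
    "('p rel \<Rightarrow> nat \<Rightarrow> 'p list set) \<Rightarrow> 'p rel \<Rightarrow> nat \<Rightarrow> ('p list \<Rightarrow> 'k::comm_ring_1) set" where
  "cocycles C r n = {c \<in> carrier (free_mod (C r n)). codiff r c = (\<lambda>_. 0)}"

definition coboundaries ::
    "('p rel \<Rightarrow> nat \<Rightarrow> 'p list set) \<Rightarrow> 'p rel \<Rightarrow> nat \<Rightarrow> ('p list \<Rightarrow> 'k::comm_ring_1) set" where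
  "coboundaries C r n =
     (case n of 0 \<Rightarrow> {\<lambda>_. 0} | Suc m \<Rightarrow> codiff r ` carrier (free_mod (C r m)))"

definition coh ::
    "('p rel \<Rightarrow> nat \<Rightarrow> 'p list set) \<Rightarrow> 'p rel \<Rightarrow> nat \<Rightarrow> ('k::comm_ring_1, ('p list \<Rightarrow> 'k) set) module"
  where
  "coh C r n = fact_mod ((free_mod (C r n)) \<lparr> carrier := cocycles C r n \<rparr>) (coboundaries C r n)"

definition coh_class ::
    "('p rel \<Rightarrow> nat \<Rightarrow> 'p list set) \<Rightarrow> 'p rel \<Rightarrow> nat \<Rightarrow> ('p list \<Rightarrow> 'k) \<Rightarrow> ('p list \<Rightarrow> 'k::comm_ring_1) set"
  where
  "coh_class C r n c = coboundaries C r n +>\<^bsub>free_mod (C r n)\<^esub> c"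

text \<open>
  Maps between cohomology groups are obtained from maps of cochains by the library idiom for maps
  out of a quotient: \<^const>\<open>the_elem\<close> of the set of classes obtained from all representatives.
  \<open>pull\<close> is \<open>f\<^sup>*\<close> for \<open>f\<close> with source the poset \<open>r\<close>.
\<close>

definition pull ::
    "'p rel \<Rightarrow> nat \<Rightarrow> ('p \<Rightarrow> 'q) \<Rightarrow> ('q list \<Rightarrow> 'k) \<Rightarrow> 'p list \<Rightarrow> 'k::comm_ring_1" where
  "pull r n f = free_ext (\<lambda>ys z. \<Sum>xs | xs \<in> chat_chains r n \<and> map f xs = ys. delta xs z)"

definition pull_coh ::
    "('p rel \<Rightarrow> nat \<Rightarrow> 'p list set) \<Rightarrow> 'p rel \<Rightarrow> nat \<Rightarrow> ('p \<Rightarrow> 'q)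
      \<Rightarrow> ('q list \<Rightarrow> 'k) set \<Rightarrow> ('p list \<Rightarrow> 'k::comm_ring_1) set" where
  "pull_coh C r n f Y = the_elem ((\<lambda>c. coh_class C r n (pull r n f c)) ` Y)"

text \<open>
  Concatenation of cochains on \<open>P\<^bsub>\<le>x\<^esub>\<close> and \<open>P\<^bsub>\<ge>x\<^esub>\<close>; the common entry \<open>x\<close> is kept once.
\<close>

definition concat_chain ::
    "('p list \<Rightarrow> 'k) \<Rightarrow> ('p list \<Rightarrow> 'k) \<Rightarrow> 'p list \<Rightarrow> 'k::comm_ring_1" where
  "concat_chain a b =
     (\<lambda>z. \<Sum>u | a u \<noteq> 0. \<Sum>v | b v \<noteq> 0. a u * b v * delta (u @ tl v) z)"

definition mu_coh ::
    "('p rel \<Rightarrow> nat \<Rightarrow> 'p list set) \<Rightarrow> 'p rel \<Rightarrow> nat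
      \<Rightarrow> ('p list \<Rightarrow> 'k) set \<Rightarrow> ('p list \<Rightarrow> 'k) set \<Rightarrow> ('p list \<Rightarrow> 'k::comm_ring_1) set" where
  "mu_coh C r n X Y = the_elem {coh_class C r n (concat_chain a b) | a b. a \<in> X \<and> b \<in> Y}"

text \<open>
  The iterated Kuenneth morphism.  From a list of chains \<open>u\<close> labelled by distinct indices \<open>i\<close> we get
  the chain in the product that starts at the family of first entries and moves along the first
  chain of the list, then along the second one, and so on.
\<close>

fun knit_from :: "('i \<Rightarrow> 'p) \<Rightarrow> ('i \<times> 'p list) list \<Rightarrow> ('i \<Rightarrow> 'p) list" where
  "knit_from f [] = []"
| "knit_from f ((i, u) # us) = map (\<lambda>x. f(i := x)) (tl u) @ knit_from (f(i := last u)) us"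

definition knit :: "('i \<times> 'p list) list \<Rightarrow> ('i \<Rightarrow> 'p) list" where
  "knit us = (let f = (\<lambda>i\<in>fst ` set us. hd (the (map_of us i))) in f # knit_from f us)"

definition kunneth :: "('i \<times> nat \<times> ('p list \<Rightarrow> 'k)) list \<Rightarrow> ('i \<Rightarrow> 'p) list \<Rightarrow> 'k::comm_ring_1" where
  "kunneth w = (\<lambda>z. \<Sum>us \<in> listset (map (\<lambda>(i, n, c). {u. c u \<noteq> 0}) w).
     (\<Prod>j<length w. snd (snd (w ! j)) (us ! j)) * delta (knit (zip (map fst w) us)) z)"

text \<open>
  Pure tensors of homogeneous elements are written as lists of triples (index, degree, element).
\<close>

definition tdeg :: "('i \<times> nat \<times> 'm) list \<Rightarrow> nat" where
  "tdeg w = (\<Sum>(i, n, y)\<leftarrow>w. n)"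

definition kunneth_coh ::
    "('i \<Rightarrow> 'p rel) \<Rightarrow> ('i \<times> nat \<times> ('p list \<Rightarrow> 'k) set) list
      \<Rightarrow> (('i \<Rightarrow> 'p) list \<Rightarrow> 'k::comm_ring_1) set" where
  "kunneth_coh r w = the_elem {coh_class c_chains (prod_poset (fst ` set w) r) (tdeg w) (kunneth w') | w'.
     list_all2 (\<lambda>(i', n', c) (i, n, X). i' = i \<and> n' = n \<and> c \<in> X) w' w}"

section \<open>Operadic poset species\<close>

text \<open>
  A functor on finite sets and bijections: \<open>pos_map P S f\<close> is the map \<open>P(S) \<rightarrow> P(f ` S)\<close> attached to
  an \<open>f\<close> that is injective on \<open>S\<close>; it only depends on the restriction of \<open>f\<close> to \<open>S\<close>.
\<close>

record ('a, 'p) poset_species =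
  pos :: "'a hfset set \<Rightarrow> 'p rel"
  pos_map :: "'a hfset set \<Rightarrow> ('a hfset \<Rightarrow> 'a hfset) \<Rightarrow> 'p \<Rightarrow> 'p"

locale poset_species =
  fixes P :: "('a, 'p, 'z) poset_species_scheme"
  assumes pos_poset: "finset S \<Longrightarrow> finite_poset (pos P S)"
    and pos_map_mono: "\<lbrakk> finset S; inj_on f S \<rbrakk> \<Longrightarrow> compat (pos P S) (pos P (f ` S)) (pos_map P S f)"
    and pos_map_cong: "\<lbrakk> finset S; inj_on f S; \<And>s. s \<in> S \<Longrightarrow> f s = g s; x \<in> Field (pos P S) \<rbrakk>
      \<Longrightarrow> pos_map P S f x = pos_map P S g x"
    and pos_map_id: "\<lbrakk> finset S; x \<in> Field (pos P S) \<rbrakk> \<Longrightarrow> pos_map P S id x = x"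
    and pos_map_comp: "\<lbrakk> finset S; inj_on f S; inj_on g (f ` S); x \<in> Field (pos P S) \<rbrakk>
      \<Longrightarrow> pos_map P S (g \<circ> f) x = pos_map P (f ` S) g (pos_map P S f x)"

text \<open>
  \<open>anchor\<close> is \<open>a\<close>, and for \<open>x\<close> in \<open>P(S)\<close> with \<open>a(x) = \<pi>\<close>, \<open>lower P S x\<close> is \<open>\<phi>\<^sub>x\<close> with values in \<open>P(\<pi>)\<close>
  and \<open>upper P S x y T\<close> is the component of \<open>\<psi>\<^sub>x(y)\<close> at the block \<open>T\<close> of \<open>\<pi>\<close>.
\<close>

record ('a, 'p) op_poset_species = "('a, 'p) poset_species" +
  anchor :: "'a hfset set \<Rightarrow> 'p \<Rightarrow> 'a hfset set"
  lower :: "'a hfset set \<Rightarrow> 'p \<Rightarrow> 'p \<Rightarrow> 'p"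
  upper :: "'a hfset set \<Rightarrow> 'p \<Rightarrow> 'p \<Rightarrow> 'a hfset \<Rightarrow> 'p"

locale operadic_poset_species = poset_species P
  for P :: "('a, 'p, 'z) op_poset_species_scheme" +
  assumes anchor_mono: "finset S \<Longrightarrow> compat (pos P S) (Part_poset S) (anchor P S)"
    and anchor_natural: "\<lbrakk> finset S; inj_on f S; x \<in> Field (pos P S) \<rbrakk>
      \<Longrightarrow> anchor P (f ` S) (pos_map P S f x) = blk_map f ` anchor P S x"
    and anchor_min: "finset S
      \<Longrightarrow> {x \<in> Field (pos P S). anchor P S x \<in> min_elems (Part_poset S)} = min_elems (pos P S)"
    and anchor_max: "finset S
      \<Longrightarrow> {x \<in> Field (pos P S). anchor P S x \<in> max_elems (Part_poset S)} = max_elems (pos P S)"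
    and lower_mono: "\<lbrakk> finset S; x \<in> Field (pos P S) \<rbrakk>
      \<Longrightarrow> compat (down (pos P S) x) (pos P (anchor P S x)) (lower P S x)"
    and upper_mono: "\<lbrakk> finset S; x \<in> Field (pos P S) \<rbrakk>
      \<Longrightarrow> compat (up (pos P S) x) (prod_poset (anchor P S x) (\<lambda>T. pos P (elts T))) (upper P S x)"
    and anchor_lower: "\<lbrakk> finset S; (y, x) \<in> pos P S \<rbrakk>
      \<Longrightarrow> anchor P (anchor P S x) (lower P S x y) = part_lower (anchor P S x) (anchor P S y)"
    and anchor_upper: "\<lbrakk> finset S; (x, y) \<in> pos P S; T \<in> anchor P S x \<rbrakk>
      \<Longrightarrow> anchor P (elts T) (upper P S x y T) = restr (anchor P S y) T"
    and lower_equivariant: "\<lbrakk> finset S; inj_on f S; (y, x) \<in> pos P S \<rbrakk>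
      \<Longrightarrow> pos_map P (anchor P S x) (blk_map f) (lower P S x y)
        = lower P (f ` S) (pos_map P S f x) (pos_map P S f y)"
    and upper_equivariant: "\<lbrakk> finset S; inj_on f S; (x, y) \<in> pos P S; T \<in> anchor P S x \<rbrakk>
      \<Longrightarrow> pos_map P (elts T) f (upper P S x y T)
        = upper P (f ` S) (pos_map P S f x) (pos_map P S f y) (blk_map f T)"
    and unitality: "\<exists>x. Field (pos P {s}) = {x}"
    and assoc_lower: "\<lbrakk> finset S; (y, x) \<in> pos P S; (x, x') \<in> pos P S \<rbrakk>
      \<Longrightarrow> lower P (anchor P S x') (lower P S x' x) (lower P S x' y)
        = pos_map P (anchor P S x) (\<lambda>T. blk (restr (anchor P S x') T)) (lower P S x y)"
    and assoc_upper: "\<lbrakk> finset S; (x, x') \<in> pos P S; (x', y) \<in> pos P S;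
        T \<in> anchor P S x; T' \<in> restr (anchor P S x') T \<rbrakk>
      \<Longrightarrow> upper P (elts T) (upper P S x x' T) (upper P S x y T) T' = upper P S x' y T'"
    and assoc_mixed: "\<lbrakk> finset S; (x, y) \<in> pos P S; (y, x') \<in> pos P S; T \<in> anchor P S x \<rbrakk>
      \<Longrightarrow> upper P (anchor P S x') (lower P S x' x) (lower P S x' y) (blk (restr (anchor P S x') T))
        = lower P (elts T) (upper P S x x' T) (upper P S x y T)"

text \<open>
  The pullbacks \<open>\<phi>\<^sub>x\<^sup>*\<close> and \<open>\<psi>\<^sub>x\<^sup>*\<close> exist on cohomology if preimages of maximal (and, for \<open>\<psi>\<^sub>x\<^sup>*\<close>, also
  minimal) elements are maximal (minimal).  The two conditions below are those which do not follow
  from \<^locale>\<open>operadic_poset_species\<close>: doubling each element of the partition posets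
  that is neither minimal nor maximal to a pair \<open>(\<pi>,0) < (\<pi>,1)\<close> gives an operadic poset species
  for which they fail.
\<close>

definition has_pullbacks :: "('a, 'p, 'z) op_poset_species_scheme \<Rightarrow> bool" where
  "has_pullbacks P \<longleftrightarrow> (\<forall>S x. finset S \<longrightarrow> x \<in> Field (pos P S) \<longrightarrow>
     (\<forall>y. (y, x) \<in> pos P S \<longrightarrow> lower P S x y \<in> max_elems (pos P (anchor P S x))
        \<longrightarrow> y \<in> max_elems (down (pos P S) x)) \<and>
     (\<forall>y. (x, y) \<in> pos P S
        \<longrightarrow> upper P S x y \<in> min_elems (prod_poset (anchor P S x) (\<lambda>T. pos P (elts T)))
        \<longrightarrow> y \<in> min_elems (up (pos P S) x)))"

text \<open>
  Unit constraints: for \<open>x\<close> maximal, \<open>\<phi>\<^sub>x\<close> is the identification of \<open>P(S)\<close> with \<open>P({{s} | s \<in> S})\<close>, and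
  for \<open>x\<close> minimal, \<open>\<psi>\<^sub>x\<close> is the inclusion into \<open>P(S)\<close>.  In \<^locale>\<open>operadic_poset_species\<close>
  these maps are only constrained to be idempotent: if the poset of partitions that are neither
  minimal nor maximal is replaced by two disjoint copies of it, the maps \<open>\<phi>\<^sub>x\<close> may also project
  the second copy onto the first one, and then the unit laws fail in cohomology.
\<close>

definition has_units :: "('a, 'p, 'z) op_poset_species_scheme \<Rightarrow> bool" where
  "has_units P \<longleftrightarrow> (\<forall>S x. finset S \<longrightarrow>
     (x \<in> max_elems (pos P S) \<longrightarrow>
        (\<forall>y. (y, x) \<in> pos P S \<longrightarrow> lower P S x y = pos_map P S (\<lambda>s. blk {s}) y)) \<and>
     (x \<in> min_elems (pos P S) \<longrightarrow> (\<forall>y. (x, y) \<in> pos P S \<longrightarrow> upper P S x y (blk S) = y)))"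

section \<open>Graded species, operads and right modules\<close>

text \<open>The ground ring, as a ring in the sense of the algebra library.\<close>

definition base_ring :: "'k::comm_ring_1 ring" where
  "base_ring = \<lparr> carrier = UNIV, monoid.mult = (*), one = 1, ring.zero = 0, add = (+) \<rparr>"

definition mod_hom :: "('k::comm_ring_1, 'm) module \<Rightarrow> ('k, 'n) module \<Rightarrow> ('m \<Rightarrow> 'n) set" where
  "mod_hom M N = {f \<in> carrier M \<rightarrow> carrier N.
     (\<forall>x\<in>carrier M. \<forall>y\<in>carrier M. f (x \<oplus>\<^bsub>M\<^esub> y) = f x \<oplus>\<^bsub>N\<^esub> f y) \<and>
     (\<forall>k. \<forall>x\<in>carrier M. f (k \<odot>\<^bsub>M\<^esub> x) = k \<odot>\<^bsub>N\<^esub> f x)}"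

text \<open>
  The degree \<open>N\<close> part of \<open>M \<otimes> \<Otimes>\<^bsub>i\<in>I\<^esub> L\<^sub>i\<close>, for graded modules \<open>M\<close> and \<open>L\<^sub>i\<close>, where \<open>I\<close> is not ordered.
  It is generated by the pure tensors of homogeneous elements for all orderings of \<open>I\<close>, subject to
  multilinearity and to the Koszul sign rule relating the different orderings.
\<close>

type_synonym ('i, 'm, 'n) tgen = "(nat \<times> 'm) \<times> ('i \<times> nat \<times> 'n) list"

definition tgens ::
    "(nat \<Rightarrow> ('k, 'm) module) \<Rightarrow> 'i set \<Rightarrow> ('i \<Rightarrow> nat \<Rightarrow> ('k, 'n) module) \<Rightarrow> nat \<Rightarrow> ('i, 'm, 'n) tgen set"
  where
  "tgens M I L N = {((m, x), w). x \<in> carrier (M m) \<and>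
     distinct (map fst w) \<and> set (map fst w) = I \<and>
     (\<forall>(i, n, y) \<in> set w. y \<in> carrier (L i n)) \<and> m + tdeg w = N}"

inductive_set trels ::
    "(nat \<Rightarrow> ('k::comm_ring_1, 'm) module) \<Rightarrow> 'i set \<Rightarrow> ('i \<Rightarrow> nat \<Rightarrow> ('k, 'n) module) \<Rightarrow> nat
      \<Rightarrow> (('i, 'm, 'n) tgen \<Rightarrow> 'k) set"
  for M I L N where
  add_head: "\<lbrakk> ((m, x), w) \<in> tgens M I L N; ((m, x'), w) \<in> tgens M I L N \<rbrakk>
    \<Longrightarrow> (\<lambda>z. delta ((m, x \<oplus>\<^bsub>M m\<^esub> x'), w) z - delta ((m, x), w) z - delta ((m, x'), w) z)
      \<in> trels M I L N"
| smult_head: "((m, x), w) \<in> tgens M I L N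
    \<Longrightarrow> (\<lambda>z. delta ((m, k \<odot>\<^bsub>M m\<^esub> x), w) z - k * delta ((m, x), w) z) \<in> trels M I L N"
| add_tail: "\<lbrakk> (h, u @ (i, n, y) # v) \<in> tgens M I L N; (h, u @ (i, n, y') # v) \<in> tgens M I L N \<rbrakk>
    \<Longrightarrow> (\<lambda>z. delta (h, u @ (i, n, y \<oplus>\<^bsub>L i n\<^esub> y') # v) z
        - delta (h, u @ (i, n, y) # v) z - delta (h, u @ (i, n, y') # v) z) \<in> trels M I L N"
| smult_tail: "(h, u @ (i, n, y) # v) \<in> tgens M I L N
    \<Longrightarrow> (\<lambda>z. delta (h, u @ (i, n, k \<odot>\<^bsub>L i n\<^esub> y) # v) z - k * delta (h, u @ (i, n, y) # v) z)
      \<in> trels M I L N"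
| koszul: "(h, u @ (i, n, y) # (i', n', y') # v) \<in> tgens M I L N
    \<Longrightarrow> (\<lambda>z. delta (h, u @ (i, n, y) # (i', n', y') # v) z
        - (-1) ^ (n * n') * delta (h, u @ (i', n', y') # (i, n, y) # v) z) \<in> trels M I L N"

definition tnull ::
    "(nat \<Rightarrow> ('k::comm_ring_1, 'm) module) \<Rightarrow> 'i set \<Rightarrow> ('i \<Rightarrow> nat \<Rightarrow> ('k, 'n) module) \<Rightarrow> nat
      \<Rightarrow> (('i, 'm, 'n) tgen \<Rightarrow> 'k) set" where
  "tnull M I L N =
     \<Inter> {H. submodule H base_ring (free_mod (tgens M I L N)) \<and> trels M I L N \<subseteq> H}"

definition tensor ::
    "(nat \<Rightarrow> ('k::comm_ring_1, 'm) module) \<Rightarrow> 'i set \<Rightarrow> ('i \<Rightarrow> nat \<Rightarrow> ('k, 'n) module) \<Rightarrow> nat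
      \<Rightarrow> ('k, (('i, 'm, 'n) tgen \<Rightarrow> 'k) set) module" where
  "tensor M I L N = fact_mod (free_mod (tgens M I L N)) (tnull M I L N)"

definition pure ::
    "(nat \<Rightarrow> ('k::comm_ring_1, 'm) module) \<Rightarrow> 'i set \<Rightarrow> ('i \<Rightarrow> nat \<Rightarrow> ('k, 'n) module) \<Rightarrow> nat
      \<Rightarrow> ('i, 'm, 'n) tgen \<Rightarrow> (('i, 'm, 'n) tgen \<Rightarrow> 'k) set" where
  "pure M I L N g = tnull M I L N +>\<^bsub>free_mod (tgens M I L N)\<^esub> delta g"

text \<open>The linear map from the tensor product to \<open>E\<close> with given values \<open>f g\<close> on pure tensors \<open>g\<close>.\<close>

definition tensor_lift ::
    "('k::comm_ring_1, 'e) module \<Rightarrow> (('i, 'm, 'n) tgen \<Rightarrow> 'e)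
      \<Rightarrow> (('i, 'm, 'n) tgen \<Rightarrow> 'k) set \<Rightarrow> 'e" where
  "tensor_lift E f X = the_elem ((\<lambda>c. finsum E (\<lambda>g. c g \<odot>\<^bsub>E\<^esub> f g) {g. c g \<noteq> 0}) ` X)"

text \<open>
  Graded linear species; \<open>gmap G S f n\<close> is the map \<open>G(S) \<rightarrow> G(f ` S)\<close> in degree \<open>n\<close>.
\<close>

record ('a, 'k, 'm) graded_species =
  gcomp :: "'a hfset set \<Rightarrow> nat \<Rightarrow> ('k, 'm) module"
  gmap :: "'a hfset set \<Rightarrow> ('a hfset \<Rightarrow> 'a hfset) \<Rightarrow> nat \<Rightarrow> 'm \<Rightarrow> 'm"

locale graded_species =
  fixes G :: "('a, 'k::comm_ring_1, 'm) graded_species"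
  assumes gcomp_module: "finset S \<Longrightarrow> Module.module base_ring (gcomp G S n)"
    and gmap_hom: "\<lbrakk> finset S; inj_on f S \<rbrakk>
      \<Longrightarrow> gmap G S f n \<in> mod_hom (gcomp G S n) (gcomp G (f ` S) n)"
    and gmap_cong: "\<lbrakk> finset S; inj_on f S; \<And>s. s \<in> S \<Longrightarrow> f s = g s; x \<in> carrier (gcomp G S n) \<rbrakk>
      \<Longrightarrow> gmap G S f n x = gmap G S g n x"
    and gmap_id: "\<lbrakk> finset S; x \<in> carrier (gcomp G S n) \<rbrakk> \<Longrightarrow> gmap G S id n x = x"
    and gmap_comp: "\<lbrakk> finset S; inj_on f S; inj_on g (f ` S); x \<in> carrier (gcomp G S n) \<rbrakk>
      \<Longrightarrow> gmap G S (g \<circ> f) n x = gmap G (f ` S) g n (gmap G S f n x)"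

text \<open>
  The generators, the module and the pure tensors of \<open>G(\<pi>) \<otimes> \<Otimes>\<^bsub>T\<in>\<pi>\<^esub> F(T)\<close> in degree \<open>N\<close>.  A composition
  map \<open>\<rho> S \<pi> N\<close> is the degree \<open>N\<close> part of a map from there to \<open>G(S)\<close>.
\<close>

abbreviation "comp_gens G F \<pi> N \<equiv> tgens (gcomp G \<pi>) \<pi> (\<lambda>T. gcomp F (elts T)) N"
abbreviation "comp_tensor G F \<pi> N \<equiv> tensor (gcomp G \<pi>) \<pi> (\<lambda>T. gcomp F (elts T)) N"
abbreviation "comp_pure G F \<pi> N \<equiv> pure (gcomp G \<pi>) \<pi> (\<lambda>T. gcomp F (elts T)) N"

type_synonym ('a, 'k, 'm, 'n) compmaps =
  "'a hfset set \<Rightarrow> 'a hfset set \<Rightarrow> nat \<Rightarrow> (('a hfset, 'm, 'n) tgen \<Rightarrow> 'k) set \<Rightarrow> 'm"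

text \<open>
  For the associativity of an action, an entry \<open>(U, n, y, w)\<close> of a list stands for a block \<open>U\<close> of
  the coarser partition \<open>\<sigma>\<close>, an element \<open>y\<close> of \<open>F(\<pi>\<^bsub>|U\<^esub>)\<close> of degree \<open>n\<close>, and a pure tensor \<open>w\<close> of elements
  of \<open>F(T)\<close> for the blocks \<open>T\<close> of \<open>\<pi>\<close> contained in \<open>U\<close>.  The sign \<open>(-1)^shuffle_exp v\<close> is the Koszul sign of
  the passage from \<open>y\<^sub>1 \<otimes> \<dots> \<otimes> y\<^sub>k \<otimes> w\<^sub>1 \<otimes> \<dots> \<otimes> w\<^sub>k\<close> to \<open>y\<^sub>1 \<otimes> w\<^sub>1 \<otimes> \<dots> \<otimes> y\<^sub>k \<otimes> w\<^sub>k\<close>.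
\<close>

fun shuffle_exp :: "('i \<times> nat \<times> 'm \<times> ('i \<times> nat \<times> 'm) list) list \<Rightarrow> nat" where
  "shuffle_exp [] = 0"
| "shuffle_exp ((U, n, y, w) # v) = tdeg w * (\<Sum>(U', n', y', w')\<leftarrow>v. n') + shuffle_exp v"

locale right_action = F: graded_species F + G: graded_species G
  for F :: "('a, 'k::comm_ring_1, 'm) graded_species"
    and \<rho>F :: "('a, 'k, 'm, 'm) compmaps"
    and \<eta> :: "'a hfset \<Rightarrow> 'm"
    and G :: "('a, 'k, 'n) graded_species"
    and \<rho> :: "('a, 'k, 'n, 'm) compmaps" +
  assumes linear: "\<lbrakk> finset S; \<pi> \<in> Parts S \<rbrakk>
      \<Longrightarrow> \<rho> S \<pi> N \<in> mod_hom (comp_tensor G F \<pi> N) (gcomp G S N)"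
    and equivariant: "\<lbrakk> finset S; \<pi> \<in> Parts S; inj_on f S; ((m, x), w) \<in> comp_gens G F \<pi> N \<rbrakk>
      \<Longrightarrow> gmap G S f N (\<rho> S \<pi> N (comp_pure G F \<pi> N ((m, x), w)))
        = \<rho> (f ` S) (blk_map f ` \<pi>) N (comp_pure G F (blk_map f ` \<pi>) N
            ((m, gmap G \<pi> (blk_map f) m x),
             map (\<lambda>(T, n, y). (blk_map f T, n, gmap F (elts T) f n y)) w))"
    and associative: "\<lbrakk> finset S; (\<sigma>, \<pi>) \<in> Part_poset S; x \<in> carrier (gcomp G \<sigma> m);
        distinct (map fst v); set (map fst v) = \<sigma>;
        \<forall>(U, n, y, w) \<in> set v. ((n, y), w) \<in> comp_gens F F (restr \<pi> U) (n + tdeg w);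
        p = m + (\<Sum>(U, n, y, w)\<leftarrow>v. n); N = p + (\<Sum>(U, n, y, w)\<leftarrow>v. tdeg w) \<rbrakk>
      \<Longrightarrow> \<rho> S \<pi> N (comp_pure G F \<pi> N
            ((p, \<rho> \<pi> (part_lower \<pi> \<sigma>) p (comp_pure G F (part_lower \<pi> \<sigma>) p
                   ((m, gmap G \<sigma> (\<lambda>U. blk (restr \<pi> U)) m x),
                    map (\<lambda>(U, n, y, w). (blk (restr \<pi> U), n, y)) v))),
             concat (map (\<lambda>(U, n, y, w). w) v)))
        = (-1) ^ shuffle_exp v \<odot>\<^bsub>gcomp G S N\<^esub> \<rho> S \<sigma> N (comp_pure G F \<sigma> N
            ((m, x),
             map (\<lambda>(U, n, y, w). (U, n + tdeg w, \<rho>F (elts U) (restr \<pi> U) (n + tdeg w)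
               (comp_pure F F (restr \<pi> U) (n + tdeg w) ((n, y), w)))) v))"
    and right_unital: "\<lbrakk> finset S; distinct ss; set ss = S; x \<in> carrier (gcomp G S n) \<rbrakk>
      \<Longrightarrow> \<rho> S ((\<lambda>s. blk {s}) ` S) n (comp_pure G F ((\<lambda>s. blk {s}) ` S) n
            ((n, gmap G S (\<lambda>s. blk {s}) n x), map (\<lambda>s. (blk {s}, 0, \<eta> s)) ss)) = x"

text \<open>
  \<open>\<eta> s\<close> is the value at \<open>1\<close> of the unit on the singleton \<open>{s}\<close>; the unit species is concentrated in
  degree \<open>0\<close> on singletons.
\<close>

locale graded_operad = right_action F \<rho>F \<eta> F \<rho>F
  for F :: "('a, 'k::comm_ring_1, 'm) graded_species"
    and \<rho>F :: "('a, 'k, 'm, 'm) compmaps"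
    and \<eta> :: "'a hfset \<Rightarrow> 'm" +
  assumes unit_closed: "\<eta> s \<in> carrier (gcomp F {s} 0)"
    and unit_natural: "gmap F {s} f 0 (\<eta> s) = \<eta> (f s)"
    and left_unital: "\<lbrakk> finset S; y \<in> carrier (gcomp F S n) \<rbrakk>
      \<Longrightarrow> \<rho>F S {blk S} n (comp_pure F F {blk S} n ((0, \<eta> (blk S)), [(blk S, n, y)])) = y"

locale right_operadic_module = graded_operad F \<rho>F \<eta> + right_action F \<rho>F \<eta> G \<rho>
  for F :: "('a, 'k::comm_ring_1, 'm) graded_species"
    and \<rho>F :: "('a, 'k, 'm, 'm) compmaps"
    and \<eta> :: "'a hfset \<Rightarrow> 'm"
    and G :: "('a, 'k, 'n) graded_species"
    and \<rho> :: "('a, 'k, 'n, 'm) compmaps"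

section \<open>The structures on the cohomology of an operadic poset species\<close>

definition coh_species ::
    "('p rel \<Rightarrow> nat \<Rightarrow> 'p list set) \<Rightarrow> ('a, 'p, 'z) op_poset_species_scheme
      \<Rightarrow> ('a, 'k::comm_ring_1, ('p list \<Rightarrow> 'k) set) graded_species" where
  "coh_species C P = \<lparr>
     gcomp = (\<lambda>S n. coh C (pos P S) n),
     gmap = (\<lambda>S f n. pull_coh C (pos P (f ` S)) n (pos_map P (f ` S) (inv_into S f))) \<rparr>"

text \<open>
  \<open>coh_comp C P S \<pi> N\<close> is the degree \<open>N\<close> part of the composition map for \<open>\<pi>\<close>:
  \<open>\<rho>\<close> if \<open>C\<close> is \<^const>\<open>c_chains\<close> and its variant with hats if \<open>C\<close> is \<^const>\<open>chat_chains\<close>.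
\<close>

definition coh_comp_pure ::
    "('p rel \<Rightarrow> nat \<Rightarrow> 'p list set) \<Rightarrow> ('a, 'p, 'z) op_poset_species_scheme
      \<Rightarrow> 'a hfset set \<Rightarrow> 'a hfset set \<Rightarrow> nat
      \<Rightarrow> ('a hfset, ('p list \<Rightarrow> 'k) set, ('p list \<Rightarrow> 'k) set) tgen
      \<Rightarrow> ('p list \<Rightarrow> 'k::comm_ring_1) set" where
  "coh_comp_pure C P S \<pi> N = (\<lambda>((m, X), w).
     finsum (coh C (pos P S) N)
       (\<lambda>x. mu_coh C (pos P S) N
          (pull_coh C (down (pos P S) x) m (lower P S x) X)
          (pull_coh c_chains (up (pos P S) x) (tdeg w) (upper P S x)
             (kunneth_coh (\<lambda>T. pos P (elts T)) w)))
       {x \<in> Field (pos P S). anchor P S x = \<pi>})"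

definition coh_comp ::
    "('p rel \<Rightarrow> nat \<Rightarrow> 'p list set) \<Rightarrow> ('a, 'p, 'z) op_poset_species_scheme
      \<Rightarrow> ('a, 'k::comm_ring_1, ('p list \<Rightarrow> 'k) set, ('p list \<Rightarrow> 'k) set) compmaps" where
  "coh_comp C P S \<pi> N = tensor_lift (coh C (pos P S) N) (coh_comp_pure C P S \<pi> N)"

definition coh_unit ::
    "('a, 'p, 'z) op_poset_species_scheme \<Rightarrow> 'a hfset \<Rightarrow> ('p list \<Rightarrow> 'k::comm_ring_1) set" where
  "coh_unit P s = coh_class c_chains (pos P {s}) 0 (delta [the_elem (Field (pos P {s}))])"

abbreviation "h_species P \<equiv> coh_species c_chains P"
abbreviation "h_comp P \<equiv> coh_comp c_chains P"
abbreviation "hhat_species P \<equiv> coh_species chat_chains P"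
abbreviation "hhat_comp P \<equiv> coh_comp chat_chains P"

end

theory Submission imports Defs begin

text \<open>
  The cohomology of a poset is that of the simplicial cochains, as functions on lists, supported on
  the chains with prescribed ends; concatenation is then the cup product and restricts to chains
  running through a given antichain.  On a product of posets, the Kuenneth morphism is the cup
  product of the cochains of the factors, pulled back along the projections: a word whose letters
  move one coordinate each.  Steenrod's cup-one product provides the coboundary that exchanges
  adjacent letters of different coordinates up to the Koszul sign, so the order of the letters
  matters only up to sign.

  On cochains, both sides of the associativity law are sums over pairs \<open>a \<le> b\<close> in \<open>P(S)\<close> with
  anchors \<open>\<sigma> \<le> \<pi>\<close>.  The axioms for \<open>\<phi>\<close> and \<open>\<psi>\<close> identify the corresponding chains in the
  product over the blocks of \<open>\<sigma>\<close>, and the two sides differ by the order of the letters, which gives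
  the shuffle sign.
\<close>

section \<open>Quotients of function spaces\<close>

text \<open>Nothing is computed with cohomology classes beyond the choice of representatives: each
  map in the statement has an explicit formula on cochains, evaluated at one chain. In the
  composition formula the sum over \<open>x\<close> then disappears, since at a chain
  \<open>z\<close> only the entry of \<open>z\<close> at the cut can be \<open>x\<close>. So
  equivariance and the unit laws become equalities of functions. Two obstacles shape the rest. The
  maps \<open>lower\<close> and \<open>upper\<close> need not be injective, so images of chains may
  repeat entries; the formulas are therefore also established on weakly increasing lists, where
  cochains supported on strict chains behave well because the two faces at a repetition cancel. And
  faces of a chain may leave the prescribed end regions. All complexes are truncated to such
  regions, and products survive the truncation because a nonzero factor determines the region of the
  cut point. Regions that are antichains pin down a coordinate of a product while another one moves.
  The set of admissible first entries stays a parameter, so one proof covers the action of the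
  operad on itself and on the module; \<open>has_pullbacks\<close> makes the end regions match
  exactly, \<open>has_units\<close> gives the unit laws.\<close>

definition fun_subspace :: "('b \<Rightarrow> 'k::comm_ring_1) set \<Rightarrow> bool" where
  "fun_subspace V \<longleftrightarrow> (\<lambda>_. 0) \<in> V \<and> (\<forall>c\<in>V. \<forall>c'\<in>V. (\<lambda>b. c b + c' b) \<in> V) \<and>
     (\<forall>k. \<forall>c\<in>V. (\<lambda>b. k * c b) \<in> V)"

lemma fun_subspace_zero: "fun_subspace V \<Longrightarrow> (\<lambda>_. 0) \<in> V"
  and fun_subspace_add: "\<lbrakk>fun_subspace V; c \<in> V; c' \<in> V\<rbrakk> \<Longrightarrow> (\<lambda>b. c b + c' b) \<in> V"
  and fun_subspace_smult: "\<lbrakk>fun_subspace V; c \<in> V\<rbrakk> \<Longrightarrow> (\<lambda>b. k * c b) \<in> V"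
  by (auto simp: fun_subspace_def)

lemma fun_subspace_uminus: "\<lbrakk>fun_subspace V; c \<in> V\<rbrakk> \<Longrightarrow> (\<lambda>b. - c b) \<in> V"
  using fun_subspace_smult[of V c "-1"] by simp

lemma fun_subspace_diff:
  assumes "fun_subspace V" "c \<in> V" "c' \<in> V" shows "(\<lambda>b. c b - c' b) \<in> V"
  using fun_subspace_add[OF assms(1) assms(2) fun_subspace_uminus[OF assms(1,3)]] by simp

lemma fun_subspace_sum:
  assumes "fun_subspace V" "finite X" "\<And>x. x \<in> X \<Longrightarrow> F x \<in> V"
  shows "(\<lambda>b. \<Sum>x\<in>X. F x b) \<in> V"
  using assms(2,3)
proof (induction X rule: finite_induct)
  case empty
  then show ?case using fun_subspace_zero[OF assms(1)] by simp
next
  case (insert x X)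
  then show ?case using fun_subspace_add[OF assms(1), of "F x" "\<lambda>b. \<Sum>x\<in>X. F x b"] by simp
qed

definition fun_mod :: "('b \<Rightarrow> 'k) set \<Rightarrow> ('k::comm_ring_1, 'b \<Rightarrow> 'k) module" where
  "fun_mod V = free_mod UNIV \<lparr>carrier := V\<rparr>"

text \<open>The operations in the record \<open>free_mod A\<close> do not depend on
  \<open>A\<close>, so a module of cochains is determined by its carrier, and cosets and quotients
  can be computed without reference to a basis.\<close>

lemma free_mod_carrier_update: "free_mod A \<lparr>carrier := V\<rparr> = fun_mod V"
  by (simp add: fun_mod_def free_mod_def)

lemma free_mod_eq_fun_mod: "free_mod A = fun_mod (carrier (free_mod A))"
  by (simp add: fun_mod_def free_mod_def)

lemma fun_mod_simps [simp]:
  "carrier (fun_mod V) = V"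
  "\<zero>\<^bsub>fun_mod V\<^esub> = (\<lambda>_. 0)"
  "c \<oplus>\<^bsub>fun_mod V\<^esub> c' = (\<lambda>b. c b + c' b)"
  "k \<odot>\<^bsub>fun_mod V\<^esub> c = (\<lambda>b. k * c b)"
  by (simp_all add: fun_mod_def free_mod_def)

definition fcoset :: "('b \<Rightarrow> 'k::comm_ring_1) set \<Rightarrow> ('b \<Rightarrow> 'k) \<Rightarrow> ('b \<Rightarrow> 'k) set" where
  "fcoset W c = {\<lambda>b. h b + c b | h. h \<in> W}"

lemma a_r_coset_fun_mod: "W +>\<^bsub>fun_mod V\<^esub> c = fcoset W c"
  by (auto simp: a_r_coset_def' fcoset_def)

lemma a_r_coset_free_mod: "W +>\<^bsub>free_mod A\<^esub> c = fcoset W c"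
  by (subst free_mod_eq_fun_mod) (rule a_r_coset_fun_mod)

lemma mem_fcoset: "x \<in> fcoset W c \<longleftrightarrow> (\<lambda>b. x b - c b) \<in> W"
  by (force simp: fcoset_def)

lemma self_mem_fcoset: "fun_subspace W \<Longrightarrow> c \<in> fcoset W c"
  by (simp add: mem_fcoset fun_subspace_zero)

lemma fcoset_eq_iff:
  assumes W: "fun_subspace W"
  shows "fcoset W c = fcoset W c' \<longleftrightarrow> (\<lambda>b. c b - c' b) \<in> W"
proof
  assume "fcoset W c = fcoset W c'"
  then show "(\<lambda>b. c b - c' b) \<in> W" using self_mem_fcoset[OF W, of c] by (simp add: mem_fcoset)
next
  assume *: "(\<lambda>b. c b - c' b) \<in> W"
  have "(\<lambda>b. x b - c b) \<in> W \<longleftrightarrow> (\<lambda>b. x b - c' b) \<in> W" for x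
    using fun_subspace_add[OF W *, of "\<lambda>b. x b - c b"]
      fun_subspace_diff[OF W _ *, of "\<lambda>b. x b - c' b"] by auto
  then show "fcoset W c = fcoset W c'" by (auto simp: mem_fcoset)
qed

lemma fcoset_zero: "fcoset W (\<lambda>_. 0) = W"
  by (auto simp: mem_fcoset)

abbreviation fun_quot :: "('b \<Rightarrow> 'k::comm_ring_1) set \<Rightarrow> ('b \<Rightarrow> 'k) set \<Rightarrow> ('k, ('b \<Rightarrow> 'k) set) module"
  where "fun_quot V W \<equiv> fact_mod (fun_mod V) W"

lemma carrier_fun_quot: "carrier (fun_quot V W) = fcoset W ` V"
proof -
  have "rcosets\<^bsub>add_monoid (fun_mod V)\<^esub> W = fcoset W ` V"
    by (auto simp: RCOSETS_def r_coset_def fcoset_def)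
  then show ?thesis by (simp add: fact_mod_def A_RCOSETS_def)
qed

lemma zero_fun_quot: "\<zero>\<^bsub>fun_quot V W\<^esub> = W"
  by (simp add: fact_mod_def)

lemma add_fun_quot:
  assumes W: "fun_subspace W"
  shows "fcoset W c \<oplus>\<^bsub>fun_quot V W\<^esub> fcoset W c' = fcoset W (\<lambda>b. c b + c' b)"
proof -
  have "fcoset W c <+>\<^bsub>fun_mod V\<^esub> fcoset W c' = fcoset W (\<lambda>b. c b + c' b)"
  proof (intro Set.set_eqI)
    fix x
    have "x \<in> fcoset W c <+>\<^bsub>fun_mod V\<^esub> fcoset W c' \<longleftrightarrow>
      (\<exists>h\<in>fcoset W c. \<exists>h'\<in>fcoset W c'. x = (\<lambda>b. h b + h' b))"
      by (auto simp: set_add_def set_mult_def)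
    also have "\<dots> \<longleftrightarrow> x \<in> fcoset W (\<lambda>b. c b + c' b)"
    proof
      assume "\<exists>h\<in>fcoset W c. \<exists>h'\<in>fcoset W c'. x = (\<lambda>b. h b + h' b)"
      then obtain h h' where "(\<lambda>b. h b - c b) \<in> W" "(\<lambda>b. h' b - c' b) \<in> W" "x = (\<lambda>b. h b + h' b)"
        by (auto simp: mem_fcoset)
      then show "x \<in> fcoset W (\<lambda>b. c b + c' b)"
        using fun_subspace_add[OF W, of "\<lambda>b. h b - c b" "\<lambda>b. h' b - c' b"]
        by (simp add: mem_fcoset algebra_simps)
    next
      assume "x \<in> fcoset W (\<lambda>b. c b + c' b)"
      then have "(\<lambda>b. x b - c' b) \<in> fcoset W c" by (simp add: mem_fcoset algebra_simps)
      moreover have "c' \<in> fcoset W c'" using self_mem_fcoset[OF W] .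
      ultimately show "\<exists>h\<in>fcoset W c. \<exists>h'\<in>fcoset W c'. x = (\<lambda>b. h b + h' b)"
        by (intro bexI[of _ "\<lambda>b. x b - c' b"] bexI[of _ c']) auto
    qed
    finally show "x \<in> fcoset W c <+>\<^bsub>fun_mod V\<^esub> fcoset W c' \<longleftrightarrow> x \<in> fcoset W (\<lambda>b. c b + c' b)" .
  qed
  then show ?thesis by (simp add: fact_mod_def)
qed

text \<open>The maps out of quotients are defined as \<open>the_elem\<close> of all values on
  representatives; this lemma and its two variants below reduce well-definedness to constancy on
  representatives.\<close>

lemma the_elem_image_const:
  assumes "A \<noteq> {}" "\<And>x. x \<in> A \<Longrightarrow> f x = y"
  shows "the_elem (f ` A) = y"
  using assms by (metis image_cong image_constant_conv the_elem_eq)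

lemma the_elem_Collect_const:
  assumes "\<exists>x. Q x" "\<And>x. Q x \<Longrightarrow> f x = y"
  shows "the_elem {f x |x. Q x} = y"
proof -
  have "{f x |x. Q x} = {y}" using assms by auto
  then show ?thesis by simp
qed

lemma the_elem_Collect2_const:
  assumes "\<exists>x x'. Q x x'" "\<And>x x'. Q x x' \<Longrightarrow> f x x' = y"
  shows "the_elem {f x x' |x x'. Q x x'} = y"
proof -
  have "{f x x' |x x'. Q x x'} = {y}" using assms by auto
  then show ?thesis by simp
qed

lemma smult_fun_quot:
  assumes W: "fun_subspace W"
  shows "k \<odot>\<^bsub>fun_quot V W\<^esub> fcoset W c = fcoset W (\<lambda>b. k * c b)"
proof -
  have "the_elem ((\<lambda>x. fcoset W (\<lambda>b. k * x b)) ` fcoset W c) = fcoset W (\<lambda>b. k * c b)"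
  proof (rule the_elem_image_const)
    show "fcoset W c \<noteq> {}" using self_mem_fcoset[OF W] by blast
    fix x assume "x \<in> fcoset W c"
    then show "fcoset W (\<lambda>b. k * x b) = fcoset W (\<lambda>b. k * c b)"
      using fun_subspace_smult[OF W, of "\<lambda>b. x b - c b" k]
      by (simp add: fcoset_eq_iff[OF W] mem_fcoset algebra_simps)
  qed
  then show ?thesis by (simp add: fact_mod_def a_r_coset_fun_mod)
qed

lemma cring_base_ring: "cring base_ring"
  by (unfold_locales) (auto simp: base_ring_def Units_def algebra_simps intro: exI[of _ "- x"
      for x])

lemma base_ring_simps [simp]:
  "carrier base_ring = UNIV" "x \<otimes>\<^bsub>base_ring\<^esub> y = x * y" "\<one>\<^bsub>base_ring\<^esub> = 1"
  "\<zero>\<^bsub>base_ring\<^esub> = 0" "x \<oplus>\<^bsub>base_ring\<^esub> y = x + y"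
  by (simp_all add: base_ring_def)

lemma module_fun_quot:
  assumes V: "fun_subspace V" and W: "fun_subspace W"
  shows "Module.module base_ring (fun_quot V W)"
proof (rule moduleI)
  note simps = carrier_fun_quot add_fun_quot[OF W] smult_fun_quot[OF W] zero_fun_quot
  show "cring base_ring" by (rule cring_base_ring)
  have zero: "W = fcoset W (\<lambda>_. 0)" by (simp add: fcoset_zero)
  show "abelian_group (fun_quot V W)"
  proof (rule abelian_groupI)
    fix x y z assume xyz: "x \<in> carrier (fun_quot V W)" "y \<in> carrier (fun_quot V W)" "z
        \<in> carrier (fun_quot V W)"
    then show "x \<oplus>\<^bsub>fun_quot V W\<^esub> y \<in> carrier (fun_quot V W)"
      by (auto simp: simps intro!: imageI fun_subspace_add[OF V])
    show "x \<oplus>\<^bsub>fun_quot V W\<^esub> y \<oplus>\<^bsub>fun_quot V W\<^esub> z = x \<oplus>\<^bsub>fun_quot V W\<^esub> (y \<oplus>\<^bsub>fun_quot V W\<^esub> z)"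
      using xyz by (auto simp: simps add.assoc)
    show "x \<oplus>\<^bsub>fun_quot V W\<^esub> y = y \<oplus>\<^bsub>fun_quot V W\<^esub> x"
      using xyz by (auto simp: simps add.commute)
  next
    show "\<zero>\<^bsub>fun_quot V W\<^esub> \<in> carrier (fun_quot V W)"
      using zero fun_subspace_zero[OF V] by (auto simp: simps)
    fix x assume "x \<in> carrier (fun_quot V W)"
    then obtain c where c: "c \<in> V" "x = fcoset W c" by (auto simp: simps)
    show "\<zero>\<^bsub>fun_quot V W\<^esub> \<oplus>\<^bsub>fun_quot V W\<^esub> x = x"
      using add_fun_quot[OF W, where c = "\<lambda>_. 0" and c' = c] c
      by (simp add: fcoset_zero zero_fun_quot)
    show "\<exists>y\<in>carrier (fun_quot V W). y \<oplus>\<^bsub>fun_quot V W\<^esub> x = \<zero>\<^bsub>fun_quot V W\<^esub>"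
      using c fun_subspace_uminus[OF V c(1)]
      by (auto simp: simps fcoset_zero intro!: bexI[of _ "\<lambda>b. - c b"])
  qed
qed (auto simp: carrier_fun_quot add_fun_quot[OF W] smult_fun_quot[OF W] algebra_simps
       intro!: imageI fun_subspace_smult[OF V])

lemma finsum_fun_quot:
  assumes V: "fun_subspace V" and W: "fun_subspace W" and "finite X" "\<And>x. x \<in> X \<Longrightarrow> F x \<in> V"
  shows "finsum (fun_quot V W) (\<lambda>x. fcoset W (F x)) X = fcoset W (\<lambda>b. \<Sum>x\<in>X. F x b)"
proof -
  interpret M: Module.module base_ring "fun_quot V W" by (rule module_fun_quot[OF V W])
  show ?thesis using assms(3,4)
  proof (induction X rule: finite_induct)
    case empty
    then show ?case by (simp add: zero_fun_quot fcoset_zero)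
  next
    case (insert x X)
    then have "finsum (fun_quot V W) (\<lambda>x. fcoset W (F x)) (insert x X)
      = fcoset W (F x) \<oplus>\<^bsub>fun_quot V W\<^esub> finsum (fun_quot V W) (\<lambda>x. fcoset W (F x)) X"
      by (intro M.finsum_insert) (auto simp: carrier_fun_quot)
    with insert show ?case by (simp add: add_fun_quot[OF W])
  qed
qed

lemma fun_subspace_free_mod: "fun_subspace (carrier (free_mod A :: ('k::comm_ring_1, 'b \<Rightarrow> 'k)
    module))"
proof -
  have 1: "finite {b. c b + c' b \<noteq> 0} \<and> {b. c b + c' b \<noteq> 0} \<subseteq> A"
    if "finite {b. c b \<noteq> 0} \<and> {b. c b \<noteq> 0} \<subseteq> A" "finite {b. c' b \<noteq> 0} \<and> {b. c' b \<noteq> 0} \<subseteq> A"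
    for c c' :: "'b \<Rightarrow> 'k"
  proof -
    have "{b. c b + c' b \<noteq> 0} \<subseteq> {b. c b \<noteq> 0} \<union> {b. c' b \<noteq> 0}" by auto
    then show ?thesis using that by (meson Un_least finite_UnI finite_subset order_trans)
  qed
  have 2: "finite {b. k * c b \<noteq> 0} \<and> {b. k * c b \<noteq> 0} \<subseteq> A"
    if "finite {b. c b \<noteq> 0} \<and> {b. c b \<noteq> 0} \<subseteq> A" for k and c :: "'b \<Rightarrow> 'k"
    using that by (auto intro: finite_subset[of _ "{b. c b \<noteq> 0}"])
  show ?thesis using 1 2 by (auto simp: fun_subspace_def free_mod_def)
qed

lemma delta_in_free_mod: "a \<in> A \<Longrightarrow> delta a \<in> carrier (free_mod A :: ('k::comm_ring_1, 'b \<Rightarrow> 'k)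
    module)"
  by (auto simp: free_mod_def delta_def of_bool_def intro: finite_subset[of _ "{a}"])

lemma module_free_mod: "Module.module base_ring (free_mod A :: ('k::comm_ring_1, 'b \<Rightarrow> 'k) module)"
proof -
  let ?V = "carrier (free_mod A :: ('k, 'b \<Rightarrow> 'k) module)"
  have V: "fun_subspace ?V" by (rule fun_subspace_free_mod)
  have "Module.module base_ring (fun_mod ?V)"
  proof (rule moduleI)
    show "cring base_ring" by (rule cring_base_ring)
    show "abelian_group (fun_mod ?V)"
    proof (rule abelian_groupI)
      fix x assume "x \<in> carrier (fun_mod ?V)"
      then show "\<exists>y\<in>carrier (fun_mod ?V). y \<oplus>\<^bsub>fun_mod ?V\<^esub> x = \<zero>\<^bsub>fun_mod ?V\<^esub>"
        using fun_subspace_uminus[OF V, of x] by (auto intro!: bexI[of _ "\<lambda>b. - x b"])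
    qed (auto simp: add.assoc add.commute fun_subspace_zero[OF V] fun_subspace_add[OF V])
  qed (auto simp: algebra_simps fun_subspace_smult[OF V])
  then show ?thesis by (simp flip: free_mod_eq_fun_mod)
qed

section \<open>Linear maps out of a tensor product\<close>

lemma tgens_swap:
  "(h, u @ (i, n, y) # (i', n', y') # v) \<in> tgens M I L N \<Longrightarrow>
   (h, u @ (i', n', y') # (i, n, y) # v) \<in> tgens M I L N"
  by (clarsimp simp: tgens_def tdeg_def) fast

lemma tgens_update:
  "\<lbrakk>(h, u @ (i, n, y) # v) \<in> tgens M I L N; y' \<in> carrier (L i n)\<rbrakk> \<Longrightarrow>
   (h, u @ (i, n, y') # v) \<in> tgens M I L N"
  by (cases h) (simp add: tgens_def tdeg_def)

lemma tgens_tail_mem: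
  "(h, u @ (i, n, y) # v) \<in> tgens M I L N \<Longrightarrow> i \<in> I \<and> y \<in> carrier (L i n)"
  by (cases h) (auto simp: tgens_def)

lemma submodule_fun_subspace:
  fixes H :: "('b \<Rightarrow> 'k::comm_ring_1) set"
  assumes "submodule H base_ring (free_mod A)" shows "fun_subspace H"
proof -
  interpret FM: Module.module base_ring "free_mod A :: ('k, 'b \<Rightarrow> 'k) module"
    by (rule module_free_mod)
  note E = FM.submoduleE[OF assms]
  have fm: "c \<oplus>\<^bsub>free_mod A\<^esub> c' = (\<lambda>b. c b + c' b)" "k \<odot>\<^bsub>free_mod A\<^esub> c = (\<lambda>b. k * c b)" for k :: 'k
      and c c'
    by (simp_all add: free_mod_def)
  obtain a where "a \<in> H" using E(2) by blast
  then have "(\<lambda>_. 0) \<in> H" using E(4)[of 0 a] by (simp add: fm)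
  then show ?thesis using E(4,5) by (auto simp: fun_subspace_def fm)
qed

lemma fun_subspace_tnull:
  fixes M :: "nat \<Rightarrow> ('k::comm_ring_1, 'm) module" and L :: "'i \<Rightarrow> nat \<Rightarrow> ('k, 'n) module"
  shows "fun_subspace (tnull M I L N)"
  using submodule_fun_subspace[where A = "tgens M I L N" and 'k = 'k]
  unfolding tnull_def fun_subspace_def by blast

text \<open>
  The values \<open>f g\<close> have representatives \<open>F g\<close>; their linear extension maps the relations into \<open>W\<close>, so
  it induces a map on the quotients.
\<close>

lemma tensor_lift_hom:
  fixes M :: "nat \<Rightarrow> ('k::comm_ring_1, 'm) module" and I :: "'i set" and N :: nat
      and L :: "'i \<Rightarrow> nat \<Rightarrow> ('k, 'n) module"
    and V W :: "('b \<Rightarrow> 'k) set"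
  assumes V: "fun_subspace V" and W: "fun_subspace W"
    and M: "\<And>m. Module.module base_ring (M m)"
        and L: "\<And>i n. i \<in> I \<Longrightarrow> Module.module base_ring (L i n)"
  defines "E \<equiv> fun_quot V W" and "G \<equiv> tgens M I L N"
  assumes closed: "\<And>g. g \<in> G \<Longrightarrow> f g \<in> carrier E"
    and f_add_head: "\<And>m x x' w. \<lbrakk>((m, x), w) \<in> G; ((m, x'), w) \<in> G\<rbrakk> \<Longrightarrow>
      f ((m, x \<oplus>\<^bsub>M m\<^esub> x'), w) = f ((m, x), w) \<oplus>\<^bsub>E\<^esub> f ((m, x'), w)"
    and f_smult_head: "\<And>k m x w. ((m, x), w) \<in> G \<Longrightarrow> f ((m, k \<odot>\<^bsub>M m\<^esub> x), w) = k \<odot>\<^bsub>E\<^esub> f ((m, x), w)"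
    and f_add_tail: "\<And>h u i n y y' v. \<lbrakk>(h, u @ (i, n, y) # v) \<in> G; (h, u @ (i, n, y') # v) \<in> G\<rbrakk> \<Longrightarrow>
      f (h, u @ (i, n, y \<oplus>\<^bsub>L i n\<^esub> y') # v) = f (h, u @ (i, n, y) # v) \<oplus>\<^bsub>E\<^esub> f (h, u @ (i, n, y') #
          v)"
    and f_smult_tail: "\<And>k h u i n y v. (h, u @ (i, n, y) # v) \<in> G \<Longrightarrow>
      f (h, u @ (i, n, k \<odot>\<^bsub>L i n\<^esub> y) # v) = k \<odot>\<^bsub>E\<^esub> f (h, u @ (i, n, y) # v)"
    and f_koszul: "\<And>h u i n y i' n' y' v. (h, u @ (i, n, y) # (i', n', y') # v) \<in> G \<Longrightarrow>
      f (h, u @ (i, n, y) # (i', n', y') # v)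
        = (-1) ^ (n * n') \<odot>\<^bsub>E\<^esub> f (h, u @ (i', n', y') # (i, n, y) # v)"
  shows "tensor_lift E f \<in> mod_hom (tensor M I L N) E"
    and "\<And>g. g \<in> G \<Longrightarrow> tensor_lift E f (pure M I L N g) = f g"
proof -
  have "\<forall>g. \<exists>c. g \<in> G \<longrightarrow> c \<in> V \<and> f g = fcoset W c"
    using closed by (fastforce simp: E_def carrier_fun_quot)
  then obtain F where F: "\<And>g. g \<in> G \<Longrightarrow> F g \<in> V" "\<And>g. g \<in> G \<Longrightarrow> f g = fcoset W (F g)" by metis
  define A where "A = carrier (free_mod G :: ('k, _ \<Rightarrow> 'k) module)"
  have A: "c \<in> A \<longleftrightarrow> finite {b. c b \<noteq> 0} \<and> {b. c b \<noteq> 0} \<subseteq> G" for c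
    by (simp add: A_def free_mod_def)
  have Asub: "fun_subspace A" unfolding A_def by (rule fun_subspace_free_mod)
  define ext where "ext c = (\<lambda>b. \<Sum>g | c g \<noteq> 0. c g * F g b)" for c :: "_ \<Rightarrow> 'k"
  have ext_superset: "ext c = (\<lambda>b. \<Sum>g\<in>Y. c g * F g b)" if "finite Y" "{g. c g \<noteq> 0} \<subseteq> Y" for c Y
    unfolding ext_def by (intro ext sum.mono_neutral_left) (use that in auto)
  have ext_V: "ext c \<in> V" if "c \<in> A" for c
    unfolding ext_def using that
    by (intro fun_subspace_sum[OF V] fun_subspace_smult[OF V]) (auto simp: A F)
  have ext_add: "ext (\<lambda>g. c g + c' g) = (\<lambda>b. ext c b + ext c' b)" if "c \<in> A" "c' \<in> A" for c c'
  proof -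
    let ?Y = "{g. c g \<noteq> 0} \<union> {g. c' g \<noteq> 0}"
    have "finite ?Y" using that by (simp add: A)
    then show ?thesis
      using ext_superset[of ?Y c] ext_superset[of ?Y c']
      by (subst ext_superset[of ?Y]) (auto simp: sum.distrib distrib_right)
  qed
  have ext_smult: "ext (\<lambda>g. k * c g) = (\<lambda>b. k * ext c b)" if "c \<in> A" for c k
  proof -
    have "finite {g. c g \<noteq> 0}" using that by (simp add: A)
    then show ?thesis
      using ext_superset[of "{g. c g \<noteq> 0}" c]
      by (subst ext_superset[of "{g. c g \<noteq> 0}"]) (auto simp: sum_distrib_left mult.assoc)
  qed
  have ext_diff: "ext (\<lambda>g. c g - c' g) = (\<lambda>b. ext c b - ext c' b)" if "c \<in> A" "c' \<in> A" for c c'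
    using ext_add[OF that(1) fun_subspace_uminus[OF Asub that(2)]] ext_smult[OF that(2), of "-1"]
    by simp
  have ext_delta: "ext (delta g) = F g" for g
    using ext_superset[of "{g}" "delta g"] by (auto simp: delta_def)
  have dA: "delta g \<in> A" if "g \<in> G" for g unfolding A_def by (rule delta_in_free_mod[OF that])
  \<comment> \<open>\<open>H\<close> is the preimage of \<open>W\<close> under the linear extension.
    As \<open>tnull\<close> is the least submodule containing the relations, it suffices that
    \<open>H\<close> is a submodule that contains \<open>trels\<close>.\<close>
  define H where "H = {c \<in> A. ext c \<in> W}"
  have "submodule H base_ring (free_mod G)"
  proof -
    interpret FM: Module.module base_ring "free_mod G :: ('k, _ \<Rightarrow> 'k) module"
      by (rule module_free_mod)
    have ainv: "\<ominus>\<^bsub>free_mod G\<^esub> a = (\<lambda>g. - a g)" if "a \<in> A" for a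
    proof -
      have "a \<in> carrier (free_mod G)" using that by (simp add: A_def)
      moreover have "(\<lambda>g. - a g) \<in> carrier (free_mod G)"
        using fun_subspace_uminus[OF Asub that] by (simp add: A_def)
      ultimately show ?thesis by (intro FM.minus_equality) (auto simp: free_mod_def)
    qed
    have fm: "\<zero>\<^bsub>free_mod G\<^esub> = (\<lambda>_. 0 :: 'k)" "c \<oplus>\<^bsub>free_mod G\<^esub> c' = (\<lambda>b. c b + c' b)"
      "k \<odot>\<^bsub>free_mod G\<^esub> c = (\<lambda>b. k * c b)" for k :: 'k and c c'
      by (simp_all add: free_mod_def)
    show ?thesis
    proof (rule FM.submoduleI)
      show "H \<subseteq> carrier (free_mod G)" by (auto simp: H_def A_def)
      show "\<zero>\<^bsub>free_mod G\<^esub> \<in> H" using fun_subspace_zero[OF Asub] fun_subspace_zero[OF W]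
        by (auto simp: H_def fm ext_def)
      show "\<ominus>\<^bsub>free_mod G\<^esub> a \<in> H" if "a \<in> H" for a
        using that fun_subspace_uminus[OF Asub] fun_subspace_uminus[OF W] ext_smult[of a "-1"]
        by (auto simp: H_def ainv)
    qed (auto simp: H_def fm ext_add ext_smult fun_subspace_add[OF Asub] fun_subspace_add[OF W]
          fun_subspace_smult[OF Asub] fun_subspace_smult[OF W])
  qed
  moreover have "trels M I L N \<subseteq> H"
  proof
    have m: "fcoset W c = fcoset W (\<lambda>b. k * c' b) \<Longrightarrow> (\<lambda>b. c b - k * c' b) \<in> W" for c c' k
      by (simp add: fcoset_eq_iff[OF W])
    have a: "fcoset W c = fcoset W (\<lambda>b. c' b + c'' b) \<Longrightarrow> (\<lambda>b. c b - c' b - c'' b) \<in> W" for c c' c''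
      by (simp add: fcoset_eq_iff[OF W] algebra_simps)
    \<comment> \<open>The five kinds of relations have only two shapes: one generator minus a
      multiple of another (\<open>H1\<close>, which also covers the Koszul rule) and additivity
      (\<open>H2\<close>).\<close>
    have H1: "(\<lambda>z. delta g z - k * delta g' z) \<in> H" if "g \<in> G" "g' \<in> G" "f g = k \<odot>\<^bsub>E\<^esub> f g'"
        for g g' k
      using that m[of "F g" k "F g'"] ext_diff[OF dA fun_subspace_smult[OF Asub dA], of g g' k]
        ext_smult[OF dA, of g' k] fun_subspace_diff[OF Asub dA fun_subspace_smult[OF Asub dA], of
            g g' k]
      by (simp add: H_def E_def F smult_fun_quot[OF W] ext_delta)
    have H2: "(\<lambda>z. delta g z - delta g' z - delta g'' z) \<in> H"
      if "g \<in> G" "g' \<in> G" "g'' \<in> G" "f g = f g' \<oplus>\<^bsub>E\<^esub> f g''" for g g' g''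
      using that a[of "F g" "F g'" "F g''"] ext_diff[OF fun_subspace_diff[OF Asub dA dA] dA, of g
          g' g'']
        ext_diff[OF dA dA, of g g'] fun_subspace_diff[OF Asub fun_subspace_diff[OF Asub dA dA] dA,
            of g g' g'']
      by (simp add: H_def E_def F add_fun_quot[OF W] ext_delta)
    fix z assume "z \<in> trels M I L N"
    then show "z \<in> H"
    proof (induction rule: trels.induct)
      case (add_head m x w x')
      interpret Module.module base_ring "M m" by (rule M)
      show ?case using add_head
        by (intro H2 f_add_head) (auto simp: G_def tgens_def)
    next
      case (smult_head m x w k)
      interpret Module.module base_ring "M m" by (rule M)
      show ?case using smult_head by (intro H1 f_smult_head) (auto simp: G_def tgens_def)
    next
      case (add_tail h u i n y v y')
      then interpret Module.module base_ring "L i n" by (intro L) (auto dest: tgens_tail_mem)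
      show ?case using add_tail
        by (intro H2 f_add_tail) (auto simp: G_def intro: tgens_update dest: tgens_tail_mem)
    next
      case (smult_tail h u i n y v k)
      then interpret Module.module base_ring "L i n" by (intro L) (auto dest: tgens_tail_mem)
      show ?case using smult_tail
          tgens_update[OF smult_tail smult_closed] tgens_tail_mem[OF smult_tail]
        by (intro H1 f_smult_tail) (auto simp: G_def)
    next
      case (koszul h u i n y i' n' y' v)
      then show ?case by (intro H1 f_koszul) (auto simp: G_def intro: tgens_swap)
    qed
  qed
  ultimately have tnull: "tnull M I L N \<subseteq> H" by (auto simp: tnull_def G_def)
  define T where "T = tnull M I L N"
  have T: "fun_subspace T" "T \<subseteq> A" "\<And>c. c \<in> T \<Longrightarrow> ext c \<in> W"
    using tnull fun_subspace_tnull[of M I L N] by (auto simp: T_def H_def)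
  have tensor: "tensor M I L N = fun_quot A T"
    by (simp add: tensor_def T_def A_def G_def flip: free_mod_eq_fun_mod)
  have lift: "tensor_lift E f (fcoset T c) = fcoset W (ext c)" if c: "c \<in> A" for c
    unfolding tensor_lift_def
  proof (rule the_elem_image_const)
    show "fcoset T c \<noteq> {}" using self_mem_fcoset[OF T(1)] by blast
    fix x assume "x \<in> fcoset T c"
    then have xc: "(\<lambda>b. x b - c b) \<in> T" by (simp add: mem_fcoset)
    have x: "x \<in> A" using fun_subspace_add[OF Asub _ c, of "\<lambda>b. x b - c b"] xc T(2) by auto
    have "finsum E (\<lambda>g. x g \<odot>\<^bsub>E\<^esub> f g) {g. x g \<noteq> 0}
        = finsum E (\<lambda>g. fcoset W (\<lambda>b. x g * F g b)) {g. x g \<noteq> 0}"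
    proof -
      interpret EM: Module.module base_ring E unfolding E_def by (rule module_fun_quot[OF V W])
      show ?thesis
        using x by (intro EM.finsum_cong') (auto simp: A F E_def smult_fun_quot[OF W]
            carrier_fun_quot
            intro!: imageI fun_subspace_smult[OF V])
    qed
    also have "\<dots> = fcoset W (ext x)" unfolding E_def ext_def
      by (intro finsum_fun_quot[OF V W]) (use x in \<open>auto simp: A F intro!: fun_subspace_smult[OF
          V]\<close>)
    also have "\<dots> = fcoset W (ext c)"
      using T(3)[OF xc] by (simp add: fcoset_eq_iff[OF W] ext_diff[OF x c])
    finally show "finsum E (\<lambda>g. x g \<odot>\<^bsub>E\<^esub> f g) {g. x g \<noteq> 0} = fcoset W (ext c)" .
  qed
  show "tensor_lift E f \<in> mod_hom (tensor M I L N) E"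
    unfolding mod_hom_def tensor
    by (auto simp: carrier_fun_quot E_def lift[unfolded E_def] add_fun_quot T(1) W smult_fun_quot
        ext_add
      ext_smult fun_subspace_add[OF Asub] fun_subspace_smult[OF Asub] intro!: imageI ext_V)
  show "tensor_lift E f (pure M I L N g) = f g" if "g \<in> G" for g
  proof -
    have "pure M I L N g = fcoset T (delta g)" by (simp add: pure_def a_r_coset_free_mod T_def)
    then show ?thesis using lift[OF dA[OF that]] that by (simp add: ext_delta F)
  qed
qed

section \<open>Simplicial cochains as functions on lists\<close>

definition del :: "nat \<Rightarrow> 'p list \<Rightarrow> 'p list" where
  "del i z = take i z @ drop (Suc i) z"

lemma length_del [simp]: "i < length z \<Longrightarrow> length (del i z) = length z - 1"
  by (simp add: del_def)

lemma nth_del: "\<lbrakk>i < length z; j < length z - 1\<rbrakk> \<Longrightarrow> del i z ! j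
    = (if j < i then z ! j else z ! Suc j)"
  by (auto simp: del_def nth_append min_def)

lemma map_del: "map f (del i z) = del i (map f z)"
  by (simp add: del_def take_map drop_map)

text \<open>The simplicial identity for faces, the combinatorial input of
  \<open>bdry_bdry\<close>.\<close>

lemma del_del:
  assumes "j \<le> i" "Suc i < length z"
  shows "del i (del j z) = del j (del (Suc i) z)"
  by (rule nth_equalityI) (use assms in \<open>auto simp: nth_del\<close>)

lemma take_del_le: "i \<le> k \<Longrightarrow> take i (del k z) = take i z"
  by (simp add: del_def min_def)

lemma take_del_ge: "\<lbrakk>k \<le> i; k < length z\<rbrakk> \<Longrightarrow> take i (del k z) = del k (take (Suc i) z)"
  by (simp add: del_def min_def take_drop Suc_diff_le)

lemma drop_del_ge: "\<lbrakk>k \<le> i; k < length z\<rbrakk> \<Longrightarrow> drop i (del k z) = drop (Suc i) z"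
  by (simp add: del_def min_def)

lemma drop_del_le: "i \<le> k \<Longrightarrow> drop i (del k z) = del (k - i) (drop i z)"
  by (simp add: del_def min_def drop_take)

lemma del_append: "del k (xs @ ys) = (if k < length xs then del k xs @ ys else xs @ del (k -
    length xs) ys)"
  by (simp add: del_def Suc_diff_le)

text \<open>The simplicial coboundary of \<open>c\<close> evaluated at \<open>z\<close>, a signed
  sum over all faces including the last one. No order relation enters, so it squares to zero and
  commutes with \<open>map\<close> on arbitrary lists; the poset reappears only through
  supports.\<close>

definition bdry :: "('p list \<Rightarrow> 'k) \<Rightarrow> 'p list \<Rightarrow> 'k::comm_ring_1" where
  "bdry c z = (\<Sum>i<length z. (-1) ^ i * c (del i z))"

lemma bdry_add: "bdry (\<lambda>z. c z + c' z) z = bdry c z + bdry c' z"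
  by (simp add: bdry_def distrib_left sum.distrib)

lemma bdry_smult: "bdry (\<lambda>z. k * c z) z = k * bdry c z"
  by (simp add: bdry_def sum_distrib_left algebra_simps)

lemma bdry_zero: "bdry (\<lambda>_. 0) z = 0"
  by (simp add: bdry_def)

lemma bdry_bdry:
  fixes c :: "'p list \<Rightarrow> 'k::comm_ring_1"
  shows "bdry (bdry c) z = 0"
proof -
  define n where "n = length z"
  define F where "F i j = (-1) ^ (i + j) * c (del j (del i z))" for i j
  have "bdry (bdry c) z = (\<Sum>i<n. \<Sum>j<n-1. F i j)"
    unfolding bdry_def n_def
    by (auto intro!: sum.cong simp: sum_distrib_left F_def power_add mult.assoc)
  also have "\<dots> = (\<Sum>(i, j)\<in>{..<n} \<times> {..<n-1}. F i j)" by (simp add: sum.cartesian_product)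
  also have "\<dots> = (\<Sum>(i, j)\<in>{(i, j). j < i \<and> i < n}. F i j) + (\<Sum>(i, j)\<in>{(i, j). i \<le> j
      \<and> j < n - 1}. F i j)"
  proof -
    have "{..<n} \<times> {..<n-1} = {(i, j). j < i \<and> i < n} \<union> {(i, j). i \<le> j \<and> j < n - 1}" by auto
    moreover have "finite {(i, j). j < i \<and> i < n}" "finite {(i, j). i \<le> j \<and> j < n - 1}"
      by (rule finite_subset[of _ "{..<n} \<times> {..<n}"]; auto)+
    moreover have "{(i, j). j < i \<and> i < n} \<inter> {(i, j). i \<le> j \<and> j < n - 1} = {}" by auto
    ultimately show ?thesis by (simp add: sum.union_disjoint)
  qed
  \<comment> \<open>By the simplicial identity the double face \<open>(i, j)\<close> with
    \<open>j < i\<close> equals the double face \<open>(j, i - 1)\<close>, whose sign is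
    opposite.\<close>
  also have "(\<Sum>(i, j)\<in>{(i, j). j < i \<and> i < n}. F i j) = (\<Sum>(i, j)\<in>{(i, j). i \<le> j
      \<and> j < n - 1}. - F i j)"
    by (rule sum.reindex_bij_witness[of _ "\<lambda>(i, j). (Suc j, i)" "\<lambda>(i, j). (j, i - 1)"])
      (auto simp: F_def n_def del_del power_add mult_ac dest!: less_imp_Suc_add)
  finally show ?thesis by (simp add: case_prod_unfold sum_negf)
qed

section \<open>Cup and cup-one products of cochains\<close>

definition cup :: "nat \<Rightarrow> ('p list \<Rightarrow> 'k) \<Rightarrow> ('p list \<Rightarrow> 'k) \<Rightarrow> 'p list \<Rightarrow> 'k::comm_ring_1" where
  "cup m a b z = a (take (Suc m) z) * b (drop m z)"

lemma sum_lessThan_add: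
  fixes f :: "nat \<Rightarrow> 'a::comm_monoid_add"
  shows "(\<Sum>k<m + n. f k) = (\<Sum>k<m. f k) + (\<Sum>k<n. f (m + k))"
  by (induction n) (simp_all add: add.assoc)

text \<open>The Leibniz rule. Faces up to position \<open>m\<close> act on the front part and the
  later ones on the back part. Each of the two terms on the right contains one face more than the
  left side provides, the last face of the front and the first face of the back; these two extra
  terms cancel.\<close>

lemma bdry_cup:
  assumes z: "length z = Suc (Suc (m + n))"
  shows "bdry (cup m a b) z =
    bdry a (take (Suc (Suc m)) z) * b (drop (Suc m) z) + (-1) ^ m * a (take (Suc m) z) * bdry b
        (drop m z)"
proof -
  have "bdry (cup m a b) z = (\<Sum>i<Suc m + Suc n. (-1) ^ i * cup m a b (del i z))"
    by (simp add: bdry_def z)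
  also have "\<dots> = (\<Sum>i<Suc m. (-1) ^ i * cup m a b (del i z)) + (\<Sum>j<Suc n. (-1) ^ (Suc m + j) * cup
      m a b (del (Suc m + j) z))"
    by (rule sum_lessThan_add)
  also have "(\<Sum>i<Suc m. (-1) ^ i * cup m a b (del i z)) =
    (\<Sum>i<Suc m. (-1) ^ i * a (del i (take (Suc (Suc m)) z))) * b (drop (Suc m) z)"
    unfolding sum_distrib_right
  proof (rule sum.cong)
    fix i assume "i \<in> {..<Suc m}"
    then have "take (Suc m) (del i z) = del i (take (Suc (Suc m)) z)" "drop m (del i z)
        = drop (Suc m) z"
      using z by (auto intro!: nth_equalityI simp: nth_del)
    then show "(-1) ^ i * cup m a b (del i z)
        = (-1) ^ i * a (del i (take (Suc (Suc m)) z)) * b (drop (Suc m) z)"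
      by (simp add: cup_def)
  qed simp
  also have "(\<Sum>j<Suc n. (-1) ^ (Suc m + j) * cup m a b (del (Suc m + j) z)) =
    (-1) ^ m * a (take (Suc m) z) * (\<Sum>j<Suc n. (-1) ^ Suc j * b (del (Suc j) (drop m z)))"
    unfolding sum_distrib_left
  proof (rule sum.cong)
    fix j assume "j \<in> {..<Suc n}"
    then have "take (Suc m) (del (Suc m + j) z) = take (Suc m) z" "drop m (del (Suc m + j) z)
        = del (Suc j) (drop m z)"
      using z by (auto intro!: nth_equalityI simp: nth_del)
    then show "(-1) ^ (Suc m + j) * cup m a b (del (Suc m + j) z) =
      (-1) ^ m * a (take (Suc m) z) * ((-1) ^ Suc j * b (del (Suc j) (drop m z)))"
      by (simp add: cup_def power_add mult.assoc)
  qed simp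
  also have "(\<Sum>i<Suc m. (-1) ^ i * a (del i (take (Suc (Suc m)) z))) =
    bdry a (take (Suc (Suc m)) z) + (-1) ^ m * a (take (Suc m) z)"
    using z by (simp add: bdry_def del_def min_def)
  also have "(\<Sum>j<Suc n. (-1) ^ Suc j * b (del (Suc j) (drop m z)))
      = bdry b (drop m z) - b (drop (Suc m) z)"
  proof -
    have "bdry b (drop m z) = (\<Sum>j<Suc (Suc n). (-1) ^ j * b (del j (drop m z)))"
      using z by (simp add: bdry_def)
    also have "\<dots> = b (drop (Suc m) z) + (\<Sum>j<Suc n. (-1) ^ Suc j * b (del (Suc j) (drop m z)))"
      by (subst sum.lessThan_Suc_shift) (simp add: del_def)
    finally show ?thesis by simp
  qed
  finally show ?thesis by (simp add: algebra_simps)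
qed

text \<open>
  Steenrod's cup-one product.  It makes the product of two cocycles commutative up to sign and
  coboundary.
\<close>

definition cup_one :: "nat \<Rightarrow> nat \<Rightarrow> ('p list \<Rightarrow> 'k) \<Rightarrow> ('p list \<Rightarrow> 'k) \<Rightarrow> 'p list \<Rightarrow> 'k::comm_ring_1"
    where
  "cup_one p q a b z = (\<Sum>i<p. (-1) ^ (i * (q + 1)) *
     (a (take (Suc i) z @ drop (i + q) z) * b (take (Suc q) (drop i z))))"

text \<open>In the \<open>i\<close>-th summand \<open>b\<close> reads a window of
  \<open>q + 1\<close> entries starting at \<open>i\<close> and \<open>a\<close> reads the list with
  the inside of the window cut out. A face falls to the left of the window, inside it, or to its
  right. The cocycle conditions for \<open>a\<close> and \<open>b\<close>, required only on the
  lists that occur here, eliminate these contributions up to terms that telescope in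
  \<open>i\<close>.\<close>

lemma bdry_cup_one:
  fixes a b :: "'p list \<Rightarrow> 'k::comm_ring_1"
  assumes z: "length z = Suc (p + q)"
    and a: "\<And>i. i \<le> p \<Longrightarrow> bdry a (take (Suc i) z @ drop (i + q) z) = 0"
    and b: "\<And>i. i < p \<Longrightarrow> bdry b (take (Suc (Suc q)) (drop i z)) = 0"
  shows "bdry (cup_one p q a b) z = (-1) ^ (q + 1) *
    ((-1) ^ (p * q) * (a (take (Suc p) z) * b (drop p z)) - b (take (Suc q) z) * a (drop q z))"
proof -
  define s where "s i = ((-1) ^ (i * (q + 1)) :: 'k)" for i
  define \<epsilon> where "\<epsilon> = ((-1) ^ (q + 1) :: 'k)"
  \<comment> \<open>\<open>A i\<close> and \<open>C i\<close> are the lists on which the cocycle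
    conditions are used: \<open>A i\<close> has the two middle faces \<open>\<alpha> i\<close> and
    \<open>\<alpha> (Suc i)\<close>, and \<open>C i\<close> has the outer faces
    \<open>\<beta> i\<close> and \<open>\<beta> (Suc i)\<close>. For \<open>q = 0\<close> the entry
    at \<open>i\<close> occurs twice in \<open>A i\<close>.\<close>
  define A where "A i = take (Suc i) z @ drop (i + q) z" for i
  define C where "C i = take (Suc (Suc q)) (drop i z)" for i
  define \<alpha> where "\<alpha> i = a (take i z @ drop (i + q) z)" for i
  define \<beta> where "\<beta> i = b (take (Suc q) (drop i z))" for i
  define L where "L i = (\<Sum>k<i. (-1) ^ k * a (del k (A i)))" for i
  define R where "R i = (\<Sum>j<p - i. (-1) ^ j * a (del (i + 2 + j) (A i)))" for i
  define M where "M i = (\<Sum>j<q. (-1) ^ j * b (del (Suc j) (C i)))" for i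
  have s_Suc: "s (Suc i) = \<epsilon> * s i" for i by (simp add: s_def \<epsilon>_def power_add)
  have eps: "\<epsilon> * \<epsilon> = 1" by (simp add: \<epsilon>_def flip: power_add power_mult_distrib)
  \<comment> \<open>The cocycle condition for \<open>a\<close> on \<open>A i\<close> solved for the
    faces outside the window; \<open>M\<close> below is the condition for \<open>b\<close> on
    \<open>C i\<close> solved for the faces inside.\<close>
  have LR: "L i + (-1) ^ i * R i = (-1) ^ i * (\<alpha> (Suc i) - \<alpha> i)" if i: "i \<le> p" for i
  proof -
    have len: "length (A i) = i + (2 + (p - i))" using i z by (simp add: A_def)
    have "0 = bdry a (A i)" using a[OF i] by (simp add: A_def)
    also have "\<dots> = (\<Sum>k<i + (2 + (p - i)). (-1) ^ k * a (del k (A i)))"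
      by (simp only: bdry_def len)
    also have "\<dots> = L i + (\<Sum>k<2 + (p - i). (-1) ^ (i + k) * a (del (i + k) (A i)))"
      by (simp only: sum_lessThan_add L_def)
    also have "(\<Sum>k<2 + (p - i). (-1) ^ (i + k) * a (del (i + k) (A i))) =
      (-1) ^ i * a (del i (A i)) + (-1) ^ Suc i * a (del (Suc i) (A i)) + (-1) ^ i * R i"
      by (subst sum_lessThan_add)
        (simp add: R_def numeral_2_eq_2 sum_distrib_left power_add mult.assoc)
    also have "a (del i (A i)) = \<alpha> i"
      using i z by (simp add: del_def A_def min_def \<alpha>_def)
    also have "a (del (Suc i) (A i)) = \<alpha> (Suc i)"
      using i z by (simp add: del_def A_def min_def \<alpha>_def)
    finally show ?thesis by (simp add: algebra_simps)
  qed
  have M: "M i = \<beta> (Suc i) + \<epsilon> * \<beta> i" if i: "i < p" for i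
  proof -
    have len: "length (C i) = Suc (Suc q)" using i z by (simp add: C_def)
    have "0 = (\<Sum>k<Suc (Suc q). (-1) ^ k * b (del k (C i)))"
      using b[OF i] len by (simp add: bdry_def C_def)
    also have "\<dots> = b (del 0 (C i)) + (\<Sum>k<Suc q. (-1) ^ Suc k * b (del (Suc k) (C i)))"
      by (subst sum.lessThan_Suc_shift) simp
    also have "(\<Sum>k<Suc q. (-1) ^ Suc k * b (del (Suc k) (C i)))
        = - M i + (-1) ^ Suc q * b (del (Suc q) (C i))"
      by (simp add: M_def sum_negf)
    also have "del (Suc q) (C i) = take (Suc q) (drop i z)" using i z by (simp add: del_def C_def)
    also have "del 0 (C i) = take (Suc q) (drop (Suc i) z)"
      by (simp add: del_def C_def drop_take)
    finally show ?thesis by (simp add: \<beta>_def \<epsilon>_def algebra_simps)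
  qed
  \<comment> \<open>Once \<open>LR\<close> and \<open>M\<close> are inserted, the
    \<open>i\<close>-th summand is the increment of \<open>u + v\<close>: \<open>u\<close> collects
    the faces to the left of the window, \<open>v\<close> the middle face.\<close>
  define u where "u i = \<epsilon> * s i * L i * \<beta> i" for i
  define v where "v i = \<epsilon> * s i * (-1) ^ i * \<alpha> i * \<beta> i" for i
  have step: "(\<Sum>k<Suc (p + q). (-1) ^ k * (a (take (Suc i) (del k z) @ drop (i + q) (del k z)) * b
      (take (Suc q) (drop i (del k z)))))
    = L (Suc i) * \<beta> (Suc i) + (-1) ^ Suc i * \<alpha> (Suc i) * M i + (-1) ^ (i + q + 1) * R i * \<beta> i"
    (is "(\<Sum>k<_. ?t k) = _") if i: "i < p" for i
  proof -
    have split: "Suc (p + q) = Suc i + (q + (p - i))" using i by simp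
    have "(\<Sum>k<Suc (p + q). ?t k) = (\<Sum>k<Suc i. ?t k) + ((\<Sum>j<q. ?t (Suc i + j)) + (\<Sum>j<p - i. ?t (Suc
        i + (q + j))))"
      unfolding split by (simp only: sum_lessThan_add)
    also have "(\<Sum>k<Suc i. ?t k) = L (Suc i) * \<beta> (Suc i)"
      unfolding L_def sum_distrib_right
    proof (rule sum.cong)
      fix k assume k: "k \<in> {..<Suc i}"
      then have "take (Suc i) (del k z) @ drop (i + q) (del k z) = del k (A (Suc i))"
        "take (Suc q) (drop i (del k z)) = take (Suc q) (drop (Suc i) z)"
        using i z by (auto simp: take_del_le take_del_ge drop_del_ge drop_del_le A_def del_append)
      then show "?t k = (-1) ^ k * a (del k (A (Suc i))) * \<beta> (Suc i)" by (simp add: \<beta>_def)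
    qed simp
    also have "(\<Sum>j<q. ?t (Suc i + j)) = (-1) ^ Suc i * \<alpha> (Suc i) * M i"
      unfolding M_def sum_distrib_left
    proof (rule sum.cong)
      fix j assume j: "j \<in> {..<q}"
      then have "take (Suc i) (del (Suc i + j) z) @ drop (i + q) (del (Suc i + j) z)
          = take (Suc i) z @ drop (Suc i + q) z"
        "take (Suc q) (drop i (del (Suc i + j) z)) = del (Suc j) (C i)"
        using i z by (auto simp: take_del_le take_del_ge drop_del_ge drop_del_le C_def)
      then show "?t (Suc i + j) = (-1) ^ Suc i * \<alpha> (Suc i) * ((-1) ^ j * b (del (Suc j) (C i)))"
        by (simp add: \<alpha>_def power_add)
    qed simp
    also have "(\<Sum>j<p - i. ?t (Suc i + (q + j))) = (-1) ^ (i + q + 1) * R i * \<beta> i"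
      unfolding R_def sum_distrib_left sum_distrib_right
    proof (rule sum.cong)
      fix j assume j: "j \<in> {..<p - i}"
      then have "take (Suc i) (del (Suc i + (q + j)) z) @ drop (i + q) (del (Suc i + (q + j)) z)
          = del (i + 2 + j) (A i)"
        "take (Suc q) (drop i (del (Suc i + (q + j)) z)) = take (Suc q) (drop i z)"
        using i z by (auto simp: take_del_le take_del_ge drop_del_ge drop_del_le A_def del_append)
      then show "?t (Suc i + (q + j)) = (-1) ^ (i + q + 1) * ((-1) ^ j * a (del (i + 2 + j) (A
          i))) * \<beta> i"
        by (simp add: \<beta>_def power_add)
    qed simp
    finally show ?thesis by simp
  qed
  have "bdry (cup_one p q a b) z = (\<Sum>i<p. \<Sum>k<Suc (p + q). (-1) ^ k * (s i *
      (a (take (Suc i) (del k z) @ drop (i + q) (del k z)) * b (take (Suc q) (drop i (del k z))))))"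
    unfolding bdry_def cup_one_def z s_def sum_distrib_left by (rule sum.swap)
  also have "\<dots> = (\<Sum>i<p. s i * (L (Suc i) * \<beta> (Suc i) + (-1) ^ Suc i * \<alpha> (Suc i) * M i + (-1) ^ (i
      + q + 1) * R i * \<beta> i))"
  proof (rule sum.cong)
    fix i assume "i \<in> {..<p}"
    then show "(\<Sum>k<Suc (p + q). (-1) ^ k * (s i *
      (a (take (Suc i) (del k z) @ drop (i + q) (del k z)) * b (take (Suc q) (drop i (del k
          z)))))) =
      s i * (L (Suc i) * \<beta> (Suc i) + (-1) ^ Suc i * \<alpha> (Suc i) * M i + (-1) ^ (i + q + 1) * R i * \<beta>
          i)"
      by (simp only: step[symmetric] lessThan_iff sum_distrib_left mult.left_commute)
  qed simp
  also have "\<dots> = (\<Sum>i<p. (u (Suc i) + v (Suc i)) - (u i + v i))"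
  proof (rule sum.cong)
    fix i assume "i \<in> {..<p}"
    then have i: "i < p" by simp
    have R: "(-1) ^ (i + q + 1) * R i = \<epsilon> * ((-1) ^ i * (\<alpha> (Suc i) - \<alpha> i) - L i)"
    proof -
      have "(-1) ^ (i + q + 1) * R i = \<epsilon> * ((-1) ^ i * R i)" by (simp add: \<epsilon>_def power_add mult_ac)
      also have "(-1) ^ i * R i = (-1) ^ i * (\<alpha> (Suc i) - \<alpha> i) - L i"
        using LR[of i] i by (metis add_diff_cancel_left' less_imp_le)
      finally show ?thesis .
    qed
    have u: "u (Suc i) = s i * L (Suc i) * \<beta> (Suc i)" "v (Suc i)
        = - s i * (-1) ^ i * \<alpha> (Suc i) * \<beta> (Suc i)"
      using eps by (simp_all add: u_def v_def s_Suc flip: mult.assoc)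
    show "s i * (L (Suc i) * \<beta> (Suc i) + (-1) ^ Suc i * \<alpha> (Suc i) * M i + (-1) ^ (i + q + 1) * R i
        * \<beta> i)
      = (u (Suc i) + v (Suc i)) - (u i + v i)"
      unfolding R M[OF i] u by (simp add: u_def v_def algebra_simps)
  qed simp
  also have "\<dots> = (u p + v p) - (u 0 + v 0)" by (rule sum_lessThan_telescope)
  \<comment> \<open>At the upper end \<open>R p\<close> is an empty sum, so \<open>LR\<close>
    determines \<open>L p\<close>; at the lower end \<open>L 0\<close> is empty. What survives are
    the two orders of the product.\<close>
  also have "\<dots> = \<epsilon> * (s p * (-1) ^ p * \<alpha> (Suc p) * \<beta> p - \<alpha> 0 * \<beta> 0)"
  proof -
    have "L p = (-1) ^ p * (\<alpha> (Suc p) - \<alpha> p)" using LR[of p] by (simp add: R_def)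
    moreover have "L 0 = 0" "s 0 = 1" by (simp_all add: L_def s_def)
    ultimately have "(u p + v p) - (u 0 + v 0) = \<epsilon> * s p * ((-1) ^ p * (\<alpha> (Suc p) - \<alpha> p)) * \<beta> p
        + \<epsilon> * s p * (-1) ^ p * \<alpha> p * \<beta> p - \<epsilon> * \<alpha> 0 * \<beta> 0"
      by (simp add: u_def v_def)
    then show ?thesis by (simp add: algebra_simps)
  qed
  also have "s p * (-1) ^ p = (-1) ^ (p * q)"
    by (simp add: s_def power_add mult_ac)
  finally show ?thesis using z by (simp add: \<epsilon>_def \<alpha>_def \<beta>_def mult_ac)
qed

section \<open>Relative cocycles and coboundaries\<close>

lemma finite_poset_refl: "\<lbrakk>finite_poset r; x \<in> Field r\<rbrakk> \<Longrightarrow> (x, x) \<in> r"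
  and finite_poset_trans: "\<lbrakk>finite_poset r; (x, y) \<in> r; (y, z) \<in> r\<rbrakk> \<Longrightarrow> (x, z) \<in> r"
  and finite_poset_antisym: "\<lbrakk>finite_poset r; (x, y) \<in> r; (y, x) \<in> r\<rbrakk> \<Longrightarrow> x = y"
  and finite_poset_finite: "finite_poset r \<Longrightarrow> finite (Field r)"
  by (auto simp: finite_poset_def partial_order_on_def preorder_on_def refl_on_def finite_Field
      intro: antisymD transD)

text \<open>Repetitions are allowed because monotone images of chains have them. Strictness is added
  separately, as distinctness, wherever it matters.\<close>

definition wchain :: "'p rel \<Rightarrow> 'p list \<Rightarrow> bool" where
  "wchain r z \<longleftrightarrow> z \<noteq> [] \<and> set z \<subseteq> Field r \<and> sorted_wrt (\<lambda>x y. (x, y) \<in> r) z"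

text \<open>The index is the length and not the degree. Length 0 gives the empty set, so
  \<open>Bc\<close> in degree 0 automatically consists of the zero cochain.\<close>

definition chl :: "'p rel \<Rightarrow> 'p set \<Rightarrow> 'p set \<Rightarrow> nat \<Rightarrow> 'p list set" where
  "chl r A B l = {z. length z = l \<and> wchain r z \<and> distinct z \<and> hd z \<in> A \<and> last z \<in> B}"

definition supp :: "('b \<Rightarrow> 'k::zero) \<Rightarrow> 'b set" where
  "supp c = {z. c z \<noteq> 0}"

text \<open>The coboundary is tested only on chains that again start in \<open>A\<close> and end in
  \<open>B\<close>. With suitable regions this gives both complexes of a poset, those of its lower
  and upper intervals, and the intermediate stages of a word in a product.\<close>

definition Zc :: "'p rel \<Rightarrow> 'p set \<Rightarrow> 'p set \<Rightarrow> nat \<Rightarrow> ('p list \<Rightarrow> 'k::comm_ring_1) set" where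
  "Zc r A B n = {c. supp c \<subseteq> chl r A B (Suc n) \<and> (\<forall>z\<in>chl r A B (Suc (Suc n)). bdry c z = 0)}"

definition Bc :: "'p rel \<Rightarrow> 'p set \<Rightarrow> 'p set \<Rightarrow> nat \<Rightarrow> ('p list \<Rightarrow> 'k::comm_ring_1) set" where
  "Bc r A B n = {b. supp b \<subseteq> chl r A B (Suc n) \<and>
     (\<exists>e. supp e \<subseteq> chl r A B n \<and> (\<forall>z\<in>chl r A B (Suc n). bdry e z = b z))}"

lemma wchain_ends: "wchain r z \<Longrightarrow> hd z \<in> Field r" "wchain r z \<Longrightarrow> last z \<in> Field r"
  unfolding wchain_def by (meson hd_in_set last_in_set subsetD)+

lemma wchain_nth_mono:
  assumes "finite_poset r" "wchain r z" "i \<le> j" "j < length z"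
  shows "(z ! i, z ! j) \<in> r"
proof (cases "i = j")
  case True
  then show ?thesis using assms nth_mem[of j z]
    by (auto simp: wchain_def intro!: finite_poset_refl)
next
  case False
  then show ?thesis using assms by (auto simp: wchain_def sorted_wrt_iff_nth_less)
qed

lemma wchain_take: "\<lbrakk>wchain r z; 0 < k\<rbrakk> \<Longrightarrow> wchain r (take k z)"
  by (auto simp: wchain_def sorted_wrt_take dest: in_set_takeD)

lemma wchain_drop: "\<lbrakk>wchain r z; k < length z\<rbrakk> \<Longrightarrow> wchain r (drop k z)"
  by (auto simp: wchain_def sorted_wrt_drop dest: in_set_dropD)

lemma wchain_map:
  assumes "wchain r z" "\<And>x y. (x, y) \<in> r \<Longrightarrow> (f x, f y) \<in> r'"
  shows "wchain r' (map f z)"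
proof -
  have "f x \<in> Field r'" if "x \<in> Field r" for x
    using that assms(2) by (auto simp: Field_def)
  then show ?thesis using assms
    by (auto simp: wchain_def sorted_wrt_map intro: sorted_wrt_mono_rel[rotated])
qed

text \<open>In the extreme case \<open>i = Suc j\<close> one entry is repeated; this occurs in the
  cup-one product with a second factor of degree 0.\<close>

lemma wchain_take_drop:
  assumes r: "finite_poset r" and "wchain r z" "i \<le> Suc j" "0 < i \<or> j < length z"
  shows "wchain r (take i z @ drop j z)"
proof -
  have "(x, y) \<in> r" if "x \<in> set (take i z)" "y \<in> set (drop j z)" for x y
  proof -
    obtain a where "a < i" "a < length z" "x = z ! a"
      using \<open>x \<in> _\<close> by (auto simp: in_set_conv_nth)
    moreover obtain b where "b < length z - j" "y = z ! (j + b)"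
      using \<open>y \<in> _\<close> by (auto simp: in_set_conv_nth)
    ultimately show ?thesis using assms by (auto intro!: wchain_nth_mono[OF r])
  qed
  then show ?thesis using assms
    by (auto simp: wchain_def sorted_wrt_append sorted_wrt_take sorted_wrt_drop
        dest: in_set_takeD in_set_dropD)
qed

lemma wchain_del:
  assumes r: "finite_poset r" and "wchain r z" "i < length z" "1 < length z"
  shows "wchain r (del i z)"
proof (cases "i = 0")
  case True
  then show ?thesis using assms by (simp add: del_def wchain_drop)
next
  case False
  then show ?thesis unfolding del_def using assms by (intro wchain_take_drop) auto
qed

lemma distinct_del: "distinct z \<Longrightarrow> distinct (del i z)"
  unfolding del_def using set_take_disj_set_drop_if_distinct[of z i "Suc i"] by simp

lemma chl_nth:
  assumes "z \<in> chl r A B (Suc n)"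
  shows "length z = Suc n" "z ! 0 \<in> A" "z ! n \<in> B"
  using assms by (auto simp: chl_def hd_conv_nth last_conv_nth wchain_def)

lemma take_chl_last: "take (Suc m) z \<in> chl r A B (Suc m) \<Longrightarrow> z ! m \<in> B"
  using chl_nth(3)[of "take (Suc m) z"] by fastforce

lemma drop_chl_hd: "drop m z \<in> chl r B C (Suc n) \<Longrightarrow> z ! m \<in> B"
  using chl_nth(1,2)[of "drop m z"] by fastforce

lemma suppD: "\<lbrakk>supp c \<subseteq> X; c z \<noteq> 0\<rbrakk> \<Longrightarrow> z \<in> X"
  by (auto simp: supp_def)

lemma chl_0 [simp]: "chl r A B 0 = {}"
  by (auto simp: chl_def wchain_def)

lemma chl_finite:
  assumes "finite_poset r" shows "finite (chl r A B l)"
  using finite_lists_length_eq[OF finite_poset_finite[OF assms], of l]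
  by (rule rev_finite_subset) (auto simp: chl_def wchain_def)

lemma fun_subspace_Zc: "fun_subspace (Zc r A B n :: ('p list \<Rightarrow> 'k::comm_ring_1) set)"
proof -
  have "supp (\<lambda>z. c z + c' z) \<subseteq> X" if "supp c \<subseteq> X" "supp c' \<subseteq> X" for c c' :: "'p list \<Rightarrow> 'k" and X
    using that by (fastforce simp: supp_def)
  moreover have "supp (\<lambda>z. k * c z) \<subseteq> X" if "supp c \<subseteq> X" for c :: "'p list \<Rightarrow> 'k" and k X
    using that by (fastforce simp: supp_def)
  ultimately show ?thesis
    by (simp add: fun_subspace_def Zc_def bdry_add bdry_smult bdry_zero) (simp add: supp_def)
qed

lemma fun_subspace_Bc: "fun_subspace (Bc r A B n :: ('p list \<Rightarrow> 'k::comm_ring_1) set)"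
proof -
  have 1: "supp (\<lambda>z. c z + c' z) \<subseteq> X" if "supp c \<subseteq> X" "supp c' \<subseteq> X" for c c' :: "'p list \<Rightarrow> 'k" and X
    using that by (fastforce simp: supp_def)
  have 2: "supp (\<lambda>z. k * c z) \<subseteq> X" if "supp c \<subseteq> X" for c :: "'p list \<Rightarrow> 'k" and k X
    using that by (fastforce simp: supp_def)
  have I: "c \<in> Bc r A B n" if "supp c \<subseteq> chl r A B (Suc n)" "supp e \<subseteq> chl r A B n"
    "\<And>z. z \<in> chl r A B (Suc n) \<Longrightarrow> bdry e z = c z" for c e :: "'p list \<Rightarrow> 'k"
    using that unfolding Bc_def by blast
  show ?thesis unfolding fun_subspace_def
  proof (intro conjI ballI allI)
    show "(\<lambda>_. 0 :: 'k) \<in> Bc r A B n" by (rule I[of _ "\<lambda>_. 0"]) (auto simp: bdry_zero supp_def)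
  next
    fix c c' :: "'p list \<Rightarrow> 'k" assume "c \<in> Bc r A B n" "c' \<in> Bc r A B n"
    then obtain e e' where "supp e \<subseteq> chl r A B n" "\<forall>z\<in>chl r A B (Suc n). bdry e z = c z"
      "supp e' \<subseteq> chl r A B n" "\<forall>z\<in>chl r A B (Suc n). bdry e' z = c' z"
      "supp c \<subseteq> chl r A B (Suc n)" "supp c' \<subseteq> chl r A B (Suc n)" by (auto simp: Bc_def)
    then show "(\<lambda>z. c z + c' z) \<in> Bc r A B n"
      by (intro I[of _ "\<lambda>z. e z + e' z"] 1) (simp_all add: bdry_add)
  next
    fix k and c :: "'p list \<Rightarrow> 'k" assume "c \<in> Bc r A B n"
    then obtain e where "supp e \<subseteq> chl r A B n" "\<forall>z\<in>chl r A B (Suc n). bdry e z = c z"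
      "supp c \<subseteq> chl r A B (Suc n)" by (auto simp: Bc_def)
    then show "(\<lambda>z. k * c z) \<in> Bc r A B n"
      by (intro I[of _ "\<lambda>z. k * e z"] 2) (simp_all add: bdry_smult)
  qed
qed

definition convex_in :: "'p rel \<Rightarrow> 'p set \<Rightarrow> bool" where
  "convex_in r A \<longleftrightarrow> (\<forall>x y z. (x, y) \<in> r \<longrightarrow> (y, z) \<in> r \<longrightarrow> x \<in> A \<longrightarrow> z \<in> A \<longrightarrow> y \<in> A)"

text \<open>The truncated coboundary could fail to square to zero if a face left the regions and a
  second face came back. Convexity excludes this: if a face of \<open>del i z\<close> lies in the
  regions, then so does \<open>del i z\<close>, and the identity for the full coboundary
  applies.\<close>

lemma Bc_subset_Zc:
  assumes r: "finite_poset r" and A: "convex_in r A" and B: "convex_in r B"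
  shows "Bc r A B n \<subseteq> (Zc r A B n :: ('p list \<Rightarrow> 'k::comm_ring_1) set)"
proof
  fix b :: "'p list \<Rightarrow> 'k" assume "b \<in> Bc r A B n"
  then obtain e where e: "supp e \<subseteq> chl r A B n" and eb: "\<And>z. z \<in> chl r A B (Suc n) \<Longrightarrow> bdry e z = b z"
    and b: "supp b \<subseteq> chl r A B (Suc n)" by (auto simp: Bc_def)
  have "bdry b z = 0" if z: "z \<in> chl r A B (Suc (Suc n))" for z
  proof -
    have zr: "wchain r z" "length z = Suc (Suc n)" "z ! 0 \<in> A" "z ! Suc n \<in> B" "distinct z"
      using z by (auto simp: chl_def hd_conv_nth last_conv_nth wchain_def)
    have "b (del i z) = bdry e (del i z)" if i: "i < Suc (Suc n)" for i
    proof (cases "del i z \<in> chl r A B (Suc n)")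
      case False
      have "e (del j (del i z)) = 0" if j: "j < Suc n" for j
      proof (rule ccontr)
        assume "e (del j (del i z)) \<noteq> 0"
        then have *: "del j (del i z) \<in> chl r A B n" using e by (auto simp: supp_def)
        then have n: "0 < n" by (cases n) auto
        have "del i z ! 0 \<in> A"
        \<comment> \<open>Only if the first two entries are both deleted is the head of
          \<open>del i z\<close> neither the head of \<open>z\<close> nor that of the smaller face;
          it is then squeezed between the two.\<close>
        proof (cases "i = 0 \<and> j = 0")
          case True
          then have "z ! Suc (Suc 0) \<in> A" using * n zr
            by (auto simp: chl_def hd_conv_nth wchain_def nth_del)
          moreover have "(z ! 0, z ! Suc 0) \<in> r" "(z ! Suc 0, z ! Suc (Suc 0)) \<in> r"
            using zr n by (auto intro!: wchain_nth_mono[OF r])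
          ultimately show ?thesis using A zr True n unfolding convex_in_def by (simp add: nth_del)
        next
          case False
          then show ?thesis using * n zr i j
            by (cases "i = 0") (auto simp: chl_def hd_conv_nth wchain_def nth_del)
        qed
        moreover have "del i z ! n \<in> B"
        proof (cases "i = Suc n \<and> j = n")
          case True
          then have "del n (del (Suc n) z) ! (n - 1) \<in> B"
            using chl_nth(3)[of "del j (del i z)" r A B "n - 1"] * n True by simp
          then have "z ! (n - 1) \<in> B" using True n zr by (auto simp: nth_del split: if_splits)
          moreover have "(z ! (n - 1), z ! n) \<in> r" "(z ! n, z ! Suc n) \<in> r"
            using zr n by (auto intro!: wchain_nth_mono[OF r])
          ultimately show ?thesis using B zr True n unfolding convex_in_def by (simp add: nth_del)
        next
          case False
          then show ?thesis using * n zr i j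
            by (cases "i = Suc n") (auto simp: chl_def last_conv_nth wchain_def nth_del split:
                if_splits)
        qed
        ultimately have "del i z \<in> chl r A B (Suc n)"
          using zr i n wchain_del[OF r zr(1), of i] distinct_del[of z i]
          by (auto simp: chl_def hd_conv_nth last_conv_nth wchain_def)
        with False show False by simp
      qed
      then have "bdry e (del i z) = 0" using zr i by (simp add: bdry_def)
      moreover have "b (del i z) = 0" using False b by (auto simp: supp_def)
      ultimately show ?thesis by simp
    qed (simp add: eb)
    then have "bdry b z = bdry (bdry e) z" using zr by (simp add: bdry_def)
    then show ?thesis by (simp add: bdry_bdry)
  qed
  with b show "b \<in> Zc r A B n" by (simp add: Zc_def)
qed

lemma chl_between:
  assumes r: "finite_poset r" and z: "z \<in> chl r A B l" and h: "h \<in> set z"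
  shows "hd z \<in> A" "last z \<in> B" "(hd z, h) \<in> r" "(h, last z) \<in> r"
proof -
  have w: "wchain r z" "z \<noteq> []" using z by (auto simp: chl_def wchain_def)
  obtain i where "i < length z" "h = z ! i" using h by (auto simp: in_set_conv_nth)
  then show "(hd z, h) \<in> r" "(h, last z) \<in> r"
    using w by (auto simp: hd_conv_nth last_conv_nth intro!: wchain_nth_mono[OF r w(1)])
qed (use z in \<open>auto simp: chl_def\<close>)

subsection \<open>Products\<close>

lemma chl_take:
  assumes "z \<in> chl r A C l" "0 < k" "k \<le> l" "z ! (k - 1) \<in> B"
  shows "take k z \<in> chl r A B k"
proof -
  have "wchain r z" "z \<noteq> []" using assms by (auto simp: chl_def wchain_def)
  then show ?thesis using assms wchain_take[of r z k]
    by (auto simp: chl_def last_conv_nth hd_take)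
qed

lemma chl_drop:
  assumes "z \<in> chl r A C l" "k < l" "z ! k \<in> B"
  shows "drop k z \<in> chl r B C (l - k)"
  using assms by (auto simp: chl_def wchain_drop hd_drop_conv_nth)

lemma chl_join:
  assumes r: "finite_poset r" and 1: "take (Suc m) z \<in> chl r A B (Suc m)"
      and 2: "drop m z \<in> chl r B C (Suc n)"
  shows "z \<in> chl r A C (Suc (m + n))" "z ! m \<in> B"
proof -
  have len: "length z = Suc (m + n)" using 1 2 by (auto simp: chl_def)
  have w1: "wchain r (take (Suc m) z)" "distinct (take (Suc m) z)" "z ! 0 \<in> A" "z ! m \<in> B"
    using 1 len by (auto simp: chl_def hd_conv_nth last_conv_nth wchain_def)
  have w2: "wchain r (drop m z)" "distinct (drop m z)" "last z \<in> C"
    using 2 len by (auto simp: chl_def)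
  have lt: "(z ! i, z ! j) \<in> r \<and> z ! i \<noteq> z ! j" if ij: "i < j" "j < length z" for i j
  proof -
    have a: "(z ! i, z ! j) \<in> r \<and> z ! i \<noteq> z ! j" if "i < j" "j \<le> m" for i j
      using that w1(1,2) len wchain_nth_mono[OF r w1(1), of i j]
        nth_eq_iff_index_eq[OF w1(2), of i j] by simp
    have b: "(z ! i, z ! j) \<in> r \<and> z ! i \<noteq> z ! j" if "i < j" "m \<le> i" "j < length z" for i j
      using that w2(1,2) len wchain_nth_mono[OF r w2(1), of "i - m" "j - m"]
        nth_eq_iff_index_eq[OF w2(2), of "i - m" "j - m"] by simp
    consider "j \<le> m" | "m \<le> i" | "i < m" "m < j" by linarith
    then show ?thesis
    proof cases
      case 3
      then show ?thesis using a[of i m] b[of m j] ij finite_poset_trans[OF r, of "z ! i" "z ! m"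
          "z ! j"]
          finite_poset_antisym[OF r, of "z ! i" "z ! m"] by auto
    qed (use a b ij in auto)
  qed
  have "set z \<subseteq> Field r"
  proof -
    have "set z = set (take (Suc m) z @ drop (Suc m) z)" by simp
    then have "set z \<subseteq> set (take (Suc m) z) \<union> set (drop m z)"
      using set_drop_subset_set_drop[of m "Suc m" z]
      by (metis Un_mono order_refl set_append le_Suc_eq)
    then show ?thesis using w1(1) w2(1) unfolding wchain_def by blast
  qed
  moreover have "distinct z" unfolding distinct_conv_nth using lt by (metis linorder_neqE_nat)
  moreover have "hd z = z ! 0" using len by (cases z) auto
  ultimately show "z \<in> chl r A C (Suc (m + n))"
    using len lt w1(3) w2(3) by (auto simp: chl_def wchain_def sorted_wrt_iff_nth_less)
  show "z ! m \<in> B" by (rule w1)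
qed

lemma supp_cup:
  assumes r: "finite_poset r" and "supp a \<subseteq> chl r A B (Suc m)" "supp b \<subseteq> chl r B C (Suc n)"
  shows "supp (cup m a b) \<subseteq> chl r A C (Suc (m + n))"
proof
  fix z assume "z \<in> supp (cup m a b)"
  then have "a (take (Suc m) z) \<noteq> 0" "b (drop m z) \<noteq> 0" by (auto simp: supp_def cup_def)
  then show "z \<in> chl r A C (Suc (m + n))" using assms(2,3)
    by (intro chl_join(1)[OF r]) (auto simp: supp_def)
qed

text \<open>In each Leibniz term the factor that is not differentiated, if nonzero, places the cut
  point in \<open>B\<close>. The differentiated factor is then evaluated on a chain with admissible
  ends, where its cocycle condition is available. The two lemmas on coboundaries below use the same
  argument.\<close>

lemma cup_Zc:
  fixes a b :: "'p list \<Rightarrow> 'k::comm_ring_1"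
  assumes r: "finite_poset r" and a: "a \<in> Zc r A B m" and b: "b \<in> Zc r B C n"
  shows "cup m a b \<in> Zc r A C (m + n)"
proof -
  have s: "supp a \<subseteq> chl r A B (Suc m)" "supp b \<subseteq> chl r B C (Suc n)" using a b by (auto simp: Zc_def)
  have "bdry (cup m a b) z = 0" if z: "z \<in> chl r A C (Suc (Suc (m + n)))" for z
  proof -
    have len: "length z = Suc (Suc (m + n))" using z by (simp add: chl_def)
    have "bdry a (take (Suc (Suc m)) z) = 0" if "b (drop (Suc m) z) \<noteq> 0"
    proof -
      have "z ! Suc m \<in> B" using suppD[OF s(2) that] by (rule drop_chl_hd)
      then have "take (Suc (Suc m)) z \<in> chl r A B (Suc (Suc m))" using z by (intro chl_take) auto
      then show ?thesis using a by (simp add: Zc_def)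
    qed
    moreover have "bdry b (drop m z) = 0" if "a (take (Suc m) z) \<noteq> 0"
    proof -
      have "z ! m \<in> B" using suppD[OF s(1) that] by (rule take_chl_last)
      then have "drop m z \<in> chl r B C (Suc (Suc n))" using chl_drop[OF z, of m B] by simp
      then show ?thesis using b by (simp add: Zc_def)
    qed
    ultimately show ?thesis unfolding bdry_cup[OF len]
      by (cases "b (drop (Suc m) z) = 0"; cases "a (take (Suc m) z) = 0") simp_all
  qed
  then show ?thesis using supp_cup[OF r s] by (simp add: Zc_def)
qed

lemma cup_Bc_left:
  fixes a b :: "'p list \<Rightarrow> 'k::comm_ring_1"
  assumes r: "finite_poset r" and a: "a \<in> Bc r A B m" and b: "b \<in> Zc r B C n"
  shows "cup m a b \<in> Bc r A C (m + n)"
proof -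
  obtain e where e: "supp e \<subseteq> chl r A B m" "\<And>z. z \<in> chl r A B (Suc m) \<Longrightarrow> bdry e z = a z"
    using a by (auto simp: Bc_def)
  have s: "supp a \<subseteq> chl r A B (Suc m)" "supp b \<subseteq> chl r B C (Suc n)" using a b
    by (auto simp: Zc_def Bc_def)
  show ?thesis
  proof (cases m)
    case 0
    then have "e = (\<lambda>_. 0)" using e(1) by (auto simp: supp_def)
    then have "a z = 0" for z using e(2)[of z] s(1)
      by (cases "a z = 0") (auto simp: supp_def bdry_zero)
    then have "cup m a b = (\<lambda>_. 0)" by (auto simp: cup_def)
    then show ?thesis using fun_subspace_zero[OF fun_subspace_Bc] by metis
  next
    case (Suc m')
    have "bdry (cup m' e b) z = cup m a b z" if z: "z \<in> chl r A C (Suc (m + n))" for z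
    proof -
      have len: "length z = Suc (Suc (m' + n))" using z Suc by (simp add: chl_def)
      have "bdry e (take (Suc m) z) = a (take (Suc m) z)" if "b (drop m z) \<noteq> 0"
      proof -
        have "z ! m \<in> B" using suppD[OF s(2) that] by (rule drop_chl_hd)
        then show ?thesis using z Suc by (intro e(2) chl_take) auto
      qed
      moreover have "bdry b (drop m' z) = 0" if "e (take m z) \<noteq> 0"
      proof -
        have "z ! m' \<in> B" using suppD[OF e(1) that] unfolding Suc by (rule take_chl_last)
        then have "drop m' z \<in> chl r B C (Suc (Suc n))" using chl_drop[OF z, of m' B] Suc by simp
        then show ?thesis using b by (simp add: Zc_def)
      qed
      ultimately show ?thesis unfolding bdry_cup[OF len] cup_def Suc
        by (cases "b (drop (Suc m') z) = 0"; cases "e (take (Suc m') z) = 0") simp_all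
    qed
    moreover have "supp (cup m' e b) \<subseteq> chl r A C (m + n)"
      using supp_cup[OF r, of e A B m' b C n] e(1) s(2) Suc by simp
    ultimately show ?thesis using supp_cup[OF r s] by (auto simp: Bc_def)
  qed
qed

lemma cup_Bc_right:
  fixes a b :: "'p list \<Rightarrow> 'k::comm_ring_1"
  assumes r: "finite_poset r" and a: "a \<in> Zc r A B m" and b: "b \<in> Bc r B C n"
  shows "cup m a b \<in> Bc r A C (m + n)"
proof -
  obtain e where e: "supp e \<subseteq> chl r B C n" "\<And>z. z \<in> chl r B C (Suc n) \<Longrightarrow> bdry e z = b z"
    using b by (auto simp: Bc_def)
  have s: "supp a \<subseteq> chl r A B (Suc m)" "supp b \<subseteq> chl r B C (Suc n)" using a b
    by (auto simp: Zc_def Bc_def)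
  show ?thesis
  proof (cases n)
    case 0
    then have "e = (\<lambda>_. 0)" using e(1) by (auto simp: supp_def)
    then have "b z = 0" for z using e(2)[of z] s(2)
      by (cases "b z = 0") (auto simp: supp_def bdry_zero)
    then have "cup m a b = (\<lambda>_. 0)" by (auto simp: cup_def)
    then show ?thesis using fun_subspace_zero[OF fun_subspace_Bc] by metis
  next
    case (Suc n')
    \<comment> \<open>The factor compensates the Leibniz sign in front of the second term.\<close>
    have "bdry (\<lambda>z. (-1) ^ m * cup m a e z) z = cup m a b z" if z: "z \<in> chl r A C (Suc (m + n))"
        for z
    proof -
      have len: "length z = Suc (Suc (m + n'))" using z Suc by (simp add: chl_def)
      have "bdry a (take (Suc (Suc m)) z) = 0" if "e (drop (Suc m) z) \<noteq> 0"
      proof -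
        have "z ! Suc m \<in> B" using suppD[OF e(1) that] unfolding Suc by (rule drop_chl_hd)
        then have "take (Suc (Suc m)) z \<in> chl r A B (Suc (Suc m))" using z Suc
          by (intro chl_take) auto
        then show ?thesis using a by (simp add: Zc_def)
      qed
      moreover have "bdry e (drop m z) = b (drop m z)" if "a (take (Suc m) z) \<noteq> 0"
      proof -
        have "z ! m \<in> B" using suppD[OF s(1) that] by (rule take_chl_last)
        then show ?thesis using chl_drop[OF z, of m B] by (intro e(2)) simp
      qed
      ultimately show ?thesis unfolding bdry_smult bdry_cup[OF len]
        by (cases "e (drop (Suc m) z) = 0"; cases "a (take (Suc m) z)
            = 0") (simp_all add: cup_def mult.assoc)
    qed
    moreover have "supp (\<lambda>z. (-1) ^ m * cup m a e z) \<subseteq> chl r A C (m + n)"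
      using supp_cup[OF r, of a A B m e C n'] e(1) s(1) Suc by (auto simp: supp_def)
    ultimately show ?thesis using supp_cup[OF r s] by (auto simp: Bc_def)
  qed
qed

subsection \<open>Pullbacks\<close>

definition pl :: "'p rel \<Rightarrow> 'p set \<Rightarrow> 'p set \<Rightarrow> nat \<Rightarrow> ('p \<Rightarrow> 'q) \<Rightarrow> ('q list \<Rightarrow> 'k) \<Rightarrow> 'p list \<Rightarrow>
    'k::comm_ring_1" where
  "pl r A B l f c z = (if z \<in> chl r A B l then c (map f z) else 0)"

lemma not_distinct_wchain:
  assumes r: "finite_poset r" and w: "wchain r z" and "\<not> distinct z"
  obtains i where "Suc i < length z" "z ! i = z ! Suc i"
proof -
  obtain i j where ij: "i < j" "j < length z" "z ! i = z ! j"
    using assms(3) unfolding distinct_conv_nth by (metis linorder_neqE_nat)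
  then have "z ! i = z ! Suc i"
    using wchain_nth_mono[OF r w, of i "Suc i"] wchain_nth_mono[OF r w, of "Suc i" j]
    by (intro finite_poset_antisym[OF r]) auto
  with ij show ?thesis by (intro that[of i]) auto
qed

text \<open>Deleting either of two equal neighbours gives the same list with opposite signs, and
  every other face still has a repetition, where \<open>c\<close> vanishes.\<close>

lemma bdry_degenerate:
  assumes r: "finite_poset r" and w: "wchain r z" and nd: "\<not> distinct z"
      and c: "\<And>z. c z \<noteq> 0 \<Longrightarrow> distinct z"
  shows "bdry c z = 0"
proof -
  obtain i where i: "Suc i < length z" "z ! i = z ! Suc i" by (rule not_distinct_wchain[OF r w nd])
  have zero: "c (del j z) = 0" if j: "j < length z" "j \<noteq> i" "j \<noteq> Suc i" for j
  proof -
    have "\<not> distinct (del j z)"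
    proof (cases "j < i")
      case True
      then have "del j z ! (i - 1) = del j z ! i" using i j by (auto simp: nth_del)
      moreover have "i - 1 < length (del j z)" "i < length (del j z)" "i - 1 \<noteq> i" using True i j
        by auto
      ultimately show ?thesis using nth_eq_iff_index_eq by blast
    next
      case False
      then have "del j z ! i = del j z ! Suc i" using i j by (auto simp: nth_del)
      moreover have "i < length (del j z)" "Suc i < length (del j z)" using False i j by auto
      ultimately show ?thesis using nth_eq_iff_index_eq by (metis n_not_Suc_n)
    qed
    then show ?thesis using c by blast
  qed
  have "bdry c z = (\<Sum>j\<in>{i, Suc i}. (-1) ^ j * c (del j z))"
    unfolding bdry_def by (rule sum.mono_neutral_right) (use i zero in auto)
  moreover have "del i z = del (Suc i) z"
    using i by (intro nth_equalityI) (auto simp: nth_del less_Suc_eq)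
  ultimately show ?thesis by simp
qed

text \<open>A face of \<open>z\<close> with image in the region must itself have its ends in
  \<open>A\<close> and \<open>B\<close>, so the truncation loses nothing. The conditions on
  \<open>f\<close> concern only elements between \<open>A\<close> and \<open>B\<close>: for a
  coordinate projection of a product they hold only there.\<close>

lemma bdry_pl:
  assumes r: "finite_poset r"
    and A: "\<And>x y h. \<lbrakk>x \<in> A; y \<in> B; (x, h) \<in> r; (h, y) \<in> r; f h \<in> A'\<rbrakk> \<Longrightarrow> h \<in> A"
    and B: "\<And>x y h. \<lbrakk>x \<in> A; y \<in> B; (x, h) \<in> r; (h, y) \<in> r; f h \<in> B'\<rbrakk> \<Longrightarrow> h \<in> B"
    and c: "supp c \<subseteq> chl r' A' B' l" and z: "z \<in> chl r A B (Suc l)"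
  shows "bdry (pl r A B l f c) z = bdry c (map f z)"
proof (cases l)
  case 0
  then have "c = (\<lambda>_. 0)" using c by (auto simp: supp_def)
  then show ?thesis by (simp add: bdry_def pl_def)
next
  case (Suc l')
  have len: "length z = Suc l" and w: "wchain r z" "distinct z" using z by (auto simp: chl_def)
  have "pl r A B l f c (del i z) = c (map f (del i z))" if i: "i < Suc l" for i
  proof (cases "c (map f (del i z)) = 0")
    case False
    have w': "wchain r (del i z)" using len i Suc by (intro wchain_del[OF r w(1)]) auto
    have "map f (del i z) \<in> chl r' A' B' l" using False c by (auto simp: supp_def)
    then have "f (hd (del i z)) \<in> A'" "f (last (del i z)) \<in> B'"
      using w' by (auto simp: chl_def hd_map last_map wchain_def)
    moreover have "hd (del i z) \<in> set z" "last (del i z) \<in> set z"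
    proof -
      have "set (del i z) \<subseteq> set z" by (auto simp: del_def dest: in_set_takeD in_set_dropD)
      then show "hd (del i z) \<in> set z" "last (del i z) \<in> set z"
        using w' unfolding wchain_def by (meson hd_in_set last_in_set subsetD)+
    qed
    ultimately have "hd (del i z) \<in> A" "last (del i z) \<in> B"
      using A B chl_between[OF r z] by metis+
    then show ?thesis using w' w len i by (simp add: pl_def chl_def distinct_del)
  qed (simp add: pl_def)
  then show ?thesis by (simp add: bdry_def len map_del)
qed

context
  fixes r :: "'p rel" and r' :: "'q rel" and f A A' B B'
  assumes r: "finite_poset r" and r': "finite_poset r'"
    and f: "\<And>x y. (x, y) \<in> r \<Longrightarrow> (f x, f y) \<in> r'"
    and A: "\<And>x y h. \<lbrakk>x \<in> A; y \<in> B; (x, h) \<in> r; (h, y) \<in> r\<rbrakk> \<Longrightarrow> f h \<in> A' \<longleftrightarrow> h \<in> A"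
    and B: "\<And>x y h. \<lbrakk>x \<in> A; y \<in> B; (x, h) \<in> r; (h, y) \<in> r\<rbrakk> \<Longrightarrow> f h \<in> B' \<longleftrightarrow> h \<in> B"
begin

lemma map_chl:
  assumes "z \<in> chl r A B l" "distinct (map f z)" shows "map f z \<in> chl r' A' B' l"
proof -
  have z: "wchain r z" "z \<noteq> []" "set z \<subseteq> Field r" using assms(1) by (auto simp: chl_def wchain_def)
  then have "f (hd z) \<in> A' \<longleftrightarrow> hd z \<in> A" "f (last z) \<in> B' \<longleftrightarrow> last z \<in> B"
    using A B chl_between[OF r assms(1)] z(2) hd_in_set last_in_set by metis+
  then show ?thesis using assms z wchain_map[of r z f r', OF _ f]
    by (simp add: chl_def hd_map last_map del: distinct_map)
qed

text \<open>A strict chain whose image under \<open>f\<close> repeats an entry is not tested by the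
  cocycle condition of \<open>c\<close>; there the coboundary vanishes by
  \<open>bdry_degenerate\<close>.\<close>

lemma pl_Zc:
  fixes c :: "'q list \<Rightarrow> 'k::comm_ring_1"
  assumes c: "c \<in> Zc r' A' B' n"
  shows "pl r A B (Suc n) f c \<in> Zc r A B n"
proof -
  have "bdry (pl r A B (Suc n) f c) z = 0" if z: "z \<in> chl r A B (Suc (Suc n))" for z
  proof -
    have "bdry (pl r A B (Suc n) f c) z = bdry c (map f z)"
      by (rule bdry_pl[OF r, where A' = A' and B' = B'
          and r' = r']) (use A B c z in \<open>auto simp: Zc_def\<close>)
    also have "\<dots> = 0"
    proof (cases "distinct (map f z)")
      case True
      then show ?thesis using map_chl[OF z] c by (auto simp: Zc_def)
    next
      case False
      show ?thesis
        by (rule bdry_degenerate[OF r' wchain_map[of r z f, OF _ f] False])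
          (use z c in \<open>auto simp: Zc_def supp_def chl_def\<close>)
    qed
    finally show ?thesis .
  qed
  then show ?thesis by (auto simp: Zc_def supp_def pl_def)
qed

lemma pl_Bc:
  fixes c :: "'q list \<Rightarrow> 'k::comm_ring_1"
  assumes c: "c \<in> Bc r' A' B' n"
  shows "pl r A B (Suc n) f c \<in> Bc r A B n"
proof -
  obtain e where e: "supp e \<subseteq> chl r' A' B' n" "\<And>z. z \<in> chl r' A' B' (Suc n) \<Longrightarrow> bdry e z = c z"
    using c by (auto simp: Bc_def)
  have c': "supp c \<subseteq> chl r' A' B' (Suc n)" using c by (auto simp: Bc_def)
  have "bdry (pl r A B n f e) z = pl r A B (Suc n) f c z" if z: "z \<in> chl r A B (Suc n)" for z
  proof -
    have "bdry (pl r A B n f e) z = bdry e (map f z)"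
      by (rule bdry_pl[OF r, where A' = A' and B' = B' and r' = r']) (use A B e(1) z in \<open>auto\<close>)
    also have "\<dots> = c (map f z)"
    proof (cases "distinct (map f z)")
      case True
      then show ?thesis using map_chl[OF z] e(2) by auto
    next
      case False
      have "bdry e (map f z) = 0"
        by (rule bdry_degenerate[OF r' wchain_map[of r z f, OF _ f] False])
          (use z e(1) in \<open>auto simp: supp_def chl_def\<close>)
      moreover have "c (map f z) = 0" using False c' by (auto simp: supp_def chl_def)
      ultimately show ?thesis by simp
    qed
    finally show ?thesis using z by (simp add: pl_def)
  qed
  moreover have "supp (pl r A B n f e) \<subseteq> chl r A B n" "supp (pl r A B (Suc n) f c)
      \<subseteq> chl r A B (Suc n)"
    by (auto simp: supp_def pl_def split: if_splits)
  ultimately show ?thesis by (auto simp: Bc_def)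
qed

end

subsection \<open>Commutativity up to coboundaries\<close>

lemma bdry_Zc_wchain:
  assumes "finite_poset r" "c \<in> Zc r A B n" "wchain r w" "length w = Suc (Suc n)" "hd w
      \<in> A" "last w \<in> B"
  shows "bdry c w = 0"
proof (cases "distinct w")
  case True
  then have "w \<in> chl r A B (Suc (Suc n))" using assms by (simp add: chl_def)
  then show ?thesis using assms by (simp add: Zc_def)
next
  case False
  show ?thesis
    by (rule bdry_degenerate[OF assms(1,3) False]) (use assms(2) in \<open>auto simp: Zc_def supp_def
        chl_def\<close>)
qed

definition antichain :: "'p rel \<Rightarrow> 'p set \<Rightarrow> bool" where
  "antichain r A \<longleftrightarrow> (\<forall>x\<in>A. \<forall>y\<in>A. (x, y) \<in> r \<longrightarrow> x = y)"

lemma antichain_squeeze: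
  assumes "finite_poset r" "antichain r A" "x \<in> A" "z \<in> A" "(x, y) \<in> r" "(y, z) \<in> r"
  shows "y \<in> A"
  using assms finite_poset_trans[OF assms(1,5,6)] finite_poset_antisym[OF assms(1,5)]
  by (auto simp: antichain_def)

lemma antichain_convex: "\<lbrakk>finite_poset r; antichain r A\<rbrakk> \<Longrightarrow> convex_in r A"
  using antichain_squeeze unfolding convex_in_def by metis

text \<open>The ends of \<open>w\<close> need not lie in \<open>A\<close> and \<open>B\<close>. But
  if \<open>c\<close> is nonzero on some face, then the ends of that face lie there, and the ends of
  \<open>w\<close>, squeezed between them and \<open>x\<close>, \<open>y\<close>, lie in the
  antichains too; otherwise every term of the coboundary is zero.\<close>

lemma bdry_Zc_between:
  assumes r: "finite_poset r" and c: "c \<in> Zc r A B n" and w: "wchain r w"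
      and len: "length w = Suc (Suc n)"
    and A: "antichain r A" "x \<in> A" "(x, hd w) \<in> r" and B: "antichain r B" "y \<in> B" "(last w, y) \<in> r"
  shows "bdry c w = 0"
proof (cases "hd w \<in> A \<and> last w \<in> B")
  case True
  then show ?thesis using bdry_Zc_wchain[OF r c w len] by simp
next
  case False
  have "c (del k w) = 0" if k: "k < length w" for k
  proof (rule ccontr)
    assume "c (del k w) \<noteq> 0"
    then have d: "del k w \<in> chl r A B (Suc n)" using c by (auto simp: Zc_def supp_def)
    have w0: "w \<noteq> []" using len by auto
    have "del k w ! 0 \<in> A" "del k w ! n \<in> B" using chl_nth[OF d] by auto
    moreover have "(hd w, del k w ! 0) \<in> r" "(del k w ! n, last w) \<in> r"
      using k len w0 by (auto simp: nth_del hd_conv_nth last_conv_nth intro!: wchain_nth_mono[OF r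
          w])
    ultimately have "hd w \<in> A" "last w \<in> B"
      using antichain_squeeze[OF r A(1,2) _ A(3)] antichain_squeeze[OF r B(1) _ B(2) _ B(3)]
      by blast+
    with False show False by simp
  qed
  then show ?thesis by (simp add: bdry_def)
qed

lemma bdry_map: "bdry (\<lambda>z. c (map f z)) z = bdry c (map f z)"
  by (simp add: bdry_def map_del)

text \<open>The cup-one formula for the cochains \<open>c\<close> and \<open>c'\<close> pulled back
  along two different maps, with end regions described jointly by both maps. The antichain
  conditions concern the second factor because in the cup-one product it is evaluated on interior
  windows, whose ends are only known to lie between those of the whole chain.\<close>

lemma swap_Bc:
  fixes c :: "'p list \<Rightarrow> 'k::comm_ring_1" and c' :: "'q list \<Rightarrow> 'k"
  assumes r: "finite_poset r" and P: "finite_poset P" and Q: "finite_poset Q"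
    and f: "\<And>x y. (x, y) \<in> r \<Longrightarrow> (f x, f y) \<in> P" and g: "\<And>x y. (x, y) \<in> r \<Longrightarrow> (g x, g y) \<in> Q"
    and c: "c \<in> Zc P A1 B1 p" and c': "c' \<in> Zc Q A2 B2 q"
    and anti: "antichain Q A2" "antichain Q B2"
    and A: "\<And>x y h. \<lbrakk>x \<in> A; y \<in> C; (x, h) \<in> r; (h, y) \<in> r\<rbrakk> \<Longrightarrow> h \<in> A \<longleftrightarrow> f h \<in> A1 \<and> g h \<in> A2"
    and C: "\<And>x y h. \<lbrakk>x \<in> A; y \<in> C; (x, h) \<in> r; (h, y) \<in> r\<rbrakk> \<Longrightarrow> h \<in> C \<longleftrightarrow> f h \<in> B1 \<and> g h \<in> B2"
  shows "(\<lambda>z. if z \<in> chl r A C (Suc (p + q)) then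
      (-1) ^ (p * q) * (c (map f (take (Suc p) z)) * c' (map g (drop p z)))
        - c' (map g (take (Suc q) z)) * c (map f (drop q z)) else 0) \<in> Bc r A C (p + q)"
    (is "?R \<in> _")
proof -
  define a where "a z = c (map f z)" for z
  define b where "b z = c' (map g z)" for z
  define H where "H = cup_one p q a b"
  \<comment> \<open>The sign is that of \<open>bdry_cup_one\<close>; it squares to one.\<close>
  define E where "E z = (if z \<in> chl r A C (p + q) then (-1) ^ (q + 1) * H z else 0)" for z
  have "bdry E z = ?R z" if z: "z \<in> chl r A C (Suc (p + q))" for z
  proof -
    let ?N = "p + q"
    have w: "wchain r z" "distinct z" and len: "length z = Suc ?N"
        and ends: "z ! 0 \<in> A" "z ! ?N \<in> C"
      using z chl_nth[OF z] by (auto simp: chl_def)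
    have betw: "(z ! 0, z ! i) \<in> r" "(z ! i, z ! ?N) \<in> r" if "i < Suc ?N" for i
      using that len by (auto intro!: wchain_nth_mono[OF r w(1)])
    have fg: "f (z ! 0) \<in> A1" "g (z ! 0) \<in> A2" "f (z ! ?N) \<in> B1" "g (z ! ?N) \<in> B2"
      using A[OF ends betw[of 0]] C[OF ends betw[of ?N]] ends by auto
    have "E (del i z) = (-1) ^ (q + 1) * H (del i z)" if i: "i < Suc ?N" for i
    proof (cases "del i z \<in> chl r A C ?N")
      case False
      \<comment> \<open>The truncation in \<open>E\<close> is harmless: a nonzero summand of
        \<open>H\<close> at the face gives ends in the regions of \<open>c\<close> directly, and in
        those of \<open>c'\<close> by squeezing between the window and the ends of
        \<open>z\<close>.\<close>
      have "H (del i z) = 0"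
      proof (rule ccontr)
        define y where "y = del i z"
        have leny: "length y = ?N" using i len by (simp add: y_def)
        assume "H (del i z) \<noteq> 0"
        then obtain j where j: "j < p" "a (take (Suc j) y @ drop (j + q) y) * b (take (Suc q)
            (drop j y)) \<noteq> 0"
          unfolding H_def cup_one_def y_def
          by (metis (no_types, lifting) lessThan_iff mult_zero_right sum.neutral)
        then have ab: "a (take (Suc j) y @ drop (j + q) y) \<noteq> 0" "b (take (Suc q) (drop j y)) \<noteq> 0"
          by auto
        have wy: "wchain r y" unfolding y_def using i len j(1) by (intro wchain_del[OF r w(1)]) auto
        have y0: "y \<noteq> []" using wy by (simp add: wchain_def)
        have nth_y: "\<exists>k<Suc ?N. y ! l = z ! k" if "l < ?N" for l
          using that i len unfolding y_def
            by (intro exI[of _ "if l < i then l else Suc l"]) (auto simp: nth_del)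
        have "map f (take (Suc j) y @ drop (j + q) y) \<in> chl P A1 B1 (Suc p)"
          using ab(1) c by (auto simp: a_def Zc_def supp_def)
        from chl_nth[OF this]
        have w1: "f ((take (Suc j) y @ drop (j + q) y) ! 0)
            \<in> A1" "f ((take (Suc j) y @ drop (j + q) y) ! p) \<in> B1"
          by (simp_all del: map_append)
        have "(take (Suc j) y @ drop (j + q) y) ! 0
            = y ! 0" "(take (Suc j) y @ drop (j + q) y) ! p = y ! (?N - 1)"
          using j(1) leny y0 by (auto simp: nth_append min_def intro!: arg_cong[where f = "(!) y"])
        then have f1: "f (y ! 0) \<in> A1" "f (y ! (?N - 1)) \<in> B1" using w1 by simp_all
        have "map g (take (Suc q) (drop j y)) \<in> chl Q A2 B2 (Suc q)"
          using ab(2) c' by (auto simp: b_def Zc_def supp_def)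
        from chl_nth[OF this] have g1: "g (y ! j) \<in> A2" "g (y ! (j + q)) \<in> B2"
          using j(1) leny by auto
        obtain k l where kl: "k < Suc ?N" "y ! 0 = z ! k" "l < Suc ?N" "y ! (?N - 1) = z ! l"
          using nth_y[of 0] nth_y[of "?N - 1"] j(1) by auto
        have "g (y ! 0) \<in> A2"
          using kl leny j(1) betw
          by (intro antichain_squeeze[OF Q anti(1) fg(2) g1(1)] g wchain_nth_mono[OF r wy]) auto
        moreover have "g (y ! (?N - 1)) \<in> B2"
          using kl leny j(1) betw
          by (intro antichain_squeeze[OF Q anti(2) g1(2) fg(4)] g wchain_nth_mono[OF r wy]) auto
        ultimately have "y ! 0 \<in> A" "y ! (?N - 1) \<in> C"
          using A[OF ends, of "y ! 0"] C[OF ends, of "y ! (?N - 1)"] f1 kl betw by auto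
        then have "y \<in> chl r A C ?N"
          using wy y0 leny distinct_del[OF w(2), of i]
          by (simp add: chl_def hd_conv_nth last_conv_nth y_def)
        with False show False by (simp add: y_def)
      qed
      then show ?thesis using False by (simp add: E_def)
    qed (simp add: E_def)
    then have "bdry E z = (\<Sum>i<Suc ?N. (-1) ^ i * ((-1) ^ (q + 1) * H (del i z)))"
      unfolding bdry_def len by (intro sum.cong refl) (simp only: lessThan_iff)
    also have "\<dots> = (-1) ^ (q + 1) * bdry H z"
      by (simp only: bdry_def len sum_distrib_left mult.left_commute)
    also have "bdry H z = (-1) ^ (q + 1) *
        ((-1) ^ (p * q) * (a (take (Suc p) z) * b (drop p z)) - b (take (Suc q) z) * a (drop q z))"
      unfolding H_def
    proof (rule bdry_cup_one[OF len])
      fix i assume i: "i \<le> p"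
      let ?w = "take (Suc i) z @ drop (i + q) z"
      have "wchain r ?w" using i len by (intro wchain_take_drop[OF r w(1)]) auto
      moreover have "hd ?w = z ! 0" "last ?w = z ! ?N"
        using i len by (auto simp: hd_append hd_take hd_conv_nth last_append last_conv_nth
            add.commute)
      ultimately show "bdry a ?w = 0" unfolding a_def bdry_map
        using fg i len wchain_map[of r ?w f P, OF _ f]
        by (intro bdry_Zc_wchain[OF P c]) (auto simp: hd_map last_map simp del: map_append)
    next
      fix i assume i: "i < p"
      define w where "w = take (Suc (Suc q)) (drop i z)"
      have w': "wchain r w" unfolding w_def using i len by (intro wchain_take wchain_drop w(1)) auto
      have w0: "hd w = z ! i" "last w = z ! (i + Suc q)" "w \<noteq> []" "length w = Suc (Suc q)"
        unfolding w_def using i len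
        by (auto simp: hd_conv_nth last_conv_nth min_def intro!: arg_cong[where f = "(!) z"])
      \<comment> \<open>The lists fed to \<open>a\<close> keep the ends of \<open>z\<close>, but the
        window fed to \<open>b\<close> does not, so the version for ends between the regions is
        required here.\<close>
      have "bdry c' (map g w) = 0"
        using i w0 by (intro bdry_Zc_between[OF Q c' wchain_map[OF w' g] _ anti(1) fg(2) _ anti(2)
            fg(4)])
          (auto simp: hd_map last_map intro!: g betw)
      then show "bdry b (take (Suc (Suc q)) (drop i z)) = 0" unfolding b_def bdry_map w_def .
    qed
    finally show ?thesis using z by (simp add: a_def b_def flip: mult.assoc power_mult_distrib
        power_add)
  qed
  moreover have "supp E \<subseteq> chl r A C (p + q)" "supp ?R \<subseteq> chl r A C (Suc (p + q))"
    by (auto simp: supp_def E_def)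
  ultimately show ?thesis unfolding Bc_def by blast
qed

section \<open>The cochain complexes of a poset\<close>

lemma sorted_wrt_strict_iff:
  "sorted_wrt (\<lambda>x y. (x, y) \<in> r \<and> x \<noteq> y) xs \<longleftrightarrow> sorted_wrt (\<lambda>x y. (x, y) \<in> r) xs \<and> distinct xs"
  by (induction xs) auto

text \<open>The two complexes differ only in the set where chains may start. This set is closed
  downwards in both cases, so inserting an entry before the first one does not leave the
  complex.\<close>

definition start :: "('p rel \<Rightarrow> nat \<Rightarrow> 'p list set) \<Rightarrow> 'p rel \<Rightarrow> 'p set" where
  "start C r = (if C = c_chains then min_elems r else Field r)"

lemma start_c_chains [simp]: "start c_chains r = min_elems r"
  by (simp add: start_def)

lemma chat_chains_eq_chl: "chat_chains r n = chl r (Field r) (max_elems r) (Suc n)"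
proof (rule Set.set_eqI)
  fix x
  have "x \<in> chat_chains r n \<longleftrightarrow> length x = Suc n \<and> wchain r x \<and> distinct x \<and> last x \<in> max_elems r"
    by (auto simp: chat_chains_def wchain_def sorted_wrt_strict_iff)
  then show "x \<in> chat_chains r n \<longleftrightarrow> x \<in> chl r (Field r) (max_elems r) (Suc n)"
    using wchain_ends(1)[of r x] by (auto simp: chl_def)
qed

lemma chains_eq_chl:
  assumes "C \<in> {chat_chains, c_chains}"
  shows "C r n = chl r (start C r) (max_elems r) (Suc n)"
proof -
  have "c_chains r n = chl r (min_elems r) (max_elems r) (Suc n)"
    by (auto simp: c_chains_def chat_chains_eq_chl chl_def min_elems_def)
  then show ?thesis using assms by (auto simp: start_def chat_chains_eq_chl)
qed

lemma antichain_min: "antichain r (min_elems r)"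
  by (auto simp: antichain_def min_elems_def)

lemma antichain_max: "antichain r (max_elems r)"
  by (auto simp: antichain_def max_elems_def)

lemma antichain_singleton: "antichain r {x}"
  by (simp add: antichain_def)

lemma start_down_closed: "\<lbrakk>x \<in> start C r; (y, x) \<in> r\<rbrakk> \<Longrightarrow> y \<in> start C r"
  by (auto simp: start_def min_elems_def Field_def split: if_splits)

lemma convex_start: "convex_in r (start C r)"
  unfolding convex_in_def by (meson start_down_closed)

text \<open>The defining differential inserts entries into basis chains; transposed, its value at
  \<open>z\<close> is a sum over faces of \<open>z\<close>. Insertions never occur after the last
  entry, while \<open>bdry\<close> includes the last face. That face contributes nothing, because
  its end and the end of \<open>z\<close> would be comparable elements of the antichain
  \<open>B\<close>.\<close>

lemma codiff_eq:
  fixes c :: "'p list \<Rightarrow> 'k::comm_ring_1"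
  assumes r: "finite_poset r" and A: "\<And>x y. \<lbrakk>x \<in> A; (y, x) \<in> r\<rbrakk> \<Longrightarrow> y \<in> A" and B: "antichain r B"
    and c: "supp c \<subseteq> chl r A B (Suc n)"
  shows "codiff r c z = (if z \<in> chl r A B (Suc (Suc n)) then bdry c z else 0)"
proof -
  let ?Z = "z \<in> chl r A B (Suc (Suc n))"
  have fin: "finite (supp c)" using c chl_finite[OF r] finite_subset by blast
  \<comment> \<open>Inserting \<open>y\<close> before position \<open>i\<close> of \<open>b\<close>
    produces \<open>z\<close> exactly if \<open>b\<close> is the \<open>i\<close>-th face of
    \<open>z\<close> and \<open>y\<close> is the deleted entry. Hence each inner sum has at most one
    nonzero term.\<close>
  have dc: "d_chain r b z = (\<Sum>i<Suc n. (-1) ^ i * of_bool (?Z \<and> b = del i z) :: 'k)"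
      if b: "b \<in> supp c" for b
  proof -
    have bc: "b \<in> chl r A B (Suc n)" using b c by auto
    have wb: "wchain r b" "distinct b" "length b = Suc n" "b ! 0 \<in> A" "b ! n \<in> B"
      using bc chl_nth[OF bc] by (auto simp: chl_def)
    have "(\<Sum>y | (y, b ! i) \<in> r \<and> y \<noteq> b ! i \<and> (0 < i \<longrightarrow> (b ! (i - 1), y) \<in> r \<and> b ! (i - 1) \<noteq> y).
       (-1) ^ i * delta (take i b @ y # drop i b) z) = ((-1) ^ i * of_bool (?Z \<and> b
           = del i z) :: 'k)"
      (is "(\<Sum>y\<in>?Y. _) = _") if i: "i < Suc n" for i
    proof -
      have finY: "finite ?Y" by (rule finite_subset[OF _ finite_poset_finite[OF r]]) (auto simp:
          Field_def)
      have ins: "?Z \<and> b = del i z \<and> y = z ! i" if y: "y \<in> ?Y"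
          and zy: "z = take i b @ y # drop i b" for y
      proof (intro conjI)
        have lenz: "length z = Suc (Suc n)" using zy wb(3) i by simp
        have zn: "z ! j = (if j < i then b ! j else if j = i then y else b ! (j - 1))"
            if "j < Suc (Suc n)" for j
          using that i wb(3) by (auto simp: zy nth_append min_def nth_Cons' )
        show del: "b = del i z" using zy i wb(3) by (simp add: del_def min_def)
        show "y = z ! i" using zn[of i] i by simp
        have lt: "(z ! j, z ! k) \<in> r \<and> z ! j \<noteq> z ! k" if jk: "j < k" "k < Suc (Suc n)" for j k
        proof -
          have b_lt: "(b ! j, b ! k) \<in> r \<and> b ! j \<noteq> b ! k" if "j < k" "k < Suc n" for j k
            using that wb wchain_nth_mono[OF r wb(1), of j k] nth_eq_iff_index_eq[OF wb(2), of j
                k] by simp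
          have le_trans: "(u, w) \<in> r \<and> u \<noteq> w" if "(u, v) \<in> r \<and> u \<noteq> v" "(v, w) \<in> r" for u v w
            using that finite_poset_trans[OF r, of u v w] finite_poset_antisym[OF r, of u v] by auto
          have le_trans': "(u, w) \<in> r \<and> u \<noteq> w" if "(u, v) \<in> r" "(v, w) \<in> r \<and> v \<noteq> w" for u v w
            using that finite_poset_trans[OF r, of u v w] finite_poset_antisym[OF r, of v w] by auto
          have b_le: "(b ! j, b ! k) \<in> r" if "j \<le> k" "k < Suc n" for j k
            using that wb by (intro wchain_nth_mono[OF r wb(1)]) auto
          consider "k < i" | "i < j" | "j < i" "i < k" | "j = i" "i < k" | "j < i" "k = i"
            using jk by linarith
          then show ?thesis
          proof cases
            case 4
            then have "(y, b ! i) \<in> r \<and> y \<noteq> b ! i" "(b ! i, b ! (k - 1)) \<in> r"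
              using y jk by (auto intro!: b_le)
            from le_trans[OF this] show ?thesis using 4 jk i by (simp add: zn)
          next
            case 5
            then have "(b ! j, b ! (i - 1)) \<in> r" "(b ! (i - 1), y) \<in> r \<and> b ! (i - 1) \<noteq> y"
              using y jk i by (auto intro!: b_le)
            from le_trans'[OF this] show ?thesis using 5 jk i by (simp add: zn)
          qed (use jk i b_lt in \<open>auto simp: zn\<close>)
        qed
        have "set z \<subseteq> Field r" using y wb(1)
          by (auto simp: zy wchain_def Field_def dest!: in_set_takeD in_set_dropD)
        moreover have "distinct z" unfolding distinct_conv_nth using lt lenz
          by (metis linorder_neqE_nat)
        moreover have "z ! 0 \<in> A" using y A[OF wb(4), of y] i wb(4)
          by (cases "i = 0") (auto simp: zn)
        moreover have "z ! Suc n \<in> B" using i wb(5) by (auto simp: zn)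
        moreover have z0: "z \<noteq> []" using lenz by auto
        moreover have "hd z = z ! 0" "last z = z ! Suc n"
          using lenz by (simp_all add: hd_conv_nth[OF z0] last_conv_nth[OF z0])
        moreover have "sorted_wrt (\<lambda>x y. (x, y) \<in> r) z" using lt lenz
          by (simp add: sorted_wrt_iff_nth_less)
        ultimately show ?Z using lenz by (simp add: chl_def wchain_def)
      qed
      have bk: "z ! i \<in> ?Y \<and> z = take i b @ z ! i # drop i b" if ?Z "b = del i z"
      proof -
        have wz: "wchain r z" "distinct z" "length z = Suc (Suc n)" using \<open>?Z\<close>
          by (auto simp: chl_def)
        have zlt: "(z ! j, z ! k) \<in> r \<and> z ! j \<noteq> z ! k" if "j < k" "k < Suc (Suc n)" for j k
          using that wz wchain_nth_mono[OF r wz(1), of j k] nth_eq_iff_index_eq[OF wz(2), of j k]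
          by simp
        have "take i b = take i z" "drop i b = drop (Suc i) z"
          unfolding \<open>b = del i z\<close> using i wz(3) by (simp_all add: take_del_le drop_del_ge)
        moreover have "z = take i z @ z ! i # drop (Suc i) z" using i wz(3)
          by (intro id_take_nth_drop) simp
        ultimately have "z = take i b @ z ! i # drop i b" by metis
        moreover have "z ! i \<in> ?Y" unfolding \<open>b = del i z\<close>
          using i wz(3) zlt[of i "Suc i"] zlt[of "i - 1" i]
          by (auto simp: nth_del)
        ultimately show ?thesis by simp
      qed
      have "(\<Sum>y\<in>?Y. (-1) ^ i * delta (take i b @ y # drop i b) z) =
        (\<Sum>y\<in>?Y. if y = z ! i then (-1) ^ i * of_bool (?Z \<and> b = del i z) else 0 :: 'k)"
      proof (intro sum.cong refl)
        fix y assume y: "y \<in> ?Y"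
        show "(-1) ^ i * delta (take i b @ y # drop i b) z =
          (if y = z ! i then (-1) ^ i * of_bool (?Z \<and> b = del i z) else 0 :: 'k)"
        proof (cases "z = take i b @ y # drop i b")
          case True
          have "?Z" "b = del i z" "y = z ! i" using ins[OF y True] by blast+
          moreover have "delta (take i b @ y # drop i b) z = (1 :: 'k)" using True
            by (simp add: delta_def)
          ultimately show ?thesis by simp
        next
          case False
          then have "\<not> (y = z ! i \<and> ?Z \<and> b = del i z)"
            using bk by blast
          moreover have "delta (take i b @ y # drop i b) z = (0 :: 'k)" using False
            by (simp add: delta_def)
          ultimately show ?thesis by auto
        qed
      qed
      also have "\<dots> = (-1) ^ i * of_bool (?Z \<and> b = del i z)"
        using bk finY by (subst sum.delta) auto
      finally show ?thesis .
    qed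
    then show ?thesis unfolding d_chain_def wb(3) by (intro sum.cong refl) (simp only: lessThan_iff)
  qed
  have "codiff r c z = (\<Sum>b\<in>supp c. c b * (\<Sum>i<Suc n. (-1) ^ i * of_bool (?Z \<and> b = del i z)))"
    unfolding codiff_def free_ext_def supp_def[symmetric] by (intro sum.cong) (simp_all add: dc)
  also have "\<dots> = (\<Sum>i<Suc n. (-1) ^ i * (\<Sum>b\<in>supp c. c b * of_bool (?Z \<and> b = del i z)))"
    unfolding sum_distrib_left by (subst sum.swap) (simp only: mult.left_commute)
  also have "\<dots> = (\<Sum>i<Suc n. (-1) ^ i * (if ?Z then c (del i z) else 0))"
  proof (intro sum.cong arg_cong2[where f = "(*)"] refl)
    fix i
    have "(\<Sum>b\<in>supp c. c b * of_bool (?Z \<and> b = del i z)) = (\<Sum>b\<in>supp c. if b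
        = del i z then (if ?Z then c (del i z) else 0) else 0)"
      by (intro sum.cong) auto
    also have "\<dots> = (if ?Z then c (del i z) else 0)" using fin by (auto simp: supp_def)
    finally show "(\<Sum>b\<in>supp c. c b * of_bool (?Z \<and> b = del i z)) = (if ?Z then c (del i z) else 0)" .
  qed
  also have "\<dots> = (if ?Z then bdry c z else 0)"
  proof (cases ?Z)
    case True
    \<comment> \<open>The last face, which has no counterpart among the insertions.\<close>
    have "c (del (Suc n) z) = 0"
    proof (rule ccontr)
      assume "c (del (Suc n) z) \<noteq> 0"
      then have "del (Suc n) z \<in> chl r A B (Suc n)" using c by (auto simp: supp_def)
      from chl_nth(3)[OF this] have "z ! n \<in> B" using chl_nth(1)[OF True] by (simp add: nth_del)
      moreover have "(z ! n, z ! Suc n) \<in> r" "z ! n \<noteq> z ! Suc n"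
        using True chl_nth(1)[OF True] wchain_nth_mono[OF r, of z n "Suc n"]
            nth_eq_iff_index_eq[of z n "Suc n"]
        by (auto simp: chl_def)
      ultimately show False using B chl_nth(3)[OF True] by (auto simp: antichain_def)
    qed
    then show ?thesis using True chl_nth(1)[OF True] by (simp add: bdry_def)
  qed simp
  finally show ?thesis .
qed

lemma carrier_free_mod_chl:
  assumes "finite_poset r"
  shows "carrier (free_mod (chl r A B n) :: ('k::comm_ring_1, _) module) = {c. supp c
      \<subseteq> chl r A B n}"
  using finite_subset[OF _ chl_finite[OF assms, of A B n]] by (auto simp: free_mod_def supp_def)

context
  fixes r :: "'p rel" and C :: "'p rel \<Rightarrow> nat \<Rightarrow> 'p list set"
  assumes r: "finite_poset r" and C: "C \<in> {chat_chains, c_chains}"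
begin

lemma cocycles_eq_Zc: "(cocycles C r n :: ('p list \<Rightarrow> 'k::comm_ring_1) set)
    = Zc r (start C r) (max_elems r) n"
proof -
  have "codiff r c z = (if z \<in> chl r (start C r) (max_elems r) (Suc (Suc n)) then bdry c z else 0)"
    if "supp c \<subseteq> chl r (start C r) (max_elems r) (Suc n)" for c :: "'p list \<Rightarrow> 'k" and z
    by (rule codiff_eq[OF r start_down_closed antichain_max that])
  then have "codiff r c = (\<lambda>_. 0) \<longleftrightarrow> (\<forall>z\<in>chl r (start C r) (max_elems r) (Suc (Suc n)). bdry c z
      = 0)"
    if "supp c \<subseteq> chl r (start C r) (max_elems r) (Suc n)" for c :: "'p list \<Rightarrow> 'k"
    using that by (auto simp: fun_eq_iff)
  then show ?thesis
    by (auto simp: cocycles_def chains_eq_chl[OF C] carrier_free_mod_chl[OF r] Zc_def)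
qed

lemma coboundaries_eq_Bc: "(coboundaries C r n :: ('p list \<Rightarrow> 'k::comm_ring_1) set)
    = Bc r (start C r) (max_elems r) n"
proof (cases n)
  case 0
  have "Bc r (start C r) (max_elems r) 0 = {\<lambda>_. 0 :: 'k}"
  proof -
    have "b = (\<lambda>_. 0)" if "b \<in> Bc r (start C r) (max_elems r) 0" for b :: "'p list \<Rightarrow> 'k"
    proof -
      from that obtain e where e: "supp e \<subseteq> {}" "\<And>z. z \<in> chl r (start C r) (max_elems r) (Suc 0)
          \<Longrightarrow> bdry e z = b z"
        "supp b \<subseteq> chl r (start C r) (max_elems r) (Suc 0)" by (auto simp: Bc_def)
      then have "e = (\<lambda>_. 0)" by (auto simp: supp_def)
      then have "b z = 0" for z using e(2)[of z] e(3)
        by (cases "b z = 0") (auto simp: supp_def bdry_zero)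
      then show ?thesis by auto
    qed
    then show ?thesis using fun_subspace_zero[OF fun_subspace_Bc] by blast
  qed
  then show ?thesis using 0 by (simp add: coboundaries_def)
next
  case (Suc m)
  have cd: "codiff r e = (\<lambda>z. if z \<in> chl r (start C r) (max_elems r) (Suc (Suc m)) then bdry e z
      else 0)"
    if "supp e \<subseteq> chl r (start C r) (max_elems r) (Suc m)" for e :: "'p list \<Rightarrow> 'k"
    by (intro ext codiff_eq[OF r start_down_closed antichain_max that])
  show ?thesis
  proof (intro Set.set_eqI iffI)
    fix b :: "'p list \<Rightarrow> 'k" assume "b \<in> coboundaries C r n"
    then obtain e where "supp e \<subseteq> chl r (start C r) (max_elems r) (Suc m)" "b = codiff r e"
      using Suc by (auto simp: coboundaries_def chains_eq_chl[OF C] carrier_free_mod_chl[OF r])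
    then show "b \<in> Bc r (start C r) (max_elems r) n"
      using Suc by (auto simp: Bc_def cd supp_def split: if_splits)
  next
    fix b :: "'p list \<Rightarrow> 'k" assume "b \<in> Bc r (start C r) (max_elems r) n"
    then obtain e where e: "supp e \<subseteq> chl r (start C r) (max_elems r) (Suc m)"
      "\<And>z. z \<in> chl r (start C r) (max_elems r) (Suc (Suc m)) \<Longrightarrow> bdry e z = b z"
      "supp b \<subseteq> chl r (start C r) (max_elems r) (Suc (Suc m))" using Suc by (auto simp: Bc_def)
    then have "b = codiff r e" by (auto simp: cd fun_eq_iff supp_def)
    then show "b \<in> coboundaries C r n"
      using Suc e by (auto simp: coboundaries_def chains_eq_chl[OF C] carrier_free_mod_chl[OF r])
  qed
qed

lemma coh_eq_fun_quot:
  "(coh C r n :: ('k::comm_ring_1, _) module)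
      = fun_quot (Zc r (start C r) (max_elems r) n) (Bc r (start C r) (max_elems r) n)"
  by (simp add: coh_def free_mod_carrier_update cocycles_eq_Zc coboundaries_eq_Bc)

lemma coh_class_eq_fcoset: "coh_class C r n c
    = fcoset (Bc r (start C r) (max_elems r) n) (c :: 'p list \<Rightarrow> 'k::comm_ring_1)"
  by (simp add: coh_class_def a_r_coset_free_mod coboundaries_eq_Bc)

lemma Bc_subset_Zc_start: "Bc r (start C r) (max_elems r) n
    \<subseteq> (Zc r (start C r) (max_elems r) n :: ('p list \<Rightarrow> 'k::comm_ring_1) set)"
  by (rule Bc_subset_Zc[OF r convex_start antichain_convex[OF r antichain_max]])

end

lemma fcoset_subset:
  assumes "fun_subspace V" "W \<subseteq> V" "c \<in> V" "x \<in> fcoset W c" shows "x \<in> V"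
  using fun_subspace_add[OF assms(1) _ assms(3), of "\<lambda>b. x b - c b"] assms
  by (auto simp: mem_fcoset)

subsection \<open>Induced maps on cohomology\<close>

lemma pl_diff: "pl r A B l f (\<lambda>z. c z - c' z) = (\<lambda>z. pl r A B l f c z - pl r A B l f c' z)"
  by (auto simp: pl_def)

lemma cup_diff_left: "cup m (\<lambda>z. a z - a' z) b = (\<lambda>z. cup m a b z - cup m a' b z)"
  by (rule ext) (simp add: cup_def left_diff_distrib)

lemma cup_diff_right: "cup m a (\<lambda>z. b z - b' z) = (\<lambda>z. cup m a b z - cup m a b' z)"
  by (rule ext) (simp add: cup_def right_diff_distrib)

text \<open>\<open>pull\<close> sums over the chains of \<open>chat_chains\<close> whatever the
  complex. Those that contribute have an image in the support of \<open>c\<close>, and this forces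
  their first entry into \<open>A\<close>.\<close>

lemma pull_eq_pl:
  fixes c :: "'q list \<Rightarrow> 'k::comm_ring_1"
  assumes r: "finite_poset r" and r': "finite_poset r'" and c: "supp c \<subseteq> chl r' A' B' (Suc n)"
    and A: "\<And>x. x \<in> Field r \<Longrightarrow> f x \<in> A' \<Longrightarrow> x \<in> A" and AF: "A \<subseteq> Field r"
  shows "pull r n f c = pl r A (max_elems r) (Suc n) f c"
proof
  fix z
  have fin: "finite (supp c)" using c chl_finite[OF r'] finite_subset by blast
  have fc: "finite (chat_chains r n)" unfolding chat_chains_eq_chl by (rule chl_finite[OF r])
  have "pull r n f c z = (\<Sum>ys\<in>supp c. c ys * (\<Sum>xs | xs \<in> chat_chains r n \<and> map f xs
      = ys. delta xs z))"
    by (simp add: pull_def free_ext_def supp_def)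
  also have "\<dots> = (\<Sum>ys\<in>supp c. if ys = map f z then (if z
      \<in> chat_chains r n then c (map f z) else 0) else 0)"
  proof (intro sum.cong refl)
    fix ys
    have "(\<Sum>xs | xs \<in> chat_chains r n \<and> map f xs = ys. delta xs z) =
      (of_bool (z \<in> chat_chains r n \<and> map f z = ys) :: 'k)"
      using fc by (auto simp: delta_def)
    then show "c ys * (\<Sum>xs | xs \<in> chat_chains r n \<and> map f xs = ys. delta xs z) =
      (if ys = map f z then (if z \<in> chat_chains r n then c (map f z) else 0) else 0)" by auto
  qed
  also have "\<dots> = (if z \<in> chat_chains r n then c (map f z) else 0)"
    using fin by (auto simp: supp_def)
  also have "\<dots> = pl r A (max_elems r) (Suc n) f c z"
  proof (cases "c (map f z) = 0")
    case False
    then have *: "map f z \<in> chl r' A' B' (Suc n)" using c by (auto simp: supp_def)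
    have "z \<in> chl r A (max_elems r) (Suc n)" if z: "z \<in> chl r (Field r) (max_elems r) (Suc n)"
    proof -
      have w: "wchain r z" "z \<noteq> []" using z by (auto simp: chl_def wchain_def)
      have "f (hd z) \<in> A'" using * w by (auto simp: chl_def hd_map)
      then show ?thesis using A wchain_ends(1)[OF w(1)] z by (auto simp: chl_def)
    qed
    moreover have "z \<in> chl r (Field r) (max_elems r) (Suc n)" if "z \<in> chl r A (max_elems r) (Suc n)"
      using that AF by (auto simp: chl_def)
    ultimately show ?thesis unfolding chat_chains_eq_chl pl_def by auto
  qed (simp add: pl_def)
  finally show "pull r n f c z = pl r A (max_elems r) (Suc n) f c z" .
qed

lemma start_Field: "start C r \<subseteq> Field r"
  by (auto simp: start_def min_elems_def)

lemma pull_coh_class: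
  fixes c :: "'q list \<Rightarrow> 'k::comm_ring_1"
  assumes r: "finite_poset r" and r': "finite_poset r'" and C: "C \<in> {chat_chains, c_chains}"
    and f: "\<And>x y. (x, y) \<in> r \<Longrightarrow> (f x, f y) \<in> r'"
    and A: "\<And>x. x \<in> Field r \<Longrightarrow> f x \<in> A' \<longleftrightarrow> x \<in> start C r"
    and B: "\<And>x. x \<in> Field r \<Longrightarrow> f x \<in> B' \<longleftrightarrow> x \<in> max_elems r"
    and conv: "convex_in r' A'" "convex_in r' B'" and c: "c \<in> Zc r' A' B' n"
  shows "pull_coh C r n f (fcoset (Bc r' A' B' n) c) =
    fcoset (Bc r (start C r) (max_elems r) n) (pl r (start C r) (max_elems r) (Suc n) f c)"
  unfolding pull_coh_def
proof (rule the_elem_image_const)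
  let ?A = "start C r" and ?B = "max_elems r"
  show "fcoset (Bc r' A' B' n) c \<noteq> {}" using self_mem_fcoset[OF fun_subspace_Bc] by blast
  fix x assume x: "x \<in> fcoset (Bc r' A' B' n) c"
  have xZ: "x \<in> Zc r' A' B' n"
    by (rule fcoset_subset[OF fun_subspace_Zc Bc_subset_Zc[OF r' conv] c x])
  have "pull r n f x = pl r ?A ?B (Suc n) f x"
    by (rule pull_eq_pl[OF r r', of _ A' B']) (use xZ A in \<open>auto simp: Zc_def start_Field\<close>)
  moreover have "pl r ?A ?B (Suc n) f (\<lambda>z. x z - c z) \<in> Bc r ?A ?B n"
  proof (rule pl_Bc[OF r r' f])
    show "(\<lambda>z. x z - c z) \<in> Bc r' A' B' n" using x by (simp add: mem_fcoset)
  qed (use A B in \<open>auto intro: FieldI2\<close>)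
  ultimately show "coh_class C r n (pull r n f x) = fcoset (Bc r ?A ?B n) (pl r ?A ?B (Suc n) f c)"
    by (simp add: coh_class_eq_fcoset[OF r C] fcoset_eq_iff[OF fun_subspace_Bc] pl_diff)
qed

text \<open>At \<open>z\<close> at most one pair \<open>(u, v)\<close> contributes, the front and
  the back part of \<open>z\<close>; both contain the common entry \<open>x\<close>, which is why
  the back part starts at index \<open>m\<close>.\<close>

lemma concat_chain_eq_cup:
  fixes a b :: "'p list \<Rightarrow> 'k::comm_ring_1"
  assumes r: "finite_poset r" and a: "supp a \<subseteq> chl r A {x} (Suc m)"
      and b: "supp b \<subseteq> chl r {x} B (Suc n)"
  shows "concat_chain a b = cup m a b"
proof
  fix z
  have fin: "finite (supp a)" "finite (supp b)" using a b chl_finite[OF r] finite_subset by blast+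
  have "concat_chain a b z = (\<Sum>u\<in>supp a. \<Sum>v\<in>supp b. a u * b v * delta (u @ tl v) z)"
    by (simp add: concat_chain_def supp_def)
  also have "\<dots> = (\<Sum>u\<in>supp a. \<Sum>v\<in>supp b. if v = drop m z then (if u
      = take (Suc m) z then a u * b v else 0) else 0)"
  proof (intro sum.cong refl)
    fix u v assume uv: "u \<in> supp a" "v \<in> supp b"
    have u: "length u = Suc m" "last u = x" "u \<noteq> []" using uv a by (auto simp: chl_def wchain_def)
    have v: "length v = Suc n" "hd v = x" "v \<noteq> []" using uv b by (auto simp: chl_def wchain_def)
    have "z = u @ tl v \<longleftrightarrow> u = take (Suc m) z \<and> v = drop m z"
    proof
      assume z: "z = u @ tl v"
      have "drop m u = [x]" using u by (metis append_butlast_last_id append_eq_conv_conj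
          diff_Suc_1 length_butlast)
      then have "drop m z = x # tl v" using z u by simp
      then show "u = take (Suc m) z \<and> v = drop m z" using z u v
        by (metis append_eq_conv_conj list.collapse)
    next
      assume "u = take (Suc m) z \<and> v = drop m z"
      then show "z = u @ tl v" by (metis append_take_drop_id drop_Suc tl_drop)
    qed
    then show "a u * b v * delta (u @ tl v) z = (if v = drop m z then (if u
        = take (Suc m) z then a u * b v else 0) else 0)"
      by (auto simp: delta_def)
  qed
  also have "\<dots> = cup m a b z"
    using fin by (cases "b (drop m z) = 0") (auto simp: cup_def supp_def)
  finally show "concat_chain a b z = cup m a b z" .
qed

lemma convex_singleton: "finite_poset r \<Longrightarrow> convex_in r {x}"
  by (intro antichain_convex antichain_singleton)

lemma mu_coh_class:
  fixes a b :: "'p list \<Rightarrow> 'k::comm_ring_1"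
  assumes r: "finite_poset r" and C: "C \<in> {chat_chains, c_chains}"
    and a: "a \<in> Zc r (start C r) {x} m" and b: "b \<in> Zc r {x} (max_elems r) n"
  shows "mu_coh C r (m + n) (fcoset (Bc r (start C r) {x} m) a) (fcoset (Bc r {x} (max_elems r) n)
      b) =
    fcoset (Bc r (start C r) (max_elems r) (m + n)) (cup m a b)"
  unfolding mu_coh_def
proof (rule the_elem_Collect2_const)
  show "\<exists>a' b'. a' \<in> fcoset (Bc r (start C r) {x} m) a \<and> b' \<in> fcoset (Bc r {x} (max_elems r) n) b"
    using self_mem_fcoset[OF fun_subspace_Bc] by blast
  fix a' b' assume *: "a' \<in> fcoset (Bc r (start C r) {x} m) a \<and> b'
      \<in> fcoset (Bc r {x} (max_elems r) n) b"
  have a': "a' \<in> Zc r (start C r) {x} m" and b': "b' \<in> Zc r {x} (max_elems r) n"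
    using fcoset_subset[OF fun_subspace_Zc Bc_subset_Zc[OF r convex_start convex_singleton[OF r]] a]
      fcoset_subset[OF fun_subspace_Zc Bc_subset_Zc[OF r convex_singleton[OF r]
          antichain_convex[OF r antichain_max]] b]
      * by auto
  have "concat_chain a' b' = cup m a' b'"
    by (rule concat_chain_eq_cup[OF r]) (use a' b' in \<open>auto simp: Zc_def\<close>)
  \<comment> \<open>The representatives are exchanged one at a time, passing through
    \<open>cup m a b'\<close>.\<close>
  moreover have "(\<lambda>z. cup m a' b' z - cup m a b z) \<in> Bc r (start C r) (max_elems r) (m + n)"
  proof -
    have "cup m (\<lambda>z. a' z - a z) b' \<in> Bc r (start C r) (max_elems r) (m + n)"
      using * b' by (intro cup_Bc_left[OF r]) (auto simp: mem_fcoset)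
    moreover have "cup m a (\<lambda>z. b' z - b z) \<in> Bc r (start C r) (max_elems r) (m + n)"
      using * a by (intro cup_Bc_right[OF r]) (auto simp: mem_fcoset)
    ultimately show ?thesis
      using fun_subspace_add[OF fun_subspace_Bc] by (fastforce simp: cup_diff_left cup_diff_right)
  qed
  ultimately show "coh_class C r (m + n) (concat_chain a' b')
      = fcoset (Bc r (start C r) (max_elems r) (m + n)) (cup m a b)"
    by (simp add: coh_class_eq_fcoset[OF r C] fcoset_eq_iff[OF fun_subspace_Bc])
qed

subsection \<open>Lower and upper intervals\<close>

lemma Field_down: "\<lbrakk>finite_poset r; x \<in> Field r\<rbrakk> \<Longrightarrow> Field (down r x) = {y. (y, x) \<in> r}"
  by (auto simp: down_def under_def Field_def dest: finite_poset_refl[unfolded Field_def])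

lemma Field_up: "\<lbrakk>finite_poset r; x \<in> Field r\<rbrakk> \<Longrightarrow> Field (up r x) = {y. (x, y) \<in> r}"
  by (auto simp: up_def above_def Field_def dest: finite_poset_refl[unfolded Field_def])

lemma finite_poset_Restr:
  assumes r: "finite_poset r" shows "finite_poset (r \<inter> (X \<times> X))"
proof -
  have "(x, x) \<in> r \<inter> (X \<times> X)" if "x \<in> Field (r \<inter> (X \<times> X))" for x
    using that finite_poset_refl[OF r, of x] by (auto simp: Field_def)
  then show ?thesis using r unfolding finite_poset_def partial_order_on_def preorder_on_def
    by (auto simp: refl_on_def trans_def antisym_def Field_def)
qed

lemma finite_poset_down: "finite_poset r \<Longrightarrow> finite_poset (down r x)"
  and finite_poset_up: "finite_poset r \<Longrightarrow> finite_poset (up r x)"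
  by (simp_all add: down_def up_def finite_poset_Restr)

lemma max_down:
  assumes r: "finite_poset r" and x: "x \<in> Field r" shows "max_elems (down r x) = {x}"
  using finite_poset_refl[OF r x] finite_poset_antisym[OF r]
  by (auto simp: max_elems_def Field_down[OF r x]) (auto simp: down_def under_def)

lemma min_up:
  assumes r: "finite_poset r" and x: "x \<in> Field r" shows "min_elems (up r x) = {x}"
  using finite_poset_refl[OF r x] finite_poset_antisym[OF r]
  by (auto simp: min_elems_def Field_up[OF r x]) (auto simp: up_def above_def)

lemma min_down:
  assumes r: "finite_poset r" and x: "x \<in> Field r" shows "min_elems (down r x)
      = min_elems r \<inter> {y. (y, x) \<in> r}"
  using finite_poset_trans[OF r]
  by (auto simp: min_elems_def Field_down[OF r x]) (auto simp: down_def under_def Field_def)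

lemma max_up:
  assumes r: "finite_poset r" and x: "x \<in> Field r" shows "max_elems (up r x)
      = max_elems r \<inter> {y. (x, y) \<in> r}"
  using finite_poset_trans[OF r]
  by (auto simp: max_elems_def Field_up[OF r x]) (auto simp: up_def above_def Field_def)

lemma start_down:
  assumes r: "finite_poset r" and x: "x \<in> Field r" shows "start C (down r x)
      = start C r \<inter> {y. (y, x) \<in> r}"
  using min_down[OF assms] Field_down[OF assms] by (auto simp: start_def Field_def)

lemma wchain_Restr: "wchain (r \<inter> (X \<times> X)) z \<longleftrightarrow> wchain r z \<and> set z \<subseteq> X \<and> set z \<subseteq> Field (r \<inter> (X \<times> X))"
proof -
  have "sorted_wrt (\<lambda>x y. (x, y) \<in> r \<inter> (X \<times> X)) z \<longleftrightarrow> sorted_wrt (\<lambda>x y. (x, y) \<in> r) z"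
    if "set z \<subseteq> X" using that by (induction z) auto
  moreover have "set z \<subseteq> X \<and> set z \<subseteq> Field r" if "set z \<subseteq> Field (r \<inter> (X \<times> X))"
    using that by (auto simp: Field_def)
  ultimately show ?thesis by (auto simp: wchain_def)
qed

text \<open>The maximum of the interval is \<open>x\<close> itself. Cochains of the lower interval
  are thus cochains of the whole poset with end region \<open>{x}\<close>, and concatenation at
  \<open>x\<close> becomes a cup product inside one poset.\<close>

lemma chl_down:
  assumes r: "finite_poset r" and x: "x \<in> Field r"
  shows "chl (down r x) (start C (down r x)) (max_elems (down r x)) l = chl r (start C r) {x} l"
proof -
  have *: "set z \<subseteq> under r x \<and> set z \<subseteq> Field (down r x)" if "z \<in> chl r (start C r) {x} l" for z
    using chl_between[OF r that] by (auto simp: Field_down[OF r x] under_def)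
  have "wchain (down r x) z \<longleftrightarrow> wchain r z \<and> set z \<subseteq> under r x \<and> set z \<subseteq> Field (down r x)" for z
    unfolding down_def by (rule wchain_Restr)
  then show ?thesis using * wchain_ends(1)[of "down r x"]
    unfolding max_down[OF r x] start_down[OF r x] chl_def Field_down[OF r x] by blast
qed

lemma chl_up:
  assumes r: "finite_poset r" and x: "x \<in> Field r"
  shows "chl (up r x) (min_elems (up r x)) (max_elems (up r x)) l = chl r {x} (max_elems r) l"
proof -
  have *: "set z \<subseteq> above r x \<and> set z \<subseteq> Field (up r x)" if "z \<in> chl r {x} (max_elems r) l" for z
    using chl_between[OF r that] by (auto simp: Field_up[OF r x] above_def)
  have "wchain (up r x) z \<longleftrightarrow> wchain r z \<and> set z \<subseteq> above r x \<and> set z \<subseteq> Field (up r x)" for z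
    unfolding up_def by (rule wchain_Restr)
  then show ?thesis using * wchain_ends(2)[of "up r x"]
    unfolding max_up[OF r x] min_up[OF r x] chl_def Field_up[OF r x] by blast
qed

lemma Zc_Bc_cong:
  assumes "\<And>l. chl r A B l = chl r' A' B' l"
  shows "Zc r A B n = Zc r' A' B' n" "Bc r A B n = Bc r' A' B' n"
  using assms by (simp_all add: Zc_def Bc_def)

section \<open>Words of cochains in a product\<close>

lemma prod_poset_mono: "\<lbrakk>(f, g) \<in> prod_poset I R; i \<in> I\<rbrakk> \<Longrightarrow> (f i, g i) \<in> R i"
  by (simp add: prod_poset_def)

lemma Field_prod_poset:
  assumes "\<And>i. i \<in> I \<Longrightarrow> finite_poset (R i)"
  shows "Field (prod_poset I R) = (\<Pi>\<^sub>E i\<in>I. Field (R i))"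
proof (intro Set.set_eqI iffI)
  fix f assume "f \<in> (\<Pi>\<^sub>E i\<in>I. Field (R i))"
  then have "(f, f) \<in> prod_poset I R"
    using finite_poset_refl[OF assms] by (auto simp: prod_poset_def PiE_iff)
  then show "f \<in> Field (prod_poset I R)" by (rule FieldI1)
qed (auto simp: Field_def prod_poset_def)

lemma finite_poset_prod:
  assumes I: "finite I" and R: "\<And>i. i \<in> I \<Longrightarrow> finite_poset (R i)"
  shows "finite_poset (prod_poset I R)"
proof -
  have "finite (\<Pi>\<^sub>E i\<in>I. Field (R i))"
    by (rule finite_PiE[OF I]) (simp add: finite_poset_finite R)
  moreover have "prod_poset I R \<subseteq> (\<Pi>\<^sub>E i\<in>I. Field (R i)) \<times> (\<Pi>\<^sub>E i\<in>I. Field (R i))"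
    by (auto simp: prod_poset_def)
  ultimately have "finite (prod_poset I R)" by (metis finite_SigmaI finite_subset)
  moreover have "(f, f) \<in> prod_poset I R" if "f \<in> Field (prod_poset I R)" for f
  proof -
    have "f \<in> (\<Pi>\<^sub>E i\<in>I. Field (R i))" using that Field_prod_poset[of I R] R by simp
    then show ?thesis using finite_poset_refl[OF R] by (auto simp: prod_poset_def PiE_iff)
  qed
  moreover have "trans (prod_poset I R)"
    using finite_poset_trans[OF R] by (intro transI) (simp add: prod_poset_def, blast)
  moreover have "antisym (prod_poset I R)"
  proof (rule antisymI)
    fix f g assume *: "(f, g) \<in> prod_poset I R" "(g, f) \<in> prod_poset I R"
    then have "f i = g i" if "i \<in> I" for i
      using that finite_poset_antisym[OF R] by (simp add: prod_poset_def)
    with * show "f = g" by (auto simp: prod_poset_def intro: PiE_ext)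
  qed
  ultimately show ?thesis
    by (auto simp: finite_poset_def partial_order_on_def preorder_on_def refl_on_def Field_def)
qed

lemma min_prod_poset:
  assumes "\<And>i. i \<in> I \<Longrightarrow> finite_poset (R i)"
  shows "min_elems (prod_poset I R) = (\<Pi>\<^sub>E i\<in>I. min_elems (R i))"
proof (intro Set.set_eqI iffI)
  fix f assume f: "f \<in> min_elems (prod_poset I R)"
  then have F: "f \<in> (\<Pi>\<^sub>E i\<in>I. Field (R i))" and
    m: "\<And>g. (g, f) \<in> prod_poset I R \<Longrightarrow> g = f" by (auto simp: min_elems_def Field_prod_poset[OF
        assms])
  have "y = f i" if "i \<in> I" "(y, f i) \<in> R i" for i y
  proof -
    have "(f(i := y), f) \<in> prod_poset I R"
      using F that finite_poset_refl[OF assms] unfolding prod_poset_def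
      by (auto simp: PiE_iff extensional_def intro: FieldI1)
    from m[OF this] show ?thesis by (metis fun_upd_same)
  qed
  then show "f \<in> (\<Pi>\<^sub>E i\<in>I. min_elems (R i))" using F by (auto simp: PiE_iff min_elems_def)
next
  fix f assume "f \<in> (\<Pi>\<^sub>E i\<in>I. min_elems (R i))"
  then have f: "f \<in> (\<Pi>\<^sub>E i\<in>I. Field (R i))" "\<And>i y. \<lbrakk>i \<in> I; (y, f i) \<in> R i\<rbrakk> \<Longrightarrow> y = f i"
    by (auto simp: min_elems_def PiE_iff)
  have "g = f" if "(g, f) \<in> prod_poset I R" for g
    using that f(2) by (intro PiE_ext[of g I "\<lambda>i. Field (R i)" f]) (auto simp: prod_poset_def)
  with f(1) show "f \<in> min_elems (prod_poset I R)"
    by (simp add: min_elems_def Field_prod_poset[OF assms])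
qed

lemma max_prod_poset:
  assumes "\<And>i. i \<in> I \<Longrightarrow> finite_poset (R i)"
  shows "max_elems (prod_poset I R) = (\<Pi>\<^sub>E i\<in>I. max_elems (R i))"
proof (intro Set.set_eqI iffI)
  fix f assume f: "f \<in> max_elems (prod_poset I R)"
  then have F: "f \<in> (\<Pi>\<^sub>E i\<in>I. Field (R i))" and
    m: "\<And>g. (f, g) \<in> prod_poset I R \<Longrightarrow> g = f" by (auto simp: max_elems_def Field_prod_poset[OF
        assms])
  have "y = f i" if "i \<in> I" "(f i, y) \<in> R i" for i y
  proof -
    have "(f, f(i := y)) \<in> prod_poset I R"
      using F that finite_poset_refl[OF assms] unfolding prod_poset_def
      by (auto simp: PiE_iff extensional_def intro: FieldI2)
    from m[OF this] show ?thesis by (metis fun_upd_same)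
  qed
  then show "f \<in> (\<Pi>\<^sub>E i\<in>I. max_elems (R i))" using F by (auto simp: PiE_iff max_elems_def)
next
  fix f assume "f \<in> (\<Pi>\<^sub>E i\<in>I. max_elems (R i))"
  then have f: "f \<in> (\<Pi>\<^sub>E i\<in>I. Field (R i))" "\<And>i y. \<lbrakk>i \<in> I; (f i, y) \<in> R i\<rbrakk> \<Longrightarrow> y = f i"
    by (auto simp: max_elems_def PiE_iff)
  have "g = f" if "(f, g) \<in> prod_poset I R" for g
    using that f(2) by (intro PiE_ext[of g I "\<lambda>i. Field (R i)" f]) (auto simp: prod_poset_def)
  with f(1) show "f \<in> max_elems (prod_poset I R)"
    by (simp add: max_elems_def Field_prod_poset[OF assms])
qed

text \<open>
  A word is a list of letters \<open>(i, n, c, B)\<close>: the cochain \<open>c\<close> of degree \<open>n\<close> moves the coordinate \<open>i\<close>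
  from its present region, recorded in a state, to the region \<open>B\<close>.
\<close>

type_synonym ('i, 'p, 'k) letter = "'i \<times> nat \<times> ('p list \<Rightarrow> 'k) \<times> 'p set"

fun wcup :: "('i, 'p, 'k::comm_ring_1) letter list \<Rightarrow> ('i \<Rightarrow> 'p) list \<Rightarrow> 'k" where
  "wcup [] z = of_bool (length z = 1)"
| "wcup ((i, n, c, B) # ls) z = c (map (\<lambda>h. h i) (take (Suc n) z)) * wcup ls (drop n z)"

text \<open>Every letter is nonzero on its segment. Over a ring with zero divisors this is weaker
  than \<open>wcup\<close> being nonzero; it is the condition under which a tuple of segments occurs
  in the Kuenneth sum.\<close>

fun wsupp :: "('i, 'p, 'k::comm_ring_1) letter list \<Rightarrow> ('i \<Rightarrow> 'p) list \<Rightarrow> bool" where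
  "wsupp [] z \<longleftrightarrow> length z = 1"
| "wsupp ((i, n, c, B) # ls) z \<longleftrightarrow> c (map (\<lambda>h. h i) (take (Suc n) z)) \<noteq> 0 \<and> wsupp ls (drop n z)"

fun wfin :: "('i \<Rightarrow> 'p set) \<Rightarrow> ('i, 'p, 'k) letter list \<Rightarrow> 'i \<Rightarrow> 'p set" where
  "wfin s [] = s"
| "wfin s ((i, n, c, B) # ls) = wfin (s(i := B)) ls"

fun wdeg :: "('i, 'p, 'k) letter list \<Rightarrow> nat" where
  "wdeg [] = 0"
| "wdeg ((i, n, c, B) # ls) = n + wdeg ls"

lemma wsupp_if_wcup: "wcup ls z \<noteq> 0 \<Longrightarrow> wsupp ls z"
  by (induction ls z rule: wcup.induct) (auto dest: mult_not_zero)

lemma letters_induct [case_names Nil Cons]: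
  assumes "\<And>s. P s []" "\<And>s i n c B ls. P (s(i := B)) ls \<Longrightarrow> P s ((i, n, c, B) # ls)"
  shows "P s ls"
  using assms by (induction ls arbitrary: s) auto

lemma wdeg_append [simp]: "wdeg (u @ v) = wdeg u + wdeg v"
  by (induction u rule: wdeg.induct) auto

lemma wfin_append [simp]: "wfin s (u @ v) = wfin (wfin s u) v"
  by (induction s u rule: letters_induct) (auto simp del: fun_upd_apply)

lemma wcup_append:
  "length z = Suc (wdeg (u @ v)) \<Longrightarrow> wcup (u @ v) z
      = wcup u (take (Suc (wdeg u)) z) * wcup v (drop (wdeg u) z)"
proof (induction u arbitrary: z)
  case (Cons l u)
  obtain i n c B where l: "l = (i, n, c, B)" by (cases l) auto
  have len: "length (drop n z) = Suc (wdeg (u @ v))" using Cons.prems by (simp add: l)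
  show ?case using Cons.IH[OF len]
    by (simp add: l min_def mult.assoc add.commute drop_take)
qed simp

text \<open>Each letter has to be a cocycle from the region reached so far to its target. Antichain
  conditions are imposed on the targets here and on the initial regions by \<open>states\<close>, so
  that every state along the word consists of antichains.\<close>

fun wok :: "('i \<Rightarrow> 'p rel) \<Rightarrow> 'i set \<Rightarrow> ('i \<Rightarrow> 'p set) \<Rightarrow> ('i, 'p, 'k::comm_ring_1) letter list \<Rightarrow> bool"
    where
  "wok R I s [] \<longleftrightarrow> True"
| "wok R I s ((i, n, c, B) # ls) \<longleftrightarrow>
     i \<in> I \<and> antichain (R i) B \<and> c \<in> Zc (R i) (s i) B n \<and> wok R I (s(i := B)) ls"

lemma wok_append: "wok R I s (u @ v) \<longleftrightarrow> wok R I s u \<and> wok R I (wfin s u) v"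
  by (induction s u rule: letters_induct) (auto simp del: fun_upd_apply)

locale product_words =
  fixes I :: "'i set" and R :: "'i \<Rightarrow> 'p rel"
  assumes finI: "finite I" and R: "\<And>i. i \<in> I \<Longrightarrow> finite_poset (R i)"
begin

abbreviation "Q \<equiv> prod_poset I R"

lemma Q: "finite_poset Q"
  by (rule finite_poset_prod[OF finI R])

definition states :: "('i \<Rightarrow> 'p set) \<Rightarrow> bool" where
  "states s \<longleftrightarrow> (\<forall>i\<in>I. antichain (R i) (s i))"

lemma states_upd: "\<lbrakk>states s; i \<in> I \<Longrightarrow> antichain (R i) B\<rbrakk> \<Longrightarrow> states (s(i := B))"
  by (simp add: states_def)

lemma states_wfin: "\<lbrakk>states s; wok R I s ls\<rbrakk> \<Longrightarrow> states (wfin s ls)"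
  by (induction s ls rule: letters_induct) (auto simp: states_upd)

text \<open>Two comparable elements of an antichain are equal, so a coordinate that begins and ends
  in the same antichain region is constant in between.\<close>

lemma Q_squeeze:
  assumes "states s" "l \<in> I" "x l \<in> s l" "y l \<in> s l" "(x, h) \<in> Q" "(h, y) \<in> Q"
  shows "h l \<in> s l" "h l = x l"
proof -
  have a: "antichain (R l) (s l)" and xh: "(x l, h l) \<in> R l" and hy: "(h l, y l) \<in> R l"
    using assms by (auto simp: states_def prod_poset_mono)
  show "h l \<in> s l" by (rule antichain_squeeze[OF R[OF assms(2)] a assms(3,4) xh hy])
  then show "h l = x l" using a xh assms(3) by (metis antichain_def)
qed

definition W :: "('i \<Rightarrow> 'p set) \<Rightarrow> ('i, 'p, 'k::comm_ring_1) letter list \<Rightarrow> ('i \<Rightarrow> 'p) list \<Rightarrow> 'k" where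
  "W s ls z = (if z \<in> chl Q (PiE I s) (PiE I (wfin s ls)) (Suc (wdeg ls)) then wcup ls z else 0)"

lemma Q_extensional: "h \<in> Field Q \<Longrightarrow> h \<in> extensional I"
  by (auto simp: Field_def prod_poset_def PiE_iff)

text \<open>
  A coordinate that is not moved by a letter stays constant, because the regions are antichains.
\<close>

lemma wsupp_visits:
  assumes "wok R I s ls" "wsupp ls z" "z \<noteq> []" "last z \<in> PiE I (wfin s ls)" "l \<in> I"
  shows "\<exists>h\<in>set z. h l \<in> s l"
  using assms
proof (induction s ls arbitrary: z rule: letters_induct)
  case (Nil s)
  then show ?case by (intro bexI[of _ "last z"]) auto
next
  case (Cons s i n c B ls)
  have c: "map (\<lambda>h. h i) (take (Suc n) z) \<in> chl (R i) (s i) B (Suc n)"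
    using Cons.prems by (auto simp: Zc_def supp_def)
  have n: "n < length z" using chl_nth(1)[OF c] by simp
  show ?case
  proof (cases "l = i")
    case True
    have "z ! 0 \<in> set z" using Cons.prems by simp
    moreover have "(z ! 0) l \<in> s l" using chl_nth(2)[OF c] True Cons.prems(3) by simp
    ultimately show ?thesis by blast
  next
    case False
    have "\<exists>h\<in>set (drop n z). h l \<in> (s(i := B)) l"
      using Cons.prems n by (intro Cons.IH) (auto simp del: fun_upd_apply)
    then show ?thesis using False by (auto dest: in_set_dropD)
  qed
qed

text \<open>The cut after the first letter lies in the updated product region. Coordinate
  \<open>i\<close> is there by the support of \<open>c\<close>. Any other coordinate is in its old
  region at the start and, by \<open>wsupp_visits\<close>, at some entry after the cut, hence at the
  cut.\<close>

lemma wsupp_Cons_mid: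
  assumes s: "states s" and ok: "wok R I s ((i, n, c, B) # ls)"
    and z: "z \<in> chl Q (PiE I s) (PiE I (wfin s ((i, n, c, B) # ls))) l"
        and ws: "wsupp ((i, n, c, B) # ls) z"
  shows "z ! n \<in> PiE I (s(i := B))" "n < length z"
proof -
  have c: "map (\<lambda>h. h i) (take (Suc n) z) \<in> chl (R i) (s i) B (Suc n)"
    using ok ws by (auto simp: Zc_def supp_def)
  show n: "n < length z" using chl_nth(1)[OF c] by simp
  have z0: "z \<noteq> []" and w: "wchain Q z" using z by (auto simp: chl_def wchain_def)
  have "(z ! n) l \<in> (s(i := B)) l" if l: "l \<in> I" for l
  proof (cases "l = i")
    case True
    then show ?thesis using chl_nth(3)[OF c] n by simp
  next
    case False
    have "\<exists>h\<in>set (drop n z). h l \<in> (s(i := B)) l"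
      using ok ws z n l by (intro wsupp_visits[of _ ls]) (auto simp: chl_def simp del:
          fun_upd_apply)
    then obtain k where k: "k < length z - n" "(z ! (n + k)) l \<in> s l"
      using False by (auto simp: in_set_conv_nth)
    have "(z ! 0) l \<in> s l" using z z0 l by (auto simp: chl_def hd_conv_nth)
    then show ?thesis
      using Q_squeeze(1)[OF s l, of "z ! 0" "z ! (n + k)" "z ! n"] k n False
        wchain_nth_mono[OF Q w, of 0 n] wchain_nth_mono[OF Q w, of n "n + k"] by simp
  qed
  moreover have "z ! n \<in> extensional I" using w n by (intro Q_extensional) (auto simp: wchain_def)
  ultimately show "z ! n \<in> PiE I (s(i := B))" by (simp add: PiE_iff)
qed

text \<open>Only the ends of the chain are constrained in \<open>W\<close>; that the cut point lies
  in the intermediate region is automatic by \<open>wsupp_Cons_mid\<close>. So a truncated word is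
  an iterated cup product of truncated letters, and the lemmas on cocycles and coboundaries apply
  letter by letter.\<close>

lemma W_Cons:
  assumes s: "states s" and ok: "wok R I s ((i, n, c, B) # ls)"
  shows "W s ((i, n, c, B) # ls) = cup n (W s [(i, n, c, B)]) (W (s(i := B)) ls)"
proof
  fix z
  let ?A = "PiE I s" and ?M = "PiE I (s(i := B))" and ?E = "PiE I (wfin (s(i := B)) ls)"
  have cup: "cup n (W s [(i, n, c, B)]) (W (s(i := B)) ls) z =
    (if take (Suc n) z \<in> chl Q ?A ?M (Suc n) \<and> drop n z
        \<in> chl Q ?M ?E (Suc (wdeg ls)) then wcup ((i, n, c, B) # ls) z else 0)"
    by (auto simp: cup_def W_def chl_def min_def)
  show "W s ((i, n, c, B) # ls) z = cup n (W s [(i, n, c, B)]) (W (s(i := B)) ls) z"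
  proof (cases "wcup ((i, n, c, B) # ls) z = 0")
    case False
    have "z \<in> chl Q ?A ?E (Suc (n + wdeg ls)) \<longleftrightarrow>
      take (Suc n) z \<in> chl Q ?A ?M (Suc n) \<and> drop n z \<in> chl Q ?M ?E (Suc (wdeg ls))"
    proof
      assume z: "z \<in> chl Q ?A ?E (Suc (n + wdeg ls))"
      have "z ! n \<in> ?M" using wsupp_Cons_mid(1)[OF s ok _ wsupp_if_wcup[OF False]] z by simp
      then show "take (Suc n) z \<in> chl Q ?A ?M (Suc n) \<and> drop n z \<in> chl Q ?M ?E (Suc (wdeg ls))"
        using chl_take[OF z, of "Suc n" ?M] chl_drop[OF z, of n ?M] by simp
    qed (auto intro: chl_join(1)[OF Q])
    then show ?thesis unfolding cup by (simp add: W_def)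
  qed (simp add: W_def cup)
qed

lemma letter_between:
  assumes s: "states s" and i: "i \<in> I" and B: "antichain (R i) B"
    and "x \<in> PiE I s" "y \<in> PiE I (s(i := B))" "(x, h) \<in> Q" "(h, y) \<in> Q"
  shows "h i \<in> s i \<longleftrightarrow> h \<in> PiE I s" "h i \<in> B \<longleftrightarrow> h \<in> PiE I (s(i := B))"
    "\<And>l. l \<noteq> i \<Longrightarrow> h l = x l"
proof -
  have *: "h l \<in> s l \<and> h l = x l" if "l \<in> I" "l \<noteq> i" for l
    using Q_squeeze[OF s that(1), of x y h] assms(4-7) that by (auto simp: PiE_iff)
  have h: "h \<in> extensional I" using assms(6) by (intro Q_extensional) (rule FieldI2)
  show "h i \<in> s i \<longleftrightarrow> h \<in> PiE I s" "h i \<in> B \<longleftrightarrow> h \<in> PiE I (s(i := B))"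
    using * h i assms(4) by (auto simp: PiE_iff)
  fix l assume "l \<noteq> i"
  then show "h l = x l" using * h assms(4) by (cases "l \<in> I") (auto simp: PiE_iff extensional_def)
qed

lemma W_single: "W s [(i, n, c, B)] = pl Q (PiE I s) (PiE I (s(i := B))) (Suc n) (\<lambda>h. h i) c"
  by (auto simp: W_def pl_def chl_def)

lemma W_single_Zc:
  assumes "states s" "i \<in> I" "antichain (R i) B" "c \<in> Zc (R i) (s i) B n"
  shows "W s [(i, n, c, B)] \<in> Zc Q (PiE I s) (PiE I (s(i := B))) n"
  unfolding W_single
proof (rule pl_Zc[OF Q R[OF assms(2)] _ _ _ assms(4)])
  show "(x i, y i) \<in> R i" if "(x, y) \<in> Q" for x y using that assms(2) by (rule prod_poset_mono)
qed (rule letter_between[OF assms(1-3)]; assumption)+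

lemma W_single_Bc:
  assumes "states s" "i \<in> I" "antichain (R i) B" "c \<in> Bc (R i) (s i) B n"
  shows "W s [(i, n, c, B)] \<in> Bc Q (PiE I s) (PiE I (s(i := B))) n"
  unfolding W_single
proof (rule pl_Bc[OF Q R[OF assms(2)] _ _ _ assms(4)])
  show "(x i, y i) \<in> R i" if "(x, y) \<in> Q" for x y using that assms(2) by (rule prod_poset_mono)
qed (rule letter_between[OF assms(1-3)]; assumption)+

text \<open>The region \<open>PiE I s\<close> is an antichain of the product and contains no chain
  with two entries, so there is nothing to test.\<close>

lemma W_Nil_Zc:
  assumes s: "states s" shows "W s [] \<in> Zc Q (PiE I s) (PiE I s) 0"
proof -
  have "z \<notin> chl Q (PiE I s) (PiE I s) (Suc (Suc 0))" for z
  proof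
    assume z: "z \<in> chl Q (PiE I s) (PiE I s) (Suc (Suc 0))"
    have zz: "(z ! 0, z ! 1) \<in> Q" "z ! 0 \<noteq> z ! 1"
      using z wchain_nth_mono[OF Q, of z 0 1] nth_eq_iff_index_eq[of z 0 1] by (auto simp: chl_def)
    have P: "z ! 0 \<in> PiE I s" "z ! 1 \<in> PiE I s" using chl_nth[OF z] by auto
    have "(z ! 0) l = (z ! 1) l" if "l \<in> I" for l
      using prod_poset_mono[OF zz(1) that] s P that by (metis PiE_mem antichain_def states_def)
    with P zz(2) show False by (metis PiE_ext)
  qed
  then show ?thesis by (auto simp: Zc_def W_def supp_def)
qed

lemma W_Zc:
  assumes "states s" "wok R I s ls"
  shows "W s ls \<in> Zc Q (PiE I s) (PiE I (wfin s ls)) (wdeg ls)"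
  using assms
proof (induction s ls rule: letters_induct)
  case (Nil s)
  then show ?case using W_Nil_Zc by simp
next
  case (Cons s i n c B ls)
  have l: "i \<in> I" "antichain (R i) B" "c \<in> Zc (R i) (s i) B n" "wok R I (s(i := B)) ls"
    using Cons.prems by auto
  have "W (s(i := B)) ls \<in> Zc Q (PiE I (s(i := B))) (PiE I (wfin (s(i := B)) ls)) (wdeg ls)"
    using Cons.prems(1) l by (intro Cons.IH states_upd)
  then show ?case unfolding W_Cons[OF Cons.prems] wfin.simps wdeg.simps
    by (rule cup_Zc[OF Q W_single_Zc[OF Cons.prems(1) l(1-3)]])
qed

text \<open>Equality of two words up to the scalar \<open>k\<close> and a relative coboundary. The
  final state and the degree are part of the relation, so that it is preserved under letters placed
  in front.\<close>

definition weq :: "('i \<Rightarrow> 'p set) \<Rightarrow> 'k::comm_ring_1 \<Rightarrow> ('i, 'p, 'k) letter list \<Rightarrow> ('i, 'p, 'k)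
    letter list \<Rightarrow> bool" where
  "weq s k ls ls' \<longleftrightarrow> wok R I s ls \<and> wok R I s ls' \<and> wfin s ls = wfin s ls' \<and> wdeg ls = wdeg ls' \<and>
     (\<lambda>z. W s ls z - k * W s ls' z) \<in> Bc Q (PiE I s) (PiE I (wfin s ls)) (wdeg ls)"

lemma weq_refl: "wok R I s ls \<Longrightarrow> weq s 1 ls ls"
  using fun_subspace_zero[OF fun_subspace_Bc] by (simp add: weq_def)

lemma weq_trans:
  assumes "weq s k ls ls'" "weq s k' ls' ls''" shows "weq s (k * k') ls ls''"
proof -
  have "(\<lambda>z. (W s ls z - k * W s ls' z) + k * (W s ls' z - k' * W s ls'' z))
      \<in> Bc Q (PiE I s) (PiE I (wfin s ls)) (wdeg ls)"
    using assms by (intro fun_subspace_add[OF fun_subspace_Bc] fun_subspace_smult[OF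
        fun_subspace_Bc]) (auto simp: weq_def)
  then show ?thesis using assms by (simp add: weq_def algebra_simps)
qed

lemma weq_Cons:
  assumes s: "states s" and l: "i \<in> I" "antichain (R i) B" "c \<in> Zc (R i) (s i) B n"
      and eq: "weq (s(i := B)) k ls ls'"
  shows "weq s k ((i, n, c, B) # ls) ((i, n, c, B) # ls')"
proof -
  have ok: "wok R I s ((i, n, c, B) # ls)" "wok R I s ((i, n, c, B) # ls')" using l eq
    by (auto simp: weq_def)
  have "cup n (W s [(i, n, c, B)]) (\<lambda>z. W (s(i := B)) ls z - k * W (s(i := B)) ls' z)
    \<in> Bc Q (PiE I s) (PiE I (wfin (s(i := B)) ls)) (n + wdeg ls)"
    by (intro cup_Bc_right[OF Q W_single_Zc[OF s l]]) (rule eq[unfolded weq_def, THEN conjunct2,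
        THEN conjunct2, THEN conjunct2, THEN conjunct2])
  moreover have "cup n (W s [(i, n, c, B)]) (\<lambda>z. W (s(i := B)) ls z - k * W (s(i := B)) ls' z) =
    (\<lambda>z. W s ((i, n, c, B) # ls) z - k * W s ((i, n, c, B) # ls') z)"
    unfolding W_Cons[OF s ok(1)] W_Cons[OF s ok(2)] by (rule ext) (simp add: cup_def algebra_simps)
  ultimately show ?thesis using eq ok by (simp add: weq_def)
qed

lemma weq_prefix:
  assumes "states s" "wok R I s u" "weq (wfin s u) k ls ls'"
  shows "weq s k (u @ ls) (u @ ls')"
  using assms
proof (induction s u rule: letters_induct)
  case (Cons s i n c B u)
  have l: "i \<in> I" "antichain (R i) B" "c \<in> Zc (R i) (s i) B n" "wok R I (s(i := B)) u"
    "weq (wfin (s(i := B)) u) k ls ls'"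
    using Cons.prems by auto
  have "weq (s(i := B)) k (u @ ls) (u @ ls')" using Cons.prems(1) l by (intro Cons.IH states_upd)
  then show ?case using weq_Cons[OF Cons.prems(1) l(1-3)] by simp
qed simp

lemma cup_assoc: "cup m a (cup n b c) z = cup (m + n) (cup m a b) c z"
proof -
  have "take (Suc m) (take (Suc (m + n)) z) = take (Suc m) z"
    "drop m (take (Suc (m + n)) z) = take (Suc n) (drop m z)" "drop n (drop m z) = drop (m + n) z"
    by (simp_all add: min_def drop_take add.commute)
  then show ?thesis by (simp only: cup_def mult.assoc)
qed

lemma W_Cons2:
  assumes s: "states s" and ok: "wok R I s ((i, n, c, B) # (i', n', c', B') # ls)"
  shows "W s ((i, n, c, B) # (i', n', c', B') # ls) =
    cup (n + n') (W s [(i, n, c, B), (i', n', c', B')]) (W (s(i := B, i' := B')) ls)"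
proof -
  have s1: "states (s(i := B))" using s ok by (simp add: states_upd)
  have 1: "W s [(i, n, c, B), (i', n', c', B')]
      = cup n (W s [(i, n, c, B)]) (W (s(i := B)) [(i', n', c', B')])"
    by (rule W_Cons[OF s]) (use ok in auto)
  have 2: "W s ((i, n, c, B) # (i', n', c', B') # ls) =
    cup n (W s [(i, n, c, B)]) (cup n' (W (s(i := B)) [(i', n', c', B')]) (W (s(i := B, i' := B'))
        ls))"
    using W_Cons[OF s ok] W_Cons[OF s1, of i' n' c' B' ls] ok by simp
  have "cup n (W s [(i, n, c, B)]) (cup n' (W (s(i := B)) [(i', n', c', B')]) (W (s(i := B, i' :=
      B')) ls)) z =
    cup (n + n') (cup n (W s [(i, n, c, B)]) (W (s(i := B)) [(i', n', c', B')])) (W (s(i := B, i'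
        := B')) ls) z" for z
    by (rule cup_assoc)
  then show ?thesis unfolding 1 2 by blast
qed

text \<open>\<open>swap_Bc\<close> for the projections to the coordinates \<open>i\<close> and
  \<open>i'\<close>; between the two regions all other coordinates are constant, so membership in
  the regions depends on these two alone. In \<open>swap_Bc\<close> the sign stands at the first
  product, hence the multiplication by \<open>(-1) ^ (n * n')\<close>. The remaining word is a cup
  factor on the right.\<close>

lemma weq_swap:
  fixes c c' :: "'p list \<Rightarrow> 'k::comm_ring_1"
  assumes s: "states s" and ok: "wok R I s ((i, n, c, B) # (i', n', c', B') # ls)" and ne: "i \<noteq> i'"
  shows "weq s ((-1) ^ (n * n')) ((i, n, c, B) # (i', n', c', B') # ls) ((i', n', c', B') # (i, n,
      c, B) # ls)"
proof -
  let ?l = "(i, n, c, B)" and ?l' = "(i', n', c', B')"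
  let ?s = "s(i := B, i' := B')"
  have l: "i \<in> I" "antichain (R i) B" "c \<in> Zc (R i) (s i) B n" "i' \<in> I" "antichain (R i') B'" "c'
      \<in> Zc (R i') (s i') B' n'"
    and okls: "wok R I ?s ls" using ok ne by auto
  have comm: "s(i' := B', i := B) = ?s" using ne by (simp add: fun_upd_twist)
  have ok': "wok R I s (?l' # ?l # ls)" using l okls ne by (simp add: comm)
  let ?A = "PiE I s" and ?C = "PiE I ?s"
  have R1: "(\<lambda>z. if z \<in> chl Q ?A ?C (Suc (n + n')) then
      (-1) ^ (n * n') * (c (map (\<lambda>h. h i) (take (Suc n) z)) * c' (map (\<lambda>h. h i') (drop n z)))
        - c' (map (\<lambda>h. h i') (take (Suc n') z)) * c (map (\<lambda>h. h i) (drop n' z)) else 0)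
            \<in> Bc Q ?A ?C (n + n')"
  proof (rule swap_Bc[OF Q R[OF l(1)] R[OF l(4)] _ _ l(3) l(6)])
    show "antichain (R i') (s i')" using s l(4) by (simp add: states_def)
    fix x y h assume xy: "x \<in> ?A" "y \<in> ?C" "(x, h) \<in> Q" "(h, y) \<in> Q"
    have other: "h k \<in> s k" if "k \<in> I" "k \<noteq> i" "k \<noteq> i'" for k
      using Q_squeeze(1)[OF s that(1), of x y h] xy that by (auto simp: PiE_iff)
    have h: "h \<in> extensional I" using xy(3) by (intro Q_extensional) (rule FieldI2)
    show "h \<in> ?A \<longleftrightarrow> h i \<in> s i \<and> h i' \<in> s i'" using other h l by (auto simp: PiE_iff)
    show "h \<in> ?C \<longleftrightarrow> h i \<in> B \<and> h i' \<in> B'" using other h l ne by (auto simp: PiE_iff)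
  qed (use l in \<open>auto simp: prod_poset_mono\<close>)
  have "(\<lambda>z. W s [?l, ?l'] z - (-1) ^ (n * n') * W s [?l', ?l] z) \<in> Bc Q ?A ?C (n + n')"
  proof -
    have "(\<lambda>z. (-1) ^ (n * n') * (if z \<in> chl Q ?A ?C (Suc (n + n')) then
      (-1) ^ (n * n') * (c (map (\<lambda>h. h i) (take (Suc n) z)) * c' (map (\<lambda>h. h i') (drop n z)))
        - c' (map (\<lambda>h. h i') (take (Suc n') z)) * c (map (\<lambda>h. h i) (drop n' z)) else 0))
      = (\<lambda>z. W s [?l, ?l'] z - (-1) ^ (n * n') * W s [?l', ?l] z)"
      by (rule ext) (auto simp: W_def comm add.commute right_diff_distrib chl_nth(1))
    then show ?thesis using fun_subspace_smult[OF fun_subspace_Bc R1, of "(-1) ^ (n * n')"] by simp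
  qed
  then have "cup (n + n') (\<lambda>z. W s [?l, ?l'] z - (-1) ^ (n * n') * W s [?l', ?l] z) (W ?s ls)
    \<in> Bc Q ?A (PiE I (wfin ?s ls)) (n + n' + wdeg ls)"
    by (rule cup_Bc_left[OF Q]) (intro W_Zc okls states_upd s l)
  moreover have "cup (n + n') (\<lambda>z. W s [?l, ?l'] z - (-1) ^ (n * n') * W s [?l', ?l] z) (W ?s ls) =
    (\<lambda>z. W s (?l # ?l' # ls) z - (-1) ^ (n * n') * W s (?l' # ?l # ls) z)"
    unfolding W_Cons2[OF s ok] W_Cons2[OF s ok'] comm
    by (rule ext) (simp add: cup_def algebra_simps)
  ultimately show ?thesis using ok ok' by (simp add: weq_def comm add.assoc)
qed

lemma weq_move:
  assumes "states s" "wok R I s (u @ (i, n, c, B) # v)" "i \<notin> fst ` set u"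
  shows "weq s ((-1) ^ (wdeg u * n)) (u @ (i, n, c, B) # v) ((i, n, c, B) # u @ v)"
  using assms
proof (induction u arbitrary: s)
  case Nil
  then show ?case using weq_refl[OF Nil(2)] by simp
next
  case (Cons l u)
  obtain j m b D where l: "l = (j, m, b, D)" by (cases l) auto
  have lj: "j \<in> I" "antichain (R j) D" "b \<in> Zc (R j) (s j) D m" "j \<noteq> i" using Cons.prems l by auto
  have s1: "states (s(j := D))" using Cons.prems(1) lj by (simp add: states_upd)
  have IH: "weq (s(j := D)) ((-1) ^ (wdeg u * n)) (u @ (i, n, c, B) # v) ((i, n, c, B) # u @ v)"
    using Cons.prems by (intro Cons.IH s1) (auto simp: l simp del: fun_upd_apply)
  have "weq s ((-1) ^ (wdeg u * n)) (l # u @ (i, n, c, B) # v) (l # (i, n, c, B) # u @ v)"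
    unfolding l by (rule weq_Cons[OF Cons.prems(1) lj(1-3) IH])
  moreover have "weq s ((-1) ^ (m * n)) (l # (i, n, c, B) # u @ v) ((i, n, c, B) # l # u @ v)"
    unfolding l using lj IH by (intro weq_swap[OF Cons.prems(1)]) (auto simp: weq_def)
  ultimately have "weq s ((-1) ^ (wdeg u * n) * (-1) ^ (m * n)) (l # u @ (i, n, c, B) # v) ((i, n,
      c, B) # l # u @ v)"
    by (rule weq_trans)
  then show ?case by (simp add: l distrib_right distrib_left power_add mult.commute)
qed

text \<open>An equality of functions: both sides read the same pieces of the same coordinate, and
  \<open>W\<close> records only the final region, in which \<open>B\<close> has been
  overwritten.\<close>

lemma W_merge:
  "W s ((i, n, c, B) # (i, n', c', B') # ls) = W s ((i, n + n', cup n c c', B') # ls)"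
proof (rule ext)
  fix z :: "('i \<Rightarrow> 'p) list"
  have "take (Suc n) (take (Suc (n + n')) z) = take (Suc n) z"
    "drop n (take (Suc (n + n')) z) = take (Suc n') (drop n z)" "drop n' (drop n z)
        = drop (n + n') z"
    by (simp_all add: min_def drop_take add.commute)
  then have "wcup ((i, n, c, B) # (i, n', c', B') # ls) z
      = wcup ((i, n + n', cup n c c', B') # ls) z"
    by (simp only: wcup.simps cup_def mult.assoc take_map drop_map)
  then show "W s ((i, n, c, B) # (i, n', c', B') # ls) z = W s ((i, n + n', cup n c c', B') # ls) z"
    by (simp add: W_def add.assoc)
qed

end

section \<open>The Kuenneth morphism\<close>

fun segs :: "('i, 'p, 'k::comm_ring_1) letter list \<Rightarrow> ('i \<Rightarrow> 'p) list \<Rightarrow> 'p list list" where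
  "segs [] z = []"
| "segs ((i, n, c, B) # ls) z = map (\<lambda>h. h i) (take (Suc n) z) # segs ls (drop n z)"

fun segs_ok :: "('i \<Rightarrow> 'p rel) \<Rightarrow> ('i \<Rightarrow> 'p set) \<Rightarrow> ('i, 'p, 'k::comm_ring_1) letter list \<Rightarrow> 'p list
    list \<Rightarrow> bool" where
  "segs_ok R s [] us \<longleftrightarrow> us = []"
| "segs_ok R s ((i, n, c, B) # ls) us \<longleftrightarrow>
     (\<exists>v vs. us = v # vs \<and> v \<in> chl (R i) (s i) B (Suc n) \<and> segs_ok R (s(i := B)) ls vs)"

abbreviation lsupps :: "('i, 'p, 'k::comm_ring_1) letter list \<Rightarrow> 'p list set list" where
  "lsupps ls \<equiv> map (\<lambda>(i, n, c, B). {u. c u \<noteq> 0}) ls"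

lemma length_segs [simp]: "length (segs ls z) = length ls"
  by (induction ls z rule: segs.induct) auto

lemma segs_ok_length: "segs_ok R s ls us \<Longrightarrow> length us = length ls"
  by (induction s ls arbitrary: us rule: letters_induct) (auto simp del: fun_upd_apply)

lemma segs_ok_hd:
  "\<lbrakk>segs_ok R s ls us; distinct (map fst ls); (i, u) \<in> set (zip (map fst ls) us)\<rbrakk> \<Longrightarrow> hd u \<in> s i"
proof (induction s ls arbitrary: us rule: letters_induct)
  case (Cons s j n c B ls)
  obtain v vs where us: "us = v # vs" "v \<in> chl (R j) (s j) B (Suc n)" "segs_ok R (s(j := B)) ls vs"
    using Cons.prems(1) by auto
  show ?case
  proof (cases "(i, u) = (j, v)")
    case True
    then show ?thesis using us by (auto simp: chl_def)
  next
    case False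
    then have iu: "(i, u) \<in> set (zip (map fst ls) vs)" using Cons.prems(3) us(1) by auto
    then have "i \<noteq> j" using Cons.prems(2) by (auto dest: set_zip_leftD)
    moreover have "hd u \<in> (s(j := B)) i" using Cons.prems(2) us(3) iu
      by (intro Cons.IH) (auto simp del: fun_upd_apply)
    ultimately show ?thesis by simp
  qed
qed simp

lemma finite_listset: "(\<And>A. A \<in> set As \<Longrightarrow> finite A) \<Longrightarrow> finite (listset As)"
proof (induction As)
  case (Cons A As)
  have "listset (A # As) = (\<lambda>(x, xs). x # xs) ` (A \<times> listset As)"
    by (auto simp: set_Cons_def)
  then show ?case using Cons by auto
qed simp

lemma wsupp_iff_segs: "length z = Suc (wdeg ls) \<Longrightarrow> wsupp ls z \<longleftrightarrow> segs ls z \<in> listset (lsupps ls)"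
  by (induction ls z rule: segs.induct) (auto simp: set_Cons_def)

lemma wcup_eq_prod:
  "length z = Suc (wdeg ls) \<Longrightarrow> wcup ls z = (\<Prod>j<length ls. fst (snd (snd (ls ! j))) (segs ls z ! j))"
  by (induction ls z rule: segs.induct) (auto simp: prod.lessThan_Suc_shift simp del:
      prod.lessThan_Suc)

lemma segs_ok_supp:
  "\<lbrakk>wok R I s ls; us \<in> listset (lsupps ls)\<rbrakk> \<Longrightarrow> segs_ok R s ls us"
proof (induction s ls arbitrary: us rule: letters_induct)
  case (Cons s i n c B ls)
  then show ?case by (auto simp: set_Cons_def Zc_def supp_def simp del: fun_upd_apply)
qed simp

context product_words
begin

lemma FQ: "Field Q = (\<Pi>\<^sub>E i\<in>I. Field (R i))"
  by (rule Field_prod_poset) (rule R)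

lemma minQ: "min_elems Q = (\<Pi>\<^sub>E i\<in>I. min_elems (R i))"
  by (rule min_prod_poset) (rule R)

lemma maxQ: "max_elems Q = (\<Pi>\<^sub>E i\<in>I. max_elems (R i))"
  by (rule max_prod_poset) (rule R)

text \<open>A chain on which every letter is nonzero moves one coordinate at a time, in the order of
  the word, so it is recovered from its segments by knitting. Together with
  \<open>chain_of_knit\<close> this makes \<open>knit\<close> and \<open>segs\<close> inverse to
  each other on the relevant chains.\<close>

lemma knit_of_chain:
  assumes "states s" "wok R I s ls" "distinct (map fst ls)"
    "z \<in> chl Q (PiE I s) (PiE I (wfin s ls)) l" "wsupp ls z"
  shows "z = hd z # knit_from (hd z) (zip (map fst ls) (segs ls z)) \<and>
    (\<forall>(i, u)\<in>set (zip (map fst ls) (segs ls z)). hd u = hd z i)"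
  using assms
proof (induction s ls arbitrary: z l rule: letters_induct)
  case (Nil s)
  then show ?case by (cases z) auto
next
  case (Cons s i n c B ls)
  have l: "i \<in> I" "antichain (R i) B" "c \<in> Zc (R i) (s i) B n" "wok R I (s(i := B)) ls"
    using Cons.prems by auto
  let ?f = "hd z" and ?M = "PiE I (s(i := B))"
  define u where "u = map (\<lambda>h. h i) (take (Suc n) z)"
  have mid: "z ! n \<in> ?M" "n < length z"
    using wsupp_Cons_mid[OF Cons.prems(1,2) _ Cons.prems(5)] Cons.prems(4) by blast+
  have lenz: "length z = l" and z0: "z \<noteq> []" using Cons.prems(4) mid(2) by (auto simp: chl_def)
  have t: "take (Suc n) z \<in> chl Q (PiE I s) ?M (Suc n)"
    using chl_take[OF Cons.prems(4), of "Suc n" ?M] mid lenz by simp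
  have d: "drop n z \<in> chl Q ?M (PiE I (wfin (s(i := B)) ls)) (l - n)"
    using chl_drop[OF Cons.prems(4), of n ?M] mid lenz by simp
  have hdt: "hd (take (Suc n) z) = ?f" and hdd: "hd (drop n z) = z ! n"
    using z0 mid(2) by (simp_all add: hd_drop_conv_nth)
  \<comment> \<open>Up to the cut only the coordinate \<open>i\<close> differs from the starting
    point.\<close>
  have upd: "h = ?f(i := h i)" if "h \<in> set (take (Suc n) z)" for h
  proof
    fix j
    show "h j = (?f(i := h i)) j"
      using letter_between(3)[OF Cons.prems(1) l(1,2) chl_between[OF Q t that], of j] hdt by simp
  qed
  have tk: "take (Suc n) z = map (\<lambda>x. ?f(i := x)) u"
    unfolding u_def map_map by (rule map_idI[symmetric]) (simp add: upd[symmetric])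
  have zt: "take (Suc n) z = take n z @ [z ! n]" by (rule take_Suc_conv_app_nth[OF mid(2)])
  have u: "u \<noteq> []" "hd u = ?f i" "last u = (z ! n) i"
  proof -
    show "u \<noteq> []" "hd u = ?f i" using z0 hdt by (simp_all add: u_def hd_map)
    show "last u = (z ! n) i" by (simp add: u_def zt)
  qed
  have zn: "z ! n = ?f(i := last u)"
    using upd[of "z ! n"] u(3) zt by simp
  have IH: "drop n z = z ! n # knit_from (z ! n) (zip (map fst ls) (segs ls (drop n z))) \<and>
    (\<forall>(i, u)\<in>set (zip (map fst ls) (segs ls (drop n z))). hd u = (z ! n) i)"
    using Cons.IH[OF states_upd[OF Cons.prems(1) l(2)] l(4) _ d] Cons.prems(3,5) unfolding hdd
    by simp
  have "z = take (Suc n) z @ tl (drop n z)" by (metis append_take_drop_id drop_Suc tl_drop)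
  also have "take (Suc n) z = ?f # map (\<lambda>x. ?f(i := x)) (tl u)"
    unfolding tk using u by (cases u) auto
  also have "tl (drop n z) = knit_from (?f(i := last u)) (zip (map fst ls) (segs ls (drop n z)))"
    using IH zn by (metis list.sel(3))
  finally have "z = ?f # knit_from ?f (zip (map fst ((i, n, c, B) # ls)) (segs ((i, n, c, B) # ls)
      z))"
    by (simp add: u_def del: fun_upd_apply)
  moreover have "hd v = ?f j" if "(j, v) \<in> set (zip (map fst ls) (segs ls (drop n z)))" for j v
  proof -
    have "j \<noteq> i" using that Cons.prems(3) by (auto dest: set_zip_leftD)
    then show ?thesis using IH that zn by auto
  qed
  ultimately show ?case using u(2) by (auto simp: u_def)
qed

lemma chain_of_knit:
  assumes "states s" "wok R I s ls" "distinct (map fst ls)" "segs_ok R s ls us" "f \<in> PiE I s" "f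
      \<in> Field Q"
    "\<And>i u. (i, u) \<in> set (zip (map fst ls) us) \<Longrightarrow> hd u = f i"
  shows "f # knit_from f (zip (map fst ls) us)
      \<in> chl Q (PiE I s) (PiE I (wfin s ls)) (Suc (wdeg ls)) \<and>
    segs ls (f # knit_from f (zip (map fst ls) us)) = us"
  using assms
proof (induction s ls arbitrary: us f rule: letters_induct)
  case (Nil s)
  then show ?case by (auto simp: chl_def wchain_def)
next
  case (Cons s i n c B ls)
  have l: "i \<in> I" "antichain (R i) B" "c \<in> Zc (R i) (s i) B n" "wok R I (s(i := B)) ls"
    using Cons.prems by auto
  obtain u vs where us: "us = u # vs" "u \<in> chl (R i) (s i) B (Suc n)" "segs_ok R (s(i := B)) ls vs"
    using Cons.prems(4) by auto
  let ?f = "f(i := last u)"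
  let ?M = "PiE I (s(i := B))"
  have hu: "hd u = f i" using Cons.prems(7) us(1) by simp
  have u: "wchain (R i) u" "distinct u" "length u = Suc n" "u \<noteq> []" "last u \<in> B"
    using us(2) by (auto simp: chl_def wchain_def)
  have fF: "f \<in> (\<Pi>\<^sub>E j\<in>I. Field (R j))" using Cons.prems(6) FQ by simp
  define z1 where "z1 = map (\<lambda>x. f(i := x)) u"
  define z2 where "z2 = ?f # knit_from ?f (zip (map fst ls) vs)"
  have F: "f(i := x) \<in> Field Q" if "x \<in> Field (R i)" for x
    unfolding FQ using fF that l(1) by (auto simp: PiE_iff extensional_def)
  have z1: "z1 \<in> chl Q (PiE I s) ?M (Suc n)"
  proof -
    have "(f(i := x), f(i := y)) \<in> Q" if "(x, y) \<in> R i" for x y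
      using fF that l(1) finite_poset_refl[OF R] unfolding prod_poset_def
      by (auto simp: PiE_iff extensional_def intro: FieldI1 FieldI2)
    then have "wchain Q z1" unfolding z1_def by (rule wchain_map[OF u(1)])
    moreover have "distinct z1" using u(2)
      by (auto simp: z1_def distinct_map inj_on_def dest: fun_upd_eqD)
    moreover have "hd z1 = f" using u hu by (simp add: z1_def hd_map)
    moreover have "last z1 = ?f" using u by (simp add: z1_def last_map)
    moreover have "?f \<in> ?M" using Cons.prems(5) u(5) l(1) by (auto simp: PiE_iff extensional_def)
    ultimately show ?thesis using u Cons.prems(5) by (simp add: chl_def z1_def)
  qed
  have fi: "hd v = ?f j" if "(j, v) \<in> set (zip (map fst ls) vs)" for j v
  proof -
    have "j \<noteq> i" using that Cons.prems(3) by (auto dest: set_zip_leftD)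
    then show ?thesis using Cons.prems(7)[of j v] that us(1) by simp
  qed
  have IH: "z2 \<in> chl Q ?M (PiE I (wfin (s(i := B)) ls)) (Suc (wdeg ls)) \<and> segs ls z2 = vs"
    unfolding z2_def
  proof (rule Cons.IH)
    show "states (s(i := B))" using Cons.prems(1) l by (simp add: states_upd)
    show "?f \<in> ?M" using Cons.prems(5) u(5) l(1) by (auto simp: PiE_iff extensional_def)
    show "?f \<in> Field Q" using F wchain_ends(2)[OF u(1)] by simp
    show "distinct (map fst ls)" using Cons.prems(3) by simp
  qed (rule l(4) us(3) fi; assumption?)+
  let ?z = "f # knit_from f (zip (map fst ((i, n, c, B) # ls)) us)"
  have z: "?z = z1 @ knit_from ?f (zip (map fst ls) vs)"
    using u hu by (cases u) (auto simp: us(1) z1_def)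
  have len1: "length z1 = Suc n" using u by (simp add: z1_def)
  have tk: "take (Suc n) ?z = z1" unfolding z using len1 by simp
  have "drop n z1 = [last z1]" using len1
    by (metis append_butlast_last_id append_eq_conv_conj diff_Suc_1 length_butlast list.size(3)
        nat.distinct(1))
  moreover have "last z1 = ?f" using u by (simp add: z1_def last_map)
  ultimately have dr: "drop n ?z = z2" unfolding z using len1 by (simp add: z2_def)
  have "?z \<in> chl Q (PiE I s) (PiE I (wfin (s(i := B)) ls)) (Suc (n + wdeg ls))"
    using chl_join(1)[OF Q, of n ?z _ ?M] tk dr z1 IH by blast
  moreover have "segs ((i, n, c, B) # ls) ?z = us"
  proof -
    have "map (\<lambda>h. h i) z1 = u" by (simp add: z1_def comp_def)
    then show ?thesis using IH us(1) unfolding segs.simps tk dr by simp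
  qed
  ultimately show ?case by simp
qed

text \<open>At a given \<open>z\<close> only the tuple \<open>segs ls z\<close> can knit to
  \<open>z\<close>, so the Kuenneth sum has at most one nonzero term, the product of the letters on
  the segments of \<open>z\<close>. Each coordinate has exactly one letter.\<close>

lemma sum_knit_eq_W:
  fixes ls :: "('i, 'p, 'k::comm_ring_1) letter list"
  assumes s: "states s" and ok: "wok R I s ls" and dist: "distinct (map fst ls)"
      and I: "fst ` set ls = I"
    and sF: "\<And>i. i \<in> I \<Longrightarrow> s i \<subseteq> Field (R i)"
  shows "(\<Sum>us\<in>listset (lsupps ls). (\<Prod>j<length ls. fst (snd (snd (ls ! j))) (us ! j)) *
      delta (knit (zip (map fst ls) us)) z) = W s ls z"
proof -
  let ?Z = "z \<in> chl Q (PiE I s) (PiE I (wfin s ls)) (Suc (wdeg ls))"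
  let ?L = "listset (lsupps ls)"
  have fin: "finite ?L"
  proof (rule finite_listset)
    have "finite {u. c u \<noteq> 0}" if "(i, n, c, B) \<in> set ls" for i n c B
      using that ok
    proof (induction s ls rule: letters_induct)
      case (Cons s j m b D ls)
      have "finite {u. b u \<noteq> 0}" if "j \<in> I" "b \<in> Zc (R j) (s j) D m"
        using that chl_finite[OF R, of j "s j" D "Suc m"] finite_subset
        by (auto simp: Zc_def supp_def)
      then show ?case using Cons by (auto simp del: fun_upd_apply)
    qed simp
    then show "finite A" if "A \<in> set (lsupps ls)" for A using that by fastforce
  qed
  have knit: "knit (zip (map fst ls) us) = f # knit_from f (zip (map fst ls) us)"
    if "f = (\<lambda>i\<in>I. hd (the (map_of (zip (map fst ls) us) i)))" "length us = length ls" for us f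
  proof -
    have "fst ` set (zip (map fst ls) us) = I" using that(2) I
      by (metis length_map list.set_map map_fst_zip)
    then show ?thesis using that by (simp add: knit_def Let_def)
  qed
  have fwd: "?Z \<and> segs ls z = us" if us: "us \<in> ?L" "z = knit (zip (map fst ls) us)" for us
  proof -
    define f where "f = (\<lambda>i\<in>I. hd (the (map_of (zip (map fst ls) us) i)))"
    have uok: "segs_ok R s ls us" by (rule segs_ok_supp[OF ok us(1)])
    have len: "length us = length ls" using segs_ok_length[OF uok] .
    have fi: "hd u = f i" if "(i, u) \<in> set (zip (map fst ls) us)" for i u
      using that dist len I by (auto simp: f_def dest: set_zip_leftD)
    have "f i \<in> s i" if "i \<in> I" for i
    proof -
      have "i \<in> set (map fst ls)" using that I by simp
      then obtain j where j: "j < length ls" "map fst ls ! j = i"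
        by (metis in_set_conv_nth length_map)
      have "(i, us ! j) \<in> set (zip (map fst ls) us)"
        using j len by (auto simp: in_set_zip intro!: exI[of _ j])
      then show ?thesis using fi segs_ok_hd[OF uok dist] by metis
    qed
    then have fs: "f \<in> PiE I s" by (auto simp: f_def)
    moreover have "f \<in> Field Q" using fs sF unfolding FQ by (auto simp: PiE_iff)
    ultimately show ?thesis
      using chain_of_knit[OF s ok dist uok _ _ fi] knit[OF f_def len] us(2) by simp
  qed
  have bwd: "z = knit (zip (map fst ls) (segs ls z))" if Z: ?Z and "wsupp ls z"
  proof -
    have *: "z = hd z # knit_from (hd z) (zip (map fst ls) (segs ls z))"
      "\<And>i u. (i, u) \<in> set (zip (map fst ls) (segs ls z)) \<Longrightarrow> hd u = hd z i"
      using knit_of_chain[OF s ok dist that] by auto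
    have hz: "hd z \<in> PiE I s" using Z by (auto simp: chl_def)
    have "hd z i = hd (the (map_of (zip (map fst ls) (segs ls z)) i))" if "i \<in> I" for i
    proof -
      have "i \<in> set (map fst ls)" using that I by simp
      then obtain j where j: "j < length ls" "map fst ls ! j = i"
        by (metis in_set_conv_nth length_map)
      have "(i, segs ls z ! j) \<in> set (zip (map fst ls) (segs ls z))"
        using j by (auto simp: in_set_zip intro!: exI[of _ j])
      then show ?thesis using *(2)[of i "segs ls z ! j"] dist by simp
    qed
    then have "hd z = (\<lambda>i\<in>I. hd (the (map_of (zip (map fst ls) (segs ls z)) i)))"
      using hz by (intro extensionalityI[of _ I]) (auto simp: PiE_iff)
    from knit[OF this] show ?thesis using *(1) by simp
  qed
  show ?thesis
  proof (cases "?Z \<and> wsupp ls z")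
    case True
    have len: "length z = Suc (wdeg ls)" using True by (auto simp: chl_def)
    have mem: "segs ls z \<in> ?L" using True wsupp_iff_segs[OF len] by simp
    have "(\<Sum>us\<in>?L. (\<Prod>j<length ls. fst (snd (snd (ls ! j))) (us ! j)) * delta (knit (zip (map fst
        ls) us)) z) =
      (\<Sum>us\<in>?L. if us = segs ls z then (\<Prod>j<length ls. fst (snd (snd (ls ! j))) (us ! j)) else 0)"
      using fwd bwd True by (intro sum.cong) (auto simp: delta_def)
    also have "\<dots> = wcup ls z" using fin mem by (simp add: wcup_eq_prod[OF len])
    finally show ?thesis using True by (simp add: W_def)
  next
    case False
    have "z \<noteq> knit (zip (map fst ls) us)" if "us \<in> ?L" for us
    proof
      assume zk: "z = knit (zip (map fst ls) us)"
      have Z: ?Z and "segs ls z = us" using fwd[OF that zk] by auto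
      moreover have "length z = Suc (wdeg ls)" using Z by (auto simp: chl_def)
      ultimately show False using False that wsupp_iff_segs by metis
    qed
    then have "(\<Sum>us\<in>?L. (\<Prod>j<length ls. fst (snd (snd (ls ! j))) (us ! j)) * delta (knit (zip (map
        fst ls) us)) z) = 0"
      by (intro sum.neutral) (auto simp: delta_def)
    moreover have "W s ls z = 0" using False wsupp_if_wcup[of ls z] by (auto simp: W_def)
    ultimately show ?thesis by simp
  qed
qed

end

section \<open>The Kuenneth morphism as a word from minimal to maximal elements\<close>

definition kl :: "('i \<Rightarrow> 'p rel) \<Rightarrow> ('i \<times> nat \<times> ('p list \<Rightarrow> 'k)) list \<Rightarrow> ('i, 'p, 'k) letter list" where
  "kl R w = map (\<lambda>(i, n, c). (i, n, c, max_elems (R i))) w"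

definition minst :: "('i \<Rightarrow> 'p rel) \<Rightarrow> 'i \<Rightarrow> 'p set" where
  "minst R i = min_elems (R i)"

lemma kl_simps [simp]:
  "kl R [] = []" "kl R ((i, n, c) # w) = (i, n, c, max_elems (R i)) # kl R w" "kl R (u @ v)
      = kl R u @ kl R v"
  by (simp_all add: kl_def)

lemma map_fst_kl [simp]: "map fst (kl R w) = map fst w"
  by (induction w) auto

lemma fst_set_kl [simp]: "fst ` set (kl R w) = fst ` set w"
  by (metis list.set_map map_fst_kl)

lemma tdeg_simps [simp]: "tdeg [] = 0" "tdeg ((i, n, c) # w) = n + tdeg w" "tdeg (u @ v)
    = tdeg u + tdeg v"
  by (simp_all add: tdeg_def)

lemma wdeg_kl [simp]: "wdeg (kl R w) = tdeg w"
  by (induction w) auto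

lemma wok_kl:
  assumes "distinct (map fst w)" "\<And>i n c. (i, n, c) \<in> set w \<Longrightarrow> i \<in> I \<and> c
      \<in> Zc (R i) (s i) (max_elems (R i)) n"
  shows "wok R I s (kl R w)"
  using assms
proof (induction w arbitrary: s)
  case (Cons l w)
  obtain i n c where l: "l = (i, n, c)" by (cases l) auto
  have "wok R I (s(i := max_elems (R i))) (kl R w)"
  proof (rule Cons.IH)
    fix j m b assume j: "(j, m, b) \<in> set w"
    then have "j \<noteq> i" using Cons.prems(1) l by (auto simp: rev_image_eqI)
    then show "j \<in> I \<and> b \<in> Zc (R j) ((s(i := max_elems (R i))) j) (max_elems (R j)) m"
      using Cons.prems(2)[of j m b] j by simp
  qed (use Cons.prems in auto)
  then show ?case using Cons.prems(2)[of i n c] by (simp add: l antichain_max)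
qed simp

lemma wfin_kl: "wfin s (kl R w) i = (if i \<in> fst ` set w then max_elems (R i) else s i)"
proof (induction w arbitrary: s)
  case (Cons l w)
  obtain j n c where l: "l = (j, n, c)" by (cases l) auto
  show ?case unfolding l kl_simps wfin.simps Cons.IH by auto
qed simp

context product_words
begin

lemma states_minst: "states (minst R)"
  by (simp add: states_def minst_def antichain_min)

lemma PiE_minst: "PiE I (minst R) = min_elems Q"
  unfolding minQ by (rule PiE_cong) (simp add: minst_def)

lemma PiE_wfin_kl: "fst ` set w = I \<Longrightarrow> PiE I (wfin s (kl R w)) = max_elems Q"
  unfolding maxQ by (rule PiE_cong) (simp add: wfin_kl)

definition kok :: "('i \<times> nat \<times> ('p list \<Rightarrow> 'k::comm_ring_1)) list \<Rightarrow> bool" where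
  "kok w \<longleftrightarrow> distinct (map fst w) \<and> fst ` set w = I \<and>
     (\<forall>(i, n, c)\<in>set w. c \<in> Zc (R i) (min_elems (R i)) (max_elems (R i)) n)"

lemma kok_wok: "kok w \<Longrightarrow> wok R I (minst R) (kl R w)"
  by (rule wok_kl) (force simp: kok_def minst_def)+

lemma kunneth_eq_W:
  fixes w :: "('i \<times> nat \<times> ('p list \<Rightarrow> 'k::comm_ring_1)) list"
  assumes "kok w" shows "kunneth w = W (minst R) (kl R w)"
proof
  fix z
  have "lsupps (kl R w) = map (\<lambda>(i, n, c). {u. c u \<noteq> 0}) w" by (auto simp: kl_def)
  moreover have "fst (snd (snd (kl R w ! j))) = snd (snd (w ! j))" if "j < length w" for j
    using that by (simp add: kl_def split_def)
  moreover have "length (kl R w) = length w" by (simp add: kl_def)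
  ultimately have "kunneth w z = (\<Sum>us\<in>listset (lsupps (kl R w)). (\<Prod>j<length (kl R w). fst (snd
      (snd (kl R w ! j))) (us ! j)) *
      delta (knit (zip (map fst (kl R w)) us)) z)"
    by (simp add: kunneth_def)
  also have "\<dots> = W (minst R) (kl R w) z"
    by (rule sum_knit_eq_W[OF states_minst kok_wok[OF assms]])
      (use assms in \<open>auto simp: kok_def minst_def min_elems_def\<close>)
  finally show "kunneth w z = W (minst R) (kl R w) z" .
qed

lemma kunneth_Zc: "kok w \<Longrightarrow> kunneth w \<in> Zc Q (min_elems Q) (max_elems Q) (tdeg w)"
  using W_Zc[OF states_minst kok_wok, of w]
  by (simp add: kunneth_eq_W PiE_minst PiE_wfin_kl kok_def)

text \<open>Words with cohomologous letters in the same places, relative to the regions reached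
  along the way. By \<open>lequiv_weq\<close> the letters can be replaced one by one without
  changing the class of the word.\<close>

fun lequiv :: "('i \<Rightarrow> 'p set) \<Rightarrow> ('i, 'p, 'k::comm_ring_1) letter list \<Rightarrow> ('i, 'p, 'k) letter list \<Rightarrow>
    bool" where
  "lequiv s [] ls' \<longleftrightarrow> ls' = []"
| "lequiv s ((i, n, c, B) # ls) ls' \<longleftrightarrow> (\<exists>c' ls''. ls' = (i, n, c', B) # ls'' \<and>
     (\<lambda>z. c z - c' z) \<in> Bc (R i) (s i) B n \<and> lequiv (s(i := B)) ls ls'')"

lemma lequiv_weq:
  assumes "states s" "wok R I s ls" "wok R I s ls'" "lequiv s ls ls'"
  shows "weq s 1 ls ls'"
  using assms
proof (induction s ls arbitrary: ls' rule: letters_induct)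
  case (Nil s)
  then show ?case by (simp add: weq_refl)
next
  case (Cons s i n c B ls)
  obtain c' ls'' where ls': "ls' = (i, n, c', B) # ls''" "(\<lambda>z. c z - c' z) \<in> Bc (R i) (s i) B n"
    "lequiv (s(i := B)) ls ls''" using Cons.prems(4) by auto
  have l: "i \<in> I" "antichain (R i) B" "c \<in> Zc (R i) (s i) B n" "wok R I (s(i := B)) ls"
    using Cons.prems(2) by auto
  have l': "c' \<in> Zc (R i) (s i) B n" "wok R I (s(i := B)) ls''"
    using Cons.prems(3) ls' by auto
  have s1: "states (s(i := B))" using Cons.prems(1) l by (simp add: states_upd)
  have "weq (s(i := B)) 1 ls ls''" by (rule Cons.IH[OF s1 l(4) l'(2) ls'(3)])
  then have A: "weq s 1 ((i, n, c, B) # ls) ((i, n, c, B) # ls'')"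
    by (rule weq_Cons[OF Cons.prems(1) l(1-3)])
  have "cup n (W s [(i, n, \<lambda>z. c z - c' z, B)]) (W (s(i := B)) ls'') \<in>
    Bc Q (PiE I s) (PiE I (wfin (s(i := B)) ls'')) (n + wdeg ls'')"
    by (rule cup_Bc_left[OF Q W_single_Bc[OF Cons.prems(1) l(1,2) ls'(2)] W_Zc[OF s1 l'(2)]])
  moreover have "cup n (W s [(i, n, \<lambda>z. c z - c' z, B)]) (W (s(i := B)) ls'') =
    (\<lambda>z. W s ((i, n, c, B) # ls'') z - W s ((i, n, c', B) # ls'') z)"
  proof -
    have "wok R I s ((i, n, c, B) # ls'')" "wok R I s ((i, n, c', B) # ls'')" using l l' by auto
    then show ?thesis
      unfolding W_Cons[OF Cons.prems(1) \<open>wok R I s ((i, n, c, B) # ls'')\<close>]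
        W_Cons[OF Cons.prems(1) \<open>wok R I s ((i, n, c', B) # ls'')\<close>] cup_diff_left[symmetric]
      by (simp add: W_single pl_diff)
  qed
  ultimately have "weq s 1 ((i, n, c, B) # ls'') ((i, n, c', B) # ls'')"
    using l l' by (simp add: weq_def)
  from weq_trans[OF A this] show ?case by (simp add: ls')
qed

text \<open>Well-definedness of the Kuenneth morphism: another choice of representatives gives again
  a list of cocycles, and the two words are related by \<open>lequiv\<close>.\<close>

lemma kunneth_coh_class:
  fixes w :: "('i \<times> nat \<times> ('p list \<Rightarrow> 'k::comm_ring_1)) list"
  assumes w: "kok w"
  shows "kunneth_coh R (map (\<lambda>(i, n, c). (i, n, coh_class c_chains (R i) n c)) w) =
    fcoset (Bc Q (min_elems Q) (max_elems Q) (tdeg w)) (kunneth w)"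
  unfolding kunneth_coh_def
proof (rule the_elem_Collect_const)
  let ?wX = "map (\<lambda>(i, n, c). (i, n, coh_class c_chains (R i) n c)) w"
  let ?rel = "\<lambda>(i', n', c) (i, n, X). i' = i \<and> n' = n \<and> c \<in> X"
  have cc: "coh_class c_chains (R i) n c = fcoset (Bc (R i) (min_elems (R i)) (max_elems (R i)) n)
      c"
    if "i \<in> I" for i n and c :: "'p list \<Rightarrow> 'k"
    using coh_class_eq_fcoset[OF R[OF that], of c_chains] by simp
  have fst_wX: "fst ` set ?wX = I" "tdeg ?wX = tdeg w"
  proof -
    have "map fst ?wX = map fst w" by (simp add: split_def)
    then show "fst ` set ?wX = I" using w unfolding kok_def by (metis list.set_map)
    show "tdeg ?wX = tdeg w" by (induction w) auto
  qed
  have "list_all2 ?rel w ?wX"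
    using w by (auto simp: list_all2_map2 list_all2_same kok_def cc self_mem_fcoset[OF
        fun_subspace_Bc] rev_image_eqI
      intro!: list.rel_refl_strong)
  then show "\<exists>w'. list_all2 ?rel w' ?wX" by blast
  fix w' :: "('i \<times> nat \<times> ('p list \<Rightarrow> 'k)) list" assume "list_all2 ?rel w' ?wX"
  then have rel: "list_all2 (\<lambda>(i', n', c') (i, n, c). i' = i \<and> n' = n \<and> c'
      \<in> coh_class c_chains (R i) n c) w' w"
    by (simp add: list_all2_map2 split_def)
  have mf: "map fst w' = map fst w" using rel
    by (induction rule: list_all2_induct) auto
  have fs: "fst ` set w' = fst ` set w" using mf by (metis list.set_map)
  have mem: "\<exists>c. (i, n, c) \<in> set w \<and> c' \<in> coh_class c_chains (R i) n c" if "(i, n, c') \<in> set w'"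
      for i n c'
    using rel that by (induction rule: list_all2_induct) auto
  have "c' \<in> Zc (R i) (min_elems (R i)) (max_elems (R i)) n" if m: "(i, n, c') \<in> set w'" for i n c'
  proof -
    obtain c where c: "(i, n, c) \<in> set w" "c' \<in> coh_class c_chains (R i) n c" using mem[OF m]
      by blast
    then have i: "i \<in> I" "c \<in> Zc (R i) (min_elems (R i)) (max_elems (R i)) n" using w
      by (force simp: kok_def)+
    show ?thesis
      by (rule fcoset_subset[OF fun_subspace_Zc Bc_subset_Zc_start[OF R[OF i(1)], of c_chains n,
          simplified]
            i(2) c(2)[unfolded cc[OF i(1)]]])
  qed
  then have w': "kok w'" using w mf fs by (auto simp: kok_def)
  have "lequiv s (kl R w') (kl R w)" if "\<And>i. i \<in> fst ` set w \<Longrightarrow> s i = min_elems (R i)" for s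
    using rel w[unfolded kok_def, THEN conjunct1] that w[unfolded kok_def, THEN conjunct2, THEN
        conjunct1, THEN equalityD1]
  proof (induction arbitrary: s rule: list_all2_induct)
    case (Cons l' w' l w)
    obtain i n c where l: "l = (i, n, c)" by (cases l) auto
    obtain c' where l': "l' = (i, n, c')" "c' \<in> coh_class c_chains (R i) n c" using Cons.hyps l
      by (cases l') auto
    have "lequiv (s(i := max_elems (R i))) (kl R w') (kl R w)"
    proof (rule Cons.IH)
      fix j assume "j \<in> fst ` set w"
      then show "(s(i := max_elems (R i))) j = min_elems (R j)" using Cons.prems l by auto
    qed (use Cons.prems in auto)
    moreover have "(\<lambda>z. c' z - c z) \<in> Bc (R i) (s i) (max_elems (R i)) n"
      using l'(2) Cons.prems l by (auto simp: cc mem_fcoset)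
    ultimately show ?case by (simp add: l l')
  qed simp
  then have "weq (minst R) 1 (kl R w') (kl R w)"
    by (intro lequiv_weq states_minst kok_wok w w') (simp add: minst_def)
  then have "(\<lambda>z. kunneth w' z - kunneth w z) \<in> Bc Q (min_elems Q) (max_elems Q) (tdeg w)"
    using w w' by (auto simp: weq_def kunneth_eq_W PiE_minst PiE_wfin_kl kok_def)
  then show "coh_class c_chains (prod_poset (fst ` set ?wX) R) (tdeg ?wX) (kunneth w') =
    fcoset (Bc Q (min_elems Q) (max_elems Q) (tdeg w)) (kunneth w)"
    unfolding fst_wX coh_class_eq_fcoset[OF Q, of c_chains, simplified]
    by (simp add: fcoset_eq_iff[OF fun_subspace_Bc])
qed

lemma wcup_add: "wcup (u @ (i, n, \<lambda>z. c z + c' z, B) # v) z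
    = wcup (u @ (i, n, c, B) # v) z + wcup (u @ (i, n, c', B) # v) z"
  by (induction u z rule: wcup.induct) (simp_all add: algebra_simps)

lemma wcup_smult: "wcup (u @ (i, n, \<lambda>z. k * c z, B) # v) z = k * wcup (u @ (i, n, c, B) # v) z"
  by (induction u z rule: wcup.induct) (simp_all add: algebra_simps)

lemma kok_update: "\<lbrakk>kok (u @ (i, n, c) # v); c' \<in> Zc (R i) (min_elems (R i)) (max_elems (R i)) n\<rbrakk>
    \<Longrightarrow> kok (u @ (i, n, c') # v)"
  by (auto simp: kok_def)

lemma kunneth_add:
  assumes "kok (u @ (i, n, c) # v)" "kok (u @ (i, n, c') # v)"
  shows "kunneth (u @ (i, n, \<lambda>z. c z + c' z) # v)
      = (\<lambda>z. kunneth (u @ (i, n, c) # v) z + kunneth (u @ (i, n, c') # v) z)"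
proof -
  have "kok (u @ (i, n, \<lambda>z. c z + c' z) # v)"
    using assms by (intro kok_update[OF assms(1)] fun_subspace_add[OF fun_subspace_Zc]) (auto
        simp: kok_def)
  then show ?thesis using assms
    by (simp add: kunneth_eq_W) (rule ext, simp add: W_def wcup_add)
qed

lemma kunneth_smult:
  assumes "kok (u @ (i, n, c) # v)"
  shows "kunneth (u @ (i, n, \<lambda>z. k * c z) # v) = (\<lambda>z. k * kunneth (u @ (i, n, c) # v) z)"
proof -
  have "kok (u @ (i, n, \<lambda>z. k * c z) # v)"
    using assms by (intro kok_update[OF assms(1)] fun_subspace_smult[OF fun_subspace_Zc]) (auto
        simp: kok_def)
  then show ?thesis using assms
    by (simp add: kunneth_eq_W) (rule ext, simp add: W_def wcup_smult)
qed

lemma kunneth_swap: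
  assumes w: "kok (u @ (i, n, c) # (i', n', c') # v)"
  shows "(\<lambda>z. kunneth (u @ (i, n, c) # (i', n', c') # v) z - (-1) ^ (n * n') * kunneth (u @ (i',
      n', c') # (i, n, c) # v) z)
    \<in> Bc Q (min_elems Q) (max_elems Q) (tdeg (u @ (i, n, c) # (i', n', c') # v))"
proof -
  have w': "kok (u @ (i', n', c') # (i, n, c) # v)" using w by (auto simp: kok_def)
  have ok: "wok R I (minst R) (kl R u @ kl R ((i, n, c) # (i', n', c') # v))" using kok_wok[OF w]
    by simp
  have ne: "i \<noteq> i'" using w by (auto simp: kok_def)
  have "weq (minst R) ((-1) ^ (n * n')) (kl R u @ (i, n, c, max_elems (R i)) # (i', n', c',
      max_elems (R i')) # kl R v)
    (kl R u @ (i', n', c', max_elems (R i')) # (i, n, c, max_elems (R i)) # kl R v)"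
    using ok unfolding wok_append
    by (intro weq_prefix states_minst weq_swap states_wfin ne) auto
  then show ?thesis using w w'
    by (simp add: weq_def kunneth_eq_W PiE_minst kok_def)
      (simp add: PiE_minst PiE_wfin_kl[of "u @ (i, n, c) # (i', n', c') # v", simplified])
qed

end

section \<open>Partitions\<close>

lemma elts_blk [simp]: "finite A \<Longrightarrow> elts (blk A) = A"
  by (simp add: blk_def Abs_fset_inverse)

lemma Parts_iff:
  assumes "finset S"
  shows "\<pi> \<in> Parts S \<longleftrightarrow> (\<forall>T\<in>\<pi>. blk (elts T) = T) \<and> partition_on S (elts ` \<pi>)"
proof
  assume "\<pi> \<in> Parts S"
  then obtain Q where Q: "\<pi> = blk ` Q" "partition_on S Q" by (auto simp: Parts_def)
  then have fin: "finite A" if "A \<in> Q" for A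
    using that assms by (auto simp: finset_def partition_on_def intro: finite_subset)
  then have "elts ` \<pi> = Q" using Q(1) by (force simp: image_image)
  then show "(\<forall>T\<in>\<pi>. blk (elts T) = T) \<and> partition_on S (elts ` \<pi>)" using Q fin by auto
next
  assume *: "(\<forall>T\<in>\<pi>. blk (elts T) = T) \<and> partition_on S (elts ` \<pi>)"
  then have "\<pi> = blk ` elts ` \<pi>" by (force simp: image_image)
  then show "\<pi> \<in> Parts S" using * by (auto simp: Parts_def)
qed

lemma PartsI:
  assumes "finset S" "\<And>T. T \<in> \<pi> \<Longrightarrow> blk (elts T) = T \<and> elts T \<noteq> {} \<and> elts T \<subseteq> S"
    "\<And>s. s \<in> S \<Longrightarrow> \<exists>T\<in>\<pi>. s \<in> elts T"
    "\<And>T T' s. \<lbrakk>T \<in> \<pi>; T' \<in> \<pi>; s \<in> elts T; s \<in> elts T'\<rbrakk> \<Longrightarrow> T = T'"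
  shows "\<pi> \<in> Parts S"
proof -
  have "\<Union> (elts ` \<pi>) = S" using assms(2,3) by blast
  moreover have "disjoint (elts ` \<pi>)" using assms(4) by (auto simp: disjoint_def)
  moreover have "{} \<notin> elts ` \<pi>" using assms(2) by auto
  ultimately show ?thesis using assms(1,2) by (simp add: Parts_iff partition_on_def)
qed

lemma PartsD:
  assumes "finset S" "\<pi> \<in> Parts S"
  shows "\<And>T. T \<in> \<pi> \<Longrightarrow> blk (elts T) = T" "\<And>T. T \<in> \<pi> \<Longrightarrow> elts T \<noteq> {}" "\<And>T. T \<in> \<pi> \<Longrightarrow> elts T \<subseteq> S"
    "\<And>T. T \<in> \<pi> \<Longrightarrow> finset (elts T)" "\<And>s. s \<in> S \<Longrightarrow> \<exists>T\<in>\<pi>. s \<in> elts T"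
    "\<And>T T' s. \<lbrakk>T \<in> \<pi>; T' \<in> \<pi>; s \<in> elts T; s \<in> elts T'\<rbrakk> \<Longrightarrow> T = T'"
    "finset \<pi>"
proof -
  have *: "\<forall>T\<in>\<pi>. blk (elts T) = T" "\<Union> (elts ` \<pi>) = S" "disjoint (elts ` \<pi>)" "{} \<notin> elts ` \<pi>"
    using assms(2) unfolding Parts_iff[OF assms(1)] partition_on_def by auto
  show 1: "blk (elts T) = T" if "T \<in> \<pi>" for T using that * by auto
  show 2: "elts T \<noteq> {}" if "T \<in> \<pi>" for T using that * by force
  show 3: "elts T \<subseteq> S" if "T \<in> \<pi>" for T using that * by auto
  show "finset (elts T)" if "T \<in> \<pi>" for T
    using 2[OF that] 3[OF that] assms(1) by (auto simp: finset_def intro: finite_subset)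
  show "\<exists>T\<in>\<pi>. s \<in> elts T" if "s \<in> S" for s using that * by auto
  show "T = T'" if "T \<in> \<pi>" "T' \<in> \<pi>" "s \<in> elts T" "s \<in> elts T'" for T T' s
  proof -
    have "elts T = elts T'" using that *(3) by (auto simp: disjoint_def)
    then show ?thesis using 1 that by metis
  qed
  have "finite (elts ` \<pi>)" using assms(1) *(2) by (auto simp: finset_def intro: finite_UnionD)
  moreover have "inj_on elts \<pi>" using 1 by (metis inj_onI)
  ultimately have "finite \<pi>" by (rule finite_imageD)
  moreover have "\<pi> \<noteq> {}" using assms(1) *(2) by (auto simp: finset_def)
  ultimately show "finset \<pi>" by (simp add: finset_def)
qed

lemma Part_poset_iff:
  assumes "finset S"
  shows "(\<alpha>, \<beta>) \<in> Part_poset S \<longleftrightarrow> \<alpha> \<in> Parts S \<and> \<beta> \<in> Parts S \<and> (\<forall>V\<in>\<beta>. \<exists>U\<in>\<alpha>. elts V \<subseteq> elts U)"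
  using Parts_iff[OF assms] by (auto simp: Part_poset_def refines_def)

lemma Field_Part_poset: "finset S \<Longrightarrow> Field (Part_poset S) = Parts S"
proof -
  assume S: "finset S"
  have "(\<pi>, \<pi>) \<in> Part_poset S" if "\<pi> \<in> Parts S" for \<pi> using that
    by (auto simp: Part_poset_iff[OF S])
  then have "Parts S \<subseteq> Field (Part_poset S)" by (auto intro: FieldI1)
  moreover have "Field (Part_poset S) \<subseteq> Parts S" by (auto simp: Field_def Part_poset_iff[OF S])
  ultimately show ?thesis by blast
qed

definition sing :: "'a hfset set \<Rightarrow> 'a hfset set" where
  "sing S = (\<lambda>s. blk {s}) ` S"

lemma blk_singleton_in_Parts: "finset S \<Longrightarrow> {blk S} \<in> Parts S"
  by (rule PartsI) (auto simp: finset_def)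

lemma sing_in_Parts: "finset S \<Longrightarrow> sing S \<in> Parts S"
  by (rule PartsI) (auto simp: finset_def sing_def)

lemma min_Part_poset:
  assumes S: "finset S" shows "min_elems (Part_poset S) = {{blk S}}"
proof -
  have fS: "finite S" using S by (simp add: finset_def)
  have le: "({blk S}, \<pi>) \<in> Part_poset S" if "\<pi> \<in> Parts S" for \<pi>
    using that blk_singleton_in_Parts[OF S] PartsD(3)[OF S that] fS
    by (auto simp: Part_poset_iff[OF S])
  have "y = {blk S}" if y: "(y, {blk S}) \<in> Part_poset S" for y
  proof -
    obtain U where U: "U \<in> y" "S \<subseteq> elts U" and yP: "y \<in> Parts S" using y fS
      by (auto simp: Part_poset_iff[OF S])
    have eU: "elts U = S" using U PartsD(3)[OF S yP U(1)] by auto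
    have "T = U" if "T \<in> y" for T
      using PartsD(2,3)[OF S yP that] PartsD(6)[OF S yP that U(1)] eU by blast
    then have "y = {U}" using U(1) by blast
    then show ?thesis using PartsD(1)[OF S yP U(1)] eU by simp
  qed
  then show ?thesis using le blk_singleton_in_Parts[OF S]
    by (auto simp: min_elems_def Field_Part_poset[OF S])
qed

lemma max_Part_poset:
  assumes S: "finset S" shows "max_elems (Part_poset S) = {sing S}"
proof -
  have le: "(\<pi>, sing S) \<in> Part_poset S" if "\<pi> \<in> Parts S" for \<pi>
    using that sing_in_Parts[OF S] PartsD(5)[OF S that]
    by (auto simp: Part_poset_iff[OF S] sing_def)
  have "y = sing S" if y: "(sing S, y) \<in> Part_poset S" for y
  proof -
    have yP: "y \<in> Parts S" and sub: "\<And>V. V \<in> y \<Longrightarrow> \<exists>s\<in>S. elts V \<subseteq> {s}"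
      using y by (auto simp: Part_poset_iff[OF S] sing_def)
    have V: "\<exists>s\<in>S. V = blk {s} \<and> elts V = {s}" if "V \<in> y" for V
    proof -
      obtain s where s: "s \<in> S" "elts V \<subseteq> {s}" using sub[OF \<open>V \<in> y\<close>] by blast
      then have "elts V = {s}" using PartsD(2)[OF S yP \<open>V \<in> y\<close>] by blast
      then show ?thesis using s(1) PartsD(1)[OF S yP \<open>V \<in> y\<close>] by metis
    qed
    have "blk {s} \<in> y" if "s \<in> S" for s
      using PartsD(5)[OF S yP that] V by fastforce
    then show ?thesis using V by (force simp: sing_def)
  qed
  then show ?thesis using le sing_in_Parts[OF S]
    by (auto simp: max_elems_def Field_Part_poset[OF S])
qed

lemma restr_union:
  assumes S: "finset S" and le: "(\<sigma>, \<pi>) \<in> Part_poset S"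
  shows "(\<Union>U\<in>\<sigma>. restr \<pi> U) = \<pi>"
  using le by (auto simp: restr_def Part_poset_iff[OF S])

lemma restr_disjoint:
  assumes S: "finset S" and le: "(\<sigma>, \<pi>) \<in> Part_poset S"
      and "U \<in> \<sigma>" "U' \<in> \<sigma>" "V \<in> restr \<pi> U" "V \<in> restr \<pi> U'"
  shows "U = U'"
proof -
  have P: "\<sigma> \<in> Parts S" "\<pi> \<in> Parts S" using le by (auto simp: Part_poset_iff[OF S])
  obtain s where "s \<in> elts V" using PartsD(2)[OF S P(2), of V] assms(5) by (auto simp: restr_def)
  then show ?thesis using PartsD(6)[OF S P(1) assms(3,4)] assms(5,6) by (auto simp: restr_def)
qed

lemma restr_in_Parts:
  assumes S: "finset S" and le: "(\<sigma>, \<pi>) \<in> Part_poset S" and U: "U \<in> \<sigma>"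
  shows "restr \<pi> U \<in> Parts (elts U)"
proof -
  have P: "\<sigma> \<in> Parts S" "\<pi> \<in> Parts S" using le by (auto simp: Part_poset_iff[OF S])
  show ?thesis
  proof (rule PartsI)
    show "finset (elts U)" by (rule PartsD(4)[OF S P(1) U])
    show "\<exists>T\<in>restr \<pi> U. s \<in> elts T" if "s \<in> elts U" for s
    proof -
      have "s \<in> S" using that PartsD(3)[OF S P(1) U] by auto
      then obtain V where V: "V \<in> \<pi>" "s \<in> elts V" using PartsD(5)[OF S P(2)] by blast
      then obtain U' where "U' \<in> \<sigma>" "elts V \<subseteq> elts U'" using le by (auto simp: Part_poset_iff[OF S])
      then have "U' = U" using PartsD(6)[OF S P(1) _ U] V that by blast
      then show ?thesis using V \<open>elts V \<subseteq> elts U'\<close> by (auto simp: restr_def)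
    qed
  qed (use PartsD(1,2,6)[OF S P(2)] in \<open>auto simp: restr_def\<close>)
qed

lemma restr_finset:
  assumes S: "finset S" and le: "(\<sigma>, \<pi>) \<in> Part_poset S" and U: "U \<in> \<sigma>"
  shows "finset (restr \<pi> U)" "restr \<pi> U \<subseteq> \<pi>" "elts (blk (restr \<pi> U)) = restr \<pi> U" "finset (elts U)"
proof -
  have P: "\<sigma> \<in> Parts S" using le by (auto simp: Part_poset_iff[OF S])
  show 1: "finset (elts U)" by (rule PartsD(4)[OF S P U])
  show "finset (restr \<pi> U)" by (rule PartsD(7)[OF 1 restr_in_Parts[OF assms]])
  then show "elts (blk (restr \<pi> U)) = restr \<pi> U" by (simp add: finset_def)
  show "restr \<pi> U \<subseteq> \<pi>" by (auto simp: restr_def)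
qed

lemma inj_on_restr:
  assumes S: "finset S" and le: "(\<sigma>, \<pi>) \<in> Part_poset S"
  shows "inj_on (\<lambda>T. blk (restr \<pi> T)) \<sigma>"
proof (rule inj_onI)
  fix U U' assume U: "U \<in> \<sigma>" "U' \<in> \<sigma>" "blk (restr \<pi> U) = blk (restr \<pi> U')"
  then have "restr \<pi> U = restr \<pi> U'" using restr_finset(3)[OF S le] by metis
  moreover obtain V where "V \<in> restr \<pi> U" using restr_finset(1)[OF S le U(1)]
    by (auto simp: finset_def)
  ultimately show "U = U'" using restr_disjoint[OF S le U(1,2)] by blast
qed

lemma part_lower_in_Parts:
  assumes S: "finset S" and le: "(\<sigma>, \<pi>) \<in> Part_poset S"
  shows "part_lower \<pi> \<sigma> \<in> Parts \<pi>"
proof -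
  have P: "\<sigma> \<in> Parts S" "\<pi> \<in> Parts S" using le by (auto simp: Part_poset_iff[OF S])
  show ?thesis
  proof (rule PartsI)
    show "finset \<pi>" by (rule PartsD(7)[OF S P(2)])
    fix X assume "X \<in> part_lower \<pi> \<sigma>"
    then obtain U where "U \<in> \<sigma>" "X = blk (restr \<pi> U)" by (auto simp: part_lower_def)
    then show "blk (elts X) = X \<and> elts X \<noteq> {} \<and> elts X \<subseteq> \<pi>"
      using restr_finset[OF S le] by (simp add: finset_def)
  next
    fix V assume "V \<in> \<pi>"
    then obtain U where "U \<in> \<sigma>" "V \<in> restr \<pi> U" using restr_union[OF S le] by blast
    then show "\<exists>X\<in>part_lower \<pi> \<sigma>. V \<in> elts X" using restr_finset(3)[OF S le]
      by (auto simp: part_lower_def)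
  next
    fix X X' V assume "X \<in> part_lower \<pi> \<sigma>" "X' \<in> part_lower \<pi> \<sigma>" "V \<in> elts X" "V \<in> elts X'"
    then show "X = X'" using restr_finset(3)[OF S le] restr_disjoint[OF S le]
      by (force simp: part_lower_def)
  qed
qed

text \<open>The coarse partition is recovered by taking, for each block of blocks, the union of its
  members.\<close>

lemma part_lower_inj:
  assumes S: "finset S" and le: "(\<sigma>, \<pi>) \<in> Part_poset S" and le': "(\<sigma>', \<pi>) \<in> Part_poset S"
    and eq: "part_lower \<pi> \<sigma> = part_lower \<pi> \<sigma>'"
  shows "\<sigma> = \<sigma>'"
proof -
  have rec: "(\<lambda>X. blk (\<Union> (elts ` elts X))) ` part_lower \<pi> \<tau> = \<tau>" if le: "(\<tau>, \<pi>) \<in> Part_poset S"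
      for \<tau>
  proof -
    have P: "\<tau> \<in> Parts S" using le by (auto simp: Part_poset_iff[OF S])
    have "blk (\<Union> (elts ` elts (blk (restr \<pi> U)))) = U" if U: "U \<in> \<tau>" for U
    proof -
      have "\<Union> (elts ` restr \<pi> U) = elts U"
        using PartsD(3,5)[OF restr_finset(4)[OF S le U] restr_in_Parts[OF S le U]] by blast
      then show ?thesis using restr_finset(3)[OF S le U] PartsD(1)[OF S P U] by simp
    qed
    then show ?thesis by (simp add: part_lower_def image_image)
  qed
  show ?thesis using rec[OF le] rec[OF le'] eq by metis
qed

lemma restr_self:
  assumes S: "finset S" and "\<pi> \<in> Parts S" "T \<in> \<pi>"
  shows "restr \<pi> T = {T}"
  using PartsD(2,6)[OF S assms(2)] assms(3) by (force simp: restr_def)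

lemma part_lower_self:
  assumes S: "finset S" and "\<pi> \<in> Parts S"
  shows "part_lower \<pi> \<pi> = sing \<pi>"
  using restr_self[OF assms] by (auto simp: part_lower_def sing_def)

lemma part_lower_min:
  assumes S: "finset S" and P: "\<pi> \<in> Parts S"
  shows "part_lower \<pi> {blk S} = {blk \<pi>}"
proof -
  have "restr \<pi> (blk S) = \<pi>" using PartsD(3)[OF S P] S by (auto simp: restr_def finset_def)
  then show ?thesis by (simp add: part_lower_def)
qed

lemma part_lower_min_iff:
  assumes S: "finset S" and le: "(\<sigma>, \<pi>) \<in> Part_poset S"
  shows "part_lower \<pi> \<sigma> = {blk \<pi>} \<longleftrightarrow> \<sigma> = {blk S}"
proof -
  have P: "\<pi> \<in> Parts S" using le by (auto simp: Part_poset_iff[OF S])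
  have "({blk S}, \<pi>) \<in> Part_poset S"
    using P blk_singleton_in_Parts[OF S] PartsD(3)[OF S P] S
    by (auto simp: Part_poset_iff[OF S] finset_def)
  then show ?thesis using part_lower_inj[OF S le] part_lower_min[OF S P] by metis
qed

lemma restr_sing_iff:
  assumes S: "finset S" and le: "(\<pi>, \<beta>) \<in> Part_poset S"
  shows "(\<forall>T\<in>\<pi>. restr \<beta> T = sing (elts T)) \<longleftrightarrow> \<beta> = sing S"
proof
  have P: "\<pi> \<in> Parts S" using le by (auto simp: Part_poset_iff[OF S])
  assume "\<forall>T\<in>\<pi>. restr \<beta> T = sing (elts T)"
  then have "\<beta> = (\<Union>T\<in>\<pi>. sing (elts T))" using restr_union[OF S le] by simp
  also have "\<dots> = sing S" using PartsD(3,5)[OF S P] by (force simp: sing_def)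
  finally show "\<beta> = sing S" .
next
  have P: "\<pi> \<in> Parts S" using le by (auto simp: Part_poset_iff[OF S])
  assume "\<beta> = sing S"
  then show "\<forall>T\<in>\<pi>. restr \<beta> T = sing (elts T)"
    using PartsD(3)[OF S P] by (force simp: sing_def restr_def)
qed

lemma restr_eqD:
  assumes S: "finset S" and "(\<sigma>, \<pi>) \<in> Part_poset S" "(\<sigma>, \<pi>') \<in> Part_poset S" "\<And>U. U \<in> \<sigma>
      \<Longrightarrow> restr \<pi> U = restr \<pi>' U"
  shows "\<pi> = \<pi>'"
proof -
  have "(\<Union>U\<in>\<sigma>. restr \<pi> U) = (\<Union>U\<in>\<sigma>. restr \<pi>' U)" by (rule SUP_cong[OF refl assms(4)])
  then show ?thesis using restr_union[OF S assms(2)] restr_union[OF S assms(3)] by simp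
qed

section \<open>Relabelling of partitions along injections\<close>

lemma finset_image: "finset S \<Longrightarrow> finset (f ` S)"
  by (simp add: finset_def)

lemma elts_blk_map: "finite (elts T) \<Longrightarrow> elts (blk_map f T) = f ` elts T"
  by (simp add: blk_map_def)

lemma blk_map_blk_map: "finite (elts T) \<Longrightarrow> blk_map g (blk_map f T) = blk ((g \<circ> f) ` elts T)"
  by (simp add: blk_map_def image_comp)

lemma blk_map_inverse:
  assumes "blk (elts T) = T" "finite (elts T)" "elts T \<subseteq> S" "inj_on f S"
  shows "blk_map (inv_into S f) (blk_map f T) = T"
proof -
  have "(inv_into S f \<circ> f) ` elts T = elts T" using assms(3,4)
    by (force simp: inv_into_f_f subset_eq)
  then show ?thesis using assms(1,2) by (simp add: blk_map_blk_map)
qed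

lemma blk_map_Parts:
  assumes S: "finset S" and P: "\<pi> \<in> Parts S" and f: "inj_on f S"
  shows "blk_map f ` \<pi> \<in> Parts (f ` S)" "inj_on (blk_map f) \<pi>"
proof -
  have fin: "finite (elts T)" if "T \<in> \<pi>" for T using PartsD(4)[OF S P that]
    by (simp add: finset_def)
  show "inj_on (blk_map f) \<pi>"
    using blk_map_inverse[OF PartsD(1)[OF S P] fin PartsD(3)[OF S P] f] by (metis inj_onI)
  show "blk_map f ` \<pi> \<in> Parts (f ` S)"
  proof (rule PartsI[OF finset_image[OF S]])
    fix X X' y assume "X \<in> blk_map f ` \<pi>" "X' \<in> blk_map f ` \<pi>" "y \<in> elts X" "y \<in> elts X'"
    then obtain T T' where T: "T \<in> \<pi>" "T' \<in> \<pi>" "X = blk_map f T" "X' = blk_map f T'" by auto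
    then obtain s s' where "s \<in> elts T" "s' \<in> elts T'" "y = f s" "y = f s'"
      using \<open>y \<in> elts X\<close> \<open>y \<in> elts X'\<close> fin by (auto simp: elts_blk_map)
    then have "s = s'" using f PartsD(3)[OF S P] T by (metis inj_onD subsetD)
    then show "X = X'" using T PartsD(6)[OF S P T(1,2)] \<open>s \<in> elts T\<close> \<open>s' \<in> elts T'\<close> by blast
  qed (use PartsD(1-3,5)[OF S P] fin in \<open>fastforce simp: elts_blk_map blk_map_def\<close>)+
qed

lemma blk_map_image_inverse:
  assumes S: "finset S" and P: "\<pi> \<in> Parts S" and f: "inj_on f S"
  shows "blk_map (inv_into S f) ` blk_map f ` \<pi> = \<pi>"
  using blk_map_inverse[OF PartsD(1)[OF S P] _ PartsD(3)[OF S P] f] PartsD(4)[OF S P]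
  by (force simp: image_image finset_def)

section \<open>Composition on cochains\<close>

lemma coh_class_self_rep:
  assumes r: "finite_poset r" and C: "C \<in> {chat_chains, c_chains}" and X: "X \<in> carrier (coh C r n)"
  obtains c where "c \<in> Zc r (start C r) (max_elems r) n" "X = coh_class C r n c"
  using X by (auto simp: coh_eq_fun_quot[OF r C] carrier_fun_quot coh_class_eq_fcoset[OF r C])

lemma poset_iso_min:
  assumes f: "\<And>x y. (x, y) \<in> r \<Longrightarrow> (f x, f y) \<in> r'" and g: "\<And>x y. (x, y) \<in> r' \<Longrightarrow> (g x, g y) \<in> r"
    and gf: "\<And>x. x \<in> Field r \<Longrightarrow> g (f x) = x" and fg: "\<And>x. x \<in> Field r' \<Longrightarrow> f (g x) = x"
        and x: "x \<in> Field r"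
  shows "f x \<in> min_elems r' \<longleftrightarrow> x \<in> min_elems r" "f x \<in> max_elems r' \<longleftrightarrow> x \<in> max_elems r" "f x
      \<in> Field r'"
proof -
  show F: "f x \<in> Field r'" using x f by (auto simp: Field_def)
  show "f x \<in> min_elems r' \<longleftrightarrow> x \<in> min_elems r"
    using F x f g gf fg unfolding min_elems_def by simp (metis FieldI1)
  show "f x \<in> max_elems r' \<longleftrightarrow> x \<in> max_elems r"
    using F x f g gf fg unfolding max_elems_def by simp (metis FieldI2)
qed

locale op_species = operadic_poset_species P for P :: "('a, 'p) op_poset_species" +
  assumes pullbacks: "has_pullbacks P" and units: "has_units P"
begin

abbreviation "bpos \<equiv> \<lambda>T. pos P (elts T)"
abbreviation "prodP \<pi> \<equiv> prod_poset \<pi> bpos"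
abbreviation "ZP C S m \<equiv> Zc (pos P S) (start C (pos P S)) (max_elems (pos P S)) m"
abbreviation "BP C S m \<equiv> Bc (pos P S) (start C (pos P S)) (max_elems (pos P S)) m"
abbreviation "ZQ \<pi> m \<equiv> Zc (prodP \<pi>) (min_elems (prodP \<pi>)) (max_elems (prodP \<pi>)) m"
abbreviation "BQ \<pi> m \<equiv> Bc (prodP \<pi>) (min_elems (prodP \<pi>)) (max_elems (prodP \<pi>)) m"
abbreviation "ZM S m \<equiv> Zc (pos P S) (min_elems (pos P S)) (max_elems (pos P S)) m"
abbreviation "chP C S l \<equiv> chl (pos P S) (start C (pos P S)) (max_elems (pos P S)) l"

lemma anchor_le: "\<lbrakk>finset S; (x, y) \<in> pos P S\<rbrakk> \<Longrightarrow> (anchor P S x, anchor P S y) \<in> Part_poset S"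
  using anchor_mono by (auto simp: compat_def)

lemma anchor_Parts: "\<lbrakk>finset S; x \<in> Field (pos P S)\<rbrakk> \<Longrightarrow> anchor P S x \<in> Parts S"
  using anchor_le[OF _ finite_poset_refl[OF pos_poset]] by (auto simp: Part_poset_iff)

lemma min_iff: "\<lbrakk>finset S; x \<in> Field (pos P S)\<rbrakk> \<Longrightarrow> x \<in> min_elems (pos P S) \<longleftrightarrow> anchor P S x = {blk S}"
  unfolding anchor_min[symmetric] by (simp add: min_Part_poset)

lemma max_iff: "\<lbrakk>finset S; x \<in> Field (pos P S)\<rbrakk> \<Longrightarrow> x \<in> max_elems (pos P S) \<longleftrightarrow> anchor P S x = sing S"
  unfolding anchor_max[symmetric] by (simp add: max_Part_poset)

lemma anchor_finset: "\<lbrakk>finset S; x \<in> Field (pos P S)\<rbrakk> \<Longrightarrow> finset (anchor P S x)"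
  by (rule PartsD(7)[OF _ anchor_Parts])

lemma block_finset: "\<lbrakk>finset S; \<pi> \<in> Parts S; T \<in> \<pi>\<rbrakk> \<Longrightarrow> finset (elts T)"
  by (rule PartsD(4))

lemma words: "\<lbrakk>finset S; \<pi> \<in> Parts S\<rbrakk> \<Longrightarrow> product_words \<pi> bpos"
  using PartsD(7)[of S \<pi>] by unfold_locales (simp_all add: finset_def[of \<pi>] pos_poset block_finset)

section \<open>Monotonicity and end conditions of the structure maps\<close>

lemma lower_le:
  assumes S: "finset S" and "x \<in> Field (pos P S)" "(y, y') \<in> pos P S" "(y', x) \<in> pos P S"
  shows "(lower P S x y, lower P S x y') \<in> pos P (anchor P S x)"
proof -
  have "(y, x) \<in> pos P S" using finite_poset_trans[OF pos_poset[OF S]] assms by blast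
  then have "(y, y') \<in> down (pos P S) x" using assms by (auto simp: down_def under_def)
  then show ?thesis using lower_mono[OF S assms(2)] by (auto simp: compat_def)
qed

lemma upper_le:
  assumes S: "finset S" and "x \<in> Field (pos P S)" "(x, y) \<in> pos P S" "(y, y') \<in> pos P S"
  shows "(upper P S x y, upper P S x y') \<in> prodP (anchor P S x)"
proof -
  have "(x, y') \<in> pos P S" using finite_poset_trans[OF pos_poset[OF S]] assms by blast
  then have "(y, y') \<in> up (pos P S) x" using assms by (auto simp: up_def above_def)
  then show ?thesis using upper_mono[OF S assms(2)] by (auto simp: compat_def)
qed

lemma pos_FieldI: "(x, y) \<in> pos P S \<Longrightarrow> x \<in> Field (pos P S) \<and> y \<in> Field (pos P S)"
  by (auto simp: Field_def)

lemma lower_Field: "\<lbrakk>finset S; (y, x) \<in> pos P S\<rbrakk> \<Longrightarrow> lower P S x y \<in> Field (pos P (anchor P S x))"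
  using lower_le[of S x y y] finite_poset_refl[OF pos_poset]
  by (auto dest!: pos_FieldI intro: FieldI1)

lemma upper_Field: "\<lbrakk>finset S; (x, y) \<in> pos P S\<rbrakk> \<Longrightarrow> upper P S x y \<in> Field (prodP (anchor P S x))"
  using upper_le[of S x y y] finite_poset_refl[OF pos_poset]
  by (auto dest!: pos_FieldI intro: FieldI1)

lemma upper_block_le:
  assumes "finset S" "(x, y) \<in> pos P S" "(y, y') \<in> pos P S" "T \<in> anchor P S x"
  shows "(upper P S x y T, upper P S x y' T) \<in> pos P (elts T)"
  using prod_poset_mono[OF upper_le[OF assms(1) _ assms(2,3)] assms(4)] pos_FieldI[OF assms(2)]
  by simp

lemma upper_block_Field:
  assumes "finset S" "(x, y) \<in> pos P S" "T \<in> anchor P S x"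
  shows "upper P S x y T \<in> Field (pos P (elts T))"
  using upper_block_le[OF assms(1,2) finite_poset_refl[OF pos_poset] assms(3)] assms pos_FieldI[OF
      assms(2)]
  by (auto intro: FieldI1)

text \<open>Minimality is detected by the anchor, and \<open>part_lower\<close> takes the value
  \<open>{blk \<pi>}\<close> only at the coarsest partition.\<close>

lemma lower_min_iff:
  assumes S: "finset S" and yx: "(y, x) \<in> pos P S"
  shows "lower P S x y \<in> min_elems (pos P (anchor P S x)) \<longleftrightarrow> y \<in> min_elems (pos P S)"
  using part_lower_min_iff[OF S anchor_le[OF S yx]] pos_FieldI[OF yx]
  by (simp add: min_iff anchor_lower S yx anchor_finset lower_Field)

text \<open>The anchors only show that \<open>lower P S x y\<close> is maximal exactly if
  \<open>y\<close> and \<open>x\<close> have the same anchor, and a fibre of the anchor may contain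
  comparable elements. That \<open>y = x\<close> then follows is the first condition of
  \<open>has_pullbacks\<close>.\<close>

lemma lower_max_iff:
  assumes S: "finset S" and yx: "(y, x) \<in> pos P S"
  shows "lower P S x y \<in> max_elems (pos P (anchor P S x)) \<longleftrightarrow> y = x"
proof
  have x: "x \<in> Field (pos P S)" using pos_FieldI[OF yx] by simp
  assume "lower P S x y \<in> max_elems (pos P (anchor P S x))"
  then have "y \<in> max_elems (down (pos P S) x)" using pullbacks S x yx
    by (auto simp: has_pullbacks_def)
  then show "y = x" using max_down[OF pos_poset[OF S] x] by simp
next
  assume yx': "y = x"
  have x: "x \<in> Field (pos P S)" using pos_FieldI[OF yx] by simp
  have "anchor P (anchor P S x) (lower P S x x) = sing (anchor P S x)"
    using anchor_lower[OF S yx] part_lower_self[OF S anchor_Parts[OF S x]] yx' by simp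
  then show "lower P S x y \<in> max_elems (pos P (anchor P S x))"
    using lower_Field[OF S yx] yx' by (simp add: max_iff anchor_finset S x)
qed

lemma lower_start_iff:
  assumes S: "finset S" and yx: "(y, x) \<in> pos P S"
  shows "lower P S x y \<in> start C (pos P (anchor P S x)) \<longleftrightarrow> y \<in> start C (pos P S)"
  using lower_min_iff[OF assms] lower_Field[OF assms] pos_FieldI[OF yx] by (simp add: start_def)

lemma prod_min_iff:
  assumes "finset S" "\<pi> \<in> Parts S" "h \<in> Field (prodP \<pi>)"
  shows "h \<in> min_elems (prodP \<pi>) \<longleftrightarrow> (\<forall>T\<in>\<pi>. anchor P (elts T) (h T) = {blk (elts T)})"
    "h \<in> max_elems (prodP \<pi>) \<longleftrightarrow> (\<forall>T\<in>\<pi>. anchor P (elts T) (h T) = sing (elts T))"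
proof -
  interpret product_words \<pi> bpos by (rule words[OF assms(1,2)])
  show "h \<in> min_elems (prodP \<pi>) \<longleftrightarrow> (\<forall>T\<in>\<pi>. anchor P (elts T) (h T) = {blk (elts T)})"
    "h \<in> max_elems (prodP \<pi>) \<longleftrightarrow> (\<forall>T\<in>\<pi>. anchor P (elts T) (h T) = sing (elts T))"
    using assms(3) unfolding minQ maxQ FQ
    by (auto simp: PiE_iff min_iff max_iff block_finset[OF assms(1,2)])
qed

text \<open>Dual to \<open>lower_max_iff\<close>: the anchors cannot separate \<open>x\<close> from
  larger elements of its fibre, so one direction is the second condition of
  \<open>has_pullbacks\<close>.\<close>

lemma upper_min_iff:
  assumes S: "finset S" and xy: "(x, y) \<in> pos P S"
  shows "upper P S x y \<in> min_elems (prodP (anchor P S x)) \<longleftrightarrow> y = x"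
proof
  have x: "x \<in> Field (pos P S)" using pos_FieldI[OF xy] by simp
  assume "upper P S x y \<in> min_elems (prodP (anchor P S x))"
  then have "y \<in> min_elems (up (pos P S) x)" using pullbacks S x xy
    by (auto simp: has_pullbacks_def)
  then show "y = x" using min_up[OF pos_poset[OF S] x] by simp
next
  assume yx: "y = x"
  have x: "x \<in> Field (pos P S)" using pos_FieldI[OF xy] by simp
  have "anchor P (elts T) (upper P S x x T) = {blk (elts T)}" if "T \<in> anchor P S x" for T
    using anchor_upper[OF S _ that, of x] xy yx restr_self[OF S anchor_Parts[OF S x] that]
      PartsD(1)[OF S anchor_Parts[OF S x] that] by simp
  then show "upper P S x y \<in> min_elems (prodP (anchor P S x))"
    using prod_min_iff(1)[OF S anchor_Parts[OF S x] upper_Field[OF S xy]] yx by simp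
qed

text \<open>Decided by anchors alone: a refinement of the anchor of \<open>x\<close> is the finest
  partition exactly if it is so inside every block.\<close>

lemma upper_max_iff:
  assumes S: "finset S" and xy: "(x, y) \<in> pos P S"
  shows "upper P S x y \<in> max_elems (prodP (anchor P S x)) \<longleftrightarrow> y \<in> max_elems (pos P S)"
proof -
  have x: "x \<in> Field (pos P S)" "y \<in> Field (pos P S)" using pos_FieldI[OF xy] by auto
  have "(\<forall>T\<in>anchor P S x. anchor P (elts T) (upper P S x y T) = sing (elts T)) \<longleftrightarrow> anchor P S y
      = sing S"
    using restr_sing_iff[OF S anchor_le[OF S xy]] anchor_upper[OF S xy] by simp
  then show ?thesis
    using prod_min_iff(2)[OF S anchor_Parts[OF S x(1)] upper_Field[OF S xy]] max_iff[OF S x(2)]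
    by simp
qed

text \<open>
  The cochains \<open>\<phi>\<^sub>x\<^sup>*(a)\<close> and \<open>\<psi>\<^sub>x\<^sup>*(K)\<close>, regarded as cochains on the chains of \<open>P(S)\<close> that end,
  respectively start, at \<open>x\<close>.
\<close>

definition lo :: "('p rel \<Rightarrow> nat \<Rightarrow> 'p list set) \<Rightarrow> 'a hfset set \<Rightarrow> nat \<Rightarrow> 'p \<Rightarrow> ('p list \<Rightarrow> 'k) \<Rightarrow> 'p
    list \<Rightarrow> 'k::comm_ring_1" where
  "lo C S m x a = pl (pos P S) (start C (pos P S)) {x} (Suc m) (lower P S x) a"

definition hi :: "'a hfset set \<Rightarrow> nat \<Rightarrow> 'p \<Rightarrow> (('a hfset \<Rightarrow> 'p) list \<Rightarrow> 'k) \<Rightarrow> 'p list \<Rightarrow>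
    'k::comm_ring_1" where
  "hi S t x K = pl (pos P S) {x} (max_elems (pos P S)) (Suc t) (upper P S x) K"

lemma pl_chl_cong: "chl r A B l = chl r' A' B' l \<Longrightarrow> pl r A B l f c = pl r' A' B' l f c"
  by (simp add: pl_def fun_eq_iff)

context
  fixes S :: "'a hfset set" and x :: 'p and C :: "'p rel \<Rightarrow> nat \<Rightarrow> 'p list set"
  assumes S: "finset S" and x: "x \<in> Field (pos P S)" and C: "C \<in> {chat_chains, c_chains}"
begin

lemma pS: "finite_poset (pos P S)"
  by (rule pos_poset[OF S])

lemma p\<pi>: "finite_poset (pos P (anchor P S x))"
  by (rule pos_poset[OF anchor_finset[OF S x]])

lemma pprod: "finite_poset (prodP (anchor P S x))"
proof -
  interpret product_words "anchor P S x" bpos by (rule words[OF S anchor_Parts[OF S x]])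
  show ?thesis by (rule Q)
qed

lemma lower_conditions:
  "(y, y') \<in> down (pos P S) x \<Longrightarrow> (lower P S x y, lower P S x y') \<in> pos P (anchor P S x)"
  "y \<in> Field (down (pos P S) x) \<Longrightarrow>
    lower P S x y \<in> start C (pos P (anchor P S x)) \<longleftrightarrow> y \<in> start C (down (pos P S) x)"
  "y \<in> Field (down (pos P S) x) \<Longrightarrow>
    lower P S x y \<in> max_elems (pos P (anchor P S x)) \<longleftrightarrow> y \<in> max_elems (down (pos P S) x)"
  using lower_mono[OF S x] lower_start_iff[OF S] lower_max_iff[OF S]
  by (auto simp: compat_def Field_down[OF pS x] start_down[OF pS x] max_down[OF pS x])

lemma upper_conditions:
  "(y, y') \<in> up (pos P S) x \<Longrightarrow> (upper P S x y, upper P S x y') \<in> prodP (anchor P S x)"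
  "y \<in> Field (up (pos P S) x) \<Longrightarrow>
    upper P S x y \<in> min_elems (prodP (anchor P S x)) \<longleftrightarrow> y \<in> min_elems (up (pos P S) x)"
  "y \<in> Field (up (pos P S) x) \<Longrightarrow>
    upper P S x y \<in> max_elems (prodP (anchor P S x)) \<longleftrightarrow> y \<in> max_elems (up (pos P S) x)"
  using upper_mono[OF S x] upper_min_iff[OF S] upper_max_iff[OF S]
  by (auto simp: compat_def Field_up[OF pS x] min_up[OF pS x] max_up[OF pS x])

lemma lo_alt: "lo C S m x a = pl (down (pos P S) x) (start C (down (pos P S) x)) (max_elems (down
    (pos P S) x)) (Suc m) (lower P S x) a"
  unfolding lo_def by (rule pl_chl_cong) (rule chl_down[OF pS x, symmetric])

lemma hi_alt: "hi S t x K = pl (up (pos P S) x) (min_elems (up (pos P S) x)) (max_elems (up (pos P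
    S) x)) (Suc t) (upper P S x) K"
  unfolding hi_def by (rule pl_chl_cong) (rule chl_up[OF pS x, symmetric])

lemma lo_Zc:
  assumes "a \<in> ZP C (anchor P S x) m"
  shows "lo C S m x a \<in> Zc (pos P S) (start C (pos P S)) {x} m"
  unfolding lo_alt Zc_Bc_cong(1)[OF chl_down[OF pS x], symmetric]
proof (rule pl_Zc[OF finite_poset_down[OF pS] p\<pi> lower_conditions(1) _ _ assms])
qed (assumption | rule lower_conditions(2,3)[OF FieldI2])+

lemma hi_Zc:
  assumes "K \<in> ZQ (anchor P S x) t"
  shows "hi S t x K \<in> Zc (pos P S) {x} (max_elems (pos P S)) t"
  unfolding hi_alt Zc_Bc_cong(1)[OF chl_up[OF pS x], symmetric]
proof (rule pl_Zc[OF finite_poset_up[OF pS] pprod upper_conditions(1) _ _ assms])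
qed (assumption | rule upper_conditions(2,3)[OF FieldI2])+

lemma hi_Bc:
  assumes "K \<in> BQ (anchor P S x) t"
  shows "hi S t x K \<in> Bc (pos P S) {x} (max_elems (pos P S)) t"
  unfolding hi_alt Zc_Bc_cong(2)[OF chl_up[OF pS x], symmetric]
proof (rule pl_Bc[OF finite_poset_up[OF pS] pprod upper_conditions(1) _ _ assms])
qed (assumption | rule upper_conditions(2,3)[OF FieldI2])+

lemma pull_coh_lower:
  assumes a: "a \<in> ZP C (anchor P S x) m"
  shows "pull_coh C (down (pos P S) x) m (lower P S x) (coh_class C (pos P (anchor P S x)) m a) =
    fcoset (Bc (pos P S) (start C (pos P S)) {x} m) (lo C S m x a)"
  unfolding coh_class_eq_fcoset[OF p\<pi> C] lo_alt Zc_Bc_cong(2)[OF chl_down[OF pS x], symmetric]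
  by (rule pull_coh_class[OF finite_poset_down[OF pS] p\<pi> C lower_conditions convex_start
        antichain_convex[OF p\<pi> antichain_max] a])

lemma pull_coh_upper:
  assumes K: "K \<in> ZQ (anchor P S x) t"
  shows "pull_coh c_chains (up (pos P S) x) t (upper P S x)
      (fcoset (BQ (anchor P S x) t) K) =
    fcoset (Bc (pos P S) {x} (max_elems (pos P S)) t) (hi S t x K)"
  unfolding hi_alt Zc_Bc_cong(2)[OF chl_up[OF pS x], symmetric]
  using pull_coh_class[OF finite_poset_up[OF pS] pprod, of c_chains x "upper P S x", OF _
      upper_conditions(1) _ _
      antichain_convex[OF pprod antichain_min] antichain_convex[OF pprod antichain_max] K]
          upper_conditions(2,3)
  by simp

end

section \<open>The composition maps on cochains\<close>

definition fibre :: "'a hfset set \<Rightarrow> 'a hfset set \<Rightarrow> 'p set" where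
  "fibre S \<pi> = {x \<in> Field (pos P S). anchor P S x = \<pi>}"

definition cc :: "('p rel \<Rightarrow> nat \<Rightarrow> 'p list set) \<Rightarrow> 'a hfset set \<Rightarrow> 'a hfset set \<Rightarrow> nat \<Rightarrow> nat \<Rightarrow> ('p
    list \<Rightarrow> 'k)
    \<Rightarrow> (('a hfset \<Rightarrow> 'p) list \<Rightarrow> 'k) \<Rightarrow> 'p list \<Rightarrow> 'k::comm_ring_1" where
  "cc C S \<pi> m t a K = (\<lambda>z. \<Sum>x\<in>fibre S \<pi>. cup m (lo C S m x a) (hi S t x K) z)"

lemma finite_fibre: "finset S \<Longrightarrow> finite (fibre S \<pi>)"
  using finite_poset_finite[OF pos_poset] by (simp add: fibre_def)

context
  fixes S \<pi> :: "'a hfset set" and C :: "'p rel \<Rightarrow> nat \<Rightarrow> 'p list set"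
  assumes S: "finset S" and C: "C \<in> {chat_chains, c_chains}"
begin

lemma cc_Zc: "\<lbrakk>a \<in> ZP C \<pi> m; K \<in> ZQ \<pi> t\<rbrakk> \<Longrightarrow> cc C S \<pi> m t a K \<in> ZP C S (m + t)"
  unfolding cc_def
  by (intro fun_subspace_sum[OF fun_subspace_Zc finite_fibre[OF S]] cup_Zc[OF pos_poset[OF S]
      lo_Zc[OF S _ C] hi_Zc[OF S _ C]])
    (auto simp: fibre_def)

lemma cc_Bc_right: "\<lbrakk>a \<in> ZP C \<pi> m; K \<in> BQ \<pi> t\<rbrakk> \<Longrightarrow> cc C S \<pi> m t a K \<in> BP C S (m + t)"
  unfolding cc_def
  by (intro fun_subspace_sum[OF fun_subspace_Bc finite_fibre[OF S]] cup_Bc_right[OF pos_poset[OF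
      S] lo_Zc[OF S _ C] hi_Bc[OF S _ C]])
    (auto simp: fibre_def)

text \<open>The summand for \<open>x\<close> is nonzero only on chains whose entry at position
  \<open>m\<close> is \<open>x\<close>. Evaluated at a chain, the sum over the fibre therefore
  collapses to a condition on the anchor of \<open>z ! m\<close>.\<close>

lemma cc_eq:
  "cc C S \<pi> m t a K z = (if z \<in> chP C S (Suc (m + t)) \<and> anchor P S (z ! m) = \<pi>
    then a (map (lower P S (z ! m)) (take (Suc m) z)) * K (map (upper P S (z ! m)) (drop m z))
        else 0)"
proof -
  let ?r = "pos P S"
  let ?Z = "z \<in> chl ?r (start C ?r) (max_elems ?r) (Suc (m + t))"
  have p: "finite_poset ?r" by (rule pos_poset[OF S])
  have term_eq: "cup m (lo C S m x a) (hi S t x K) z = (if ?Z \<and> z ! m = x then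
      a (map (lower P S x) (take (Suc m) z)) * K (map (upper P S x) (drop m z)) else 0)" for x
  proof -
    have "take (Suc m) z \<in> chl ?r (start C ?r) {x} (Suc m) \<and> drop m z
        \<in> chl ?r {x} (max_elems ?r) (Suc t) \<longleftrightarrow> ?Z \<and> z ! m = x"
      using chl_join[OF p, of m z "start C ?r" "{x}" "max_elems ?r" t] chl_take[of z ?r _ _ "Suc
          (m + t)" "Suc m" "{x}"]
        chl_drop[of z ?r _ _ "Suc (m + t)" m "{x}"] by auto
    then show ?thesis by (auto simp: cup_def lo_def hi_def pl_def)
  qed
  show ?thesis
  proof (cases ?Z)
    case True
    then have F: "z ! m \<in> Field ?r" using nth_mem[of m z] by (auto simp: chl_def wchain_def)
    have "cc C S \<pi> m t a K z = (\<Sum>x\<in>fibre S \<pi>. if x = z ! m then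
        a (map (lower P S (z ! m)) (take (Suc m) z)) * K (map (upper P S (z ! m)) (drop m z)) else
            0)"
      unfolding cc_def by (intro sum.cong) (auto simp: term_eq True)
    also have "\<dots> = (if z ! m \<in> fibre S \<pi> then
        a (map (lower P S (z ! m)) (take (Suc m) z)) * K (map (upper P S (z ! m)) (drop m z)) else
            0)"
      using finite_fibre[OF S] by simp
    finally show ?thesis using True F by (auto simp: fibre_def)
  qed (simp add: cc_def term_eq)
qed

lemma cc_add_left: "cc C S \<pi> m t (\<lambda>z. a z + a' z) K
    = (\<lambda>z. cc C S \<pi> m t a K z + cc C S \<pi> m t a' K z)"
  by (rule ext) (auto simp: cc_eq distrib_right)

lemma cc_smult_left: "cc C S \<pi> m t (\<lambda>z. k * a z) K = (\<lambda>z. k * cc C S \<pi> m t a K z)"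
  by (rule ext) (auto simp: cc_eq mult.assoc)

lemma cc_add_right: "cc C S \<pi> m t a (\<lambda>z. K z + K' z)
    = (\<lambda>z. cc C S \<pi> m t a K z + cc C S \<pi> m t a K' z)"
  by (rule ext) (auto simp: cc_eq distrib_left)

lemma cc_smult_right: "cc C S \<pi> m t a (\<lambda>z. k * K z) = (\<lambda>z. k * cc C S \<pi> m t a K z)"
  by (rule ext) (auto simp: cc_eq mult.left_commute)

end

abbreviation "cls w \<equiv> map (\<lambda>(T, n, c). (T, n, coh_class c_chains (pos P (elts T)) n c)) w"

abbreviation "kokP \<pi> w \<equiv> product_words.kok \<pi> bpos w"

lemma tdeg_cls [simp]: "tdeg (cls w) = tdeg w"
  by (induction w) auto

text \<open>Kuenneth morphism, pullbacks, concatenation and sum have all been computed on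
  representatives; their composite is \<open>cc\<close> applied to the word of the
  representatives.\<close>

lemma coh_comp_pure_class:
  assumes S: "finset S" and \<pi>: "\<pi> \<in> Parts S" and C: "C \<in> {chat_chains, c_chains}"
    and a: "a \<in> ZP C \<pi> m" and w: "kokP \<pi> w"
  shows "coh_comp_pure C P S \<pi> (m + tdeg w) ((m, coh_class C (pos P \<pi>) m a), cls w) =
    coh_class C (pos P S) (m + tdeg w) (cc C S \<pi> m (tdeg w) a (kunneth w))"
proof -
  interpret product_words \<pi> bpos by (rule words[OF S \<pi>])
  have p: "finite_poset (pos P S)" by (rule pos_poset[OF S])
  have K: "kunneth w \<in> ZQ \<pi> (tdeg w)" by (rule kunneth_Zc[OF w])
  have "mu_coh C (pos P S) (m + tdeg w) (pull_coh C (down (pos P S) x) m (lower P S x) (coh_class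
      C (pos P \<pi>) m a))
      (pull_coh c_chains (up (pos P S) x) (tdeg w) (upper P S x) (kunneth_coh bpos (cls w)))
    = fcoset (BP C S (m + tdeg w)) (cup m (lo C S m x a) (hi S (tdeg w) x (kunneth w)))" if x: "x
        \<in> fibre S \<pi>" for x
  proof -
    have xF: "x \<in> Field (pos P S)" and ax: "anchor P S x = \<pi>" using x by (auto simp: fibre_def)
    show ?thesis
      unfolding kunneth_coh_class[OF w]
      using pull_coh_lower[OF S xF C, of a m] pull_coh_upper[OF S xF C, of "kunneth w" "tdeg w"]
        mu_coh_class[OF p C lo_Zc[OF S xF C, of a m] hi_Zc[OF S xF C, of "kunneth w" "tdeg w"]] a K
      by (simp add: ax)
  qed
  then have "coh_comp_pure C P S \<pi> (m + tdeg w) ((m, coh_class C (pos P \<pi>) m a), cls w) =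
    finsum (coh C (pos P S) (m + tdeg w)) (\<lambda>x. fcoset (BP C S (m + tdeg w)) (cup m (lo C S m x a)
        (hi S (tdeg w) x (kunneth w)))) (fibre S \<pi>)"
    unfolding coh_comp_pure_def prod.case fibre_def[symmetric] tdeg_cls
  proof -
    interpret M: Module.module base_ring "coh C (pos P S) (m + tdeg w) :: ('b, _) module"
      unfolding coh_eq_fun_quot[OF p C] by (rule module_fun_quot[OF fun_subspace_Zc
          fun_subspace_Bc])
    assume "\<And>x. x \<in> fibre S \<pi> \<Longrightarrow> mu_coh C (pos P S) (m + tdeg w) (pull_coh C (down (pos P S) x) m
        (lower P S x) (coh_class C (pos P \<pi>) m a))
      (pull_coh c_chains (up (pos P S) x) (tdeg w) (upper P S x) (kunneth_coh bpos (cls w)))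
    = fcoset (BP C S (m + tdeg w)) (cup m (lo C S m x a) (hi S (tdeg w) x (kunneth w)))"
    then show "finsum (coh C (pos P S) (m + tdeg w)) (\<lambda>x. mu_coh C (pos P S) (m + tdeg w)
        (pull_coh C (down (pos P S) x) m (lower P S x) (coh_class C (pos P \<pi>) m a))
      (pull_coh c_chains (up (pos P S) x) (tdeg w) (upper P S x) (kunneth_coh bpos (cls w))))
          (fibre S \<pi>) =
      finsum (coh C (pos P S) (m + tdeg w)) (\<lambda>x. fcoset (BP C S (m + tdeg w)) (cup m (lo C S m x
          a) (hi S (tdeg w) x (kunneth w)))) (fibre S \<pi>)"
      using cup_Zc[OF p lo_Zc[OF S _ C] hi_Zc[OF S _ C]] a K
      by (intro M.finsum_cong') (auto simp: coh_eq_fun_quot[OF p C] carrier_fun_quot fibre_def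
          intro!: imageI)
  qed
  also have "\<dots> = fcoset (BP C S (m + tdeg w)) (cc C S \<pi> m (tdeg w) a (kunneth w))"
    unfolding coh_eq_fun_quot[OF p C] cc_def
    by (rule finsum_fun_quot[OF fun_subspace_Zc fun_subspace_Bc finite_fibre[OF S]])
      (use cup_Zc[OF p lo_Zc[OF S _ C] hi_Zc[OF S _ C]] a K in \<open>auto simp: fibre_def\<close>)
  finally show ?thesis by (simp add: coh_class_eq_fcoset[OF p C])
qed

end

section \<open>Linearity and functoriality\<close>

context
  fixes r :: "'p rel" and C :: "'p rel \<Rightarrow> nat \<Rightarrow> 'p list set"
  assumes r: "finite_poset r" and C: "C \<in> {chat_chains, c_chains}"
begin

lemma coh_module: "Module.module base_ring (coh C r n :: ('k::comm_ring_1, _) module)"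
  unfolding coh_eq_fun_quot[OF r C] by (rule module_fun_quot[OF fun_subspace_Zc fun_subspace_Bc])

lemma coh_class_carrier: "c \<in> Zc r (start C r) (max_elems r) n \<Longrightarrow> coh_class C r n c
    \<in> carrier (coh C r n)"
  by (simp add: coh_eq_fun_quot[OF r C] carrier_fun_quot coh_class_eq_fcoset[OF r C])

lemma coh_class_add: "coh_class C r n c \<oplus>\<^bsub>coh C r n\<^esub> coh_class C r n c'
    = coh_class C r n (\<lambda>z. c z + c' z)"
  by (simp add: coh_eq_fun_quot[OF r C] coh_class_eq_fcoset[OF r C] add_fun_quot[OF
      fun_subspace_Bc])

lemma coh_class_smult: "k \<odot>\<^bsub>coh C r n\<^esub> coh_class C r n c = coh_class C r n (\<lambda>z. k * c z)"
  by (simp add: coh_eq_fun_quot[OF r C] coh_class_eq_fcoset[OF r C] smult_fun_quot[OF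
      fun_subspace_Bc])

lemma coh_class_eq_iff: "coh_class C r n c = coh_class C r n c' \<longleftrightarrow> (\<lambda>z. c z - c' z)
    \<in> Bc r (start C r) (max_elems r) n"
  by (simp add: coh_class_eq_fcoset[OF r C] fcoset_eq_iff[OF fun_subspace_Bc])

end

lemma gcomp_coh_species [simp]: "gcomp (coh_species C P) S = coh C (pos P S)"
  by (simp add: coh_species_def)

context op_species
begin

section \<open>Descent of the composition maps to the tensor product\<close>

lemma cls_rep:
  assumes "\<And>T n y. (T, n, y) \<in> set w \<Longrightarrow> finset (elts T) \<and> y
      \<in> carrier (coh c_chains (pos P (elts T)) n)"
  shows "\<exists>w'. w = cls w' \<and> map fst w' = map fst w \<and>
    (\<forall>(T, n, c)\<in>set w'. c \<in> ZM (elts T) n)"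
  using assms
proof (induction w)
  case (Cons l w)
  obtain T n y where l: "l = (T, n, y)" by (cases l) auto
  have T: "finite_poset (pos P (elts T))" and y: "y \<in> carrier (coh c_chains (pos P (elts T)) n)"
    using Cons.prems[of T n y] l pos_poset by auto
  obtain c where c: "c \<in> ZM (elts T) n"
    "y = coh_class c_chains (pos P (elts T)) n c"
    using coh_class_self_rep[OF T _ y] by auto
  obtain w' where w': "w = cls w'" "map fst w' = map fst w"
    "\<forall>(T, n, c)\<in>set w'. c \<in> ZM (elts T) n"
    using Cons by force
  have "l # w = cls ((T, n, c) # w')" using c w' l by simp
  then show ?case using c w' l by (intro exI[of _ "(T, n, c) # w'"]) auto
qed simp

lemma kokP_iff:
  assumes "finset S" "\<pi> \<in> Parts S"
  shows "kokP \<pi> w \<longleftrightarrow> distinct (map fst w) \<and> fst ` set w = \<pi> \<and>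
    (\<forall>(T, n, c)\<in>set w. c \<in> ZM (elts T) n)"
proof -
  interpret product_words \<pi> bpos by (rule words[OF assms])
  show ?thesis by (simp add: kok_def)
qed

context
  fixes S \<pi> :: "'a hfset set" and C :: "'p rel \<Rightarrow> nat \<Rightarrow> 'p list set"
  assumes S: "finset S" and \<pi>: "\<pi> \<in> Parts S" and C: "C \<in> {chat_chains, c_chains}"
begin

abbreviation "gens \<equiv> tgens (coh C (pos P \<pi>)) \<pi> (\<lambda>T. coh c_chains (pos P (elts T)))"

lemma p\<pi>': "finite_poset (pos P \<pi>)"
  by (rule pos_poset[OF PartsD(7)[OF S \<pi>]])

lemma pS': "finite_poset (pos P S)"
  by (rule pos_poset[OF S])

lemma pT: "T \<in> \<pi> \<Longrightarrow> finite_poset (pos P (elts T))"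
  by (rule pos_poset[OF PartsD(4)[OF S \<pi>]])

lemma gens_rep:
  assumes "((m, X), w) \<in> gens N"
  obtains a w' where "a \<in> ZP C \<pi> m" "X = coh_class C (pos P \<pi>) m a" "w = cls w'" "kokP \<pi> w'" "N
      = m + tdeg w'"
proof -
  have X: "X \<in> carrier (coh C (pos P \<pi>) m)" and w: "distinct (map fst w)" "set (map fst w) = \<pi>"
    "\<And>T n y. (T, n, y) \<in> set w \<Longrightarrow> y \<in> carrier (coh c_chains (pos P (elts T)) n)"
        and N: "N = m + tdeg w"
    using assms by (auto simp: tgens_def)
  obtain a where a: "a \<in> ZP C \<pi> m" "X = coh_class C (pos P \<pi>) m a"
    by (rule coh_class_self_rep[OF p\<pi>' C X])
  have "\<exists>w'. w = cls w' \<and> map fst w' = map fst w \<and>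
    (\<forall>(T, n, c)\<in>set w'. c \<in> ZM (elts T) n)"
  proof (rule cls_rep)
    fix T n y assume t: "(T, n, y) \<in> set w"
    then have "T \<in> \<pi>" using w(2) by force
    then show "finset (elts T) \<and> y \<in> carrier (coh c_chains (pos P (elts T)) n)"
      using w(3)[OF t] PartsD(4)[OF S \<pi>] by simp
  qed
  then obtain w' where w': "w = cls w'" "map fst w' = map fst w"
    "\<forall>(T, n, c)\<in>set w'. c \<in> ZM (elts T) n" by blast
  have "fst ` set w' = \<pi>" "distinct (map fst w')" using w'(2) w(1,2) by (metis list.set_map)+
  then have "kokP \<pi> w'" unfolding kokP_iff[OF S \<pi>] using w'(3) by blast
  moreover have "N = m + tdeg w'" using N w'(1) by simp
  ultimately show thesis using that a w'(1) by blast
qed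

lemma map_fst_cls [simp]: "map fst (cls w) = map fst w"
  by (simp add: split_def)

lemma gens_cls:
  assumes "a \<in> ZP C \<pi> m" "kokP \<pi> w"
  shows "((m, coh_class C (pos P \<pi>) m a), cls w) \<in> gens (m + tdeg w)"
proof -
  have "set (map fst w) = \<pi>" using assms(2) by (auto simp: kokP_iff[OF S \<pi>])
  have "coh_class c_chains (pos P (elts T)) n c \<in> carrier (coh c_chains (pos P (elts T)) n)"
    if t: "(T, n, c) \<in> set w" for T n c
  proof -
    have "T \<in> \<pi>" using \<open>set (map fst w) = \<pi>\<close> t by force
    then show ?thesis using t assms(2) coh_class_carrier[OF pT, of T c_chains c n]
      by (auto simp: kokP_iff[OF S \<pi>])
  qed
  then have "\<forall>(T, n, y)\<in>set (cls w). y \<in> carrier (coh c_chains (pos P (elts T)) n)" by auto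
  moreover have "set (map fst (cls w)) = \<pi>" "distinct (map fst (cls w))"
    using assms(2) unfolding map_fst_cls by (auto simp: kokP_iff[OF S \<pi>])
  ultimately show ?thesis using coh_class_carrier[OF p\<pi>' C assms(1)]
    unfolding tgens_def mem_Collect_eq prod.case tdeg_cls by blast
qed

lemma gens_rep_tail:
  assumes "(h, u @ (i, n, y) # v) \<in> gens N"
  obtains m a u' c v' where "h = (m, coh_class C (pos P \<pi>) m a)" "a \<in> ZP C \<pi> m" "u = cls u'" "v
      = cls v'"
    "y = coh_class c_chains (pos P (elts i)) n c" "kokP \<pi> (u' @ (i, n, c) # v')" "N
        = m + tdeg (u' @ (i, n, c) # v')"
    "i \<in> \<pi>" "c \<in> ZM (elts i) n"
proof -
  obtain m X where h: "h = (m, X)" by (cases h) auto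
  obtain a w' where *: "a \<in> ZP C \<pi> m" "X = coh_class C (pos P \<pi>) m a" "u @ (i, n, y) # v
      = cls w'" "kokP \<pi> w'" "N = m + tdeg w'"
    by (rule gens_rep[OF assms[unfolded h]])
  from *(3) obtain u' l v' where w': "w' = u' @ l # v'" "u = cls u'" "v = cls v'"
    "(i, n, y) = (case l of (T, n, c) \<Rightarrow> (T, n, coh_class c_chains (pos P (elts T)) n c))"
    by (auto simp: append_eq_map_conv Cons_eq_map_conv)
  obtain c where "l = (i, n, c)" "y = coh_class c_chains (pos P (elts i)) n c" using w'(4)
    by (cases l) auto
  moreover from this have "i \<in> \<pi>" "c \<in> ZM (elts i) n"
    using *(4) w'(1) by (auto simp: kokP_iff[OF S \<pi>])
  ultimately show thesis using that[of m a u' v' c] * w' h by simp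
qed

text \<open>After representatives are chosen, the hypotheses of \<open>tensor_lift_hom\<close>
  become bilinearity of \<open>cc\<close> and multilinearity of \<open>kunneth\<close>, which hold
  exactly, and the Koszul rule, which holds up to a coboundary.\<close>

lemma comp_lift:
  fixes N
  shows "coh_comp C P S \<pi> N \<in> mod_hom (tensor (coh C (pos P \<pi>)) \<pi> (\<lambda>T. coh c_chains (pos P (elts
      T))) N)
      (coh C (pos P S) N :: ('k::comm_ring_1, _) module)"
    and "g \<in> gens N \<Longrightarrow> coh_comp C P S \<pi> N (pure (coh C (pos P \<pi>)) \<pi> (\<lambda>T. coh c_chains (pos P (elts
        T))) N g)
      = (coh_comp_pure C P S \<pi> N g :: ('p list \<Rightarrow> 'k) set)"
proof -
  interpret product_words \<pi> bpos by (rule words[OF S \<pi>])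
  note val = coh_comp_pure_class[OF S \<pi> C]
  let ?E = "coh C (pos P S) N :: ('k, _) module"
  have E: "?E = fun_quot (ZP C S N) (BP C S N)" by (rule coh_eq_fun_quot[OF pS' C])
  let ?f = "coh_comp_pure C P S \<pi> N :: _ \<Rightarrow> ('p list \<Rightarrow> 'k) set"
  have closed: "?f g \<in> carrier ?E" if gN: "g \<in> gens N" for g
  proof -
    obtain m X w where g: "g = ((m, X), w)" by (metis surj_pair)
    obtain a w' where *: "a \<in> ZP C \<pi> m" "X = coh_class C (pos P \<pi>) m a" "w
        = cls w'" "kokP \<pi> w'" "N = m + tdeg w'"
      by (rule gens_rep[OF gN[unfolded g]])
    show ?thesis using val[OF *(1,4)] * g coh_class_carrier[OF pS' C cc_Zc[OF S C *(1)
        kunneth_Zc[OF *(4)]]] by simp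
  qed
  have add_head: "?f ((m, x \<oplus>\<^bsub>coh C (pos P \<pi>) m\<^esub> x'), w) = ?f ((m, x), w) \<oplus>\<^bsub>?E\<^esub> ?f ((m, x'), w)"
    if g: "((m, x), w) \<in> gens N" "((m, x'), w) \<in> gens N" for m x x' w
  proof -
    obtain a w' where *: "a \<in> ZP C \<pi> m" "x = coh_class C (pos P \<pi>) m a" "w
        = cls w'" "kokP \<pi> w'" "N = m + tdeg w'"
      by (rule gens_rep[OF g(1)])
    obtain a' where a': "a' \<in> ZP C \<pi> m" "x' = coh_class C (pos P \<pi>) m a'"
      by (rule gens_rep[OF g(2)])
    show ?thesis
      using val[OF *(1,4)] val[OF a'(1) *(4)] val[OF fun_subspace_add[OF fun_subspace_Zc *(1)
          a'(1)] *(4)]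
      by (simp add: * a' coh_class_add[OF p\<pi>' C] coh_class_add[OF pS' C] cc_add_left[OF S C])
  qed
  have smult_head: "?f ((m, k \<odot>\<^bsub>coh C (pos P \<pi>) m\<^esub> x), w) = k \<odot>\<^bsub>?E\<^esub> ?f ((m, x), w)"
    if g: "((m, x), w) \<in> gens N" for k m x w
  proof -
    obtain a w' where *: "a \<in> ZP C \<pi> m" "x = coh_class C (pos P \<pi>) m a" "w
        = cls w'" "kokP \<pi> w'" "N = m + tdeg w'"
      by (rule gens_rep[OF g])
    show ?thesis
      using val[OF *(1,4)] val[OF fun_subspace_smult[OF fun_subspace_Zc *(1)] *(4), of k]
      by (simp add: * coh_class_smult[OF p\<pi>' C] coh_class_smult[OF pS' C] cc_smult_left[OF S C])
  qed
  have add_tail: "?f (h, u @ (i, n, y \<oplus>\<^bsub>coh c_chains (pos P (elts i)) n\<^esub> y') # v)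
      = ?f (h, u @ (i, n, y) # v) \<oplus>\<^bsub>?E\<^esub> ?f (h, u @ (i, n, y') # v)"
    if "(h, u @ (i, n, y) # v) \<in> gens N" "(h, u @ (i, n, y') # v) \<in> gens N" for h u i n y y' v
  proof -
    from that(1) obtain m a u' c v' where *: "h = (m, coh_class C (pos P \<pi>) m a)" "a
        \<in> ZP C \<pi> m" "u = cls u'" "v = cls v'"
      "y = coh_class c_chains (pos P (elts i)) n c" "kok (u' @ (i, n, c) # v')" "N
          = m + tdeg (u' @ (i, n, c) # v')" "i \<in> \<pi>"
      "c \<in> ZM (elts i) n" by (rule gens_rep_tail)
    from that(2) obtain c' where c': "y' = coh_class c_chains (pos P (elts i)) n c'"
      "c' \<in> ZM (elts i) n" by (rule gens_rep_tail)
    have k: "kok (u' @ (i, n, c') # v')" "kok (u' @ (i, n, \<lambda>z. c z + c' z) # v')"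
      using kok_update[OF *(6) c'(2)] kok_update[OF *(6) fun_subspace_add[OF fun_subspace_Zc *(9)
          c'(2)]] by auto
    show ?thesis
      using val[OF *(2,6)] val[OF *(2) k(1)] val[OF *(2) k(2)]
      by (simp add: *(1,3,4,5,7) c'(1) coh_class_add[OF pT[OF *(8)], of c_chains, simplified]
          coh_class_add[OF pS' C] kunneth_add[OF *(6) k(1)]
          cc_add_right[OF S C])
  qed
  have smult_tail: "?f (h, u @ (i, n, k \<odot>\<^bsub>coh c_chains (pos P (elts i)) n\<^esub> y) # v)
      = k \<odot>\<^bsub>?E\<^esub> ?f (h, u @ (i, n, y) # v)"
    if "(h, u @ (i, n, y) # v) \<in> gens N" for k h u i n y v
  proof -
    from that obtain m a u' c v' where *: "h = (m, coh_class C (pos P \<pi>) m a)" "a \<in> ZP C \<pi> m" "u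
        = cls u'" "v = cls v'"
      "y = coh_class c_chains (pos P (elts i)) n c" "kok (u' @ (i, n, c) # v')" "N
          = m + tdeg (u' @ (i, n, c) # v')" "i \<in> \<pi>"
      "c \<in> ZM (elts i) n" by (rule gens_rep_tail)
    have k: "kok (u' @ (i, n, \<lambda>z. k * c z) # v')"
      using kok_update[OF *(6) fun_subspace_smult[OF fun_subspace_Zc *(9)]] by auto
    show ?thesis
      using val[OF *(2,6)] val[OF *(2) k]
      by (simp add: *(1,3,4,5,7) coh_class_smult[OF pT[OF *(8)], of c_chains, simplified]
          coh_class_smult[OF pS' C] kunneth_smult[OF *(6)]
          cc_smult_right[OF S C])
  qed
  have koszul: "?f (h, u @ (i, n, y) # (i', n', y') # v)
      = (-1) ^ (n * n') \<odot>\<^bsub>?E\<^esub> ?f (h, u @ (i', n', y') # (i, n, y) # v)"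
    if "(h, u @ (i, n, y) # (i', n', y') # v) \<in> gens N" for h u i n y i' n' y' v
  proof -
    from that obtain m a u' c vv where *: "h = (m, coh_class C (pos P \<pi>) m a)" "a \<in> ZP C \<pi> m" "u
        = cls u'" "(i', n', y') # v = cls vv"
      "y = coh_class c_chains (pos P (elts i)) n c" "kok (u' @ (i, n, c) # vv)" "N
          = m + tdeg (u' @ (i, n, c) # vv)" "i \<in> \<pi>"
      by (rule gens_rep_tail)
    from *(4) obtain l v' where l: "vv = l # v'" "v = cls v'"
      "(i', n', y') = (case l of (T, n, c) \<Rightarrow> (T, n, coh_class c_chains (pos P (elts T)) n c))"
      by (auto simp: Cons_eq_map_conv)
    obtain c' where l': "l = (i', n', c')" "y' = coh_class c_chains (pos P (elts i')) n' c'"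
      using l(3) by (cases l) auto
    have k: "kok (u' @ (i, n, c) # (i', n', c') # v')" "kok (u' @ (i', n', c') # (i, n, c) # v')"
      using *(6) by (auto simp: l l' kok_def)
    have N: "N = m + tdeg (u' @ (i, n, c) # (i', n', c') # v')" "N
        = m + tdeg (u' @ (i', n', c') # (i, n, c) # v')"
      using *(7) by (auto simp: l l')
    have deg: "tdeg (u' @ (i', n', c') # (i, n, c) # v')
        = tdeg (u' @ (i, n, c) # (i', n', c') # v')" by simp
    \<comment> \<open>The difference of the two orders of the Kuenneth product is a coboundary by
      \<open>kunneth_swap\<close>; with a cocycle on the left, \<open>cc\<close> maps it to a
      coboundary.\<close>
    have "cc C S \<pi> m (tdeg (u' @ (i, n, c) # (i', n', c') # v')) a
        (\<lambda>z. kunneth (u' @ (i, n, c) # (i', n', c') # v') z + (- ((-1) ^ (n * n'))) * kunneth (u'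
            @ (i', n', c') # (i, n, c) # v') z) \<in> BP C S N"
      unfolding N(1) using kunneth_swap[OF k(1)] by (intro cc_Bc_right[OF S C *(2)]) simp
    then have "coh_class C (pos P S) N (cc C S \<pi> m (tdeg (u' @ (i, n, c) # (i', n', c') # v')) a
        (kunneth (u' @ (i, n, c) # (i', n', c') # v')))
      = coh_class C (pos P S) N (\<lambda>z. (-1) ^ (n * n') * cc C S \<pi> m (tdeg (u' @ (i, n, c) # (i', n',
          c') # v')) a (kunneth (u' @ (i', n', c') # (i, n, c) # v')) z)"
      unfolding coh_class_eq_iff[OF pS' C] cc_add_right[OF S C] cc_smult_right[OF S C] by simp
    then show ?thesis
      using val[OF *(2) k(1)] val[OF *(2) k(2)]
      unfolding *(1,3,5) l(2) l'(2) N(1)[symmetric] N(2)[symmetric] deg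
      by (simp add: coh_class_smult[OF pS' C])
  qed
  have M: "Module.module base_ring (coh C (pos P \<pi>) m :: ('k, _) module)" for m
    by (rule coh_module[OF p\<pi>' C])
  have L: "Module.module base_ring (coh c_chains (pos P (elts T)) n :: ('k, _) module)" if "T \<in> \<pi>"
      for T n
    by (rule coh_module[OF pT[OF that]]) simp
  show "coh_comp C P S \<pi> N \<in> mod_hom (tensor (coh C (pos P \<pi>)) \<pi> (\<lambda>T. coh c_chains (pos P (elts
      T))) N) ?E"
    unfolding coh_comp_def
    by (rule tensor_lift_hom(1)[where M = "coh C (pos P \<pi>)"
        and L = "\<lambda>T. coh c_chains (pos P (elts T))" and V = "ZP C S N"
          and W = "BP C S N" and f = ?f, folded E, OF fun_subspace_Zc fun_subspace_Bc M L closed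
              add_head smult_head add_tail smult_tail koszul])
  show "coh_comp C P S \<pi> N (pure (coh C (pos P \<pi>)) \<pi> (\<lambda>T. coh c_chains (pos P (elts T))) N g)
      = ?f g" if "g \<in> gens N"
    unfolding coh_comp_def
    by (rule tensor_lift_hom(2)[where M = "coh C (pos P \<pi>)"
        and L = "\<lambda>T. coh c_chains (pos P (elts T))" and V = "ZP C S N"
          and W = "BP C S N" and f = ?f, folded E, OF fun_subspace_Zc fun_subspace_Bc M L closed
              add_head smult_head add_tail smult_tail koszul that])
qed

text \<open>The interface for the axioms: from here on a composition map is evaluated through
  \<open>cc\<close> on representatives, without returning to the tensor product.\<close>

lemma comp_value:
  assumes "a \<in> ZP C \<pi> m" "kokP \<pi> w" "N = m + tdeg w"
  shows "coh_comp C P S \<pi> N (pure (coh C (pos P \<pi>)) \<pi> (\<lambda>T. coh c_chains (pos P (elts T))) N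
      ((m, coh_class C (pos P \<pi>) m a), cls w))
          = coh_class C (pos P S) N (cc C S \<pi> m (tdeg w) a (kunneth w))"
  using comp_lift(2)[OF gens_cls[OF assms(1,2)]] coh_comp_pure_class[OF S \<pi> C assms(1,2)] assms(3)
  by simp

end

subsection \<open>Transport along bijections\<close>

lemma pos_map_le: "\<lbrakk>finset S; inj_on f S; (x, y) \<in> pos P S\<rbrakk> \<Longrightarrow> (pos_map P S f x, pos_map P S f y)
    \<in> pos P (f ` S)"
  using pos_map_mono by (auto simp: compat_def)

lemma pos_map_Field: "\<lbrakk>finset S; inj_on f S; x \<in> Field (pos P S)\<rbrakk> \<Longrightarrow> pos_map P S f x
    \<in> Field (pos P (f ` S))"
  using pos_map_le[of S f x x] finite_poset_refl[OF pos_poset] by (auto intro: FieldI1)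

lemma pos_map_inverse:
  assumes S: "finset S" and f: "inj_on f S" and x: "x \<in> Field (pos P S)"
  shows "pos_map P (f ` S) (inv_into S f) (pos_map P S f x) = x"
proof -
  have g: "inj_on (inv_into S f) (f ` S)" by (rule inj_on_inv_into) simp
  have "pos_map P (f ` S) (inv_into S f) (pos_map P S f x) = pos_map P S (inv_into S f \<circ> f) x"
    by (rule pos_map_comp[OF S f g x, symmetric])
  also have "\<dots> = pos_map P S id x"
  proof (rule pos_map_cong[OF S _ _ x])
    show eq: "(inv_into S f \<circ> f) s = id s" if "s \<in> S" for s using that f by simp
    show "inj_on (inv_into S f \<circ> f) S" using eq by (simp cong: inj_on_cong)
  qed
  also have "\<dots> = x" by (rule pos_map_id[OF S x])
  finally show ?thesis .
qed

abbreviation "unmap S f \<equiv> pos_map P (f ` S) (inv_into S f)"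

lemma inv_image: "inj_on f S \<Longrightarrow> inv_into S f ` f ` S = S"
  by (simp add: inv_into_image_cancel)

lemma back_le: "\<lbrakk>finset S; inj_on f S; (x, y) \<in> pos P (f ` S)\<rbrakk> \<Longrightarrow> (unmap S f x, unmap S f y)
    \<in> pos P S"
  using pos_map_le[of "f ` S" "inv_into S f" x y]
  by (simp add: inv_image finset_image inj_on_inv_into)

lemma back_Field: "\<lbrakk>finset S; inj_on f S; x \<in> Field (pos P (f ` S))\<rbrakk> \<Longrightarrow> unmap S f x
    \<in> Field (pos P S)"
  using pos_map_Field[of "f ` S" "inv_into S f" x]
  by (simp add: inv_image finset_image inj_on_inv_into)

lemma pos_map_back:
  assumes S: "finset S" and f: "inj_on f S" and x: "x \<in> Field (pos P (f ` S))"
  shows "pos_map P S f (unmap S f x) = x"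
proof -
  have g: "inj_on (inv_into S f) (f ` S)" by (rule inj_on_inv_into) simp
  have f': "inj_on f (inv_into S f ` f ` S)" using f by (simp add: inv_image)
  have "pos_map P S f (unmap S f x) = pos_map P (f ` S) (f \<circ> inv_into S f) x"
    using pos_map_comp[OF finset_image[OF S] g f' x] by (simp add: inv_image[OF f])
  also have "\<dots> = pos_map P (f ` S) id x"
  proof (rule pos_map_cong[OF finset_image[OF S] _ _ x])
    show eq: "(f \<circ> inv_into S f) s = id s" if "s \<in> f ` S" for s using that
      by (simp add: f_inv_into_f)
    show "inj_on (f \<circ> inv_into S f) (f ` S)" using eq by (simp cong: inj_on_cong)
  qed
  also have "\<dots> = x" by (rule pos_map_id[OF finset_image[OF S] x])
  finally show ?thesis .
qed

lemma back_conditions: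
  assumes S: "finset S" and f: "inj_on f S" and x: "x \<in> Field (pos P (f ` S))"
  shows "unmap S f x \<in> start C (pos P S) \<longleftrightarrow> x \<in> start C (pos P (f ` S))"
    "unmap S f x \<in> max_elems (pos P S) \<longleftrightarrow> x \<in> max_elems (pos P (f ` S))"
proof -
  note iso = poset_iso_min[of "pos P (f ` S)" "unmap S f" "pos P S" "pos_map P S f", OF back_le[OF
      S f] pos_map_le[OF S f]
      pos_map_back[OF S f] pos_map_inverse[OF S f] x]
  show "unmap S f x \<in> start C (pos P S) \<longleftrightarrow> x \<in> start C (pos P (f ` S))"
    using iso(1,3) x by (simp add: start_def)
  show "unmap S f x \<in> max_elems (pos P S) \<longleftrightarrow> x \<in> max_elems (pos P (f ` S))" by (rule iso(2))
qed

text \<open>Cochains pull back while species are covariant, so the transport along \<open>f\<close>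
  is the pullback along the inverse relabelling \<open>unmap S f\<close>.\<close>

definition tr :: "('p rel \<Rightarrow> nat \<Rightarrow> 'p list set) \<Rightarrow> 'a hfset set \<Rightarrow> ('a hfset \<Rightarrow> 'a hfset) \<Rightarrow> nat
    \<Rightarrow> ('p list \<Rightarrow> 'k) \<Rightarrow> 'p list \<Rightarrow> 'k::comm_ring_1" where
  "tr C S f n c = pl (pos P (f ` S)) (start C (pos P (f ` S))) (max_elems (pos P (f ` S))) (Suc n)
      (unmap S f) c"

context
  fixes S :: "'a hfset set" and C :: "'p rel \<Rightarrow> nat \<Rightarrow> 'p list set" and f :: "'a hfset \<Rightarrow> 'a hfset"
  assumes S: "finset S" and C: "C \<in> {chat_chains, c_chains}" and f: "inj_on f S"
begin

lemma tr_Zc: "c \<in> ZP C S n \<Longrightarrow> tr C S f n c \<in> ZP C (f ` S) n"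
  unfolding tr_def
proof (rule pl_Zc[OF pos_poset[OF finset_image[OF S]] pos_poset[OF S] back_le[OF S f]])
qed (assumption | rule back_conditions[OF S f] | erule FieldI2)+

lemma gmap_class:
  assumes c: "c \<in> ZP C S n"
  shows "gmap (coh_species C P) S f n (coh_class C (pos P S) n c)
      = coh_class C (pos P (f ` S)) n (tr C S f n c)"
proof -
  have "gmap (coh_species C P) S f n (coh_class C (pos P S) n c) =
    pull_coh C (pos P (f ` S)) n (unmap S f) (fcoset (BP C S n) c)"
    by (simp add: coh_species_def coh_class_eq_fcoset[OF pos_poset[OF S] C])
  also have "\<dots> = fcoset (BP C (f ` S) n) (tr C S f n c)" unfolding tr_def
    by (rule pull_coh_class[OF pos_poset[OF finset_image[OF S]] pos_poset[OF S] C back_le[OF S f]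
          back_conditions[OF S f] convex_start antichain_convex[OF pos_poset[OF S] antichain_max]
              c])
  finally show ?thesis by (simp add: coh_class_eq_fcoset[OF pos_poset[OF finset_image[OF S]] C])
qed

lemma map_back_chl:
  assumes z: "z \<in> chP C (f ` S) l"
  shows "map (unmap S f) z \<in> chP C S l"
proof -
  have "set z \<subseteq> Field (pos P (f ` S))" "distinct z" using z by (auto simp: chl_def wchain_def)
  then have d: "distinct (map (unmap S f) z)"
    using pos_map_back[OF S f] by (auto simp: distinct_map inj_on_def subset_iff) (metis)
  show ?thesis
  proof (rule map_chl[OF pos_poset[OF finset_image[OF S]] pos_poset[OF S] back_le[OF S f] _ _ z d])
  qed (assumption | rule back_conditions[OF S f] | erule FieldI2)+
qed

end

lemma graded_species_coh:
  assumes C: "C \<in> {chat_chains, c_chains}"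
  shows "graded_species (coh_species C P :: ('a, 'k::comm_ring_1, _) graded_species)"
proof (rule graded_species.intro)
  fix S :: "'a hfset set" and n assume S: "finset S"
  show "Module.module base_ring (gcomp (coh_species C P :: ('a, 'k, _) graded_species) S n)"
    by (simp add: coh_module[OF pos_poset[OF S] C])
  note rep = coh_class_self_rep[OF pos_poset[OF S] C]
  {
    fix f :: "'a hfset \<Rightarrow> 'a hfset" assume f: "inj_on f S"
    note [simp] = coh_class_add[OF pos_poset[OF S] C] coh_class_add[OF pos_poset[OF
        finset_image[OF S]] C]
      coh_class_smult[OF pos_poset[OF S] C] coh_class_smult[OF pos_poset[OF finset_image[OF S]] C]
    show "gmap (coh_species C P) S f n \<in> mod_hom (gcomp (coh_species C P) S n) (gcomp (coh_species
        C P :: ('a, 'k, _) graded_species) (f ` S) n)"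
      unfolding mod_hom_def gcomp_coh_species
    proof (intro CollectI conjI ballI allI funcsetI)
      fix X assume "X \<in> carrier (coh C (pos P S) n :: ('k, _) module)"
      then obtain c where c: "c \<in> ZP C S n" "X = coh_class C (pos P S) n c" by (rule rep)
      show "gmap (coh_species C P) S f n X \<in> carrier (coh C (pos P (f ` S)) n)"
        using c by (simp add: gmap_class[OF S C f] coh_class_carrier[OF pos_poset[OF
            finset_image[OF S]] C] tr_Zc[OF S C f])
      show "gmap (coh_species C P) S f n (k \<odot>\<^bsub>coh C (pos P S) n\<^esub> X)
          = k \<odot>\<^bsub>coh C (pos P (f ` S)) n\<^esub> gmap (coh_species C P) S f n X" for k
        using c fun_subspace_smult[OF fun_subspace_Zc c(1), of k]
        by (simp add: gmap_class[OF S C f])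
          (rule arg_cong[where f = "coh_class C _ n"], auto simp: tr_def pl_def fun_eq_iff)
      fix X' assume "X' \<in> carrier (coh C (pos P S) n :: ('k, _) module)"
      then obtain c' where c': "c' \<in> ZP C S n" "X' = coh_class C (pos P S) n c'" by (rule rep)
      show "gmap (coh_species C P) S f n (X \<oplus>\<^bsub>coh C (pos P S) n\<^esub> X')
          = gmap (coh_species C P) S f n X \<oplus>\<^bsub>coh C (pos P (f ` S)) n\<^esub> gmap (coh_species C P) S f n
          X'"
        using c c' fun_subspace_add[OF fun_subspace_Zc c(1) c'(1)]
        by (simp add: gmap_class[OF S C f])
          (rule arg_cong[where f = "coh_class C _ n"], auto simp: tr_def pl_def fun_eq_iff)
    qed
    fix X assume "X \<in> carrier (gcomp (coh_species C P :: ('a, 'k, _) graded_species) S n)"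
    then obtain c where c: "c \<in> ZP C S n" "X = coh_class C (pos P S) n c" using rep by auto
    show "gmap (coh_species C P) S f n X = gmap (coh_species C P) S g n X"
        if fg: "\<And>s. s \<in> S \<Longrightarrow> f s = g s" for g
    proof -
      have g: "inj_on g S" using f fg by (simp cong: inj_on_cong)
      have im: "f ` S = g ` S" using fg by simp
      have "inv_into S f y = inv_into S g y" if "y \<in> g ` S" for y using that fg f g im
        by (metis f_inv_into_f inv_into_f_f inv_into_into)
      then have "unmap S f x = unmap S g x" if "x \<in> Field (pos P (g ` S))" for x
        unfolding im using that inj_on_inv_into[of "f ` S" f S] im
        by (intro pos_map_cong finset_image S) auto
      then have "tr C S f n c = tr C S g n c" unfolding tr_def im pl_def
        by (intro ext if_cong refl arg_cong[where f = c] map_cong) (auto simp: chl_def wchain_def)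
      then show ?thesis using c(1) by (simp add: c(2) gmap_class[OF S C f] gmap_class[OF S C g] im)
    qed
    show "gmap (coh_species C P) S (g \<circ> f) n X
        = gmap (coh_species C P) (f ` S) g n (gmap (coh_species C P) S f n X)"
      if g: "inj_on g (f ` S)" for g
    proof -
      have gf: "inj_on (g \<circ> f) S" using f g by (rule comp_inj_on)
      have im: "(g \<circ> f) ` S = g ` f ` S" by (rule image_comp[symmetric])
      have *: "pos_map P (g ` f ` S) (inv_into S (g \<circ> f)) x = unmap S f (unmap (f ` S) g x)"
          if x: "x \<in> Field (pos P (g ` f ` S))" for x
      proof -
        have "unmap S f (unmap (f ` S) g x) = pos_map P (g ` f ` S) (inv_into S f \<circ> inv_into (f `
            S) g) x"
          using pos_map_comp[OF finset_image[OF finset_image[OF S]] inj_on_inv_into[OF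
              subset_refl] _ x, of "inv_into S f"]
          by (simp add: inv_image[OF g] inj_on_inv_into)
        also have "\<dots> = pos_map P (g ` f ` S) (inv_into S (g \<circ> f)) x"
        proof (rule pos_map_cong[OF finset_image[OF finset_image[OF S]] _ _ x])
          show "(inv_into S f \<circ> inv_into (f ` S) g) y = inv_into S (g \<circ> f) y"
              if y: "y \<in> g ` f ` S" for y
          proof -
            obtain s where s: "s \<in> S" "y = g (f s)" using y by auto
            then have "inv_into S (g \<circ> f) y = s" using inv_into_f_f[OF gf s(1)] by simp
            then show ?thesis using s f g by simp
          qed
          show "inj_on (inv_into S f \<circ> inv_into (f ` S) g) (g ` f ` S)"
            by (rule comp_inj_on) (simp_all add: inv_image[OF g] inj_on_inv_into)
        qed
        finally show ?thesis by (rule sym)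
      qed
      have "tr C S (g \<circ> f) n c = tr C (f ` S) g n (tr C S f n c)"
      proof (intro ext)
        fix z
        let ?r = "pos P (g ` f ` S)"
        show "tr C S (g \<circ> f) n c z = tr C (f ` S) g n (tr C S f n c) z"
        proof (cases "z \<in> chl ?r (start C ?r) (max_elems ?r) (Suc n)")
          case True
          then have "map (pos_map P (g ` f ` S) (inv_into S (g \<circ> f))) z
              = map (unmap S f) (map (unmap (f ` S) g) z)"
            using * by (auto simp: chl_def wchain_def)
          then show ?thesis using True map_back_chl[OF finset_image[OF S] C g, of z "Suc n"]
            unfolding tr_def pl_def im by (simp del: map_map map_eq_conv)
        next
          case False
          then show ?thesis unfolding tr_def pl_def im by simp
        qed
      qed
      then show ?thesis using c(1)
        by (simp add: c(2) gmap_class[OF S C f] gmap_class[OF S C gf] gmap_class[OF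
            finset_image[OF S] C g] tr_Zc[OF S C f] image_comp)
    qed
  }
  fix X assume "X \<in> carrier (gcomp (coh_species C P :: ('a, 'k, _) graded_species) S n)"
  then obtain c where c: "c \<in> ZP C S n" "X = coh_class C (pos P S) n c" using rep by auto
  have *: "unmap S id x = x" if "x \<in> Field (pos P S)" for x
    using pos_map_inverse[OF S inj_on_id that] by (simp add: pos_map_id[OF S that])
  have "tr C S id n c = c"
  proof
    fix z
    show "tr C S id n c z = c z"
    proof (cases "z \<in> chP C S (Suc n)")
      case True
      then have "map (unmap S id) z = z" using * by (intro map_idI) (auto simp: chl_def wchain_def)
      then show ?thesis using True by (simp add: tr_def pl_def)
    next
      case False
      then show ?thesis using c(1) by (auto simp: tr_def pl_def Zc_def supp_def)
    qed
  qed
  then show "gmap (coh_species C P) S id n X = X"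
    using gmap_class[OF S C inj_on_id c(1)] by (simp add: c(2))
qed

end

section \<open>Equivariance and units\<close>

text \<open>Each step of \<open>z\<close> lies inside the segment of some letter, and there the
  coordinate of that letter already changes because its cochain lives on strict chains.\<close>

lemma wsupp_nodup:
  assumes "\<And>i n c B u. \<lbrakk>(i, n, c, B) \<in> set ls; c u \<noteq> 0\<rbrakk> \<Longrightarrow> distinct u \<and> length u = Suc n"
    "wsupp ls z" "Suc k < length z"
  shows "z ! k \<noteq> z ! Suc k"
  using assms
proof (induction ls z arbitrary: k rule: wsupp.induct)
  case (2 i n c B ls z)
  have c: "distinct (map (\<lambda>h. h i) (take (Suc n) z)) \<and> length (map (\<lambda>h. h i) (take (Suc n) z))
      = Suc n"
    using 2(2)[of i n c B "map (\<lambda>h. h i) (take (Suc n) z)"] 2(3) by simp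
  show ?case
  proof (cases "Suc k \<le> n")
    case True
    have "map (\<lambda>h. h i) (take (Suc n) z) ! k \<noteq> map (\<lambda>h. h i) (take (Suc n) z) ! Suc k"
      using c True by (subst nth_eq_iff_index_eq) auto
    then show ?thesis using True c by auto
  next
    case False
    have "drop n z ! (k - n) \<noteq> drop n z ! Suc (k - n)"
    proof (rule "2.IH")
      show "distinct u \<and> length u = Suc n'" if "(i', n', c', B') \<in> set ls" "c' u \<noteq> 0"
          for i' n' c' B' u
        using 2(2)[of i' n' c' B' u] that by simp
    qed (use 2(3,4) False in auto)
    then show ?thesis using False 2(4) by simp
  qed
qed simp

text \<open>Compares two words along one chain \<open>d\<close> of a source poset, read through
  \<open>F\<close> and through \<open>F'\<close>: agreement of corresponding letters on weak chains
  in \<open>D\<close> suffices. Empty lists are included because a word may run past the end of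
  \<open>d\<close>.\<close>

lemma wcup_transfer:
  assumes "list_all2 (\<lambda>(i, n, c, B) (i', n', c', B'). n = n' \<and>
      (\<forall>e. set e \<subseteq> D \<longrightarrow> (e = [] \<or> wchain r e) \<longrightarrow> c (map (\<lambda>x. F x i) e)
          = c' (map (\<lambda>x. F' x i') e))) ls ls'"
    and "d = [] \<or> wchain r d" "set d \<subseteq> D"
  shows "wcup ls (map F d) = wcup ls' (map F' d)"
  using assms
proof (induction arbitrary: d rule: list_all2_induct)
  case (Cons l ls l' ls')
  obtain i n c B where l: "l = (i, n, c, B)" by (cases l) auto
  obtain i' c' B' where l': "l' = (i', n, c', B')"
    "\<forall>e. set e \<subseteq> D \<longrightarrow> (e = [] \<or> wchain r e) \<longrightarrow> c (map (\<lambda>x. F x i) e) = c' (map (\<lambda>x. F' x i') e)"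
    using Cons.hyps(1) l by (cases l') auto
  have "set (take (Suc n) d) \<subseteq> D" "take (Suc n) d = [] \<or> wchain r (take (Suc n) d)"
    using Cons.prems by (auto dest: in_set_takeD intro: wchain_take)
  then have 1: "c (map (\<lambda>x. F x i) (take (Suc n) d)) = c' (map (\<lambda>x. F' x i') (take (Suc n) d))"
    using l'(2) by blast
  have "drop n d = [] \<or> wchain r (drop n d)"
    using Cons.prems(1) by (cases "n < length d") (auto intro: wchain_drop)
  moreover have "set (drop n d) \<subseteq> D" using Cons.prems(2) by (auto dest: in_set_dropD)
  ultimately have "wcup ls (map F (drop n d)) = wcup ls' (map F' (drop n d))" by (rule Cons.IH)
  with 1 show ?case by (simp add: l l'(1) take_map drop_map comp_def)
qed simp

context product_words
begin

text \<open>Images under \<open>upper\<close> are only weak chains. On those with the right ends and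
  length the truncation in \<open>W\<close> may be dropped, since a repetition makes the word itself
  vanish by \<open>wsupp_nodup\<close>.\<close>

lemma W_wchain:
  assumes ok: "wok R I s ls" and t: "wchain Q t" "hd t \<in> PiE I s" "last t
      \<in> PiE I (wfin s ls)" "length t = Suc (wdeg ls)"
  shows "W s ls t = wcup ls t"
proof (cases "wcup ls t = 0")
  case False
  have supp: "distinct u \<and> length u = Suc n" if "(i, n, c, B) \<in> set ls" "c u \<noteq> 0" for i n c B u
    using ok that
    by (induction s ls rule: letters_induct) (auto simp: Zc_def supp_def chl_def simp del:
        fun_upd_apply)
  have "distinct t"
  proof (rule ccontr)
    assume "\<not> distinct t"
    then obtain k where "Suc k < length t" "t ! k = t ! Suc k"
      by (rule not_distinct_wchain[OF Q t(1)])
    moreover from this have "t ! k \<noteq> t ! Suc k"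
      using supp by (intro wsupp_nodup[OF _ wsupp_if_wcup[OF False]])
    ultimately show False by simp
  qed
  then show ?thesis using t by (simp add: W_def chl_def)
qed (simp add: W_def)

lemma kunneth_wchain:
  assumes w: "kok w" and t: "wchain Q t" "hd t \<in> min_elems Q" "last t \<in> max_elems Q" "length t
      = Suc (tdeg w)"
  shows "kunneth w t = wcup (kl R w) t"
  unfolding kunneth_eq_W[OF w]
  by (rule W_wchain[OF kok_wok[OF w]])
    (use t w in \<open>auto simp: PiE_minst PiE_wfin_kl kok_def\<close>)

end

context op_species
begin

abbreviation "klP w \<equiv> kl bpos w"

lemma chl_wchain_parts:
  assumes S: "finset S" and z: "z \<in> chl (pos P S) A B (Suc (m + t))"
  shows "wchain (pos P S) (take (Suc m) z)" "wchain (pos P S) (drop m z)" "z ! m \<in> Field (pos P S)"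
    "\<And>y. y \<in> set (take (Suc m) z) \<Longrightarrow> (y, z ! m) \<in> pos P S" "\<And>y. y \<in> set (drop m z) \<Longrightarrow> (z ! m, y)
        \<in> pos P S"
    "wchain (pos P (anchor P S (z ! m))) (map (lower P S (z ! m)) (take (Suc m) z))"
    "wchain (prodP (anchor P S (z ! m))) (map (upper P S (z ! m)) (drop m z))"
proof -
  have w: "wchain (pos P S) z" and len: "length z = Suc (m + t)" using z by (auto simp: chl_def)
  show tk: "wchain (pos P S) (take (Suc m) z)" and dr: "wchain (pos P S) (drop m z)"
    using w len by (auto intro: wchain_take wchain_drop)
  show x: "z ! m \<in> Field (pos P S)" using w len by (auto simp: wchain_def)
  show tk_le: "(y, z ! m) \<in> pos P S" if "y \<in> set (take (Suc m) z)" for y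
    using that len by (auto simp: in_set_conv_nth intro!: wchain_nth_mono[OF pos_poset[OF S] w])
  show dr_le: "(z ! m, y) \<in> pos P S" if "y \<in> set (drop m z)" for y
    using that len by (auto simp: in_set_conv_nth intro!: wchain_nth_mono[OF pos_poset[OF S] w])
  have "wchain (down (pos P S) (z ! m)) (take (Suc m) z)"
    unfolding down_def wchain_Restr using tk tk_le
    by (auto simp: under_def Field_down[OF pos_poset[OF S] x, unfolded down_def under_def])
  then show "wchain (pos P (anchor P S (z ! m))) (map (lower P S (z ! m)) (take (Suc m) z))"
    by (rule wchain_map) (use lower_mono[OF S x] in \<open>auto simp: compat_def\<close>)
  have "wchain (up (pos P S) (z ! m)) (drop m z)"
    unfolding up_def wchain_Restr using dr dr_le
    by (auto simp: above_def Field_up[OF pos_poset[OF S] x, unfolded up_def above_def])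
  then show "wchain (prodP (anchor P S (z ! m))) (map (upper P S (z ! m)) (drop m z))"
    by (rule wchain_map) (use upper_mono[OF S x] in \<open>auto simp: compat_def\<close>)
qed

lemma upper_chl_ends:
  assumes S: "finset S" and z: "z \<in> chl (pos P S) A (max_elems (pos P S)) (Suc (m + t))"
  shows "hd (map (upper P S (z ! m)) (drop m z)) \<in> min_elems (prodP (anchor P S (z ! m)))"
    "last (map (upper P S (z ! m)) (drop m z)) \<in> max_elems (prodP (anchor P S (z ! m)))"
proof -
  note parts = chl_wchain_parts[OF S z]
  have d: "drop m z \<noteq> []" using parts(2) by (simp add: wchain_def)
  have "hd (drop m z) = z ! m" using d by (simp add: hd_drop_conv_nth)
  then show "hd (map (upper P S (z ! m)) (drop m z)) \<in> min_elems (prodP (anchor P S (z ! m)))"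
    using upper_min_iff[OF S parts(5), of "z ! m"] hd_in_set[OF d] d by (simp add: hd_map)
  have "last (drop m z) \<in> max_elems (pos P S)" using z d by (auto simp: chl_def last_drop)
  then show "last (map (upper P S (z ! m)) (drop m z)) \<in> max_elems (prodP (anchor P S (z ! m)))"
    using upper_max_iff[OF S parts(5)[OF last_in_set[OF d]]] d by (simp add: last_map)
qed

text \<open>On a chain of the complex, \<open>upper P S (z ! m)\<close> sends the part after the cut
  to a weak chain from minimal to maximal elements of the product, so the Kuenneth cochain can be
  replaced by its untruncated word.\<close>

lemma cc_kunneth:
  assumes S: "finset S" and \<pi>: "\<pi> \<in> Parts S" and C: "C \<in> {chat_chains, c_chains}" and w: "kokP \<pi> w"
    and z: "z \<in> chP C S (Suc (m + tdeg w))"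
  shows "cc C S \<pi> m (tdeg w) a (kunneth w) z = (if anchor P S (z ! m) = \<pi> then
    a (map (lower P S (z ! m)) (take (Suc m) z)) * wcup (klP w) (map (upper P S (z ! m)) (drop m
        z)) else 0)"
proof (cases "anchor P S (z ! m) = \<pi>")
  case True
  interpret product_words \<pi> bpos by (rule words[OF S \<pi>])
  have "kunneth w (map (upper P S (z ! m)) (drop m z))
      = wcup (klP w) (map (upper P S (z ! m)) (drop m z))"
    using chl_wchain_parts(7)[OF S z] upper_chl_ends[OF S z] chl_nth(1)[OF z] True
    by (intro kunneth_wchain[OF w]) auto
  then show ?thesis using True z by (simp add: cc_eq[OF S C])
qed (simp add: cc_eq[OF S C])

text \<open>Where the right-hand side is nonzero, the support of \<open>c\<close> yields length,
  distinctness and ends of the image, and these pass back to \<open>t\<close> along the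
  isomorphism.\<close>

lemma tr_wchain:
  assumes S: "finset S" and f: "inj_on f S" and c: "c \<in> ZP C S n" and t: "wchain (pos P (f ` S)) t"
  shows "tr C S f n c t = c (map (unmap S f) t)"
proof (cases "c (map (unmap S f) t) = 0")
  case False
  let ?r = "pos P (f ` S)"
  have m: "map (unmap S f) t \<in> chP C S (Suc n)"
    using c False by (auto simp: Zc_def supp_def)
  have t0: "t \<noteq> []" using t by (simp add: wchain_def)
  have "t \<in> chl ?r (start C ?r) (max_elems ?r) (Suc n)"
    using m t t0 back_conditions(1)[OF S f wchain_ends(1)[OF t], of C] back_conditions(2)[OF S f
        wchain_ends(2)[OF t]]
    by (auto simp: chl_def hd_map last_map distinct_map)
  then show ?thesis by (simp add: tr_def pl_def)
qed (simp add: tr_def pl_def)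

lemma wchain_klP_mem:
  assumes "finset S" "\<pi> \<in> Parts S" "kokP \<pi> w" "(T, n, c) \<in> set w"
  shows "T \<in> \<pi>" "c \<in> ZM (elts T) n"
  using assms(3,4) unfolding kokP_iff[OF assms(1,2)] by force+

text \<open>The identity holds already for cochains (\<open>eq\<close> in the proof): at a chain
  \<open>z\<close>, the axioms \<open>anchor_natural\<close>, \<open>lower_equivariant\<close> and
  \<open>upper_equivariant\<close> match the anchor, the part before the cut and each letter of the
  part after it.\<close>

lemma equivariant_coh:
  assumes S: "finset S" and \<pi>: "\<pi> \<in> Parts S" and f: "inj_on f S"
      and C: "C \<in> {chat_chains, c_chains}"
    and g: "((m, X), w) \<in> comp_gens (coh_species C P :: ('a, 'k::comm_ring_1, _) graded_species)
        (h_species P) \<pi> N"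
  shows "gmap (coh_species C P) S f N (coh_comp C P S \<pi> N (comp_pure (coh_species C P) (h_species
      P) \<pi> N ((m, X), w)))
    = coh_comp C P (f ` S) (blk_map f ` \<pi>) N (comp_pure (coh_species C P) (h_species P) (blk_map f
        ` \<pi>) N
      ((m, gmap (coh_species C P) \<pi> (blk_map f) m X),
       map (\<lambda>(T, n, y). (blk_map f T, n, gmap (h_species P) (elts T) f n y)) w))"
proof -
  obtain a w' where a: "a \<in> ZP C \<pi> m" "X = coh_class C (pos P \<pi>) m a"
      and w': "w = cls w'" "kokP \<pi> w'" and N: "N = m + tdeg w'"
    using gens_rep[OF S \<pi> C g[unfolded gcomp_coh_species]] by blast
  let ?\<pi> = "blk_map f ` \<pi>"
  have fS: "finset (f ` S)" by (rule finset_image[OF S])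
  have \<pi>': "?\<pi> \<in> Parts (f ` S)" and inj: "inj_on (blk_map f) \<pi>" using blk_map_Parts[OF S \<pi> f]
    by auto
  have f\<pi>: "finset \<pi>" by (rule PartsD(7)[OF S \<pi>])
  have blkT: "finset (elts T)" "inj_on f (elts T)" "elts (blk_map f T) = f ` elts T" if "T \<in> \<pi>"
      for T
    using PartsD(3,4)[OF S \<pi> that] inj_on_subset[OF f] by (auto simp: elts_blk_map finset_def)
  let ?a = "tr C \<pi> (blk_map f) m a"
  define w'' where "w'' = map (\<lambda>(T, n, c). (blk_map f T, n, tr c_chains (elts T) f n c)) w'"
  note wmem = wchain_klP_mem[OF S \<pi> w'(2)]
  have a': "?a \<in> ZP C ?\<pi> m" by (rule tr_Zc[OF f\<pi> C inj a(1)])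
  have mf: "map fst w'' = map (blk_map f) (map fst w')" by (simp add: w''_def split_def)
  have kw'': "kokP ?\<pi> w''"
    unfolding kokP_iff[OF fS \<pi>']
  proof (intro conjI)
    have "set (map fst w') = \<pi>" "distinct (map fst w')" using w'(2) by (auto simp: kokP_iff[OF S \<pi>])
    then show "distinct (map fst w'')" unfolding mf using inj by (simp only: distinct_map)
    have "fst ` set w'' = set (map fst w'')" by simp
    also have "\<dots> = ?\<pi>" unfolding mf using \<open>set (map fst w') = \<pi>\<close> by (simp only: set_map)
    finally show "fst ` set w'' = ?\<pi>" .
    show "\<forall>(T, n, c)\<in>set w''. c \<in> ZM (elts T) n"
    proof -
      have "tr c_chains (elts T) f n c \<in> ZM (f ` elts T) n"
        if t: "(T, n, c) \<in> set w'" for T n c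
        using tr_Zc[OF blkT(1)[OF wmem(1)[OF t]] _ blkT(2)[OF wmem(1)[OF t]], of c_chains c n]
            wmem(2)[OF t] by simp
      then show ?thesis using blkT(3) wmem(1) by (fastforce simp: w''_def)
    qed
  qed
  have td: "tdeg w'' = tdeg w'" unfolding w''_def by (induction w') auto
  have cls: "map (\<lambda>(T, n, y). (blk_map f T, n, gmap (h_species P) (elts T) f n y)) w = cls w''"
    unfolding w'(1) w''_def map_map
  proof (rule map_cong[OF refl])
    fix l assume l: "l \<in> set w'"
    obtain T n c where l': "l = (T, n, c)" by (cases l) auto
    note T = wmem[OF l[unfolded l']]
    show "((\<lambda>(T, n, y). (blk_map f T, n, gmap (h_species P) (elts T) f n y)) \<circ> (\<lambda>(T, n, c). (T, n,
        coh_class c_chains (pos P (elts T)) n c))) l =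
      ((\<lambda>(T, n, c). (T, n, coh_class c_chains (pos P (elts T)) n c)) \<circ> (\<lambda>(T, n, c). (blk_map f T,
          n, tr c_chains (elts T) f n c))) l"
      using gmap_class[OF blkT(1)[OF T(1)] _ blkT(2)[OF T(1)], of c_chains c n] T(2)
      by (simp add: l' blkT(3)[OF T(1)])
  qed
  have eq: "tr C S f N (cc C S \<pi> m (tdeg w') a (kunneth w'))
      = cc C (f ` S) ?\<pi> m (tdeg w'') ?a (kunneth w'')"
  proof
    fix z
    let ?r = "pos P (f ` S)"
    show "tr C S f N (cc C S \<pi> m (tdeg w') a (kunneth w')) z
        = cc C (f ` S) ?\<pi> m (tdeg w'') ?a (kunneth w'') z"
    proof (cases "z \<in> chl ?r (start C ?r) (max_elems ?r) (Suc N)")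
      case z: True
      define z' where "z' = map (unmap S f) z"
      let ?x = "z ! m" and ?x' = "z' ! m"
      have z': "z' \<in> chP C S (Suc (m + tdeg w'))"
        unfolding z'_def N[symmetric] by (rule map_back_chl[OF S C f z])
      have zz: "z \<in> chl ?r (start C ?r) (max_elems ?r) (Suc (m + tdeg w''))" using z
        by (simp add: N td)
      have len: "length z = Suc (m + tdeg w')" using chl_nth(1)[OF zz] by (simp add: td)
      note parts = chl_wchain_parts[OF fS zz]
      have x': "?x' = unmap S f ?x" using len by (simp add: z'_def)
      have xF: "?x' \<in> Field (pos P S)" unfolding x' by (rule back_Field[OF S f parts(3)])
      have fx: "pos_map P S f ?x' = ?x" unfolding x' by (rule pos_map_back[OF S f parts(3)])
      \<comment> \<open>Relabelling of partitions is injective, being undone by the inverse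
        map.\<close>
      have anchor_iff: "anchor P (f ` S) ?x = ?\<pi> \<longleftrightarrow> anchor P S ?x' = \<pi>"
      proof -
        have "anchor P (f ` S) ?x = blk_map f ` anchor P S ?x'" using anchor_natural[OF S f xF] fx
          by simp
        then show ?thesis using blk_map_image_inverse[OF S \<pi> f] blk_map_image_inverse[OF S
            anchor_Parts[OF S xF] f] by metis
      qed
      show ?thesis
      proof (cases "anchor P S ?x' = \<pi>")
        case anc: True
        have anc': "anchor P (f ` S) ?x = ?\<pi>" using anc anchor_iff by simp
        \<comment> \<open>\<open>lower_equivariant\<close> with the relabelling moved to the other
          side.\<close>
        have lowr: "unmap \<pi> (blk_map f) (lower P (f ` S) ?x y) = lower P S ?x' (unmap S f y)"
            if y: "y \<in> set (take (Suc m) z)" for y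
        proof -
          have yx: "(y, ?x) \<in> ?r" using parts(4) y by simp
          then have le: "(unmap S f y, ?x') \<in> pos P S" unfolding x' by (rule back_le[OF S f])
          have "pos_map P \<pi> (blk_map f) (lower P S ?x' (unmap S f y)) = lower P (f ` S) ?x y"
            using lower_equivariant[OF S f le] pos_map_back[OF S f] pos_FieldI[OF yx]
            by (simp add: fx anc)
          then show ?thesis using pos_map_inverse[OF f\<pi> inj, of "lower P S ?x' (unmap S f y)"]
              lower_Field[OF S le] anc by simp
        qed
        have A: "?a (map (lower P (f ` S) ?x) (take (Suc m) z))
            = a (map (lower P S ?x') (take (Suc m) z'))"
        proof -
          have "?a (map (lower P (f ` S) ?x) (take (Suc m) z))
              = a (map (unmap \<pi> (blk_map f)) (map (lower P (f ` S) ?x) (take (Suc m) z)))"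
            by (rule tr_wchain[OF f\<pi> inj a(1)]) (use parts(6) anc' in simp)
          then show ?thesis using lowr by (simp add: z'_def take_map comp_def cong: map_cong)
        qed
        have "wcup (klP w'') (map (upper P (f ` S) ?x) (drop m z))
            = wcup (klP w') (map (\<lambda>y. upper P S ?x' (unmap S f y)) (drop m z))"
        proof (rule wcup_transfer[of "set (drop m z)" ?r])
          have "list_all2 (\<lambda>(i, n, c, B) (i', n', c', B'). n = n' \<and>
              (\<forall>e. set e \<subseteq> set (drop m z) \<longrightarrow> e = [] \<or> wchain ?r e \<longrightarrow>
                c (map (\<lambda>x. upper P (f ` S) ?x x i) e)
                    = c' (map (\<lambda>x. upper P S ?x' (unmap S f x) i') e)))
            (klP (map (\<lambda>(T, n, c). (blk_map f T, n, tr c_chains (elts T) f n c)) v)) (klP v)"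
                if "set v \<subseteq> set w'" for v
            using that
          proof (induction v)
            case (Cons l v)
            obtain T n c where l: "l = (T, n, c)" by (cases l) auto
            have lw: "(T, n, c) \<in> set w'" using Cons.prems l by simp
            note T = wmem[OF lw] and bT = blkT[OF wmem(1)[OF lw]]
            have H: "tr c_chains (elts T) f n c (map (\<lambda>x. upper P (f ` S) ?x x (blk_map f T)) e)
                = c (map (\<lambda>x. upper P S ?x' (unmap S f x) T) e)"
              if e: "set e \<subseteq> set (drop m z)" "e = [] \<or> wchain ?r e" for e
            proof (cases "e = []")
              case True
              then show ?thesis using T(2) by (auto simp: tr_def pl_def chl_def wchain_def Zc_def
                  supp_def)
            next
              case False
              have TT: "blk_map f T \<in> anchor P (f ` S) ?x" "T \<in> anchor P S ?x'"
                using T(1) anc anc' by auto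
              have "wchain (pos P (f ` elts T)) (map (\<lambda>x. upper P (f ` S) ?x x (blk_map f T)) e)"
              proof -
                have we: "wchain ?r e" using e(2) False by simp
                have "wchain (up ?r ?x) e" unfolding up_def wchain_Restr
                  using we e(1) parts(5) by (auto simp: above_def Field_up[OF pos_poset[OF fS]
                      parts(3), unfolded up_def above_def])
                then show ?thesis
                proof (rule wchain_map)
                  fix x y assume "(x, y) \<in> up ?r ?x"
                  then have "(x, y) \<in> ?r" "(?x, x) \<in> ?r" by (auto simp: up_def above_def)
                  from upper_block_le[OF fS this(2,1) TT(1)]
                  show "(upper P (f ` S) ?x x (blk_map f T), upper P (f ` S) ?x y (blk_map f T))
                      \<in> pos P (f ` elts T)"
                    by (simp add: bT(3))
                qed
              qed
              then have "tr c_chains (elts T) f n c (map (\<lambda>x. upper P (f ` S) ?x x (blk_map f T))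
                  e) =
                c (map (unmap (elts T) f) (map (\<lambda>x. upper P (f ` S) ?x x (blk_map f T)) e))"
                using T(2) by (intro tr_wchain[OF bT(1,2)]) simp_all
              moreover have "unmap (elts T) f (upper P (f ` S) ?x y (blk_map f T))
                  = upper P S ?x' (unmap S f y) T" if y: "y \<in> set e" for y
              proof -
                have xy: "(?x, y) \<in> ?r" using parts(5) y e(1) by auto
                then have le: "(?x', unmap S f y) \<in> pos P S" unfolding x' by (rule back_le[OF S f])
                have "pos_map P (elts T) f (upper P S ?x' (unmap S f y) T)
                    = upper P (f ` S) ?x y (blk_map f T)"
                  using upper_equivariant[OF S f le TT(2)] pos_map_back[OF S f] pos_FieldI[OF xy]
                  by (simp add: fx)
                then show ?thesis
                  using pos_map_inverse[OF bT(1,2) upper_block_Field[OF S le TT(2)]] by simp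
              qed
              ultimately show ?thesis by (simp add: comp_def cong: map_cong)
            qed
            then show ?case using Cons H[of "[]"] by (simp add: l)
          qed simp
          then show "list_all2 (\<lambda>(i, n, c, B) (i', n', c', B'). n = n' \<and>
              (\<forall>e. set e \<subseteq> set (drop m z) \<longrightarrow> e = [] \<or> wchain ?r e \<longrightarrow>
                c (map (\<lambda>x. upper P (f ` S) ?x x i) e)
                    = c' (map (\<lambda>x. upper P S ?x' (unmap S f x) i') e))) (klP w'') (klP w')"
            unfolding w''_def by blast
        qed (use parts(2) in auto)
        also have "map (\<lambda>y. upper P S ?x' (unmap S f y)) (drop m z)
            = map (upper P S ?x') (drop m z')"
          by (simp add: z'_def drop_map)
        finally have K: "wcup (klP w'') (map (upper P (f ` S) ?x) (drop m z))
            = wcup (klP w') (map (upper P S ?x') (drop m z'))" .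
        show ?thesis
          using z cc_kunneth[OF S \<pi> C w'(2) z', of a] cc_kunneth[OF fS \<pi>' C kw'' zz, of ?a] A K
              anc anc'
          by (simp add: tr_def pl_def z'_def)
      next
        case False
        then show ?thesis
          using z cc_kunneth[OF S \<pi> C w'(2) z', of a] cc_kunneth[OF fS \<pi>' C kw'' zz, of ?a]
              anchor_iff
          by (simp add: tr_def pl_def z'_def)
      qed
    next
      case False
      then show ?thesis by (simp add: tr_def pl_def cc_eq[OF fS C] N td)
    qed
  qed
  have "cc C S \<pi> m (tdeg w') a (kunneth w') \<in> ZP C S N"
    unfolding N by (rule cc_Zc[OF S C a(1) product_words.kunneth_Zc[OF words[OF S \<pi>] w'(2)]])
  then have "gmap (coh_species C P) S f N (coh_comp C P S \<pi> N (comp_pure (coh_species C P)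
      (h_species P) \<pi> N ((m, X), w)))
    = coh_class C (pos P (f ` S)) N (tr C S f N (cc C S \<pi> m (tdeg w') a (kunneth w')))"
    by (simp add: comp_value[OF S \<pi> C a(1) w'(2) N] a(2) w'(1) gmap_class[OF S C f])
  also have "\<dots> = coh_comp C P (f ` S) ?\<pi> N (comp_pure (coh_species C P) (h_species P) ?\<pi> N ((m,
      coh_class C (pos P ?\<pi>) m ?a), cls w''))"
    by (simp add: comp_value[OF fS \<pi>' C a' kw''] N td eq[unfolded N td])
  also have "coh_class C (pos P ?\<pi>) m ?a = gmap (coh_species C P) \<pi> (blk_map f) m X"
    by (simp add: a(2) gmap_class[OF f\<pi> C inj a(1)])
  finally show ?thesis unfolding cls .
qed

subsection \<open>Units\<close>

definition pt :: "'a hfset \<Rightarrow> 'p" where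
  "pt s = the_elem (Field (pos P {s}))"

lemma Field_singleton: "Field (pos P {s}) = {pt s}"
proof -
  obtain x where "Field (pos P {s}) = {x}" using unitality[of s] by blast
  then show ?thesis by (simp add: pt_def)
qed

lemma finset_singleton: "finset {s}"
  by (simp add: finset_def)

lemma chl_singleton: "chl (pos P {s}) (min_elems (pos P {s})) (max_elems (pos P {s})) l = (if l
    = 1 then {[pt s]} else {})"
proof -
  have r: "(pt s, pt s) \<in> pos P {s}"
    by (rule finite_poset_refl[OF pos_poset[OF finset_singleton]]) (simp add: Field_singleton)
  have "x = pt s \<and> y = pt s" if "(x, y) \<in> pos P {s}" for x y
    using FieldI1[OF that] FieldI2[OF that] by (simp add: Field_singleton)
  then have "pos P {s} = {(pt s, pt s)}" using r by fast
  then have mm: "min_elems (pos P {s}) = {pt s}" "max_elems (pos P {s}) = {pt s}"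
    by (simp_all add: min_elems_def max_elems_def Field_def)
  have "z = [pt s]" if "set z \<subseteq> {pt s}" "distinct z" "z \<noteq> []" for z
  proof -
    have "card (set z) \<le> 1" using card_mono[OF _ that(1)] by simp
    then have "length z \<le> 1" using that(2) by (simp add: distinct_card)
    then show ?thesis using that by (cases z) auto
  qed
  then have "z \<in> chl (pos P {s}) {pt s} {pt s} l \<longleftrightarrow> l = 1 \<and> z = [pt s]" for z
    unfolding chl_def wchain_def Field_singleton by fastforce
  then show ?thesis unfolding mm by auto
qed

abbreviation "uc s \<equiv> (delta [pt s] :: 'p list \<Rightarrow> 'k::comm_ring_1)"

lemma uc_Zc: "uc s \<in> ZM {s} 0"
  by (auto simp: Zc_def supp_def chl_singleton delta_def)

lemma coh_unit_eq: "coh_unit P s = coh_class c_chains (pos P {s}) 0 (uc s)"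
  by (simp add: coh_unit_def pt_def)

text \<open>The units have degree 0, so the cut is at the last entry \<open>x\<close>, which is
  maximal and has the finest anchor automatically. By \<open>has_units\<close> the map
  \<open>lower P S x\<close> is the relabelling of \<open>S\<close> by singletons, which
  \<open>tr\<close> undoes; each unit letter is evaluated at the only point of its poset and gives
  1.\<close>

lemma right_unital_coh:
  assumes S: "finset S" and C: "C \<in> {chat_chains, c_chains}" and ss: "distinct ss" "set ss = S"
    and X: "X \<in> carrier (gcomp (coh_species C P :: ('a, 'k::comm_ring_1, _) graded_species) S n)"
  shows "coh_comp C P S ((\<lambda>s. blk {s}) ` S) n (comp_pure (coh_species C P) (h_species P) ((\<lambda>s. blk
      {s}) ` S) n
    ((n, gmap (coh_species C P) S (\<lambda>s. blk {s}) n X), map (\<lambda>s. (blk {s}, 0, coh_unit P s)) ss)) = X"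
proof -
  let ?\<sigma> = "\<lambda>s. blk {s} :: 'a hfset"
  have \<pi>: "?\<sigma> ` S = sing S" "sing S \<in> Parts S" using sing_in_Parts[OF S] by (auto simp: sing_def)
  have inj: "inj_on ?\<sigma> A" for A by (rule inj_onI) (metis elts_blk finite.emptyI finite_insert
      singleton_inject)
  obtain c where c: "c \<in> ZP C S n" "X = coh_class C (pos P S) n c"
    using coh_class_self_rep[OF pos_poset[OF S] C] X by auto
  define w where "w = map (\<lambda>s. (?\<sigma> s, 0 :: nat, uc s :: _ \<Rightarrow> 'k)) ss"
  have clsw: "map (\<lambda>s. (?\<sigma> s, 0, coh_unit P s)) ss = cls w" by (simp add: w_def coh_unit_eq)
  have td: "tdeg w = 0" unfolding w_def by (induction ss) auto
  have kw: "kokP (sing S) w"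
    unfolding kokP_iff[OF S \<pi>(2)]
  proof (intro conjI)
    have "map fst w = map ?\<sigma> ss" by (simp add: w_def)
    then show "distinct (map fst w)" using ss inj by (simp add: distinct_map)
    show "fst ` set w = sing S" using ss by (force simp: w_def sing_def)
    show "\<forall>(T, n, c)\<in>set w. c \<in> ZM (elts T) n"
      using uc_Zc by (auto simp: w_def)
  qed
  have tc: "tr C S ?\<sigma> n c \<in> ZP C (sing S) n" using tr_Zc[OF S C inj c(1)] \<pi>(1) by simp
  have "cc C S (sing S) n (tdeg w) (tr C S ?\<sigma> n c) (kunneth w) = c"
  proof
    fix z
    show "cc C S (sing S) n (tdeg w) (tr C S ?\<sigma> n c) (kunneth w) z = c z"
    proof (cases "z \<in> chP C S (Suc (n + tdeg w))")
      case z: True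
      let ?x = "z ! n"
      note parts = chl_wchain_parts[OF S z]
      have len: "length z = Suc n" using chl_nth(1)[OF z] td by simp
      have xm: "?x \<in> max_elems (pos P S)" using chl_nth(3)[OF z] td by simp
      have anc: "anchor P S ?x = sing S" using max_iff[OF S parts(3)] xm by simp
      have lowr: "lower P S ?x y = pos_map P S ?\<sigma> y" if "(y, ?x) \<in> pos P S" for y
        using units S xm that by (auto simp: has_units_def)
      have "tr C S ?\<sigma> n c (map (lower P S ?x) (take (Suc n) z))
          = c (map (unmap S ?\<sigma>) (map (lower P S ?x) (take (Suc n) z)))"
        by (rule tr_wchain[OF S inj c(1)]) (use parts(6) anc \<pi>(1) in simp)
      also have "map (unmap S ?\<sigma>) (map (lower P S ?x) (take (Suc n) z)) = z"
      proof -
        have "unmap S ?\<sigma> (lower P S ?x y) = y" if "y \<in> set z" for y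
        proof -
          have "(y, ?x) \<in> pos P S" using parts(4)[of y] that len by simp
          then show ?thesis using pos_map_inverse[OF S inj] pos_FieldI by (simp add: lowr)
        qed
        then show ?thesis using len by (simp add: map_idI)
      qed
      finally have A: "tr C S ?\<sigma> n c (map (lower P S ?x) (take (Suc n) z)) = c z" .
      have d: "drop n z = [?x]" using len by (metis Cons_nth_drop_Suc drop_all lessI order_refl)
      have hF: "upper P S ?x ?x (?\<sigma> s) = pt s" if "s \<in> S" for s
      proof -
        have "?\<sigma> s \<in> anchor P S ?x" using that anc by (auto simp: sing_def)
        from upper_block_Field[OF S finite_poset_refl[OF pos_poset[OF S] parts(3)] this] show
            ?thesis
          by (simp add: Field_singleton)
      qed
      have "wcup (klP (map (\<lambda>s. (?\<sigma> s, 0 :: nat, uc s :: _ \<Rightarrow> 'k)) ts)) [upper P S ?x ?x] = 1"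
          if "set ts \<subseteq> S" for ts
        using that by (induction ts) (auto simp: hF delta_def)
      then have "wcup (klP w) (map (upper P S ?x) (drop n z)) = 1" using ss by (simp add: w_def d)
      then show ?thesis using cc_kunneth[OF S \<pi>(2) C kw z, of "tr C S ?\<sigma> n c"] A anc by simp
    next
      case False
      then show ?thesis using c(1) td by (auto simp: cc_eq[OF S C] Zc_def supp_def)
    qed
  qed
  then have "coh_comp C P S (sing S) n (pure (coh C (pos P (sing S))) (sing S) (\<lambda>T. coh c_chains
      (pos P (elts T))) n
      ((n, coh_class C (pos P (sing S)) n (tr C S ?\<sigma> n c)), cls w)) = X"
    using comp_value[OF S \<pi>(2) C tc kw, of n] td c(2) by simp
  then show ?thesis unfolding clsw using gmap_class[OF S C inj c(1)] by (simp add: \<pi>(1) c(2))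
qed

text \<open>Here the cut is at the first entry. In the complex of the operad it is minimal, so its
  anchor has a single block, and by \<open>has_units\<close> the component of \<open>upper\<close>
  at this block is the identity.\<close>

lemma left_unital_coh:
  assumes S: "finset S" and X: "X \<in> carrier (gcomp (h_species P :: ('a, 'k::comm_ring_1, _)
      graded_species) S n)"
  shows "h_comp P S {blk S} n (comp_pure (h_species P) (h_species P) {blk S} n ((0, coh_unit P
      (blk S)), [(blk S, n, X)])) = X"
proof -
  have C: "c_chains \<in> {chat_chains, c_chains}" by simp
  have \<pi>: "{blk S} \<in> Parts S" by (rule blk_singleton_in_Parts[OF S])
  have eS: "elts (blk S) = S" using S by (simp add: finset_def)
  obtain c where c: "c \<in> ZP c_chains S n" "X = coh_class c_chains (pos P S) n c"
    using coh_class_self_rep[OF pos_poset[OF S] C] X by auto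
  let ?w = "[(blk S, n, c)]"
  have kw: "kokP {blk S} ?w" using c(1) by (simp add: kokP_iff[OF S \<pi>] eS)
  have u: "uc (blk S) \<in> ZP c_chains {blk S} 0" using uc_Zc[of "blk S"] by simp
  have "cc c_chains S {blk S} 0 (tdeg ?w) (uc (blk S)) (kunneth ?w) = c"
  proof
    fix z
    show "cc c_chains S {blk S} 0 (tdeg ?w) (uc (blk S)) (kunneth ?w) z = c z"
    proof (cases "z \<in> chl (pos P S) (start c_chains (pos P S)) (max_elems (pos P S)) (Suc (0 +
        tdeg ?w))")
      case z: True
      let ?x = "z ! 0"
      note parts = chl_wchain_parts[OF S z]
      have len: "length z = Suc n" using chl_nth(1)[OF z] by simp
      have xm: "?x \<in> min_elems (pos P S)" using chl_nth(2)[OF z] by simp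
      have anc: "anchor P S ?x = {blk S}" using min_iff[OF S parts(3)] xm by simp
      have "take (Suc 0) z = [?x]" using len by (cases z) auto
      moreover have "lower P S ?x ?x = pt (blk S)"
        using lower_Field[OF S finite_poset_refl[OF pos_poset[OF S] parts(3)]] anc
        by (simp add: Field_singleton)
      ultimately have A: "uc (blk S) (map (lower P S ?x) (take (Suc 0) z)) = (1 :: 'k)"
        by (simp add: delta_def)
      have "upper P S ?x y (blk S) = y" if "y \<in> set z" for y
        using units S xm parts(5)[of y] that by (auto simp: has_units_def)
      then have "map (\<lambda>h. h (blk S)) (map (upper P S ?x) (drop 0 z)) = z"
        by (simp add: comp_def map_idI)
      then have K: "wcup (klP ?w) (map (upper P S ?x) (drop 0 z)) = c z" using len
        by (simp add: take_map)
      show ?thesis using cc_kunneth[OF S \<pi> C kw z, of "uc (blk S)"] A K anc by simp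
    next
      case False
      then show ?thesis using c(1) by (auto simp: cc_eq[OF S C] Zc_def supp_def)
    qed
  qed
  then show ?thesis
    using comp_value[OF S \<pi> C u kw, of n] c(2) by (simp add: coh_unit_eq eS)
qed

lemma unit_natural_coh:
  "gmap (h_species P) {s} f 0 (coh_unit P s) = (coh_unit P (f s) :: ('p list \<Rightarrow> 'k::comm_ring_1)
      set)"
proof -
  have C: "c_chains \<in> {chat_chains, c_chains}" by simp
  have f: "inj_on f {s}" by simp
  have "tr c_chains {s} f 0 (uc s) = (uc (f s) :: _ \<Rightarrow> 'k)"
  proof
    fix z
    have "unmap {s} f (pt (f s)) = pt s"
      using back_Field[OF finset_singleton f, of "pt (f s)"] by (simp add: Field_singleton)
    then show "tr c_chains {s} f 0 (uc s) z = (uc (f s) z :: 'k)"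
      by (simp add: tr_def pl_def chl_singleton delta_def)
  qed
  then show ?thesis
    using gmap_class[OF finset_singleton C f, of "uc s :: _ \<Rightarrow> 'k" 0] uc_Zc[of s, where 'b = 'k]
    by (simp add: coh_unit_eq)
qed

end

section \<open>Associativity\<close>

lemma wcup_cong:
  "(\<And>x i. \<lbrakk>x \<in> set d; i \<in> fst ` set ls\<rbrakk> \<Longrightarrow> F x i = F' x i) \<Longrightarrow> wcup ls (map F d) = wcup ls (map F' d)"
proof (induction ls arbitrary: d)
  case (Cons l ls)
  obtain i n c B where l: "l = (i, n, c, B)" by (cases l) auto
  have "map (\<lambda>x. F x i) (take (Suc n) d) = map (\<lambda>x. F' x i) (take (Suc n) d)"
    using Cons.prems by (auto simp: l dest: in_set_takeD)
  moreover have "wcup ls (map F (drop n d)) = wcup ls (map F' (drop n d))"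
    using Cons.prems by (intro Cons.IH) (auto simp: l dest: in_set_dropD)
  ultimately show ?case by (simp only: l wcup.simps take_map drop_map map_map comp_def)
qed simp

text \<open>Every letter visits both its source and its target region; this is how the value of a
  coordinate at the cut is identified later.\<close>

lemma wsupp_meets:
  assumes "wsupp ls z" "(i, n, c, B) \<in> set ls" "supp c \<subseteq> chl r A B (Suc n)"
  shows "\<exists>h\<in>set z. h i \<in> A" "\<exists>h\<in>set z. h i \<in> B"
proof -
  have "\<exists>h\<in>set z. \<exists>h'\<in>set z. h i \<in> A \<and> h' i \<in> B"
    using assms
  proof (induction ls z rule: wsupp.induct)
    case (2 j n' c' B' ls z)
    show ?case
    proof (cases "(i, n, c, B) = (j, n', c', B')")
      case True
      let ?u = "map (\<lambda>h. h i) (take (Suc n) z)"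
      have "?u \<in> chl r A B (Suc n)" using 2 True by (auto simp: supp_def)
      then have "hd ?u \<in> A" "last ?u \<in> B" "?u \<noteq> []" by (auto simp: chl_def)
      then have "hd (take (Suc n) z) i \<in> A" "last (take (Suc n) z) i \<in> B" "take (Suc n) z \<noteq> []"
        by (auto simp: hd_map last_map simp del: take_eq_Nil)
      then show ?thesis by (meson hd_in_set in_set_takeD last_in_set)
    next
      case False
      then show ?thesis using 2 by (auto dest!: in_set_dropD)
    qed
  qed simp
  then show "\<exists>h\<in>set z. h i \<in> A" "\<exists>h\<in>set z. h i \<in> B" by blast+
qed

text \<open>Distributivity: a word whose letters are sums over the finite sets \<open>F i\<close> is
  the sum over all choice functions. Coordinates in the word are distinct, so the choice for the
  first letter is independent of the rest.\<close>

lemma wcup_sum: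
  fixes h :: "'i \<Rightarrow> nat \<Rightarrow> 'm \<Rightarrow> 'w \<Rightarrow> 'x \<Rightarrow> 'p list \<Rightarrow> 'k::comm_ring_1"
  assumes "distinct (map fst v)" "\<And>i. i \<in> fst ` set v \<Longrightarrow> finite (F i)"
  shows "(\<Sum>b\<in>PiE (fst ` set v) F. wcup (map (\<lambda>(i, n, c, w). (i, d n w, h i n c w (b i), D i)) v)
      z) =
    wcup (map (\<lambda>(i, n, c, w). (i, d n w, \<lambda>u. \<Sum>x\<in>F i. h i n c w x u, D i)) v) z"
  using assms
proof (induction v arbitrary: z)
  case (Cons l v)
  obtain i n c w where l: "l = (i, n, c, w)" by (cases l) auto
  let ?J = "fst ` set v"
  have i: "i \<notin> ?J" "distinct (map fst v)" using Cons.prems(1) by (auto simp: l)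
  let ?f = "\<lambda>b v. map (\<lambda>(i, n, c, w). (i, d n w, h i n c w (b i), D i)) v"
  let ?u = "map (\<lambda>h. h i) (take (Suc (d n w)) z)" and ?z = "drop (d n w) z"
  have "j \<noteq> i" if "(j, m, b, E) \<in> set v" for j m b E using i(1) that by (auto simp: rev_image_eqI)
  then have upd: "?f (b(i := x)) v = ?f b v" for b x
    by (fastforce intro!: map_cong)
  have IH: "(\<Sum>b\<in>PiE ?J F. wcup (?f b v) ?z) = wcup (map (\<lambda>(i, n, c, w). (i, d n w, \<lambda>u. \<Sum>x\<in>F i. h i
      n c w x u, D i)) v) ?z"
    using Cons.prems by (intro Cons.IH i(2)) auto
  have "(\<Sum>b\<in>PiE (fst ` set (l # v)) F. wcup (?f b (l # v)) z) =
    (\<Sum>b\<in>(\<lambda>(x, g). g(i := x)) ` (F i \<times> PiE ?J F). h i n c w (b i) ?u * wcup (?f b v) ?z)"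
    by (simp add: l PiE_insert_eq)
  also have "\<dots> = (\<Sum>(x, b)\<in>F i \<times> PiE ?J F. h i n c w x ?u * wcup (?f b v) ?z)"
    by (subst sum.reindex[OF inj_combinator[OF i(1)]]) (auto simp: upd intro!: sum.cong simp del:
        fun_upd_apply, simp)
  also have "\<dots> = (\<Sum>x\<in>F i. h i n c w x ?u) * (\<Sum>b\<in>PiE ?J F. wcup (?f b v) ?z)"
    by (simp add: sum.cartesian_product[symmetric] sum_product)
  finally show ?case by (simp add: IH l)
qed simp

lemma wok_distinct:
  assumes "distinct (map fst ls)"
  shows "wok R I s ls \<longleftrightarrow> (\<forall>(i, n, c, B)\<in>set ls. i \<in> I \<and> antichain (R i) B \<and> c \<in> Zc (R i) (s i) B n)"
  using assms
proof (induction ls arbitrary: s)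
  case (Cons l ls)
  obtain i n c B where l: "l = (i, n, c, B)" by (cases l) auto
  have "j \<noteq> i" if "(j, m, b, E) \<in> set ls" for j m b E using Cons.prems that
    by (auto simp: l rev_image_eqI)
  then have "(\<forall>(j, m, b, E)\<in>set ls. j \<in> I \<and> antichain (R j) E \<and> b \<in> Zc (R j) ((s(i := B)) j) E m) \<longleftrightarrow>
    (\<forall>(j, m, b, E)\<in>set ls. j \<in> I \<and> antichain (R j) E \<and> b \<in> Zc (R j) (s j) E m)" by fastforce
  then show ?case using Cons by (simp add: l)
qed simp

lemma wfin_regions:
  assumes "\<And>i n c B. (i, n, c, B) \<in> set ls \<Longrightarrow> B = D i"
  shows "wfin s ls i = (if i \<in> fst ` set ls then D i else s i)"
  using assms
proof (induction ls arbitrary: s)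
  case (Cons l ls)
  obtain j n c B where l: "l = (j, n, c, B)" by (cases l) auto
  have "wfin (s(j := B)) ls i = (if i \<in> fst ` set ls then D i else (s(j := B)) i)"
    by (rule Cons.IH) (use Cons.prems in auto)
  then show ?case using Cons.prems[of j n c B] by (auto simp: l)
qed simp

context product_words
begin

lemma weq_merge:
  assumes s: "states s" and ok: "wok R I s ((i, n, c, B) # (i, n', c', B') # ls)"
  shows "weq s 1 ((i, n, c, B) # (i, n', c', B') # ls) ((i, n + n', cup n c c', B') # ls)"
  using assms fun_subspace_zero[OF fun_subspace_Bc] W_merge[of s i n c B n' c' B' ls]
  by (auto simp: weq_def intro: cup_Zc[OF R])

text \<open>By induction, the second letter of the first coordinate is moved to the left past the
  first letters of all the others, which costs exactly the first term of \<open>shuffle_exp\<close>.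
  There it meets the first letter of its own coordinate and is merged with it.\<close>

lemma weq_unshuffle:
  fixes f :: "'i \<Rightarrow> nat \<Rightarrow> 'm \<Rightarrow> 'p list \<Rightarrow> 'k::comm_ring_1"
      and v :: "('i \<times> nat \<times> 'm \<times> ('i \<times> nat \<times> 'm) list) list"
  assumes "states s" "distinct (map fst v)"
    "\<And>i n c w. (i, n, c, w) \<in> set v \<Longrightarrow> i \<in> I \<and> antichain (R i) (B i) \<and> antichain (R i) (D i) \<and>
       f i n c \<in> Zc (R i) (s i) (B i) n \<and> g i w \<in> Zc (R i) (B i) (D i) (tdeg w)"
  shows "weq s ((-1) ^ shuffle_exp v)
    (map (\<lambda>(i, n, c, w). (i, n, f i n c, B i)) v @ map (\<lambda>(i, n, c, w). (i, tdeg w, g i w, D i)) v)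
    (map (\<lambda>(i, n, c, w). (i, n + tdeg w, cup n (f i n c) (g i w), D i)) v)"
  using assms
proof (induction v arbitrary: s)
  case Nil
  then show ?case using weq_refl[of s "[]"] by simp
next
  case (Cons l v)
  obtain i n c w where l: "l = (i, n, c, w)" by (cases l) auto
  let ?y = "\<lambda>v. map (\<lambda>(i, n, c, w). (i, n, f i n c, B i)) v"
      and ?w = "\<lambda>v. map (\<lambda>(i, n, c, w). (i, tdeg w, g i w, D i)) v"
    and ?m = "\<lambda>v. map (\<lambda>(i, n, c, w). (i, n + tdeg w, cup n (f i n c) (g i w), D i)) v"
  have fst_eq: "map fst (?y v) = map fst v" "map fst (?w v) = map fst v"
    by (simp_all add: split_def)
  have fst_set: "fst ` set (?y v) = fst ` set v" using fst_eq by (metis list.set_map)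
  have i: "i \<notin> fst ` set v" "distinct (map fst v)" using Cons.prems(2) by (auto simp: l)
  have li: "i \<in> I" "antichain (R i) (B i)" "antichain (R i) (D i)" "f i n c
      \<in> Zc (R i) (s i) (B i) n" "g i w \<in> Zc (R i) (B i) (D i) (tdeg w)"
    using Cons.prems(3)[of i n c w] by (auto simp: l)
  have other: "s j = (s(i := X)) j" if "(j, n', c', w') \<in> set v" for j n' c' w' X using i(1) that
    by (auto simp: rev_image_eqI)
  have s1: "states (s(i := B i))" "states (s(i := D i))" using Cons.prems(1) li
    by (simp_all add: states_upd)
  have oky: "wok R I (s(i := B i)) (?y v)"
    unfolding wok_distinct[OF i(2)[folded fst_eq(1)]]
  proof -
    have "j \<in> I \<and> antichain (R j) (B j) \<and> f j n' c' \<in> Zc (R j) ((s(i := B i)) j) (B j) n'"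
        if "(j, n', c', w') \<in> set v" for j n' c' w'
      using Cons.prems(3)[of j n' c' w'] other[OF that] that by (simp add: l)
    then show "\<forall>(j, n', c', B')\<in>set (?y v). j \<in> I \<and> antichain (R j) B' \<and> c'
        \<in> Zc (R j) ((s(i := B i)) j) B' n'"
      by (auto simp del: fun_upd_apply)
  qed
  have fin: "wfin (s(i := B i)) (?y v) j = (if j \<in> fst ` set v then B j else (s(i := B i)) j)" for j
    unfolding fst_set[symmetric] by (rule wfin_regions) auto
  have "distinct (map fst (?w (l # v)))" using Cons.prems(2) by (simp add: split_def comp_def)
  then have okw: "wok R I (wfin (s(i := B i)) (?y v)) ((i, tdeg w, g i w, D i) # ?w v)"
  proof (subst wok_distinct)
    have "B j = wfin (s(i := B i)) (?y v) j" if "(j, n', c', w') \<in> set (l # v)" for j n' c' w'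
      using that i(1) unfolding fin by (auto simp: l rev_image_eqI)
    then have "j \<in> I \<and> antichain (R j) (D j) \<and> g j w'
        \<in> Zc (R j) (wfin (s(i := B i)) (?y v) j) (D j) (tdeg w')"
      if "(j, n', c', w') \<in> set (l # v)" for j n' c' w'
      using Cons.prems(3)[OF that] that by simp
    then show "\<forall>(j, n', c', B')\<in>set ((i, tdeg w, g i w, D i) # ?w v). j \<in> I \<and> antichain (R j) B' \<and>
      c' \<in> Zc (R j) (wfin (s(i := B i)) (?y v) j) B' n'"
      by (auto simp: l simp del: fun_upd_apply)
  qed (use \<open>distinct (map fst (?w (l # v)))\<close> l in simp)
  have IH: "weq (s(i := D i)) ((-1) ^ shuffle_exp v) (?y v @ ?w v) (?m v)"
  proof (rule Cons.IH[OF s1(2) i(2)])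
    fix j n' c' w' assume "(j, n', c', w') \<in> set v"
    then show "j \<in> I \<and> antichain (R j) (B j) \<and> antichain (R j) (D j) \<and>
       f j n' c' \<in> Zc (R j) ((s(i := D i)) j) (B j) n' \<and> g j w' \<in> Zc (R j) (B j) (D j) (tdeg w')"
      using Cons.prems(3)[of j n' c' w'] other by simp
  qed
  have "weq (s(i := B i)) ((-1) ^ (wdeg (?y v) * tdeg w)) (?y v @ (i, tdeg w, g i w, D i) # ?w v)
      ((i, tdeg w, g i w, D i) # ?y v @ ?w v)"
    by (rule weq_move[OF s1(1)]) (use oky okw i(1) fst_set in \<open>simp_all add: wok_append\<close>)
  from weq_Cons[OF Cons.prems(1) li(1,2,4) this]
  have 1: "weq s ((-1) ^ (wdeg (?y v) * tdeg w)) (?y (l # v) @ ?w (l # v)) ((i, n, f i n c, B i) #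
      (i, tdeg w, g i w, D i) # ?y v @ ?w v)"
    by (simp add: l)
  have 2: "weq s 1 ((i, n, f i n c, B i) # (i, tdeg w, g i w, D i) # ?y v @ ?w v) ((i, n + tdeg w,
      cup n (f i n c) (g i w), D i) # ?y v @ ?w v)"
    by (rule weq_merge[OF Cons.prems(1)]) (use 1 in \<open>simp add: weq_def\<close>)
  have 3: "weq s ((-1) ^ shuffle_exp v) ((i, n + tdeg w, cup n (f i n c) (g i w), D i) # ?y v @ ?w
      v) (?m (l # v))"
    using weq_Cons[OF Cons.prems(1) li(1,3) cup_Zc[OF R[OF li(1)] li(4,5)] IH] by (simp add: l)
  have "wdeg (?y v) = (\<Sum>(U', n', y', w')\<leftarrow>v. n')" by (induction v) auto
  then have "(-1) ^ (wdeg (?y v) * tdeg w) * (1 * (-1) ^ shuffle_exp v)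
      = ((-1) ^ shuffle_exp (l # v) :: 'k)"
    by (simp add: l power_add mult.commute)
  then show ?case using weq_trans[OF 1 weq_trans[OF 2 3]] by simp
qed

text \<open>If the word is nonzero, every coordinate meets its minimal and its maximal elements
  somewhere along \<open>t\<close>. By monotonicity it does so already at the ends, and
  \<open>kunneth_wchain\<close> applies.\<close>

lemma kunneth_eq_wcup:
  assumes w: "kok w" and t: "wchain Q t" "length t = Suc (tdeg w)"
  shows "kunneth w t = wcup (kl R w) t"
proof (cases "wcup (kl R w) t = 0")
  case False
  note supp = wsupp_meets[OF wsupp_if_wcup[OF False]]
  have t0: "t \<noteq> []" using t by auto
  have le: "(hd t, h) \<in> Q" "(h, last t) \<in> Q" if "h \<in> set t" for h
    using that t0 wchain_nth_mono[OF Q t(1)] by (auto simp: in_set_conv_nth hd_conv_nth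
        last_conv_nth)
  have F: "hd t \<in> Field Q" "last t \<in> Field Q" using wchain_ends[OF t(1)] by auto
  have "hd t i \<in> min_elems (R i) \<and> last t i \<in> max_elems (R i)" if i: "i \<in> I" for i
  proof -
    obtain n c where l: "(i, n, c) \<in> set w" using w i by (force simp: kok_def)
    have "(i, n, c, max_elems (R i)) \<in> set (kl R w)" "supp c
        \<subseteq> chl (R i) (min_elems (R i)) (max_elems (R i)) (Suc n)"
      using l w by (force simp: kl_def, auto simp: kok_def Zc_def)
    then obtain h h' where h: "h \<in> set t" "h i \<in> min_elems (R i)" "h' \<in> set t" "h' i
        \<in> max_elems (R i)"
      using supp by meson
    moreover have "hd t i = h i" "last t i = h' i"
      using prod_poset_mono[OF le(1)[OF h(1)] i] prod_poset_mono[OF le(2)[OF h(3)] i] h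
      by (auto simp: min_elems_def max_elems_def)
    ultimately show ?thesis by simp
  qed
  then have "hd t \<in> min_elems Q" "last t \<in> max_elems Q"
    using F unfolding minQ maxQ FQ by (auto simp: PiE_iff)
  then show ?thesis using kunneth_wchain[OF w t(1) _ _ t(2)] by simp
next
  case True
  then show ?thesis by (simp add: kunneth_eq_W[OF w] W_def)
qed

end

context op_species
begin

section \<open>Evaluation of pullbacks and compositions on weak chains\<close>

lemma lo_wchain:
  assumes S: "finset S" and x: "x \<in> Field (pos P S)" and c: "c \<in> ZP C (anchor P S x) n"
    and e: "wchain (pos P S) e" "\<And>y. y \<in> set e \<Longrightarrow> (y, x) \<in> pos P S"
  shows "lo C S n x c e = c (map (lower P S x) e)"
proof (cases "c (map (lower P S x) e) = 0")
  case False
  then have m: "map (lower P S x) e \<in> chP C (anchor P S x) (Suc n)"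
    using c by (auto simp: Zc_def supp_def)
  have e0: "e \<noteq> []" using e(1) by (simp add: wchain_def)
  have "e \<in> chl (pos P S) (start C (pos P S)) {x} (Suc n)"
    using m e0 e lower_start_iff[OF S e(2)[OF hd_in_set[OF e0]], of C] lower_max_iff[OF S e(2)[OF
        last_in_set[OF e0]]]
    by (auto simp: chl_def hd_map last_map distinct_map)
  then show ?thesis by (simp add: lo_def pl_def)
qed (simp add: lo_def pl_def)

lemma hi_wchain:
  assumes S: "finset S" and x: "x \<in> Field (pos P S)" and K: "K \<in> ZQ (anchor P S x) t"
    and e: "wchain (pos P S) e" "\<And>y. y \<in> set e \<Longrightarrow> (x, y) \<in> pos P S"
  shows "hi S t x K e = K (map (upper P S x) e)"
proof (cases "K (map (upper P S x) e) = 0")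
  case False
  then have m: "map (upper P S x) e \<in> chl (prodP (anchor P S x)) (min_elems (prodP (anchor P S
      x))) (max_elems (prodP (anchor P S x))) (Suc t)"
    using K by (auto simp: Zc_def supp_def)
  have e0: "e \<noteq> []" using e(1) by (simp add: wchain_def)
  have "e \<in> chl (pos P S) {x} (max_elems (pos P S)) (Suc t)"
    using m e0 e upper_min_iff[OF S e(2)[OF hd_in_set[OF e0]]] upper_max_iff[OF S e(2)[OF
        last_in_set[OF e0]]]
    by (auto simp: chl_def hd_map last_map distinct_map)
  then show ?thesis by (simp add: hi_def pl_def)
qed (simp add: hi_def pl_def)

lemma wchain_upper:
  assumes S: "finset S" and x: "x \<in> Field (pos P S)"
      and e: "wchain (pos P S) e" "\<And>y. y \<in> set e \<Longrightarrow> (x, y) \<in> pos P S"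
  shows "wchain (prodP (anchor P S x)) (map (upper P S x) e)"
proof -
  have "wchain (up (pos P S) x) e"
    unfolding up_def wchain_Restr using e
    by (auto simp: above_def Field_up[OF pos_poset[OF S] x, unfolded up_def above_def])
  then show ?thesis by (rule wchain_map) (use upper_mono[OF S x] in \<open>auto simp: compat_def\<close>)
qed

text \<open>For a degenerate \<open>z\<close> the left side is zero by truncation. On the right, a
  repetition before the cut kills the value of \<open>a\<close>, and one after the cut kills the
  word. This case arises when a composition is evaluated on the image of a chain under
  \<open>lower\<close>.\<close>

lemma cc_kunneth_wchain:
  assumes S: "finset S" and \<pi>: "\<pi> \<in> Parts S" and C: "C \<in> {chat_chains, c_chains}"
      and a: "a \<in> ZP C \<pi> m" and w: "kokP \<pi> w"
    and z: "wchain (pos P S) z" "hd z \<in> start C (pos P S)" "last z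
        \<in> max_elems (pos P S)" "length z = Suc (m + tdeg w)"
  shows "cc C S \<pi> m (tdeg w) a (kunneth w) z = (if anchor P S (z ! m) = \<pi> then
    a (map (lower P S (z ! m)) (take (Suc m) z)) * wcup (klP w) (map (upper P S (z ! m)) (drop m
        z)) else 0)"
proof (cases "distinct z")
  case True
  then show ?thesis using z by (intro cc_kunneth[OF S \<pi> C w]) (auto simp: chl_def)
next
  case False
  obtain i where i: "Suc i < length z" "z ! i = z ! Suc i"
    by (rule not_distinct_wchain[OF pos_poset[OF S] z(1) False])
  have "a (map (lower P S (z ! m)) (take (Suc m) z)) * wcup (klP w) (map (upper P S (z ! m)) (drop
      m z)) = 0"
    if anc: "anchor P S (z ! m) = \<pi>"
  proof (cases "Suc i \<le> m")
    case True
    have "\<not> distinct (map (lower P S (z ! m)) (take (Suc m) z))"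
      using True i z(4) nth_eq_iff_index_eq[of "map (lower P S (z ! m)) (take (Suc m) z)" i "Suc
          i"] by auto
    then have "map (lower P S (z ! m)) (take (Suc m) z) \<notin> supp a" using a
      by (auto simp: Zc_def chl_def)
    then show ?thesis by (simp add: supp_def)
  next
    case False
    have "distinct u \<and> length u = Suc n" if "(T, n, c, B) \<in> set (klP w)" "c u \<noteq> 0" for T n c B u
      using wchain_klP_mem(2)[OF S \<pi> w] that by (force simp: kl_def Zc_def supp_def chl_def)
    then have "map (upper P S (z ! m)) (drop m z) ! (i - m) \<noteq> map (upper P S (z ! m)) (drop m z) !
        Suc (i - m)"
      if "wcup (klP w) (map (upper P S (z ! m)) (drop m z)) \<noteq> 0"
      using wsupp_if_wcup[OF that] i(1) False by (intro wsupp_nodup[of "klP w"]) auto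
    moreover have "map (upper P S (z ! m)) (drop m z) ! (i - m)
        = map (upper P S (z ! m)) (drop m z) ! Suc (i - m)"
      using i False by simp
    ultimately have "wcup (klP w) (map (upper P S (z ! m)) (drop m z)) = 0" by blast
    then show ?thesis by simp
  qed
  then show ?thesis using False by (simp add: cc_eq[OF S C] chl_def)
qed

end

context op_species
begin

text \<open>
  For a list \<open>v\<close> as in the associativity axiom, \<open>uw\<close>, \<open>cw\<close> and \<open>mw\<close> are the pure tensors to which the
  inner and the outer composition of the left-hand side and the outer composition of the
  right-hand side are applied.
\<close>

definition uw :: "'a hfset set \<Rightarrow> ('a hfset \<times> nat \<times> 'c \<times> 'w) list \<Rightarrow> ('a hfset \<times> nat \<times> 'c) list" where
  "uw \<pi> v = map (\<lambda>(U, n, c, w). (blk (restr \<pi> U), n, c)) v"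

definition cw :: "('a hfset \<times> nat \<times> 'c \<times> 'w list) list \<Rightarrow> 'w list" where
  "cw v = concat (map (\<lambda>(U, n, c, w). w) v)"

definition mw :: "'a hfset set \<Rightarrow> ('a hfset \<times> nat \<times> ('p list \<Rightarrow> 'k) \<times> ('a hfset \<times> nat \<times> ('p list \<Rightarrow>
    'k)) list) list
    \<Rightarrow> ('a hfset \<times> nat \<times> ('p list \<Rightarrow> 'k::comm_ring_1)) list" where
  "mw \<pi> v = map (\<lambda>(U, n, c, w). (U, n + tdeg w, cc c_chains (elts U) (restr \<pi> U) n (tdeg w) c
      (kunneth w))) v"

abbreviation "deg1 v \<equiv> \<Sum>(U, n, c, w)\<leftarrow>v. n"
abbreviation "deg2 v \<equiv> \<Sum>(U, n, c, w)\<leftarrow>v. tdeg w"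

text \<open>The choice \<open>b\<close> assigns to each block of \<sigma> the element of its poset
  at which the inner composition is cut. The region \<open>{b U}\<close> makes this cut point the
  target of the first letter and the source of the letter of \<open>wlet\<close> in the same
  coordinate.\<close>

definition ylet :: "('a hfset \<Rightarrow> 'p) \<Rightarrow> ('a hfset \<times> nat \<times> ('p list \<Rightarrow> 'k) \<times> 'w) list \<Rightarrow> ('a hfset, 'p,
    'k::comm_ring_1) letter list" where
  "ylet b v = map (\<lambda>(U, n, c, w). (U, n, lo c_chains (elts U) n (b U) c, {b U})) v"

definition wlet :: "('a hfset \<Rightarrow> 'p) \<Rightarrow> ('a hfset \<times> nat \<times> 'c \<times> ('a hfset \<times> nat \<times> ('p list \<Rightarrow> 'k))
    list) list
    \<Rightarrow> ('a hfset, 'p, 'k::comm_ring_1) letter list" where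
  "wlet b v = map (\<lambda>(U, n, c, w). (U, tdeg w, hi (elts U) (tdeg w) (b U) (kunneth w), max_elems
      (pos P (elts U)))) v"

abbreviation "WP \<sigma> \<equiv> product_words.W \<sigma> bpos (minst bpos)"

text \<open>
  Evaluated on a chain through \<open>a \<le> b\<close> with anchors \<open>\<sigma> \<le> \<pi>\<close>, the left-hand side of associativity is a
  product over the blocks of \<open>\<sigma>\<close> of words in which every coordinate first moves to its component of
  \<open>\<psi>\<^sub>a(b)\<close> and only then to the top.  The right-hand side moves one coordinate after the other.
\<close>

definition split_sum :: "'a hfset set \<Rightarrow> 'a hfset set \<Rightarrow> ('a hfset \<times> nat \<times> ('p list \<Rightarrow> 'k) \<times> ('a
    hfset \<times> nat \<times> ('p list \<Rightarrow> 'k)) list) list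
    \<Rightarrow> ('a hfset \<Rightarrow> 'p) list \<Rightarrow> 'k::comm_ring_1" where
  "split_sum \<sigma> \<pi> v t = (\<Sum>b\<in>PiE \<sigma> (\<lambda>U. fibre (elts U) (restr \<pi> U)). WP \<sigma> (ylet b v @ wlet b v) t)"

lemma tdeg_uw: "tdeg (uw \<pi> v) = deg1 v"
  by (induction v) (auto simp: uw_def)

lemma tdeg_cw: "tdeg (cw v) = deg2 v"
  by (induction v) (auto simp: cw_def)

lemma fst_cw: "fst ` set (cw v) = (\<Union>l\<in>set v. fst ` set (snd (snd (snd l))))"
  by (auto simp: cw_def split_def image_UN)

lemma tdeg_mw: "tdeg (mw \<pi> v) = deg1 v + deg2 v"
  by (induction v) (auto simp: mw_def)

lemma wdeg_ylet: "wdeg (ylet b v) = deg1 v"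
  by (induction v) (auto simp: ylet_def)

lemma wdeg_wlet: "wdeg (wlet b v) = deg2 v"
  by (induction v) (auto simp: wlet_def)

context
  fixes S \<sigma> \<pi> :: "'a hfset set" and C :: "'p rel \<Rightarrow> nat \<Rightarrow> 'p list set" and m :: nat
      and a :: "'p list \<Rightarrow> 'k::comm_ring_1"
    and v :: "('a hfset \<times> nat \<times> ('p list \<Rightarrow> 'k) \<times> ('a hfset \<times> nat \<times> ('p list \<Rightarrow> 'k)) list) list"
  assumes S: "finset S" and le: "(\<sigma>, \<pi>) \<in> Part_poset S" and C: "C \<in> {chat_chains, c_chains}"
      and a: "a \<in> ZP C \<sigma> m"
    and v: "distinct (map fst v)" "fst ` set v = \<sigma>"
    and v_mem: "\<forall>(U, n, c, w)\<in>set v. c \<in> ZP c_chains (restr \<pi> U) n \<and> kokP (restr \<pi> U) w"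
begin

abbreviation "\<rho> \<equiv> \<lambda>U. blk (restr \<pi> U)"

lemma parts: "\<sigma> \<in> Parts S" "\<pi> \<in> Parts S" "finset \<pi>" "finset \<sigma>" "part_lower \<pi> \<sigma> \<in> Parts \<pi>" "\<rho> ` \<sigma>
    = part_lower \<pi> \<sigma>"
proof -
  show 1: "\<sigma> \<in> Parts S" "\<pi> \<in> Parts S" using le S by (auto simp: Part_poset_iff)
  show "finset \<pi>" "finset \<sigma>" using PartsD(7)[OF S] 1 by auto
  show "part_lower \<pi> \<sigma> \<in> Parts \<pi>" "\<rho> ` \<sigma> = part_lower \<pi> \<sigma>" using part_lower_in_Parts[OF S le]
    by (auto simp: part_lower_def)
qed

lemma v_block:
  assumes "(U, n, c, w) \<in> set v"
  shows "U \<in> \<sigma>" "finset (elts U)" "restr \<pi> U \<in> Parts (elts U)" "elts (\<rho> U) = restr \<pi> U"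
    "c \<in> ZM (restr \<pi> U) n"
    "kokP (restr \<pi> U) w" "kunneth w \<in> ZQ (restr \<pi> U) (tdeg w)"
proof -
  show U: "U \<in> \<sigma>" using assms v(2) by force
  show *: "finset (elts U)" "restr \<pi> U \<in> Parts (elts U)" "elts (\<rho> U) = restr \<pi> U"
    using restr_finset[OF S le U] restr_in_Parts[OF S le U] by auto
  show "c \<in> ZM (restr \<pi> U) n"
    "kokP (restr \<pi> U) w" using v_mem assms by auto
  then show "kunneth w \<in> ZQ (restr \<pi> U) (tdeg w)"
    by (intro product_words.kunneth_Zc[OF words[OF *(1,2)]])
qed

lemma kokP_uw: "kokP (part_lower \<pi> \<sigma>) (uw \<pi> v)"
  unfolding kokP_iff[OF parts(3,5)]
proof (intro conjI)
  have mf: "map fst (uw \<pi> v) = map \<rho> (map fst v)" by (simp add: uw_def split_def)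
  show "distinct (map fst (uw \<pi> v))"
    unfolding mf using v inj_on_restr[OF S le] by (simp only: distinct_map list.set_map)
  have "fst ` set (uw \<pi> v) = set (map fst (uw \<pi> v))" by simp
  also have "\<dots> = part_lower \<pi> \<sigma>" unfolding mf using v parts(6) by (simp only: list.set_map)
  finally show "fst ` set (uw \<pi> v) = part_lower \<pi> \<sigma>" .
  show "\<forall>(T, n, c)\<in>set (uw \<pi> v). c \<in> ZM (elts T) n"
    using v_block(4,5) by (fastforce simp: uw_def)
qed

text \<open>Blocks of \<pi> inside different blocks of \<sigma> are different, so the concatenated
  lists index each block of \<pi> once.\<close>

lemma kokP_cw: "kokP \<pi> (cw v)"
  unfolding kokP_iff[OF S parts(2)]
proof (intro conjI)
  have k: "distinct (map fst w) \<and> fst ` set w = restr \<pi> U \<and>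
      (\<forall>(T, n, c)\<in>set w. c \<in> ZM (elts T) n)"
    if "(U, n, c, w) \<in> set v" for U n c w
    using v_block(6)[OF that] unfolding kokP_iff[OF v_block(2,3)[OF that]] .
  then have fw: "fst ` set (snd (snd (snd l))) = restr \<pi> (fst l)" "fst l \<in> \<sigma>" if "l \<in> set v" for l
  proof -
    obtain U n c w where "l = (U, n, c, w)" by (cases l) auto
    then show "fst ` set (snd (snd (snd l))) = restr \<pi> (fst l)" "fst l \<in> \<sigma>"
      using k[of U n c w] v_block(1)[of U n c w] that by simp_all
  qed
  have "fst ` set (cw v) = (\<Union>l\<in>set v. restr \<pi> (fst l))"
    unfolding fst_cw by (intro SUP_cong refl fw(1))
  also have "\<dots> = (\<Union>U\<in>\<sigma>. restr \<pi> U)" unfolding v(2)[symmetric] by simp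
  finally show "fst ` set (cw v) = \<pi>" using restr_union[OF S le] by simp
  have "distinct (map fst (cw v'))" if "set v' \<subseteq> set v" "distinct (map fst v')" for v'
    using that
  proof (induction v')
    case (Cons l v')
    obtain U n c w where l: "l = (U, n, c, w)" by (cases l) auto
    have U: "(U, n, c, w) \<in> set v" using Cons.prems l by simp
    have "fst ` set w \<inter> fst ` set (cw v') = {}"
    proof (rule ccontr)
      assume "fst ` set w \<inter> fst ` set (cw v') \<noteq> {}"
      then obtain V l' where V: "V \<in> fst ` set w" "l' \<in> set v'" "V \<in> fst ` set (snd (snd (snd l')))"
        unfolding fst_cw by blast
      have "l' \<in> set v" using V(2) Cons.prems by auto
      then have "U = fst l'"
        using restr_disjoint[OF S le, of U "fst l'" V] fw[OF U] fw[of l'] V by simp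
      then show False using V(2) Cons.prems(2) by (simp add: l)
    qed
    then show ?case using Cons k[OF U] by (auto simp: l cw_def)
  qed (simp add: cw_def)
  then show "distinct (map fst (cw v))" using v(1) by simp
  show "\<forall>(T, n, c)\<in>set (cw v). c \<in> ZM (elts T) n"
    using k by (fastforce simp: cw_def)
qed

lemma kokP_mw: "kokP \<sigma> (mw \<pi> v)"
  unfolding kokP_iff[OF S parts(1)]
proof (intro conjI)
  have mf: "map fst (mw \<pi> v) = map fst v" by (simp add: mw_def split_def)
  show "distinct (map fst (mw \<pi> v))" "fst ` set (mw \<pi> v) = \<sigma>" using mf v
    by (simp, metis list.set_map)
  have "cc c_chains (elts U) (restr \<pi> U) n (tdeg w) c (kunneth w) \<in>
      ZM (elts U) (n + tdeg w)"
    if "(U, n, c, w) \<in> set v" for U n c w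
    using cc_Zc[OF v_block(2)[OF that], of c_chains c "restr \<pi> U" n "kunneth w" "tdeg w"]
        v_block(5,7)[OF that] by simp
  then show "\<forall>(T, n, c)\<in>set (mw \<pi> v). c \<in> ZM (elts T) n"
    by (auto simp: mw_def)
qed

lemma upper_fibre:
  assumes ab: "(a0, b0) \<in> pos P S" and a0: "anchor P S a0 = \<sigma>" and U: "U \<in> \<sigma>"
  shows "upper P S a0 b0 U \<in> Field (pos P (elts U))" "anchor P (elts U) (upper P S a0 b0 U)
      = restr (anchor P S b0) U"
  using upper_block_Field[OF S ab] anchor_upper[OF S ab] U a0 by auto

lemma wchain_upper_block:
  assumes a0: "a0 \<in> Field (pos P S)" "anchor P S a0 = \<sigma>"
      and e: "wchain (pos P S) e" "\<And>y. y \<in> set e \<Longrightarrow> (a0, y) \<in> pos P S"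
    and U: "U \<in> \<sigma>"
  shows "wchain (pos P (elts U)) (map (\<lambda>y. upper P S a0 y U) e)"
proof -
  have "wchain (pos P (elts U)) (map (\<lambda>h. h U) (map (upper P S a0) e))"
    by (rule wchain_map[OF wchain_upper[OF S a0(1) e, unfolded a0(2)]]) (auto intro:
        prod_poset_mono[OF _ U])
  then show ?thesis by (simp add: comp_def)
qed

text \<open>The axiom \<open>assoc_mixed\<close>, letter by letter: the component at
  \<open>\<rho> U\<close> of the upper part of \<open>lower P S b0 y\<close> is obtained from the
  component of \<open>upper P S a0 y\<close> at \<open>U\<close> by the lower map at the cut point
  of \<open>U\<close>. So every letter of the inner composition on the left becomes a letter of
  \<open>ylet\<close>.\<close>

lemma wcup_uw:
  assumes ab: "(a0, b0) \<in> pos P S" and anc: "anchor P S a0 = \<sigma>" "anchor P S b0 = \<pi>"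
    and d: "wchain (pos P S) d" "\<And>y. y \<in> set d \<Longrightarrow> (a0, y) \<in> pos P S \<and> (y, b0) \<in> pos P S"
  shows "wcup (klP (uw \<pi> v)) (map (\<lambda>y. upper P \<pi> (lower P S b0 a0) (lower P S b0 y)) d) =
    wcup (ylet (upper P S a0 b0) v) (map (upper P S a0) d)"
proof (rule wcup_transfer[of "set d" "pos P S"])
  have a0: "a0 \<in> Field (pos P S)" using pos_FieldI[OF ab] by simp
  have H: "c (map (\<lambda>y. upper P \<pi> (lower P S b0 a0) (lower P S b0 y) (\<rho> U)) e) =
      lo c_chains (elts U) n (upper P S a0 b0 U) c (map (\<lambda>y. upper P S a0 y U) e)"
    if l: "(U, n, c, w) \<in> set v" and e: "set e \<subseteq> set d" "e = [] \<or> wchain (pos P S) e" for U n c w e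
  proof (cases "e = []")
    case True
    then show ?thesis using v_block(5)[OF l] by (auto simp: lo_def pl_def chl_def wchain_def
        Zc_def supp_def)
  next
    case False
    note U = v_block[OF l]
    note f = upper_fibre[OF ab anc(1) U(1)]
    have "lo c_chains (elts U) n (upper P S a0 b0 U) c (map (\<lambda>y. upper P S a0 y U) e) =
      c (map (lower P (elts U) (upper P S a0 b0 U)) (map (\<lambda>y. upper P S a0 y U) e))"
    proof (rule lo_wchain[OF U(2) f(1)])
      show "c \<in> ZP c_chains (anchor P (elts U) (upper P S a0 b0 U)) n" using U(5)
        by (simp add: f(2) anc)
      show "wchain (pos P (elts U)) (map (\<lambda>y. upper P S a0 y U) e)"
        using e False d(2) by (intro wchain_upper_block[OF a0 anc(1) _ _ U(1)]) auto
      show "(y, upper P S a0 b0 U) \<in> pos P (elts U)" if "y \<in> set (map (\<lambda>y. upper P S a0 y U) e)"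
          for y
        using that e(1) d(2) U(1) anc(1) by (auto intro!: upper_block_le[OF S])
    qed
    also have "map (lower P (elts U) (upper P S a0 b0 U)) (map (\<lambda>y. upper P S a0 y U) e) =
      map (\<lambda>y. upper P \<pi> (lower P S b0 a0) (lower P S b0 y) (\<rho> U)) e"
      using assoc_mixed[OF S, of a0 _ b0 U] d(2) e(1) anc U(1) by (auto simp: subset_iff)
    finally show ?thesis by simp
  qed
  show "list_all2 (\<lambda>(i, n, c, B) (i', n', c', B'). n = n' \<and>
      (\<forall>e. set e \<subseteq> set d \<longrightarrow> e = [] \<or> wchain (pos P S) e \<longrightarrow>
        c (map (\<lambda>x. upper P \<pi> (lower P S b0 a0) (lower P S b0 x) i) e)
            = c' (map (\<lambda>x. upper P S a0 x i') e)))
    (klP (uw \<pi> v)) (ylet (upper P S a0 b0) v)"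
    using H unfolding kl_def uw_def ylet_def map_map list_all2_map1 list_all2_map2 list_all2_same
    using H[OF _ _ disjI1[OF refl]] by auto
qed (use d(1) in auto)

text \<open>The axiom \<open>assoc_upper\<close>: for each block \<open>U\<close> of \<sigma>, the
  subword for the blocks of \<pi> inside \<open>U\<close> becomes a single letter in the coordinate
  \<open>U\<close>, the Kuenneth cochain pulled back to the elements above the cut point. The list
  \<open>v'\<close> is general only for the induction.\<close>

lemma wcup_cw:
  assumes ab: "(a0, b0) \<in> pos P S" and anc: "anchor P S a0 = \<sigma>" "anchor P S b0 = \<pi>"
  shows "\<lbrakk>wchain (pos P S) e; \<And>y. y \<in> set e \<Longrightarrow> (b0, y) \<in> pos P S; length e
      = Suc (tdeg (cw v')); set v' \<subseteq> set v\<rbrakk>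
    \<Longrightarrow> wcup (klP (cw v')) (map (upper P S b0) e)
        = wcup (wlet (upper P S a0 b0) v') (map (upper P S a0) e)"
proof (induction v' arbitrary: e)
  case (Cons l v')
  obtain U n c w where l: "l = (U, n, c, w)" by (cases l) auto
  have lv: "(U, n, c, w) \<in> set v" using Cons.prems l by simp
  note U = v_block[OF lv]
  note f = upper_fibre[OF ab anc(1) U(1)]
  interpret product_words "restr \<pi> U" bpos by (rule words[OF U(2,3)])
  have F: "a0 \<in> Field (pos P S)" "b0 \<in> Field (pos P S)" using pos_FieldI[OF ab] by auto
  have len: "length e = Suc (tdeg w + tdeg (cw v'))" using Cons.prems(3) by (simp add: l cw_def)
  have a0e: "(a0, y) \<in> pos P S" if "y \<in> set e" for y
    using finite_poset_trans[OF pos_poset[OF S] ab Cons.prems(2)[OF that]] .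
  let ?e = "take (Suc (tdeg w)) e" and ?e' = "drop (tdeg w) e"
  have e: "wchain (pos P S) ?e" "wchain (pos P S) ?e'" using Cons.prems(1) len
    by (auto intro: wchain_take wchain_drop)
  let ?b = "upper P S a0 b0 U"
  have we: "wchain (pos P (elts U)) (map (\<lambda>y. upper P S a0 y U) ?e)"
    using a0e by (intro wchain_upper_block[OF F(1) anc(1) e(1) _ U(1)]) (auto dest: in_set_takeD)
  have le_b: "(?b, y) \<in> pos P (elts U)" if "y \<in> set (map (\<lambda>y. upper P S a0 y U) ?e)" for y
    using that Cons.prems(2) U(1) anc(1) by (auto dest!: in_set_takeD intro!: upper_block_le[OF S
        ab])
  have "hi (elts U) (tdeg w) ?b (kunneth w) (map (\<lambda>y. upper P S a0 y U) ?e) =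
    kunneth w (map (upper P (elts U) ?b) (map (\<lambda>y. upper P S a0 y U) ?e))"
    by (rule hi_wchain[OF U(2) f(1) _ we le_b]) (use U(7) in \<open>simp add: f(2) anc\<close>)
  also have "\<dots> = wcup (klP w) (map (upper P (elts U) ?b) (map (\<lambda>y. upper P S a0 y U) ?e))"
    using wchain_upper[OF U(2) f(1) we le_b] len
    by (intro kunneth_eq_wcup[OF U(6)]) (simp_all add: f(2) anc)
  also have "\<dots> = wcup (klP w) (map (upper P S b0) ?e)"
    unfolding map_map
  proof (rule wcup_cong)
    fix y T assume "y \<in> set ?e" "T \<in> fst ` set (klP w)"
    moreover have "fst ` set (klP w) = restr \<pi> U" using U(6) by (simp add: kok_def)
    ultimately show "(upper P (elts U) ?b \<circ> (\<lambda>y. upper P S a0 y U)) y T = upper P S b0 y T"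
      using assoc_upper[OF S ab Cons.prems(2), of y U T] anc U(1) by (auto dest: in_set_takeD)
  qed
  finally have 1: "hi (elts U) (tdeg w) ?b (kunneth w) (map (\<lambda>y. upper P S a0 y U) ?e)
      = wcup (klP w) (map (upper P S b0) ?e)" .
  have 2: "wcup (klP (cw v')) (map (upper P S b0) ?e')
      = wcup (wlet (upper P S a0 b0) v') (map (upper P S a0) ?e')"
    by (rule Cons.IH[OF e(2)]) (use Cons.prems len in \<open>auto dest: in_set_dropD\<close>)
  have "wcup (klP (cw (l # v'))) (map (upper P S b0) e)
      = wcup (klP w @ klP (cw v')) (map (upper P S b0) e)"
    by (simp add: l cw_def)
  also have "\<dots> = wcup (klP w) (map (upper P S b0) ?e) * wcup (klP (cw v')) (map (upper P S b0) ?e')"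
    using wcup_append[of "map (upper P S b0) e" "klP w" "klP (cw v')"] len
    by (simp add: take_map drop_map)
  also have "\<dots> = wcup (wlet (upper P S a0 b0) (l # v')) (map (upper P S a0) e)"
    unfolding 1[symmetric] 2 by (simp add: l wlet_def take_map drop_map comp_def)
  finally show ?case .
qed (simp add: cw_def wlet_def)

text \<open>The instance of \<open>weq_unshuffle\<close> for a fixed choice of cut points: the
  intermediate regions are \<open>{b U}\<close> and the final ones are the maximal elements.\<close>

lemma wok_split:
  assumes b: "b \<in> PiE \<sigma> (\<lambda>U. fibre (elts U) (restr \<pi> U))"
  shows "product_words.weq \<sigma> bpos (minst bpos) ((-1) ^ shuffle_exp v)
      (ylet b v @ wlet b v)
      (map (\<lambda>(U, n, c, w). (U, n + tdeg w, cup n (lo c_chains (elts U) n (b U) c) (hi (elts U)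
          (tdeg w) (b U) (kunneth w)),
         max_elems (pos P (elts U)))) v)"
proof -
  interpret product_words \<sigma> bpos by (rule words[OF S parts(1)])
  show ?thesis
    unfolding ylet_def wlet_def
  proof (rule weq_unshuffle[where f = "\<lambda>U n c. lo c_chains (elts U) n (b U) c"
      and g = "\<lambda>U w. hi (elts U) (tdeg w) (b U) (kunneth w)"
        and B = "\<lambda>U. {b U}" and D = "\<lambda>U. max_elems (pos P (elts U))", OF states_minst v(1)])
    fix U n c w assume l: "(U, n, c, w) \<in> set v"
    note U = v_block[OF l]
    have bU: "b U \<in> Field (pos P (elts U))" "anchor P (elts U) (b U) = restr \<pi> U"
      using b U(1) by (auto simp: fibre_def PiE_iff)
    show "U \<in> \<sigma> \<and> antichain (pos P (elts U)) {b U}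
        \<and> antichain (pos P (elts U)) (max_elems (pos P (elts U))) \<and>
      lo c_chains (elts U) n (b U) c \<in> Zc (pos P (elts U)) (minst bpos U) {b U} n \<and>
      hi (elts U) (tdeg w) (b U) (kunneth w) \<in> Zc (pos P (elts U)) {b U} (max_elems (pos P (elts
          U))) (tdeg w)"
      using lo_Zc[OF U(2) bU(1), of c_chains c n] hi_Zc[OF U(2) bU(1), of c_chains "kunneth w"
          "tdeg w"] U
      by (simp add: bU(2) antichain_singleton antichain_max minst_def)
  qed
qed

text \<open>Each letter of \<open>mw \<pi> v\<close> is a composition and hence a sum over possible
  cut points in its block. Expanded over all choices \<open>b\<close>, the Kuenneth cochain is a sum
  of merged words, and \<open>wok_split\<close> compares each of them with the corresponding summand
  of \<open>split_sum\<close>.\<close>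

lemma split_sum_cong: "(\<lambda>t. split_sum \<sigma> \<pi> v t - (-1) ^ shuffle_exp v * kunneth (mw \<pi> v) t)
    \<in> BQ \<sigma> (deg1 v + deg2 v)"
proof -
  interpret product_words \<sigma> bpos by (rule words[OF S parts(1)])
  let ?R = bpos
  let ?F = "\<lambda>U. fibre (elts U) (restr \<pi> U)"
  let ?m = "\<lambda>b. map (\<lambda>(U, n, c, w). (U, n + tdeg w, cup n (lo c_chains (elts U) n (b U) c) (hi
      (elts U) (tdeg w) (b U) (kunneth w)),
         max_elems (pos P (elts U)))) v"
  have kl_mw: "kl ?R (mw \<pi> v) = map (\<lambda>(U, n, c, w). (U, n + tdeg w,
      \<lambda>u. \<Sum>x\<in>?F U. cup n (lo c_chains (elts U) n x c) (hi (elts U) (tdeg w) x (kunneth w)) u,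
          max_elems (pos P (elts U)))) v"
    by (simp add: kl_def mw_def cc_def split_def comp_def)
  have fin: "finite (?F U)" if "U \<in> \<sigma>" for U by (rule finite_fibre[OF PartsD(4)[OF S parts(1)
      that]])
  have fm: "fst ` set (?m b) = \<sigma>" for b
  proof -
    have "map fst (?m b) = map fst v" by (simp add: split_def)
    then show ?thesis using v(2) by (metis list.set_map)
  qed
  have ends: "PiE \<sigma> (wfin (minst ?R) (?m b)) = max_elems Q" for b
  proof -
    have "wfin (minst ?R) (?m b) U = max_elems (pos P (elts U))" if "U \<in> \<sigma>" for U
      using that fm[of b] by (subst wfin_regions[of _ "\<lambda>U. max_elems (pos P (elts U))"]) auto
    then show ?thesis unfolding maxQ by (intro PiE_cong)
  qed
  have deg: "wdeg (?m b) = deg1 v + deg2 v" for b by (induction v) auto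
  have K: "kunneth (mw \<pi> v) t = (\<Sum>b\<in>PiE \<sigma> ?F. W (minst ?R) (?m b) t)" for t
  proof (cases "t \<in> chl Q (min_elems Q) (max_elems Q) (Suc (deg1 v + deg2 v))")
    case True
    have "(\<Sum>b\<in>PiE (fst ` set v) ?F. wcup (?m b) t) = wcup (kl ?R (mw \<pi> v)) t"
      unfolding kl_mw
      by (rule wcup_sum[where d = "\<lambda>n w. n + tdeg w" and D = "\<lambda>U. max_elems (pos P (elts U))" and
          h = "\<lambda>U n c w x. cup n (lo c_chains (elts U) n x c) (hi (elts U) (tdeg w) x (kunneth
              w))", OF v(1)])
        (use fin v(2) in simp)
    then show ?thesis using True v(2) kokP_mw PiE_wfin_kl[of "mw \<pi> v"]
      by (simp add: kunneth_eq_W[OF kokP_mw] W_def deg ends PiE_minst tdeg_mw kok_def)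
  next
    case False
    then show ?thesis using kokP_mw PiE_wfin_kl[of "mw \<pi> v"]
      by (simp add: kunneth_eq_W[OF kokP_mw] W_def deg ends PiE_minst tdeg_mw kok_def)
  qed
  have "(\<lambda>t. \<Sum>b\<in>PiE \<sigma> ?F. WP \<sigma> (ylet b v @ wlet b v) t - (-1) ^ shuffle_exp v * WP \<sigma> (?m b) t)
      \<in> BQ \<sigma> (deg1 v + deg2 v)"
  proof (rule fun_subspace_sum[OF fun_subspace_Bc])
    show "finite (PiE \<sigma> ?F)" using finI fin by (rule finite_PiE)
    show "(\<lambda>t. WP \<sigma> (ylet b v @ wlet b v) t - (-1) ^ shuffle_exp v * WP \<sigma> (?m b) t)
        \<in> BQ \<sigma> (deg1 v + deg2 v)" if "b \<in> PiE \<sigma> ?F" for b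
    proof -
      note we = wok_split[OF that, unfolded weq_def]
      have "wfin (minst ?R) (ylet b v @ wlet b v)
          = wfin (minst ?R) (?m b)" "wdeg (ylet b v @ wlet b v) = wdeg (?m b)"
        using we by blast+
      from we[THEN conjunct2, THEN conjunct2, THEN conjunct2, THEN conjunct2, unfolded this ends
          deg PiE_minst]
      show ?thesis .
    qed
  qed
  then show ?thesis by (simp add: split_sum_def K sum_distrib_left sum_subtractf)
qed

text \<open>On a given chain the choice \<open>b\<close> is forced: it is the family of coordinates
  at the position where the first letters end. The sum thus collapses to a condition on
  anchors.\<close>

lemma split_sum_value:
  assumes t: "wchain (prodP \<sigma>) t" "hd t \<in> min_elems (prodP \<sigma>)" "last t
      \<in> max_elems (prodP \<sigma>)" "length t = Suc (deg1 v + deg2 v)"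
  shows "split_sum \<sigma> \<pi> v t = (if \<forall>U\<in>\<sigma>. anchor P (elts U) ((t ! deg1 v) U) = restr \<pi> U
    then wcup (ylet (t ! deg1 v) v @ wlet (t ! deg1 v) v) t else 0)"
proof -
  interpret product_words \<sigma> bpos by (rule words[OF S parts(1)])
  let ?R = bpos
  let ?F = "\<lambda>U. fibre (elts U) (restr \<pi> U)" and ?q = "deg1 v"
  let ?h = "t ! ?q"
  have hQ: "?h \<in> Field Q" using t(1,4) by (auto simp: wchain_def)
  have W: "WP \<sigma> (ylet b v @ wlet b v) t = wcup (ylet b v @ wlet b v) t" if b: "b \<in> PiE \<sigma> ?F" for b
  proof -
    note we = wok_split[OF b, unfolded weq_def]
    have "fst ` set (wlet b v) = \<sigma>"
    proof -
      have "map fst (wlet b v) = map fst v" by (simp add: wlet_def split_def)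
      then show ?thesis using v(2) by (metis list.set_map)
    qed
    then have "wfin (minst ?R) (ylet b v @ wlet b v) U = max_elems (pos P (elts U))" if "U \<in> \<sigma>"
        for U
      using that unfolding wfin_append
      by (subst wfin_regions[of _ "\<lambda>U. max_elems (pos P (elts U))"]) (auto simp: wlet_def)
    then have "PiE \<sigma> (wfin (minst ?R) (ylet b v @ wlet b v)) = max_elems Q" unfolding maxQ
      by (intro PiE_cong)
    then show ?thesis using t we by (intro W_wchain) (simp_all add: PiE_minst wdeg_ylet wdeg_wlet)
  qed
  \<comment> \<open>The coordinate \<open>U\<close> takes the value \<open>b U\<close> at or before
    the cut, as target of its first letter, and at or after the cut, as source of its second letter.
    By antisymmetry it has this value at the cut.\<close>
  have only: "b = ?h" if b: "b \<in> PiE \<sigma> ?F" and nz: "wcup (ylet b v @ wlet b v) t \<noteq> 0" for b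
  proof (rule PiE_ext)
    show "b \<in> PiE \<sigma> (\<lambda>U. Field (pos P (elts U)))" using b by (auto simp: PiE_iff fibre_def)
    show "?h \<in> PiE \<sigma> (\<lambda>U. Field (pos P (elts U)))" using hQ FQ by simp
    fix U assume U: "U \<in> \<sigma>"
    obtain n c w where l: "(U, n, c, w) \<in> set v" using U v(2) by force
    have bU: "b U \<in> Field (pos P (elts U))" "anchor P (elts U) (b U) = restr \<pi> U" using b U
      by (auto simp: fibre_def PiE_iff)
    have "wcup (ylet b v) (take (Suc ?q) t) \<noteq> 0" "wcup (wlet b v) (drop ?q t) \<noteq> 0"
      using nz wcup_append[of t "ylet b v" "wlet b v"] t(4) by (auto simp: wdeg_ylet wdeg_wlet)
    note ws = this[THEN wsupp_if_wcup]
    have "(U, n, lo c_chains (elts U) n (b U) c, {b U}) \<in> set (ylet b v)"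
      "(U, tdeg w, hi (elts U) (tdeg w) (b U) (kunneth w), max_elems (pos P (elts U)))
          \<in> set (wlet b v)"
      using l by (force simp: ylet_def wlet_def)+
    moreover have "supp (lo c_chains (elts U) n (b U) c)
        \<subseteq> chl (pos P (elts U)) (start c_chains (pos P (elts U))) {b U} (Suc n)"
      "supp (hi (elts U) (tdeg w) (b U) (kunneth w))
          \<subseteq> chl (pos P (elts U)) {b U} (max_elems (pos P (elts U))) (Suc (tdeg w))"
      by (auto simp: lo_def hi_def pl_def supp_def)
    ultimately obtain h h' where h: "h \<in> set (take (Suc ?q) t)" "h U = b U" "h'
        \<in> set (drop ?q t)" "h' U = b U"
      using wsupp_meets(2)[OF ws(1)] wsupp_meets(1)[OF ws(2)] by (metis singletonD)
    have "(h, ?h) \<in> Q" "(?h, h') \<in> Q"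
      using h(1,3) t(4) by (auto simp: in_set_conv_nth intro!: wchain_nth_mono[OF Q t(1)])
    then have "(b U, ?h U) \<in> pos P (elts U)" "(?h U, b U) \<in> pos P (elts U)"
      using prod_poset_mono[of _ _ \<sigma> ?R U] U h(2,4) by metis+
    then show "b U = ?h U" using finite_poset_antisym[OF R[OF U]] by blast
  qed
  have fin: "finite (PiE \<sigma> ?F)"
    using finI finite_fibre[OF PartsD(4)[OF S parts(1)]] by (rule finite_PiE)
  have "split_sum \<sigma> \<pi> v t = (\<Sum>b\<in>PiE \<sigma> ?F. if b = ?h then wcup (ylet ?h v @ wlet ?h v) t else 0)"
    unfolding split_sum_def
  proof (rule sum.cong[OF refl])
    fix b assume b: "b \<in> PiE \<sigma> ?F"
    show "WP \<sigma> (ylet b v @ wlet b v) t = (if b = ?h then wcup (ylet ?h v @ wlet ?h v) t else 0)"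
    proof (cases "b = ?h")
      case True
      show ?thesis using W[OF b] unfolding True by simp
    next
      case False
      then show ?thesis using W[OF b] only[OF b] by auto
    qed
  qed
  also have "\<dots> = (if ?h \<in> PiE \<sigma> ?F then wcup (ylet ?h v @ wlet ?h v) t else 0)"
    using fin by simp
  also have "?h \<in> PiE \<sigma> ?F \<longleftrightarrow> (\<forall>U\<in>\<sigma>. anchor P (elts U) (?h U) = restr \<pi> U)"
    using hQ unfolding FQ by (auto simp: PiE_iff fibre_def)
  finally show ?thesis .
qed

text \<open>Both sides are compared at a chain \<open>z\<close> with the two cut points
  \<open>?a0\<close> and \<open>?b0\<close>. The part before \<open>?a0\<close> is handled by
  \<open>assoc_lower\<close>, the part between them by \<open>wcup_uw\<close>, the part after
  \<open>?b0\<close> by \<open>wcup_cw\<close>. The letters stand in the same order on both sides,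
  so no sign and no coboundary appears.\<close>

lemma assoc_cochains:
  "cc C S \<pi> (m + deg1 v) (deg2 v) (cc C \<pi> (part_lower \<pi> \<sigma>) m (deg1 v) (tr C \<sigma> \<rho> m a) (kunneth (uw
      \<pi> v))) (kunneth (cw v)) =
   cc C S \<sigma> m (deg1 v + deg2 v) a (split_sum \<sigma> \<pi> v)"
proof
  fix z :: "'p list"
  let ?q = "deg1 v" and ?r = "deg2 v"
  let ?a0 = "z ! m" and ?b0 = "z ! (m + ?q)"
  let ?X = "cc C \<pi> (part_lower \<pi> \<sigma>) m ?q (tr C \<sigma> \<rho> m a) (kunneth (uw \<pi> v))"
  show "cc C S \<pi> (m + ?q) ?r ?X (kunneth (cw v)) z = cc C S \<sigma> m (?q + ?r) a (split_sum \<sigma> \<pi> v) z"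
  proof (cases "z \<in> chP C S (Suc (m + ?q + ?r))")
    case z: True
    then have zm: "z \<in> chP C S (Suc (m + (?q + ?r)))" by (simp add: add.assoc)
    note za = chl_wchain_parts[OF S zm] and zb = chl_wchain_parts[OF S z]
    have len: "length z = Suc (m + ?q + ?r)" using z by (simp add: chl_def)
    let ?d = "take (Suc ?q) (drop m z)" and ?t = "map (upper P S ?a0) (drop m z)"
    have ab: "(?a0, ?b0) \<in> pos P S"
      using len by (intro za(5)) (auto simp: in_set_conv_nth intro!: exI[of _ ?q])
    have d_eq: "?d = drop m (take (Suc (m + ?q)) z)" by (simp add: drop_take)
    have d: "wchain (pos P S) ?d" "\<And>y. y \<in> set ?d \<Longrightarrow> (?a0, y) \<in> pos P S \<and> (y, ?b0) \<in> pos P S"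
    proof -
      show "wchain (pos P S) ?d" using za(2) len by (intro wchain_take) auto
      show "(?a0, y) \<in> pos P S \<and> (y, ?b0) \<in> pos P S" if "y \<in> set ?d" for y
        using that za(5)[of y] zb(4)[of y] by (metis d_eq in_set_dropD in_set_takeD)
    qed
    have L: "cc C S \<pi> (m + ?q) ?r ?X (kunneth (cw v)) z = (if anchor P S ?b0 = \<pi> then
      ?X (map (lower P S ?b0) (take (Suc (m + ?q)) z)) * wcup (klP (cw v)) (map (upper P S ?b0)
          (drop (m + ?q) z)) else 0)"
      using cc_kunneth[OF S parts(2) C kokP_cw, of z "m + ?q" ?X] z by (simp add: tdeg_cw)
    have R: "cc C S \<sigma> m (?q + ?r) a (split_sum \<sigma> \<pi> v) z = (if anchor P S ?a0 = \<sigma> then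
      a (map (lower P S ?a0) (take (Suc m) z)) * split_sum \<sigma> \<pi> v ?t else 0)"
      using zm by (simp add: cc_eq[OF S C])
    \<comment> \<open>The inner composition is evaluated on the image of the lower part of
      \<open>z\<close>, which may repeat entries; therefore the version for weak chains is
      used.\<close>
    have X: "?X (map (lower P S ?b0) (take (Suc (m + ?q)) z)) = (if anchor P S ?a0 = \<sigma> then
        a (map (lower P S ?a0) (take (Suc m) z)) * wcup (ylet (upper P S ?a0 ?b0) v) (map (upper P
            S ?a0) ?d) else 0)"
      if b0: "anchor P S ?b0 = \<pi>"
    proof -
      let ?z = "map (lower P S ?b0) (take (Suc (m + ?q)) z)"
      have tr: "tr C \<sigma> \<rho> m a \<in> ZP C (part_lower \<pi> \<sigma>) m"
        using tr_Zc[OF parts(4) C inj_on_restr[OF S le] a] parts(6) by simp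
      have ne: "take (Suc (m + ?q)) z \<noteq> []" using len by auto
      have hd: "hd (take (Suc (m + ?q)) z) = z ! 0" "last (take (Suc (m + ?q)) z) = ?b0"
        using len ne by (cases z; simp) (use len last_conv_nth[OF ne] in simp)
      have "z ! 0 \<in> set (take (Suc (m + ?q)) z)" using hd_in_set[OF ne] hd by simp
      then have "(z ! 0, ?b0) \<in> pos P S" by (rule zb(4))
      then have "lower P S ?b0 (z ! 0) \<in> start C (pos P \<pi>)" "lower P S ?b0 ?b0
          \<in> max_elems (pos P \<pi>)"
        using lower_start_iff[OF S, of "z ! 0" ?b0 C] lower_max_iff[OF S finite_poset_refl[OF
            pos_poset[OF S] zb(3)]]
          chl_nth(2)[OF z] b0 by auto
      then have "?X ?z = (if anchor P \<pi> (?z ! m) = part_lower \<pi> \<sigma> then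
          tr C \<sigma> \<rho> m a (map (lower P \<pi> (?z ! m)) (take (Suc m) ?z)) * wcup (klP (uw \<pi> v)) (map
              (upper P \<pi> (?z ! m)) (drop m ?z)) else 0)"
        using cc_kunneth_wchain[OF parts(3,5) C tr kokP_uw, of ?z] zb(6) b0 ne hd len
        by (simp add: tdeg_uw hd_map last_map)
      moreover have "?z ! m = lower P S ?b0 ?a0" using len by simp
      moreover have "anchor P \<pi> (lower P S ?b0 ?a0) = part_lower \<pi> \<sigma> \<longleftrightarrow> anchor P S ?a0 = \<sigma>"
        using anchor_lower[OF S ab] part_lower_inj[OF S le, of "anchor P S ?a0"] anchor_le[OF S
            ab] b0 by auto
      \<comment> \<open>\<open>assoc_lower\<close> holds up to the relabelling of \<sigma> by
        \<open>\<rho>\<close>; the transport \<open>tr\<close> in the statement cancels it.\<close>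
      moreover have "tr C \<sigma> \<rho> m a (map (lower P \<pi> (lower P S ?b0 ?a0)) (take (Suc m) ?z))
          = a (map (lower P S ?a0) (take (Suc m) z))"
        if a0: "anchor P S ?a0 = \<sigma>"
      proof -
        have "map (lower P \<pi> (lower P S ?b0 ?a0)) (take (Suc m) ?z)
            = map (pos_map P \<sigma> \<rho>) (map (lower P S ?a0) (take (Suc m) z))"
          using assoc_lower[OF S za(4) ab] a0 b0 by (simp add: take_map min_def)
        moreover have "map (unmap \<sigma> \<rho>) (map (pos_map P \<sigma> \<rho>) (map (lower P S ?a0) (take (Suc m)
            z))) = map (lower P S ?a0) (take (Suc m) z)"
          using pos_map_inverse[OF parts(4) inj_on_restr[OF S le] lower_Field[OF S za(4), unfolded
              a0]] by simp
        moreover have "wchain (pos P (\<rho> ` \<sigma>)) (map (pos_map P \<sigma> \<rho>) (map (lower P S ?a0) (take (Suc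
            m) z)))"
          by (rule wchain_map[OF za(6)]) (auto simp: a0 intro: pos_map_le[OF parts(4)
              inj_on_restr[OF S le]])
        ultimately show ?thesis using tr_wchain[OF parts(4) inj_on_restr[OF S le] a] by metis
      qed
      moreover have "wcup (klP (uw \<pi> v)) (map (upper P \<pi> (lower P S ?b0 ?a0)) (drop m ?z)) =
          wcup (ylet (upper P S ?a0 ?b0) v) (map (upper P S ?a0) ?d)" if "anchor P S ?a0 = \<sigma>"
        using wcup_uw[OF ab that b0 d] unfolding d_eq by (simp add: drop_map comp_def)
      ultimately show ?thesis by simp
    qed
    \<comment> \<open>A partition finer than \<sigma> is determined by its restrictions to the
      blocks of \<sigma>, so the anchor condition of \<open>split_sum_value\<close> is the condition
      on \<open>?b0\<close>.\<close>
    have G: "split_sum \<sigma> \<pi> v ?t = (if anchor P S ?b0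
        = \<pi> then wcup (ylet (upper P S ?a0 ?b0) v) (map (upper P S ?a0) ?d) *
        wcup (klP (cw v)) (map (upper P S ?b0) (drop (m + ?q) z)) else 0)" if a0: "anchor P S ?a0
            = \<sigma>"
    proof -
      have "?t ! ?q = upper P S ?a0 ?b0" using len by simp
      moreover have "(\<forall>U\<in>\<sigma>. anchor P (elts U) (upper P S ?a0 ?b0 U) = restr \<pi> U) \<longleftrightarrow> anchor P S ?b0
          = \<pi>"
        using upper_fibre(2)[OF ab a0] restr_eqD[OF S _ le, of "anchor P S ?b0"] anchor_le[OF S
            ab] a0 by auto
      moreover have "wcup (ylet b v @ wlet b v) ?t
          = wcup (ylet b v) (map (upper P S ?a0) ?d) * wcup (wlet b v) (map (upper P S ?a0) (drop
          (m + ?q) z))" for b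
        using wcup_append[of ?t "ylet b v" "wlet b v"] len
        by (simp add: wdeg_ylet wdeg_wlet take_map drop_map add.commute)
      moreover have "wcup (wlet (upper P S ?a0 ?b0) v) (map (upper P S ?a0) (drop (m + ?q) z)) =
          wcup (klP (cw v)) (map (upper P S ?b0) (drop (m + ?q) z))" if "anchor P S ?b0 = \<pi>"
        using wcup_cw[OF ab a0 that zb(2,5), of v] len by (simp add: tdeg_cw)
      ultimately show ?thesis
        using split_sum_value[of ?t] za(7) upper_chl_ends[OF S zm] len by (simp add: a0)
    qed
    show ?thesis unfolding L R using X G by (auto simp: mult.assoc)
  qed (simp add: cc_eq[OF S C] add.assoc)
qed

text \<open>The only coboundary comes from reordering letters in the product over \<sigma>.
  Composition with the cocycle \<open>a\<close> turns it into a coboundary on \<open>P(S)\<close>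
  and carries the shuffle sign along.\<close>

lemma assoc_class:
  "coh_class C (pos P S) (m + deg1 v + deg2 v) (cc C S \<pi> (m + deg1 v) (deg2 v)
      (cc C \<pi> (part_lower \<pi> \<sigma>) m (deg1 v) (tr C \<sigma> \<rho> m a) (kunneth (uw \<pi> v))) (kunneth (cw v))) =
   (-1) ^ shuffle_exp v \<odot>\<^bsub>coh C (pos P S) (m + deg1 v + deg2 v)\<^esub>
     coh_class C (pos P S) (m + deg1 v + deg2 v) (cc C S \<sigma> m (tdeg (mw \<pi> v)) a (kunneth (mw \<pi> v)))"
proof -
  have "cc C S \<sigma> m (deg1 v + deg2 v) a (\<lambda>t. split_sum \<sigma> \<pi> v t - (-1) ^ shuffle_exp v * kunneth (mw
      \<pi> v) t)
    \<in> BP C S (m + (deg1 v + deg2 v))"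
    by (rule cc_Bc_right[OF S C a split_sum_cong])
  also have "cc C S \<sigma> m (deg1 v + deg2 v) a (\<lambda>t. split_sum \<sigma> \<pi> v t - (-1) ^ shuffle_exp v *
      kunneth (mw \<pi> v) t) =
    (\<lambda>z. cc C S \<sigma> m (deg1 v + deg2 v) a (split_sum \<sigma> \<pi> v) z - (-1) ^ shuffle_exp v * cc C S \<sigma> m
        (deg1 v + deg2 v) a (kunneth (mw \<pi> v)) z)"
    by (rule ext) (auto simp: cc_eq[OF S C] algebra_simps)
  finally show ?thesis
    unfolding assoc_cochains coh_class_smult[OF pos_poset[OF S] C] coh_class_eq_iff[OF
        pos_poset[OF S] C]
    by (simp only: tdeg_mw add.assoc)
qed

end

end

context op_species
begin

section \<open>From cochains to classes and the structure axioms\<close>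

lemma assoc_rep:
  fixes v :: "('a hfset \<times> nat \<times> ('p list \<Rightarrow> 'k::comm_ring_1) set \<times> ('a hfset \<times> nat \<times> ('p list \<Rightarrow> 'k)
      set) list) list"
  assumes S: "finset S" and le: "(\<sigma>, \<pi>) \<in> Part_poset S"
    and "\<And>U n y w. (U, n, y, w) \<in> set v \<Longrightarrow> U \<in> \<sigma> \<and>
      ((n, y), w) \<in> comp_gens (h_species P) (h_species P) (restr \<pi> U) (n + tdeg w)"
  shows "\<exists>v'. v = map (\<lambda>(U, n, c, w). (U, n, coh_class c_chains (pos P (restr \<pi> U)) n c, cls w))
      v' \<and>
    (\<forall>(U, n, c, w)\<in>set v'. c \<in> ZP c_chains (restr \<pi> U) n \<and> kokP (restr \<pi> U) w)"
  using assms(3)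
proof (induction v)
  case (Cons l v)
  obtain U n y w where l: "l = (U, n, y, w)" by (cases l) auto
  have U: "U \<in> \<sigma>" and g: "((n, y), w) \<in> comp_gens (h_species P) (h_species P) (restr \<pi> U) (n +
      tdeg w)"
    using Cons.prems l by auto
  obtain c w' where "c \<in> ZP c_chains (restr \<pi> U) n" "y
      = coh_class c_chains (pos P (restr \<pi> U)) n c" "w = cls w'" "kokP (restr \<pi> U) w'"
    using gens_rep[OF restr_finset(4)[OF S le U] restr_in_Parts[OF S le U] _ g[unfolded
        gcomp_coh_species]] by blast
  moreover obtain v' where "v = map (\<lambda>(U, n, c, w). (U, n, coh_class c_chains (pos P (restr \<pi> U))
      n c, cls w)) v'"
    "\<forall>(U, n, c, w)\<in>set v'. c \<in> ZP c_chains (restr \<pi> U) n \<and> kokP (restr \<pi> U) w"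
    using Cons.IH Cons.prems by force
  ultimately show ?case by (intro exI[of _ "(U, n, c, w') # v'"]) (simp add: l)
qed simp

text \<open>All classes are replaced by representatives, which turns the three lists of the axiom
  into the classes of \<open>uw\<close>, \<open>cw\<close> and \<open>mw\<close>. Each composition
  is then evaluated by \<open>comp_value\<close>, and \<open>assoc_class\<close> remains.\<close>

lemma associative_coh:
  fixes v :: "('a hfset \<times> nat \<times> ('p list \<Rightarrow> 'k::comm_ring_1) set \<times> ('a hfset \<times> nat \<times> ('p list \<Rightarrow> 'k)
      set) list) list"
  assumes S: "finset S" and le: "(\<sigma>, \<pi>) \<in> Part_poset S" and C: "C \<in> {chat_chains, c_chains}"
    and X: "X \<in> carrier (gcomp (coh_species C P :: ('a, 'k, _) graded_species) \<sigma> m)"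
    and v: "distinct (map fst v)" "set (map fst v) = \<sigma>"
    and g: "\<forall>(U, n, y, w)\<in>set v. ((n, y), w) \<in> comp_gens (h_species P) (h_species P) (restr \<pi> U)
        (n + tdeg w)"
    and p: "p = m + deg1 v" and N: "N = p + deg2 v"
  shows "coh_comp C P S \<pi> N (comp_pure (coh_species C P) (h_species P) \<pi> N
      ((p, coh_comp C P \<pi> (part_lower \<pi> \<sigma>) p (comp_pure (coh_species C P) (h_species P)
          (part_lower \<pi> \<sigma>) p
             ((m, gmap (coh_species C P) \<sigma> (\<lambda>U. blk (restr \<pi> U)) m X),
              map (\<lambda>(U, n, y, w). (blk (restr \<pi> U), n, y)) v))),
       concat (map (\<lambda>(U, n, y, w). w) v)))
    = (-1) ^ shuffle_exp v \<odot>\<^bsub>gcomp (coh_species C P) S N\<^esub> coh_comp C P S \<sigma> N (comp_pure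
        (coh_species C P) (h_species P) \<sigma> N
      ((m, X),
       map (\<lambda>(U, n, y, w). (U, n + tdeg w, h_comp P (elts U) (restr \<pi> U) (n + tdeg w)
         (comp_pure (h_species P) (h_species P) (restr \<pi> U) (n + tdeg w) ((n, y), w)))) v))"
proof -
  have fin: "finset \<sigma>" "finset \<pi>" using PartsD(7)[OF S] le S by (auto simp: Part_poset_iff)
  obtain a where a: "a \<in> ZP C \<sigma> m" "X = coh_class C (pos P \<sigma>) m a"
    using coh_class_self_rep[OF pos_poset[OF fin(1)] C] X by auto
  obtain v' where v': "v = map (\<lambda>(U, n, c, w). (U, n, coh_class c_chains (pos P (restr \<pi> U)) n c,
      cls w)) v'"
    and m0: "\<forall>(U, n, c, w)\<in>set v'. c \<in> ZP c_chains (restr \<pi> U) n \<and> kokP (restr \<pi> U) w"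
  proof -
    have "U \<in> \<sigma> \<and> ((n, y), w) \<in> comp_gens (h_species P) (h_species P) (restr \<pi> U) (n + tdeg w)"
        if "(U, n, y, w) \<in> set v" for U n y w
      using g v(2) that by force
    from assoc_rep[OF S le this] show thesis using that by blast
  qed
  have "map fst v = map fst v'" unfolding v' by (simp add: split_def)
  then have d: "distinct (map fst v')" "fst ` set v' = \<sigma>" using v by (simp, metis list.set_map)
  note ctx = S le C a(1) d m0
  note vb = v_block[OF ctx]
  have deg: "deg1 v = deg1 v'" "deg2 v = deg2 v'" "shuffle_exp v = shuffle_exp v'"
  proof -
    have d1: "deg1 (map (\<lambda>(U, n, c, w). (U, n, coh_class c_chains (pos P (restr \<pi> U)) n c, cls w))
        u) = deg1 u"
      for u :: "('a hfset \<times> nat \<times> ('p list \<Rightarrow> 'k) \<times> ('a hfset \<times> nat \<times> ('p list \<Rightarrow> 'k)) list) list"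
      by (induction u) auto
    show "deg1 v = deg1 v'" unfolding v' by (rule d1)
    show "deg2 v = deg2 v'" unfolding v' by (induction v') auto
    show "shuffle_exp v = shuffle_exp v'" unfolding v'
      by (induction v') (auto simp: d1 simp del: map_map)
  qed
  have 1: "map (\<lambda>(U, n, y, w). (blk (restr \<pi> U), n, y)) v = cls (uw \<pi> v')"
    unfolding v' uw_def map_map using vb(4) by (intro map_cong) auto
  have 2: "concat (map (\<lambda>(U, n, y, w). w) v) = cls (cw v')"
    unfolding v' cw_def map_concat map_map by (intro arg_cong[where f = concat] map_cong) auto
  have 3: "map (\<lambda>(U, n, y, w). (U, n + tdeg w, h_comp P (elts U) (restr \<pi> U) (n + tdeg w)
      (comp_pure (h_species P) (h_species P) (restr \<pi> U) (n + tdeg w) ((n, y), w)))) v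
          = cls (mw \<pi> v')"
    unfolding v' mw_def map_map
  proof (rule map_cong[OF refl])
    fix l assume l: "l \<in> set v'"
    obtain U n c w where l': "l = (U, n, c, w)" by (cases l) auto
    note U = vb[OF l[unfolded l']]
    show "((\<lambda>(U, n, y, w). (U, n + tdeg w, h_comp P (elts U) (restr \<pi> U) (n + tdeg w)
        (comp_pure (h_species P) (h_species P) (restr \<pi> U) (n + tdeg w) ((n, y), w)))) \<circ>
        (\<lambda>(U, n, c, w). (U, n, coh_class c_chains (pos P (restr \<pi> U)) n c, cls w))) l =
      ((\<lambda>(T, n, c). (T, n, coh_class c_chains (pos P (elts T)) n c)) \<circ>
        (\<lambda>(U, n, c, w). (U, n + tdeg w, cc c_chains (elts U) (restr \<pi> U) n (tdeg w) c (kunneth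
            w)))) l"
      using comp_value[OF U(2,3), of c_chains c n w] U(5,6) by (simp add: l')
  qed
  let ?b = "tr C \<sigma> (\<lambda>U. blk (restr \<pi> U)) m a"
  let ?X = "cc C \<pi> (part_lower \<pi> \<sigma>) m (deg1 v') ?b (kunneth (uw \<pi> v'))"
  note pp = parts[OF ctx]
  have gm: "gmap (coh_species C P) \<sigma> (\<lambda>U. blk (restr \<pi> U)) m X
      = coh_class C (pos P (part_lower \<pi> \<sigma>)) m ?b"
    using gmap_class[OF fin(1) C inj_on_restr[OF S le] a(1)] by (simp add: a(2) pp(6))
  have b: "?b \<in> ZP C (part_lower \<pi> \<sigma>) m" using tr_Zc[OF fin(1) C inj_on_restr[OF S le] a(1)]
    by (simp add: pp(6))
  have Xz: "?X \<in> ZP C \<pi> p"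
    using cc_Zc[OF fin(2) C b product_words.kunneth_Zc[OF words[OF fin(2) pp(5)] kokP_uw[OF ctx]]]
    by (simp add: tdeg_uw p deg)
  have "coh_comp C P \<pi> (part_lower \<pi> \<sigma>) p (comp_pure (coh_species C P) (h_species P) (part_lower \<pi>
      \<sigma>) p
      ((m, gmap (coh_species C P) \<sigma> (\<lambda>U. blk (restr \<pi> U)) m X), cls (uw \<pi> v')))
          = coh_class C (pos P \<pi>) p ?X"
    unfolding gm gcomp_coh_species
    using comp_value[OF fin(2) pp(5) C b kokP_uw[OF ctx], of p] by (simp add: tdeg_uw p deg)
  moreover have "coh_comp C P S \<pi> N (comp_pure (coh_species C P) (h_species P) \<pi> N ((p, coh_class
      C (pos P \<pi>) p ?X), cls (cw v'))) =
      coh_class C (pos P S) N (cc C S \<pi> p (deg2 v') ?X (kunneth (cw v')))"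
    unfolding gcomp_coh_species
    using comp_value[OF S pp(2) C Xz kokP_cw[OF ctx], of N] by (simp add: tdeg_cw N deg)
  moreover have "coh_comp C P S \<sigma> N (comp_pure (coh_species C P) (h_species P) \<sigma> N ((m, X), cls
      (mw \<pi> v'))) =
      coh_class C (pos P S) N (cc C S \<sigma> m (tdeg (mw \<pi> v')) a (kunneth (mw \<pi> v')))"
    unfolding gcomp_coh_species a(2)
    using comp_value[OF S pp(1) C a(1) kokP_mw[OF ctx], of N] by (simp add: tdeg_mw N p deg)
  moreover note assoc_class[OF ctx]
  ultimately show ?thesis
    unfolding 1 2 3 deg by (simp add: N p deg)
qed

end

text \<open>Both choices of \<open>C\<close> are used: \<open>c_chains\<close> gives the action of
  the operad on itself, hence its associativity, and \<open>chat_chains\<close> gives the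
  module.\<close>

lemma right_action_coh:
  fixes P :: "('a, 'p) op_poset_species"
  assumes "op_species P" and C: "C \<in> {chat_chains, c_chains}"
  shows "right_action (h_species P) (h_comp P) (coh_unit P) (coh_species C P) (coh_comp C P ::
      ('a, 'k::comm_ring_1, _, _) compmaps)"
proof -
  interpret op_species P by fact
  have C': "c_chains \<in> {chat_chains, c_chains}" by simp
  show ?thesis
  proof (intro right_action.intro graded_species_coh C C' right_action_axioms.intro)
    show "coh_comp C P S \<pi> N \<in> mod_hom (comp_tensor (coh_species C P) (h_species P) \<pi> N) (gcomp
        (coh_species C P :: ('a, 'k, _) graded_species) S N)"
      if "finset S" "\<pi> \<in> Parts S" for S \<pi> N
      using comp_lift(1)[OF that C] by simp
  qed (rule equivariant_coh associative_coh right_unital_coh; (assumption | rule C))+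
qed

lemma graded_operad_coh:
  fixes P :: "('a, 'p) op_poset_species"
  assumes "op_species P"
  shows "graded_operad (h_species P) (h_comp P) (coh_unit P :: 'a hfset \<Rightarrow> ('p list \<Rightarrow>
      'k::comm_ring_1) set)"
proof -
  interpret op_species P by fact
  have C': "c_chains \<in> {chat_chains, c_chains}" by simp
  show ?thesis
  proof (intro graded_operad.intro right_action_coh assms C' graded_operad_axioms.intro)
    show "coh_unit P s \<in> carrier (gcomp (h_species P :: ('a, 'k, _) graded_species) {s} 0)" for s
      using coh_class_carrier[OF pos_poset[OF finset_singleton] C', of "uc s" s 0] uc_Zc[of s]
      by (simp add: coh_unit_eq)
  qed (rule unit_natural_coh left_unital_coh; assumption?)+
qed

theorem theorem2p13:
  fixes P :: "('a, 'p) op_poset_species"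
  assumes "operadic_poset_species P"
    and "has_pullbacks P"
    and "has_units P"
  shows "right_operadic_module
    (h_species P :: ('a, 'k::comm_ring_1, ('p list \<Rightarrow> 'k) set) graded_species)
    (h_comp P) (coh_unit P)
    (hhat_species P) (hhat_comp P)"
proof -
  have "op_species P" using assms by (intro op_species.intro op_species_axioms.intro)
  then show ?thesis by (intro right_operadic_module.intro graded_operad_coh right_action_coh)
      simp_all
qed

end
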